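(* Let $m\ge 1$, $G=\mathrm{GL}(2m,\mathbb{C})$, $\lambda\in\mathbb{R}$ and $k\in\mathbb{Z}$. Upon restriction to the symmetric subgroup $H_4=\mathrm{GL}(m,\mathbb{H})$ the unitary principal series representation $\pi_{i\lambda,k}^G$ of $G$ decomposes as the Hilbert space direct sum $$\pi_{i\lambda,k}^G|_{H_4}\;\cong\;\bigoplus_{\substack{j\ge|k|\\ j\in k+2\mathbb{Z}}}\pi_{i\lambda,j}^{\mathrm{GL}(m,\mathbb{H})}.$$
   Context: All inductions are normalized parabolic inductions: for a unitary representation $\omega$ of a parabolic subgroup $Q$ of $L$, $L$ acts by left translation on the $L^2$-completion of functions $f$ with $f(gx)=\delta_Q(x)^{-1/2}\omega(x)^{-1}f(g)$, $x\in Q$, $\delta_Q(x)=|\det\mathrm{Ad}(x)|_{\mathfrak{n}}|$ ($\mathfrak n$ the Lie algebra of the nilradical, as a real vector space). Let $n=2m$ and let $P=(\mathrm{GL}(1,\mathbb{C})\times\mathrm{GL}(n-1,\mathbb{C}))\ltimes\mathbb{C}^{n-1}$ be the standard maximal parabolic subgroup of $G=\mathrm{GL}(n,\mathbb{C})$, the stabilizer of the line $\mathbb{C}e_1$. For $\lambda\in\mathbb{R}$, $k\in\mathbb{Z}$ let $\chi_{i\lambda,k}(\mathrm{diag}(w,g))=|w|^{i\lambda}(w/|w|)^k$ ($w\in\mathrm{GL}(1,\mathbb{C})$, $g\in\mathrm{GL}(n-1,\mathbb{C})$), extended trivially on the nilradical to $P$, and $\pi_{i\lambda,k}^G=\mathrm{Ind}_P^G(\chi_{i\lambda,k})$.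 $\mathbb{H}$ denotes the quaternions, and $H=\mathrm{GL}(m,\mathbb{H})$ (invertible $m\times m$ matrices over $\mathbb{H}$ acting from the left on $\mathbb{H}^m$) is regarded as a subgroup of $\mathrm{GL}(2m,\mathbb{C})$ via $\mathbb{H}^m\cong\mathbb{C}^{2m}$, where $\mathbb{C}\subset\mathbb{H}$ acts on $\mathbb{H}^m$ by right multiplication. Let $$P_H=\left\{\begin{pmatrix}a&b\\0&C\end{pmatrix}:a\in\mathbb{H}^\times,\ b\in\mathbb{H}^{m-1},\ C\in\mathrm{GL}(m-1,\mathbb{H})\right\}$$ (for $m=1$, $P_H=H=\mathbb{H}^\times$). For $j\in\mathbb{N}_0$ let $(\tau_j,V_j)$ be the unique irreducible representation of $\mathrm{Sp}(1)\cong\mathrm{SU}(2)$ (the unit quaternions) of dimension $j+1$. Let $\omega_{i\lambda,j}$ be the unitary representation of $P_H$ on $V_j$ given by $$\omega_{i\lambda,j}\begin{pmatrix}a&b\\0&C\end{pmatrix}=|a|^{i\lambda}\tau_j\left(\tfrac{a}{|a|}\right),$$ with $|a|$ the quaternionic norm, and $\pi_{i\lambda,j}^{\mathrm{GL}(m,\mathbb{H})}=\mathrm{Ind}_{P_H}^H(\omega_{i\lambda,j})$; these are irreducible unitary representations of $H$. *)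

theory Defs
  imports "HOL-Analysis.Analysis"
begin

section \<open>Quaternions\<close>

datatype quat = Quat (q1: real) (qi: real) (qj: real) (qk: real)

lemma quat_eq_iff: "x = y \<longleftrightarrow> q1 x = q1 y \<and> qi x = qi y \<and> qj x = qj y \<and> qk x = qk y"
  by (cases x; cases y) auto

instantiation quat :: ring_1
begin

definition "0 = Quat 0 0 0 0"
definition "1 = Quat 1 0 0 0"
definition "x + y = Quat (q1 x + q1 y) (qi x + qi y) (qj x + qj y) (qk x + qk y)"
definition "x - y = Quat (q1 x - q1 y) (qi x - qi y) (qj x - qj y) (qk x - qk y)"
definition "- x = Quat (- q1 x) (- qi x) (- qj x) (- qk x)"
definition "x * y = Quat
  (q1 x * q1 y - qi x * qi y - qj x * qj y - qk x * qk y)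
  (q1 x * qi y + qi x * q1 y + qj x * qk y - qk x * qj y)
  (q1 x * qj y - qi x * qk y + qj x * q1 y + qk x * qi y)
  (q1 x * qk y + qi x * qj y - qj x * qi y + qk x * q1 y)"

lemmas quat_ring_defs = zero_quat_def one_quat_def plus_quat_def minus_quat_def
  uminus_quat_def times_quat_def

instance
  by standard (simp_all add: quat_ring_defs quat_eq_iff algebra_simps)

end

instantiation quat :: real_inner
begin

definition "r *\<^sub>R x = Quat (r * q1 x) (r * qi x) (r * qj x) (r * qk x)"
definition "inner x y = q1 x * q1 y + qi x * qi y + qj x * qj y + qk x * qk y" for x y :: quat
definition "norm x = sqrt (inner x x)" for x :: quat
definition "sgn x = inverse (norm x) *\<^sub>R x" for x :: quat
definition "dist x y = norm (x - y)" for x y :: quat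
definition "uniformity = (INF e\<in>{0<..}. principal {(x :: quat, y). dist x y < e})"
definition "open U \<longleftrightarrow> (\<forall>x\<in>U. \<forall>\<^sub>F (x', y) in uniformity. x' = x \<longrightarrow> y \<in> U)" for U :: "quat set"

instance
proof
  fix x :: quat
  show "0 \<le> inner x x"
    by (simp add: inner_quat_def)
  show "inner x x = 0 \<longleftrightarrow> x = 0"
  proof
    assume "inner x x = 0"
    then have "(q1 x)\<^sup>2 + (qi x)\<^sup>2 + (qj x)\<^sup>2 + (qk x)\<^sup>2 = 0"
      by (simp add: inner_quat_def power2_eq_square)
    then have "(q1 x)\<^sup>2 = 0 \<and> (qi x)\<^sup>2 = 0 \<and> (qj x)\<^sup>2 = 0 \<and> (qk x)\<^sup>2 = 0"
      by (smt (verit) zero_le_power2)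
    then show "x = 0"
      by (simp add: quat_eq_iff zero_quat_def)
  qed (simp add: inner_quat_def zero_quat_def)
qed (simp_all add: scaleR_quat_def inner_quat_def quat_ring_defs quat_eq_iff algebra_simps
    norm_quat_def sgn_quat_def dist_quat_def uniformity_quat_def open_quat_def)

end

instantiation quat :: real_normed_div_algebra
begin

definition "inverse x = (1 / (norm x)\<^sup>2) *\<^sub>R Quat (q1 x) (- qi x) (- qj x) (- qk x)" for x :: quat
definition "x div y = x * inverse y" for x y :: quat

instance
proof
  fix x y :: quat and r :: real
  show "r *\<^sub>R x * y = r *\<^sub>R (x * y)" "x * r *\<^sub>R y = r *\<^sub>R (x * y)"
    by (simp_all add: scaleR_quat_def quat_ring_defs algebra_simps)
  have norm2: "(norm z)\<^sup>2 = q1 z * q1 z + qi z * qi z + qj z * qj z + qk z * qk z" for z :: quat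
    by (simp add: norm_quat_def inner_quat_def)
  show "norm (x * y) = norm x * norm y"
    unfolding norm_quat_def real_sqrt_mult[symmetric]
    by (simp add: inner_quat_def times_quat_def algebra_simps)
  show "inverse x * x = 1" "x * inverse x = 1" if "x \<noteq> 0"
  proof -
    define c where "c = 1 / (norm x)\<^sup>2"
    have c: "c * (q1 x * q1 x + qi x * qi x + qj x * qj x + qk x * qk x) = 1"
      using that by (simp add: c_def norm2[symmetric])
    have inv: "inverse x = c *\<^sub>R Quat (q1 x) (- qi x) (- qj x) (- qk x)"
      by (simp add: inverse_quat_def c_def)
    show "inverse x * x = 1" "x * inverse x = 1"
      using c by (simp_all add: inv quat_eq_iff scaleR_quat_def times_quat_def one_quat_def
          algebra_simps)
  qed
  show "x div y = x * inverse y"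
    by (simp add: divide_quat_def)
  show "inverse (0::quat) = 0"
    by (simp add: inverse_quat_def scaleR_quat_def zero_quat_def)
qed

end

definition quat_of_complex :: "complex \<Rightarrow> quat" where
  "quat_of_complex z = Quat (Re z) (Im z) 0 0"

text \<open>
  A quaternion is written as \<open>x + j y\<close> with \<open>x, y\<close> complex; since \<open>j (c + d i) = c j - d k\<close>, the
  second coordinate of \<open>Quat a b c d\<close> is \<open>c - d i\<close>. These coordinates are linear for right
  multiplication by complex numbers. The copy \<open>Inl\<close> of the index type carries the
  \<open>x\<close>-coordinates, so the quaternionic basis vector at \<open>i\<close> is the complex basis vector at \<open>Inl i\<close>.
\<close>

definition quat_to_complex_vec :: "quat^'m::finite \<Rightarrow> complex^('m + 'm)" where
  "quat_to_complex_vec v = (\<chi> s. case s of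
      Inl i \<Rightarrow> Complex (q1 (v $ i)) (qi (v $ i))
    | Inr i \<Rightarrow> Complex (qj (v $ i)) (- qk (v $ i)))"

definition complex_to_quat_vec :: "complex^('m::finite + 'm) \<Rightarrow> quat^'m" where
  "complex_to_quat_vec u = (\<chi> i.
     Quat (Re (u $ Inl i)) (Im (u $ Inl i)) (Re (u $ Inr i)) (- Im (u $ Inr i)))"

definition quat_matrix_embed :: "quat^'m::finite^'m \<Rightarrow> complex^('m + 'm)^('m + 'm)" where
  "quat_matrix_embed A = matrix (\<lambda>u. quat_to_complex_vec (A *v complex_to_quat_vec u))"

lemma complex_to_quat_vec_inverse [simp]: "complex_to_quat_vec (quat_to_complex_vec v) = v"
  by (simp add: vec_eq_iff complex_to_quat_vec_def quat_to_complex_vec_def quat_eq_iff)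

lemma quat_to_complex_vec_inverse [simp]: "quat_to_complex_vec (complex_to_quat_vec u) = u"
  by (simp add: vec_eq_iff complex_to_quat_vec_def quat_to_complex_vec_def split: sum.split)

lemma quat_to_complex_vec_right_mult:
  "quat_to_complex_vec (\<chi> i. v $ i * quat_of_complex z) = z *s quat_to_complex_vec v"
  by (simp add: vec_eq_iff quat_to_complex_vec_def quat_of_complex_def times_quat_def
      complex_eq_iff algebra_simps split: sum.split)

lemma quat_matrix_embed_mult:
  fixes v :: "quat^'m::finite"
  shows "quat_matrix_embed A *v quat_to_complex_vec v = quat_to_complex_vec (A *v v)"
proof -
  let ?f = "\<lambda>u. quat_to_complex_vec (A *v complex_to_quat_vec u)"
  have add: "complex_to_quat_vec (u + w) = complex_to_quat_vec u + complex_to_quat_vec w"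
    for u w :: "complex^('m + 'm)"
    by (simp add: vec_eq_iff complex_to_quat_vec_def plus_quat_def)
  have add': "quat_to_complex_vec (u + w) = quat_to_complex_vec u + quat_to_complex_vec w"
    for u w :: "quat^'m"
    by (simp add: vec_eq_iff quat_to_complex_vec_def plus_quat_def complex_eq_iff split: sum.split)
  have scale: "complex_to_quat_vec (z *s u) = (\<chi> i. complex_to_quat_vec u $ i * quat_of_complex z)"
    for z and u :: "complex^('m + 'm)"
    by (metis complex_to_quat_vec_inverse quat_to_complex_vec_inverse quat_to_complex_vec_right_mult)
  have "A *v (\<chi> i. w $ i * q) = (\<chi> i. (A *v w) $ i * q)" for w q
    by (simp add: vec_eq_iff matrix_vector_mult_def sum_distrib_right mult.assoc)
  then have "Vector_Spaces.linear (*s) (*s) ?f"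
    by unfold_locales
      (simp_all add: add add' scale quat_to_complex_vec_right_mult vec.scale_right_distrib
        vec.scale_left_distrib matrix_vector_right_distrib)
  from matrix_works[OF this] show ?thesis
    by (simp add: quat_matrix_embed_def)
qed


section \<open>Groups of matrices\<close>

definition GL :: "('r::ring_1^'n::finite^'n) set" where
  "GL = {g. invertible g}"

text \<open>
  The standard maximal compact subgroup: \<open>U(n)\<close> over the complex numbers, \<open>Sp(n)\<close> over the
  quaternions.
\<close>

definition isometry_group :: "('r::{real_inner,ring_1}^'n::finite^'n) set" where
  "isometry_group = {g \<in> GL. \<forall>v. norm (g *v v) = norm v}"

text \<open>
  The index \<open>e\<close> plays the role of the first coordinate; vanishing of the entries of column \<open>e\<close>
  off the diagonal means block upper triangular with respect to the splitting \<open>1 + (n - 1)\<close>.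
\<close>

definition parabolic :: "'n \<Rightarrow> ('r::ring_1^'n::finite^'n) set" where
  "parabolic e = {g \<in> GL. \<forall>i. i \<noteq> e \<longrightarrow> g $ i $ e = 0}"

definition nilradical :: "'n \<Rightarrow> ('r::ring_1^'n::finite^'n) set" where
  "nilradical e = {X. \<forall>i j. \<not> (i = e \<and> j \<noteq> e) \<longrightarrow> X $ i $ j = 0}"

definition Ad :: "'r::ring_1^'n::finite^'n \<Rightarrow> 'r^'n^'n \<Rightarrow> 'r^'n^'n" where
  "Ad g X = g ** X ** matrix_inv g"

text \<open>
  The determinant of a real linear endomorphism \<open>T\<close> of a finite-dimensional subspace \<open>S\<close>, expanded
  in an orthonormal basis.
\<close>

definition det_on :: "'a::real_inner set \<Rightarrow> ('a \<Rightarrow> 'a) \<Rightarrow> real" where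
  "det_on S T =
     (let B = (SOME B. finite B \<and> pairwise orthogonal B \<and> (\<forall>b\<in>B. norm b = 1) \<and> span B = S)
      in \<Sum>p | p permutes B. of_int (sign p) * (\<Prod>b\<in>B. inner (T b) (p b)))"

definition modulus :: "'n \<Rightarrow> 'r::{real_inner,ring_1}^'n::finite^'n \<Rightarrow> real" where
  "modulus e x = \<bar>det_on (nilradical e) (Ad x)\<bar>"

definition is_haar_prob ::
  "('r::{real_inner,ring_1}^'n::finite^'n) set \<Rightarrow> ('r^'n^'n) measure \<Rightarrow> bool" where
  "is_haar_prob K \<mu> \<longleftrightarrow>
     emeasure \<mu> K = 1 \<and> sets \<mu> = sets (restrict_space borel K) \<and>
     (\<forall>k\<in>K. distr \<mu> \<mu> (\<lambda>x. k ** x) = \<mu>)"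


section \<open>Unitary representations\<close>

text \<open>
  The Hilbert space of a representation is given by a space with a positive semidefinite inner
  product; the actual Hilbert space is its quotient by the null vectors.
\<close>

record ('g, 'v) hilbert_rep =
  vectors :: "'v set"
  add :: "'v \<Rightarrow> 'v \<Rightarrow> 'v"
  scale :: "complex \<Rightarrow> 'v \<Rightarrow> 'v"
  ip :: "'v \<Rightarrow> 'v \<Rightarrow> complex"
  act :: "'g \<Rightarrow> 'v \<Rightarrow> 'v"

definition null_eq :: "('g, 'v) hilbert_rep \<Rightarrow> 'v \<Rightarrow> 'v \<Rightarrow> bool" where
  "null_eq R x y \<longleftrightarrow> (let d = add R x (scale R (- 1) y) in ip R d d = 0)"

text \<open>
  A map as below is the same as a unitary intertwining operator between the quotients by null
  vectors (preservation of the inner product makes it well defined and injective there).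
\<close>

definition unitarily_equivalent ::
  "'g set \<Rightarrow> ('g, 'v) hilbert_rep \<Rightarrow> ('g, 'w) hilbert_rep \<Rightarrow> bool" where
  "unitarily_equivalent H R S \<longleftrightarrow> (\<exists>U.
     (\<forall>x\<in>vectors R. U x \<in> vectors S) \<and>
     (\<forall>x\<in>vectors R. \<forall>y\<in>vectors R. null_eq S (U (add R x y)) (add S (U x) (U y))) \<and>
     (\<forall>c. \<forall>x\<in>vectors R. null_eq S (U (scale R c x)) (scale S c (U x))) \<and>
     (\<forall>x\<in>vectors R. \<forall>y\<in>vectors R. ip S (U x) (U y) = ip R x y) \<and>
     (\<forall>z\<in>vectors S. \<exists>x\<in>vectors R. null_eq S (U x) z) \<and>
     (\<forall>h\<in>H. \<forall>x\<in>vectors R. null_eq S (U (act R h x)) (act S h (U x))))"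

definition restrict_rep :: "('h \<Rightarrow> 'g) \<Rightarrow> ('g, 'v) hilbert_rep \<Rightarrow> ('h, 'v) hilbert_rep" where
  "restrict_rep \<iota> R =
     \<lparr>vectors = vectors R, add = add R, scale = scale R, ip = ip R, act = (\<lambda>h. act R (\<iota> h))\<rparr>"

definition hilbert_sum ::
  "'i set \<Rightarrow> ('i \<Rightarrow> ('g, 'v) hilbert_rep) \<Rightarrow> ('g, 'i \<Rightarrow> 'v) hilbert_rep" where
  "hilbert_sum J R =
     \<lparr>vectors = {F. (\<forall>j\<in>J. F j \<in> vectors (R j)) \<and>
                    (\<lambda>j. Re (ip (R j) (F j) (F j))) summable_on J},
      add = (\<lambda>F F' j. add (R j) (F j) (F' j)),
      scale = (\<lambda>c F j. scale (R j) c (F j)),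
      ip = (\<lambda>F F'. \<Sum>\<^sub>\<infinity>j\<in>J. ip (R j) (F j) (F' j)),
      act = (\<lambda>h F j. act (R j) h (F j))\<rparr>"

text \<open>
  The standard Hermitian space of dimension \<open>d\<close>, for \<open>d\<close> varying in a single type.
\<close>

definition cvec :: "nat \<Rightarrow> (nat \<Rightarrow> complex) set" where
  "cvec d = {v. \<forall>i\<ge>d. v i = 0}"

definition cinner :: "nat \<Rightarrow> (nat \<Rightarrow> complex) \<Rightarrow> (nat \<Rightarrow> complex) \<Rightarrow> complex" where
  "cinner d u v = (\<Sum>i<d. u i * cnj (v i))"

definition cvec_subspace :: "nat \<Rightarrow> (nat \<Rightarrow> complex) set \<Rightarrow> bool" where
  "cvec_subspace d W \<longleftrightarrow> W \<subseteq> cvec d \<and> (\<lambda>i. 0) \<in> W \<and>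
     (\<forall>u\<in>W. \<forall>v\<in>W. (\<lambda>i. u i + v i) \<in> W) \<and> (\<forall>c. \<forall>v\<in>W. (\<lambda>i. c * v i) \<in> W)"

definition unitary_rep_on ::
  "'g::{monoid_mult,topological_space} set \<Rightarrow> nat \<Rightarrow>
     ('g \<Rightarrow> (nat \<Rightarrow> complex) \<Rightarrow> (nat \<Rightarrow> complex)) \<Rightarrow> bool" where
  "unitary_rep_on S d \<tau> \<longleftrightarrow>
     (\<forall>g\<in>S. \<forall>v\<in>cvec d. \<tau> g v \<in> cvec d) \<and>
     (\<forall>g\<in>S. \<forall>u\<in>cvec d. \<forall>v\<in>cvec d. \<tau> g (\<lambda>i. u i + v i) = (\<lambda>i. \<tau> g u i + \<tau> g v i)) \<and>
     (\<forall>g\<in>S. \<forall>c. \<forall>v\<in>cvec d. \<tau> g (\<lambda>i. c * v i) = (\<lambda>i. c * \<tau> g v i)) \<and>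
     (\<forall>v\<in>cvec d. \<tau> 1 v = v) \<and>
     (\<forall>g\<in>S. \<forall>h\<in>S. \<forall>v\<in>cvec d. \<tau> (g * h) v = \<tau> g (\<tau> h v)) \<and>
     (\<forall>g\<in>S. \<forall>u\<in>cvec d. \<forall>v\<in>cvec d. cinner d (\<tau> g u) (\<tau> g v) = cinner d u v) \<and>
     (\<forall>v\<in>cvec d. \<forall>i. continuous_on S (\<lambda>g. \<tau> g v i))"

definition irreducible_unitary_rep_on ::
  "'g::{monoid_mult,topological_space} set \<Rightarrow> nat \<Rightarrow>
     ('g \<Rightarrow> (nat \<Rightarrow> complex) \<Rightarrow> (nat \<Rightarrow> complex)) \<Rightarrow> bool" where
  "irreducible_unitary_rep_on S d \<tau> \<longleftrightarrow>
     unitary_rep_on S d \<tau> \<and> 0 < d \<and>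
     (\<forall>W. cvec_subspace d W \<and> (\<forall>g\<in>S. \<forall>v\<in>W. \<tau> g v \<in> W) \<longrightarrow> W = {\<lambda>i. 0} \<or> W = cvec d)"

definition Sp1 :: "quat set" where
  "Sp1 = {q. norm q = 1}"


section \<open>Parabolic induction\<close>

text \<open>
  Normalized induction from the parabolic subgroup \<open>Q = parabolic e\<close> of a unitary representation
  \<open>\<omega>\<close> of \<open>Q\<close> on \<open>cvec d\<close>. By the Iwasawa decomposition a function with the required equivariance
  is determined by its restriction to the maximal compact subgroup \<open>K\<close>, and the \<open>L\<^sup>2\<close>-norm is that
  of the restriction with respect to the Haar measure \<open>\<mu>\<close> of \<open>K\<close>. The completion consists of the
  measurable equivariant functions of finite norm, modulo null functions.
\<close>

definition induced_rep ::
  "('r::{real_inner,ring_1}^'n::finite^'n) measure \<Rightarrow> 'n \<Rightarrow> nat \<Rightarrow>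
     ('r^'n^'n \<Rightarrow> (nat \<Rightarrow> complex) \<Rightarrow> (nat \<Rightarrow> complex)) \<Rightarrow>
     ('r^'n^'n, 'r^'n^'n \<Rightarrow> nat \<Rightarrow> complex) hilbert_rep" where
  "induced_rep \<mu> e d \<omega> =
     \<lparr>vectors = {f.
        (\<forall>g\<in>GL. f g \<in> cvec d) \<and>
        (\<forall>i. (\<lambda>g. f g i) \<in> borel_measurable (restrict_space borel GL)) \<and>
        (\<forall>g\<in>GL. \<forall>x\<in>parabolic e. f (g ** x) =
           (\<lambda>i. of_real (modulus e x powr (- 1 / 2)) * inv_into (cvec d) (\<omega> x) (f g) i)) \<and>
        integrable \<mu> (\<lambda>k. cinner d (f k) (f k))},
      add = (\<lambda>f f' g i. f g i + f' g i),
      scale = (\<lambda>c f g i. c * f g i),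
      ip = (\<lambda>f f'. \<integral>k. cinner d (f k) (f' k) \<partial>\<mu>),
      act = (\<lambda>h f g. f (matrix_inv h ** g))\<rparr>"

definition chi :: "'n \<Rightarrow> real \<Rightarrow> int \<Rightarrow> complex^'n::finite^'n \<Rightarrow> complex" where
  "chi e lam k x = (let w = x $ e $ e in
     of_real (norm w) powr (\<i> * of_real lam) * (w / of_real (norm w)) powi k)"

definition pi_G ::
  "(complex^'n::finite^'n) measure \<Rightarrow> 'n \<Rightarrow> real \<Rightarrow> int \<Rightarrow>
     (complex^'n^'n, complex^'n^'n \<Rightarrow> nat \<Rightarrow> complex) hilbert_rep" where
  "pi_G \<mu> e lam k = induced_rep \<mu> e 1 (\<lambda>x v i. chi e lam k x * v i)"

definition omega ::
  "'m \<Rightarrow> real \<Rightarrow> (quat \<Rightarrow> (nat \<Rightarrow> complex) \<Rightarrow> (nat \<Rightarrow> complex)) \<Rightarrow>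
     quat^'m::finite^'m \<Rightarrow> (nat \<Rightarrow> complex) \<Rightarrow> (nat \<Rightarrow> complex)" where
  "omega e lam \<tau> x v = (let a = x $ e $ e in
     (\<lambda>i. of_real (norm a) powr (\<i> * of_real lam) * \<tau> ((1 / norm a) *\<^sub>R a) v i))"

definition pi_H ::
  "(quat^'m::finite^'m) measure \<Rightarrow> 'm \<Rightarrow> real \<Rightarrow>
     (nat \<Rightarrow> quat \<Rightarrow> (nat \<Rightarrow> complex) \<Rightarrow> (nat \<Rightarrow> complex)) \<Rightarrow> nat \<Rightarrow>
     (quat^'m^'m, quat^'m^'m \<Rightarrow> nat \<Rightarrow> complex) hilbert_rep" where
  "pi_H \<nu> e lam \<tau> j = induced_rep \<nu> e (j + 1) (omega e lam (\<tau> j))"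

end

theory Submission
  imports Defs "HOL-Probability.Probability_Measure" "Jordan_Normal_Form.Determinant"
begin

text \<open>
  The group \<open>GL(m, \<H>)\<close> acts transitively on the complex lines of \<open>\<H>\<^sup>m = \<complex>\<^sup>2\<^sup>m\<close>, so restriction from
  \<open>GL(2m, \<complex>)\<close> loses nothing: an element of the representation induced from \<open>P\<close> is determined by its
  values on the quaternionic group, where it is covariant under the stabilizer of the line, the
  subgroup of \<open>P\<^sub>H\<close> of elements whose corner entry is complex. The modulus functions of \<open>P\<close> and \<open>P\<^sub>H\<close>
  agree on this subgroup (\<open>modulus_quat_matrix_embed\<close>), and the two norms agree because \<open>Sp(m)\<close> is
  transitive on the unit sphere of \<open>\<complex>\<^sup>2\<^sup>m\<close>: a function of the distinguished column has the same
  integral over \<open>U(2m)\<close> and over \<open>Sp(m)\<close> (\<open>nn_integral_unitary_eq_symplectic\<close>). Conversely every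
  covariant function on the quaternionic group extends (\<open>extension_covariant\<close>).

  The quotient of \<open>P\<^sub>H\<close> by the stabilizer of the line is \<open>Sp(1) / U(1)\<close>, which allows induction in two stages.
  For a covariant \<open>f\<close> and a fixed \<open>h\<close>, the function \<open>q \<mapsto> f (h diag(q, 1))\<close> on \<open>Sp(1)\<close> transforms by
  the character \<open>z\<^sup>-\<^sup>k\<close> of \<open>U(1)\<close> on the right. Its expansion in matrix coefficients of the
  representations \<open>\<tau>\<^sub>j\<close> sees only the vectors of weight \<open>k\<close>, and such a vector exists, and is unique up
  to a scalar, exactly if \<open>j \<ge> \<bar>k\<bar>\<close> and \<open>j - k\<close> is even. Integrating against these coefficients gives
  for each such \<open>j\<close> a function with values in \<open>V\<^sub>j\<close>, which lies in the space of the representation of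
  \<open>GL(m, \<H>)\<close> induced from \<open>\<omega>\<^sub>j\<close> (\<open>fibre_coeff_parabolic\<close>). Parseval's identity on \<open>Sp(1)\<close>, integrated
  over \<open>Sp(m)\<close>, shows that the resulting map is isometric (\<open>coeff_norm_sums\<close>); pairing a family of
  vector-valued functions with the weight vectors and summing inverts it (\<open>synthesis\<close>). The map is
  given by integration on the right and so commutes with left translations.

  The expansion on \<open>Sp(1)\<close> has to be valid for arbitrary irreducible \<open>\<tau>\<^sub>j\<close> of the right dimension. The
  concrete representations on binary forms of degree \<open>j\<close> have coefficients that span a dense space of
  continuous functions (\<open>coef_span_dense\<close>), by the approximation theorem of Weierstrass. Averaging
  intertwines \<open>\<tau>\<^sub>j\<close> with some space of forms (\<open>average_form_nonzero\<close>), and by Schur's lemma and equality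
  of dimensions this is an equivalence (\<open>rep_equivalent_form\<close>).
\<close>

no_notation vec_index (infixl "$" 100)
hide_const (open) Matrix.mat Matrix.vec Matrix.row Determinant.det Matrix.col Matrix.orthogonal Matrix.invertible_mat
hide_fact (open) Matrix.vec_eq_iff Matrix.mat_def Matrix.vec_def Determinant.det_def Matrix.orthogonal_def

section \<open>Quaternions as a Euclidean space\<close>

instantiation quat :: euclidean_space
begin

definition "Basis = {Quat 1 0 0 0, Quat 0 1 0 0, Quat 0 0 1 0, Quat 0 0 0 1}"

instance
proof
  show "(Basis :: quat set) \<noteq> {}" "finite (Basis :: quat set)" by (simp_all add: Basis_quat_def)
  show "inner u v = (if u = v then 1 else 0)" if "u \<in> Basis" "v \<in> Basis" for u v :: quat
    using that unfolding Basis_quat_def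
    by (elim insertE emptyE) (simp_all add: inner_quat_def)
  have "x = Quat 0 0 0 0" if "q1 x = 0" "qi x = 0" "qj x = 0" "qk x = 0" for x
    using that by (cases x) simp
  then show "(\<forall>u\<in>Basis. inner x u = 0) \<longleftrightarrow> x = 0" for x :: quat
    unfolding Basis_quat_def by (simp add: inner_quat_def zero_quat_def) (metis quat.sel)
qed

end

lemma bounded_linear_quat_coordinates:
  "bounded_linear q1" "bounded_linear qi" "bounded_linear qj" "bounded_linear qk"
  unfolding linear_conv_bounded_linear[symmetric]
  by (simp_all add: linear_iff plus_quat_def scaleR_quat_def)

lemma continuous_on_quat_coordinates [continuous_intros]:
  assumes "continuous_on S f"
  shows "continuous_on S (\<lambda>x. q1 (f x))" "continuous_on S (\<lambda>x. qi (f x))"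
    "continuous_on S (\<lambda>x. qj (f x))" "continuous_on S (\<lambda>x. qk (f x))"
  using assms by (simp_all add: bounded_linear.continuous_on[OF bounded_linear_quat_coordinates(1)]
      bounded_linear.continuous_on[OF bounded_linear_quat_coordinates(2)]
      bounded_linear.continuous_on[OF bounded_linear_quat_coordinates(3)]
      bounded_linear.continuous_on[OF bounded_linear_quat_coordinates(4)])

lemma quat_norm2: "(norm (z::quat))\<^sup>2 = (q1 z)\<^sup>2 + (qi z)\<^sup>2 + (qj z)\<^sup>2 + (qk z)\<^sup>2"
  by (simp add: norm_quat_def inner_quat_def power2_eq_square)

definition quat_conj :: "quat \<Rightarrow> quat" where
  "quat_conj z = Quat (q1 z) (- qi z) (- qj z) (- qk z)"

lemma inner_quat_mult_left: "inner (a * b) c = inner b (quat_conj a * (c::quat))"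
  by (simp add: inner_quat_def quat_conj_def times_quat_def algebra_simps)

lemma quat_conj_mult: "quat_conj (a * b) = quat_conj b * quat_conj a"
  by (simp add: quat_conj_def times_quat_def quat_eq_iff algebra_simps)

lemma of_real_quat: "of_real r = Quat r 0 0 0"
  by (simp add: of_real_def scaleR_quat_def one_quat_def)

lemma quat_mult_conj: "a * quat_conj a = of_real ((norm a)\<^sup>2)" "quat_conj a * a = of_real ((norm a)\<^sup>2)"
  unfolding of_real_quat quat_norm2
  by (simp_all add: quat_conj_def times_quat_def power2_eq_square)

lemma linear_quat_conj: "linear quat_conj"
  by (auto intro!: linearI simp: quat_conj_def plus_quat_def scaleR_quat_def)

lemma continuous_on_quat_conj [continuous_intros]:
  "continuous_on S f \<Longrightarrow> continuous_on S (\<lambda>x. quat_conj (f x))"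
  by (rule bounded_linear.continuous_on[OF iffD1[OF linear_conv_bounded_linear linear_quat_conj]])

section \<open>Matrices over a normed division algebra\<close>

lemma bounded_bilinear_matrix_mult:
  "bounded_bilinear (\<lambda>(A::'r::{euclidean_space,real_normed_div_algebra}^'n::finite^'n) B::'r^'n^'n. A ** B)"
  unfolding bilinear_conv_bounded_bilinear[symmetric] bilinear_def
  by (simp add: linear_iff matrix_matrix_mult_def vec_eq_iff sum.distrib algebra_simps
      scaleR_sum_right)

lemmas matrix_mult_bounded_bilinear_facts =
  bounded_bilinear.continuous_on[OF bounded_bilinear_matrix_mult, continuous_intros]

lemma GL_mult:
  assumes "A \<in> GL" "B \<in> GL" shows "A ** B \<in> GL"
proof -
  from assms obtain A' B' where "A ** A' = mat 1" "A' ** A = mat 1" "B ** B' = mat 1" "B' ** B = mat 1"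
    by (auto simp: GL_def invertible_def)
  moreover have "(A ** B) ** (B' ** A') = A ** (B ** B') ** A'" "(B' ** A') ** (A ** B) = B' ** (A' ** A) ** B"
    by (simp_all only: matrix_mul_assoc)
  ultimately have "(A ** B) ** (B' ** A') = mat 1" "(B' ** A') ** (A ** B) = mat 1"
    by (simp_all add: matrix_mul_rid)
  then show ?thesis by (auto simp: GL_def invertible_def)
qed

lemma GL_inv_cancel:
  assumes "A \<in> GL" shows "A ** matrix_inv A = mat 1" "matrix_inv A ** A = mat 1"
  using assms someI_ex[of "\<lambda>A'. A ** A' = mat 1 \<and> A' ** A = mat 1"]
  by (auto simp: GL_def invertible_def matrix_inv_def)

lemma GL_inv: "A \<in> GL \<Longrightarrow> matrix_inv A \<in> GL"
  using GL_inv_cancel[of A] by (auto simp: GL_def invertible_def)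

lemma GL_I: "A ** B = mat 1 \<Longrightarrow> B ** A = mat 1 \<Longrightarrow> A \<in> GL"
  by (auto simp: GL_def invertible_def)

lemma one_in_GL: "mat 1 \<in> GL"
  by (rule GL_I) (auto simp: matrix_mul_lid)

lemma matrix_inv_eqI:
  fixes A B :: "'r::ring_1^'n::finite^'n"
  assumes "A ** B = mat 1" "B ** A = mat 1" shows "matrix_inv A = B"
proof -
  have "matrix_inv A = (B ** A) ** matrix_inv A" using assms by (simp add: matrix_mul_lid)
  also have "\<dots> = B" using GL_inv_cancel(1)[OF GL_I[OF assms]]
    by (simp add: matrix_mul_assoc[symmetric] matrix_mul_rid)
  finally show ?thesis .
qed

lemma GL_cancel_left: "A \<in> GL \<Longrightarrow> A ** (matrix_inv A ** B) = B" "A \<in> GL \<Longrightarrow> matrix_inv A ** (A ** B) = B"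
  by (simp_all add: matrix_mul_assoc GL_inv_cancel)

lemma GL_cancel_right: "A \<in> GL \<Longrightarrow> (B ** A) ** matrix_inv A = B" "A \<in> GL \<Longrightarrow> (B ** matrix_inv A) ** A = B"
  by (simp_all add: matrix_mul_assoc[symmetric] GL_inv_cancel)

lemma matrix_inv_mult:
  assumes "A \<in> GL" "B \<in> GL" shows "matrix_inv (A ** B) = matrix_inv B ** matrix_inv A"
proof (rule matrix_inv_eqI)
  show "A ** B ** (matrix_inv B ** matrix_inv A) = mat 1"
    using assms by (simp add: matrix_mul_assoc GL_cancel_right GL_inv_cancel)
  show "matrix_inv B ** matrix_inv A ** (A ** B) = mat 1"
    using assms by (simp add: matrix_mul_assoc[symmetric] GL_cancel_left GL_inv_cancel)
qed

lemma matrix_inv_inv: "A \<in> GL \<Longrightarrow> matrix_inv (matrix_inv A) = A"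
  by (rule matrix_inv_eqI) (auto simp: GL_inv_cancel)

text \<open>
  Near \<open>1\<close> the identity \<open>y\<inverse> = 1 - (y - 1) y\<inverse>\<close> bounds \<open>y\<inverse>\<close>, and translation carries this to
  every invertible matrix. No commutativity of the entries enters.
\<close>

lemma continuous_on_matrix_inv:
  "continuous_on (GL :: ('r::{euclidean_space,real_normed_div_algebra}^'n::finite^'n) set) matrix_inv"
  unfolding continuous_on_sequentially
proof (intro allI ballI impI)
  fix x :: "nat \<Rightarrow> 'r^'n^'n" and a
  assume a: "a \<in> GL" and x: "(\<forall>n. x n \<in> GL) \<and> x \<longlonglongrightarrow> a"
  interpret bounded_bilinear "\<lambda>(A::'r^'n^'n) B::'r^'n^'n. A ** B"
    by (rule bounded_bilinear_matrix_mult)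
  obtain K where K: "K > 0" "\<And>(A::'r^'n^'n) (B::'r^'n^'n). norm (A ** B) \<le> norm A * norm B * K"
    using pos_bounded by blast
  define I where "I = norm (mat 1 :: 'r^'n^'n)"
  define y where "y n = matrix_inv a ** x n" for n
  have yGL: "y n \<in> GL" for n using a x by (simp add: y_def GL_mult GL_inv)
  have y1: "y \<longlonglongrightarrow> mat 1"
    unfolding y_def using tendsto[OF tendsto_const[of "matrix_inv a"] conjunct2[OF x]] GL_inv_cancel(2)[OF a] by simp
  have yinv: "matrix_inv (y n) = mat 1 - (y n - mat 1) ** matrix_inv (y n)" for n
    by (simp add: diff_left GL_inv_cancel[OF yGL] matrix_mul_lid)
  have "\<forall>\<^sub>F n in sequentially. norm (y n - mat 1) * K \<le> 1/2"
  proof -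
    have "(\<lambda>n. norm (y n - mat 1) * K) \<longlonglongrightarrow> 0"
      by (rule tendsto_mult_left_zero) (use y1 in \<open>simp add: tendsto_norm_zero_iff LIM_zero_iff\<close>)
    then show ?thesis by (rule eventually_mono[OF order_tendstoD(2)[of _ _ _ "1/2"]]) auto
  qed
  then have bnd: "\<forall>\<^sub>F n in sequentially. norm (matrix_inv (y n)) \<le> 2 * I"
  proof eventually_elim
    case (elim n)
    have "norm (matrix_inv (y n)) \<le> I + norm ((y n - mat 1) ** matrix_inv (y n))"
      unfolding I_def by (subst yinv) (rule norm_triangle_ineq4)
    also have "\<dots> \<le> I + (norm (y n - mat 1) * K) * norm (matrix_inv (y n))"
      using K(2)[of "y n - mat 1" "matrix_inv (y n)"] by (simp add: mult_ac)
    also have "\<dots> \<le> I + 1/2 * norm (matrix_inv (y n))"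
      by (intro add_left_mono mult_right_mono elim) auto
    finally show ?case by simp
  qed
  have "(\<lambda>n. (y n - mat 1) ** matrix_inv (y n)) \<longlonglongrightarrow> 0"
  proof (rule Lim_null_comparison)
    show "\<forall>\<^sub>F n in sequentially. norm ((y n - mat 1) ** matrix_inv (y n)) \<le> norm (y n - mat 1) * (2 * I) * K"
      using bnd by eventually_elim
        (rule order_trans[OF K(2)], use K(1) in \<open>auto intro!: mult_right_mono mult_left_mono\<close>)
    show "(\<lambda>n. norm (y n - mat 1) * (2 * I) * K) \<longlonglongrightarrow> 0"
      by (intro tendsto_mult_left_zero) (use y1 in \<open>simp add: tendsto_norm_zero_iff LIM_zero_iff\<close>)
  qed
  then have "(\<lambda>n. matrix_inv (y n)) \<longlonglongrightarrow> mat 1 - 0"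
    by (subst yinv) (intro tendsto_intros)
  then have "(\<lambda>n. matrix_inv (y n) ** matrix_inv a) \<longlonglongrightarrow> mat 1 ** matrix_inv a"
    by (intro tendsto) auto
  moreover have "matrix_inv (y n) ** matrix_inv a = matrix_inv (x n)" for n
    using a x by (simp add: y_def matrix_inv_mult GL_inv matrix_inv_inv GL_cancel_right)
  ultimately show "(matrix_inv \<circ> x) \<longlonglongrightarrow> matrix_inv a"
    by (simp add: matrix_mul_lid o_def)
qed

text \<open>Column \<open>e\<close> of \<open>g\<close> is the vector \<open>g e\<close>; right multiplication by \<open>P\<close> only rescales it.\<close>

lemma parabolic_column:
  assumes "B \<in> parabolic e" shows "(A ** B) $ i $ e = A $ i $ e * B $ e $ e"
proof -
  have "(A ** B) $ i $ e = (\<Sum>k\<in>UNIV. A $ i $ k * B $ k $ e)" by (simp add: matrix_matrix_mult_def)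
  also have "\<dots> = (\<Sum>k\<in>{e}. A $ i $ k * B $ k $ e)"
    using assms by (intro sum.mono_neutral_right) (auto simp: parabolic_def)
  finally show ?thesis by simp
qed

lemma parabolic_GL: "x \<in> parabolic e \<Longrightarrow> x \<in> GL" by (simp add: parabolic_def)

lemma parabolic_mult:
  "x \<in> parabolic e \<Longrightarrow> y \<in> parabolic e \<Longrightarrow> x ** y \<in> parabolic e"
  using parabolic_column[of y e x] by (auto simp: parabolic_def GL_mult)

lemma parabolic_inv_ee:
  assumes "x \<in> parabolic e"
  shows "matrix_inv x $ e $ e * x $ e $ e = 1"
  using parabolic_column[OF assms, of "matrix_inv x" e] GL_inv_cancel(2)[OF parabolic_GL[OF assms]]
  by (simp add: mat_def)

lemma parabolic_ee_nonzero: "(x::'r::division_ring^'n::finite^'n) \<in> parabolic e \<Longrightarrow> x $ e $ e \<noteq> 0"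
  using parabolic_inv_ee[of x e] by auto

lemma parabolic_inv:
  assumes "(x::'r::division_ring^'n::finite^'n) \<in> parabolic e"
  shows "matrix_inv x \<in> parabolic e" "matrix_inv x $ e $ e = inverse (x $ e $ e)"
proof -
  have *: "matrix_inv x $ i $ e * x $ e $ e = (if i = e then 1 else 0)" for i
    using parabolic_column[OF assms, of "matrix_inv x" i] GL_inv_cancel(2)[OF parabolic_GL[OF assms]]
    by (simp add: mat_def)
  have "matrix_inv x $ i $ e = 0" if "i \<noteq> e" for i
    using *[of i] parabolic_ee_nonzero[OF assms] that by simp
  then show "matrix_inv x \<in> parabolic e"
    using GL_inv[OF parabolic_GL[OF assms]] by (simp add: parabolic_def)
  have "matrix_inv x $ e $ e = matrix_inv x $ e $ e * (x $ e $ e * inverse (x $ e $ e))"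
    using parabolic_ee_nonzero[OF assms] by simp
  also have "\<dots> = inverse (x $ e $ e)"
    using *[of e] by (simp add: mult.assoc[symmetric] del: right_inverse)
  finally show "matrix_inv x $ e $ e = inverse (x $ e $ e)" .
qed

lemma same_column_parabolic:
  assumes "g \<in> GL" "g' \<in> GL" and col: "\<And>i. g' $ i $ e = g $ i $ e * w"
  shows "matrix_inv g ** g' \<in> parabolic e" "(matrix_inv g ** g') $ e $ e = w"
proof -
  have "(matrix_inv g ** g') $ i $ e = (if i = e then w else 0)" for i
  proof -
    have "(matrix_inv g ** g') $ i $ e = (\<Sum>k\<in>UNIV. matrix_inv g $ i $ k * g $ k $ e) * w"
      by (simp add: matrix_matrix_mult_def col sum_distrib_right mult.assoc)
    also have "\<dots> = (matrix_inv g ** g) $ i $ e * w" by (simp add: matrix_matrix_mult_def)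
    finally show ?thesis by (simp add: GL_inv_cancel assms mat_def)
  qed
  then show "matrix_inv g ** g' \<in> parabolic e" "(matrix_inv g ** g') $ e $ e = w"
    using assms by (auto simp: parabolic_def GL_mult GL_inv)
qed

section \<open>Quaternionic matrices inside complex matrices\<close>

lemma axis_mult_vec: "(A *v axis j q) = (\<chi> i. A $ i $ j * (q::'r::ring_1))"
proof -
  have "(\<Sum>k\<in>UNIV. A $ i $ k * axis j q $ k) = A $ i $ j * q" for i
    using sum.delta[of UNIV j "\<lambda>k. A $ i $ k * q"] by (simp add: axis_def if_distrib cong: if_cong)
  then show ?thesis by (simp add: matrix_vector_mult_def vec_eq_iff)
qed

lemma quat_matrix_embed_entries:
  "quat_matrix_embed A $ Inl i $ Inl j = Complex (q1 (A $ i $ j)) (qi (A $ i $ j))"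
  "quat_matrix_embed A $ Inr i $ Inl j = Complex (qj (A $ i $ j)) (- qk (A $ i $ j))"
  "quat_matrix_embed A $ Inl i $ Inr j = Complex (- qj (A $ i $ j)) (- qk (A $ i $ j))"
  "quat_matrix_embed A $ Inr i $ Inr j = Complex (q1 (A $ i $ j)) (- qi (A $ i $ j))"
proof -
  have l: "complex_to_quat_vec (axis (Inl j) 1) = axis j 1"
    by (auto simp: complex_to_quat_vec_def vec_eq_iff axis_def zero_quat_def one_quat_def)
  have r: "complex_to_quat_vec (axis (Inr j) 1) = axis j (Quat 0 0 1 0)"
    by (auto simp: complex_to_quat_vec_def vec_eq_iff axis_def zero_quat_def one_quat_def)
  show "quat_matrix_embed A $ Inl i $ Inl j = Complex (q1 (A $ i $ j)) (qi (A $ i $ j))"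
    "quat_matrix_embed A $ Inr i $ Inl j = Complex (qj (A $ i $ j)) (- qk (A $ i $ j))"
    "quat_matrix_embed A $ Inl i $ Inr j = Complex (- qj (A $ i $ j)) (- qk (A $ i $ j))"
    "quat_matrix_embed A $ Inr i $ Inr j = Complex (q1 (A $ i $ j)) (- qi (A $ i $ j))"
    by (simp_all add: quat_matrix_embed_def matrix_def l r axis_mult_vec quat_to_complex_vec_def
        times_quat_def one_quat_def)
qed

lemma quat_matrix_embed_mult_vec:
  "quat_matrix_embed A *v u = quat_to_complex_vec (A *v complex_to_quat_vec u)"
  using quat_matrix_embed_mult[of A "complex_to_quat_vec u"] by simp

lemma quat_matrix_embed_hom: "quat_matrix_embed (A ** B) = quat_matrix_embed A ** quat_matrix_embed B"
  by (simp add: matrix_eq quat_matrix_embed_mult_vec flip: matrix_vector_mul_assoc)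

lemma quat_matrix_embed_one: "quat_matrix_embed (mat 1) = mat 1"
  by (simp add: matrix_eq quat_matrix_embed_mult_vec)

lemma quat_matrix_embed_GL:
  assumes "A \<in> GL"
  shows "quat_matrix_embed A \<in> GL" "matrix_inv (quat_matrix_embed A) = quat_matrix_embed (matrix_inv A)"
proof -
  have *: "quat_matrix_embed A ** quat_matrix_embed (matrix_inv A) = mat 1"
    "quat_matrix_embed (matrix_inv A) ** quat_matrix_embed A = mat 1"
    by (simp_all add: GL_inv_cancel[OF assms] quat_matrix_embed_one flip: quat_matrix_embed_hom)
  show "quat_matrix_embed A \<in> GL" by (rule GL_I[OF *])
  show "matrix_inv (quat_matrix_embed A) = quat_matrix_embed (matrix_inv A)" by (rule matrix_inv_eqI[OF *])
qed

lemma sum_UNIV_Plus: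
  fixes g :: "'a::finite + 'b::finite \<Rightarrow> 'c::comm_monoid_add"
  shows "(\<Sum>s\<in>UNIV. g s) = (\<Sum>i\<in>UNIV. g (Inl i)) + (\<Sum>i\<in>UNIV. g (Inr i))"
  using sum.Plus[of "UNIV :: 'a set" "UNIV :: 'b set" g] by simp

lemma norm_quat_to_complex_vec: "norm (quat_to_complex_vec v) = norm v"
  unfolding norm_vec_def L2_set_def sum_UNIV_Plus sum.distrib[symmetric]
  by (simp add: quat_to_complex_vec_def cmod_power2 quat_norm2 add.assoc)

lemma norm_complex_to_quat_vec: "norm (complex_to_quat_vec u) = norm u"
  using norm_quat_to_complex_vec[of "complex_to_quat_vec u"] by simp

lemma quat_matrix_embed_isometry:
  assumes "A \<in> isometry_group" shows "quat_matrix_embed A \<in> isometry_group"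
  using assms quat_matrix_embed_GL[of A]
  by (simp add: isometry_group_def quat_matrix_embed_mult_vec norm_quat_to_complex_vec
      norm_complex_to_quat_vec)

lemma continuous_on_quat_matrix_embed:
  "continuous_on S (quat_matrix_embed :: quat^'m::finite^'m \<Rightarrow> _)"
proof -
  have "continuous_on S (\<lambda>A::quat^'m^'m. quat_matrix_embed A $ s $ t)" for s t
    by (cases s; cases t)
      (simp_all add: quat_matrix_embed_entries Complex_eq continuous_intros)
  then have "continuous_on S (\<lambda>A::quat^'m^'m. \<chi> s t. quat_matrix_embed A $ s $ t)"
    by (intro continuous_on_vec_lambda) 
  then show ?thesis by (simp add: vec_nth_inverse)
qed

section \<open>Determinants on subspaces\<close>

definition onb :: "'a::real_inner set \<Rightarrow> 'a set \<Rightarrow> bool" where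
  "onb B S \<longleftrightarrow> finite B \<and> pairwise orthogonal B \<and> (\<forall>b\<in>B. norm b = 1) \<and> span B = S"

definition det_sum :: "'a::real_inner set \<Rightarrow> ('a \<Rightarrow> 'a) \<Rightarrow> real" where
  "det_sum B T = (\<Sum>p | p permutes B. of_int (sign p) * (\<Prod>b\<in>B. inner (T b) (p b)))"

lemma onb_exists:
  fixes S :: "'a::euclidean_space set"
  assumes "subspace S" obtains B where "onb B S"
proof -
  obtain B where "pairwise orthogonal B" "\<And>x. x \<in> B \<Longrightarrow> norm x = 1" "independent B" "span B = S"
    using orthonormal_basis_subspace[OF assms] by metis
  then have "onb B S" by (auto simp: onb_def independent_imp_finite)
  with that show thesis .
qed

lemma det_on_eq_det_sum:
  fixes S :: "'a::euclidean_space set"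
  assumes "subspace S"
  obtains B where "onb B S" "\<And>T. det_on S T = det_sum B T"
proof -
  define B where "B = (SOME B. finite B \<and> pairwise orthogonal B \<and> (\<forall>b\<in>B. norm b = 1) \<and> span B = S)"
  have "\<exists>B. onb B S" using onb_exists[OF assms] by metis
  then have "onb B S" unfolding B_def onb_def by (rule someI_ex)
  moreover have "det_on S T = det_sum B T" for T
    by (simp add: det_on_def det_sum_def Let_def B_def)
  ultimately show thesis by (rule that)
qed

lemma onb_subset: "onb B S \<Longrightarrow> b \<in> B \<Longrightarrow> b \<in> S"
  by (auto simp: onb_def span_base)

lemma onb_inner: "onb B S \<Longrightarrow> a \<in> B \<Longrightarrow> b \<in> B \<Longrightarrow> inner a b = (if a = b then 1 else 0)"
  by (auto simp: onb_def pairwise_def orthogonal_def norm_eq_1)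

lemma onb_expand: "onb B S \<Longrightarrow> x \<in> S \<Longrightarrow> (\<Sum>b\<in>B. inner x b *\<^sub>R b) = x"
  by (rule orthonormal_basis_expand) (auto simp: onb_def)

lemma onb_inner_expand:
  assumes "onb B S" "x \<in> S" shows "inner x y = (\<Sum>b\<in>B. inner x b * inner b y)"
proof -
  have "inner x y = inner (\<Sum>b\<in>B. inner x b *\<^sub>R b) y" using onb_expand[OF assms] by simp
  then show ?thesis by (simp add: inner_sum_left)
qed

text \<open>
  Enumerating the basis turns the sum over permutations into the determinant of a square matrix
  indexed by numbers, for which multiplicativity is known.
\<close>

definition mat_on :: "nat \<Rightarrow> (nat \<Rightarrow> 'a::real_inner) \<Rightarrow> ('a \<Rightarrow> 'a) \<Rightarrow> real mat" where
  "mat_on n f T = Matrix.mat n n (\<lambda>(i, j). inner (T (f i)) (f j))"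

lemma det_sum_eq_det:
  assumes f: "bij_betw f {0..<n} B"
  shows "det_sum B T = Determinant.det (mat_on n f T)"
proof -
  have inj: "inj_on f {0..<n}" using f by (simp add: bij_betw_def)
  have "det_sum B T = (\<Sum>p | p permutes {0..<n}. of_int (sign (map_permutation {0..<n} f p)) *
      (\<Prod>b\<in>B. inner (T b) (map_permutation {0..<n} f p b)))"
    unfolding det_sum_def
    by (rule sum.reindex_bij_betw[symmetric], use bij_betw_permutations[OF f] f in
      \<open>simp add: map_permutation_def restrict_id_def bij_betw_def cong: if_cong\<close>)
  also have "\<dots> = (\<Sum>p | p permutes {0..<n}. of_int (sign p) * (\<Prod>i = 0..<n. inner (T (f i)) (f (p i))))"
  proof (rule sum.cong[OF refl])
    fix p assume "p \<in> {p. p permutes {0..<n}}"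
    then have p: "p permutes {0..<n}" by simp
    have "(\<Prod>b\<in>B. inner (T b) (map_permutation {0..<n} f p b)) =
        (\<Prod>i = 0..<n. inner (T (f i)) (map_permutation {0..<n} f p (f i)))"
      by (rule prod.reindex_bij_betw[OF f, symmetric])
    then show "of_int (sign (map_permutation {0..<n} f p)) * (\<Prod>b\<in>B. inner (T b) (map_permutation {0..<n} f p b))
        = of_int (sign p) * (\<Prod>i = 0..<n. inner (T (f i)) (f (p i)))"
      by (simp add: sign_map_permutation[OF inj p] map_permutation_apply[OF inj])
  qed
  also have "\<dots> = Determinant.det (mat_on n f T)"
    unfolding Determinant.det_def mat_on_def
    by (auto intro!: sum.cong prod.cong dest: permutes_in_image[of _ "{0..<n}"])
  finally show ?thesis .
qed

lemma mat_on_carrier: "mat_on n f T \<in> carrier_mat n n"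
  by (simp add: mat_on_def)

lemma onb_enumerate:
  assumes "onb B S" obtains f where "bij_betw f {0..<card B} B"
  using assms ex_bij_betw_nat_finite[of B] by (auto simp: onb_def)

lemma det_sum_comp:
  assumes B: "onb B S" and T1: "linear T1" and T2: "\<And>x. x \<in> S \<Longrightarrow> T2 x \<in> S"
  shows "det_sum B (\<lambda>x. T1 (T2 x)) = det_sum B T1 * det_sum B T2"
proof -
  obtain f where f: "bij_betw f {0..<card B} B" using onb_enumerate[OF B] .
  have fB: "f i \<in> B" if "i < card B" for i using f that by (auto simp: bij_betw_def)
  have "mat_on (card B) f (\<lambda>x. T1 (T2 x)) = mat_on (card B) f T2 * mat_on (card B) f T1"
  proof (rule eq_matI; simp add: mat_on_def scalar_prod_def)
    fix i k assume ik: "i < card B" "k < card B"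
    have "T2 (f i) \<in> S" using ik fB onb_subset[OF B] T2 by blast
    then have "T1 (T2 (f i)) = T1 (\<Sum>b\<in>B. inner (T2 (f i)) b *\<^sub>R b)" using onb_expand[OF B] by simp
    also have "\<dots> = (\<Sum>b\<in>B. inner (T2 (f i)) b *\<^sub>R T1 b)" by (simp add: linear_sum[OF T1] linear_cmul[OF T1])
    also have "\<dots> = (\<Sum>j = 0..<card B. inner (T2 (f i)) (f j) *\<^sub>R T1 (f j))"
      by (rule sum.reindex_bij_betw[OF f, symmetric])
    finally show "inner (T1 (T2 (f i))) (f k) = (\<Sum>j = 0..<card B. inner (T2 (f i)) (f j) * inner (T1 (f j)) (f k))"
      by (simp add: inner_sum_left)
  qed
  then show ?thesis
    by (simp add: det_sum_eq_det[OF f] Determinant.det_mult[OF mat_on_carrier mat_on_carrier])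
qed

lemma det_sum_id:
  assumes B: "onb B S" shows "det_sum B (\<lambda>x. x) = 1"
proof -
  obtain f where f: "bij_betw f {0..<card B} B" using onb_enumerate[OF B] .
  have "mat_on (card B) f (\<lambda>x. x) = 1\<^sub>m (card B)"
  proof (rule eq_matI; simp add: mat_on_def)
    fix i j assume ij: "i < card B" "j < card B"
    then have "f i \<in> B" "f j \<in> B" "f i = f j \<longleftrightarrow> i = j" using f by (auto simp: bij_betw_def inj_on_def)
    then show "(i = j \<longrightarrow> inner (f j) (f j) = 1) \<and> (i \<noteq> j \<longrightarrow> inner (f i) (f j) = 0)"
      using onb_inner[OF B] by simp
  qed
  then show ?thesis by (simp add: det_sum_eq_det[OF f])
qed

text \<open>
  With the identity map for \<open>\<phi>\<close> this says that the determinant does not depend on the orthonormal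
  basis; in general it transports a determinant from one space to an isometric one.
\<close>

lemma det_sum_isometry:
  assumes B: "onb B S" and B': "onb B' S'"
    and \<phi>: "linear \<phi>" "\<And>x y. x \<in> S \<Longrightarrow> y \<in> S \<Longrightarrow> inner (\<phi> x) (\<phi> y) = inner x y" "\<phi> ` S = S'"
    and T: "linear T'" "\<And>x. x \<in> S \<Longrightarrow> T x \<in> S" "\<And>x. x \<in> S \<Longrightarrow> \<phi> (T x) = T' (\<phi> x)"
  shows "det_sum B T = det_sum B' T'"
proof -
  have BS: "b \<in> B \<Longrightarrow> b \<in> S" and BS': "c \<in> B' \<Longrightarrow> c \<in> S'" for b c
    using onb_subset B B' by blast+
  have \<phi>S: "x \<in> S \<Longrightarrow> \<phi> x \<in> S'" for x using \<phi>(3) by blast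
  \<comment> \<open>Both cardinalities are the sum of the squares of all entries of the transition matrix.\<close>
  have "(\<Sum>c\<in>B'. inner (\<phi> b) c * inner c (\<phi> b)) = 1" if "b \<in> B" for b
    using onb_inner_expand[OF B' \<phi>S[OF BS[OF that]], of "\<phi> b"] \<phi>(2)[OF BS BS, OF that that]
      onb_inner[OF B that that] by simp
  then have "real (card B) = (\<Sum>b\<in>B. \<Sum>c\<in>B'. inner (\<phi> b) c * inner c (\<phi> b))"
    by simp
  also have "\<dots> = (\<Sum>c\<in>B'. \<Sum>b\<in>B. inner (\<phi> b) c * inner c (\<phi> b))" by (rule sum.swap)
  also have "\<dots> = (\<Sum>c\<in>B'. 1)"
  proof (rule sum.cong[OF refl])
    fix c assume c: "c \<in> B'"
    then obtain y where y: "y \<in> S" "c = \<phi> y" using BS' \<phi>(3) by blast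
    have "(\<Sum>b\<in>B. inner (\<phi> b) c * inner c (\<phi> b)) = (\<Sum>b\<in>B. inner y b * inner b y)"
      by (intro sum.cong) (simp_all add: y BS \<phi>(2) inner_commute)
    also have "\<dots> = inner c c" using onb_inner_expand[OF B y(1), of y] \<phi>(2)[OF y(1) y(1)] y by simp
    finally show "(\<Sum>b\<in>B. inner (\<phi> b) c * inner c (\<phi> b)) = 1" using onb_inner[OF B' c c] by simp
  qed
  finally have card: "card B' = card B" by simp
  obtain f where f: "bij_betw f {0..<card B} B" using onb_enumerate[OF B] .
  obtain g where g: "bij_betw g {0..<card B} B'" using onb_enumerate[OF B'] card by auto
  have fB: "f i \<in> B" if "i < card B" for i using f that by (auto simp: bij_betw_def)
  define Q where "Q = Matrix.mat (card B) (card B) (\<lambda>(i, j). inner (\<phi> (f i)) (g j))"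
  have Q: "Q \<in> carrier_mat (card B) (card B)" by (simp add: Q_def)
  have sumB': "(\<Sum>j = 0..<card B. h (g j)) = (\<Sum>c\<in>B'. h c)" for h :: "'b \<Rightarrow> real"
    by (rule sum.reindex_bij_betw[OF g])
  have "mat_on (card B) f T * Q = Q * mat_on (card B) g T'"
  proof (rule eq_matI; simp add: mat_on_def Q_def scalar_prod_def)
    fix i k assume ik: "i < card B" "k < card B"
    have S: "f i \<in> S" "T (f i) \<in> S" using fB ik BS T by blast+
    have "\<phi> (T (f i)) = \<phi> (\<Sum>b\<in>B. inner (T (f i)) b *\<^sub>R b)" using onb_expand[OF B S(2)] by simp
    also have "\<dots> = (\<Sum>b\<in>B. inner (T (f i)) b *\<^sub>R \<phi> b)" by (simp add: linear_sum[OF \<phi>(1)] linear_cmul[OF \<phi>(1)])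
    also have "\<dots> = (\<Sum>j = 0..<card B. inner (T (f i)) (f j) *\<^sub>R \<phi> (f j))"
      by (rule sum.reindex_bij_betw[OF f, symmetric])
    finally have 1: "inner (\<phi> (T (f i))) (g k) = (\<Sum>j = 0..<card B. inner (T (f i)) (f j) * inner (\<phi> (f j)) (g k))"
      by (simp add: inner_sum_left)
    have "T' (\<phi> (f i)) = T' (\<Sum>c\<in>B'. inner (\<phi> (f i)) c *\<^sub>R c)" using onb_expand[OF B' \<phi>S[OF S(1)]] by simp
    also have "\<dots> = (\<Sum>c\<in>B'. inner (\<phi> (f i)) c *\<^sub>R T' c)" by (simp add: linear_sum[OF T(1)] linear_cmul[OF T(1)])
    also have "\<dots> = (\<Sum>j = 0..<card B. inner (\<phi> (f i)) (g j) *\<^sub>R T' (g j))"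
      by (rule sum.reindex_bij_betw[OF g, symmetric])
    finally have 2: "inner (T' (\<phi> (f i))) (g k) = (\<Sum>j = 0..<card B. inner (\<phi> (f i)) (g j) * inner (T' (g j)) (g k))"
      by (simp add: inner_sum_left)
    show "(\<Sum>j = 0..<card B. inner (T (f i)) (f j) * inner (\<phi> (f j)) (g k)) =
        (\<Sum>j = 0..<card B. inner (\<phi> (f i)) (g j) * inner (T' (g j)) (g k))"
      using 1 2 T(3)[OF S(1)] by simp
  qed
  then have "Determinant.det (mat_on (card B) f T) * Determinant.det Q
      = Determinant.det Q * Determinant.det (mat_on (card B) g T')"
    by (metis Determinant.det_mult mat_on_carrier Q)
  moreover have "Q * Q\<^sup>T = 1\<^sub>m (card B)"
  proof (rule eq_matI; simp add: Q_def scalar_prod_def)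
    fix i k assume ik: "i < card B" "k < card B"
    have "(\<Sum>j = 0..<card B. inner (\<phi> (f i)) (g j) * inner (\<phi> (f k)) (g j)) = inner (f i) (f k)"
      using onb_inner_expand[OF B' \<phi>S[OF BS[OF fB[OF ik(1)]]], of "\<phi> (f k)"]
        sumB'[of "\<lambda>c. inner (\<phi> (f i)) c * inner (\<phi> (f k)) c"] \<phi>(2) BS fB ik by (simp add: inner_commute)
    moreover have "f i = f k \<longleftrightarrow> i = k" using f ik by (auto simp: bij_betw_def inj_on_def)
    ultimately show "(i = k \<longrightarrow> (\<Sum>j = 0..<card B. inner (\<phi> (f k)) (g j) * inner (\<phi> (f k)) (g j)) = 1) \<and>
        (i \<noteq> k \<longrightarrow> (\<Sum>j = 0..<card B. inner (\<phi> (f i)) (g j) * inner (\<phi> (f k)) (g j)) = 0)"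
      using onb_inner[OF B fB[OF ik(1)] fB[OF ik(2)]] by auto
  qed
  then have "Determinant.det Q * Determinant.det Q = 1"
    using Determinant.det_mult[OF Q, of "Q\<^sup>T"] Determinant.det_transpose[OF Q] Q by simp
  ultimately have "Determinant.det (mat_on (card B) f T) = Determinant.det (mat_on (card B) g T')"
    by (metis mult.commute mult_cancel_left mult_zero_left zero_neq_one)
  then show ?thesis by (simp add: det_sum_eq_det[OF f] det_sum_eq_det[OF g])
qed

text \<open>
  A permutation that moves \<open>b\<close> sends some other element to \<open>b\<close> and contributes nothing.
\<close>

lemma det_sum_insert:
  assumes "finite B" "b \<notin> B" and bb: "inner (T b) b = 1" and b: "\<And>c. c \<in> B \<Longrightarrow> inner (T c) b = 0"
  shows "det_sum (insert b B) T = det_sum B T"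
proof -
  have "det_sum (insert b B) T = (\<Sum>p | p permutes B. of_int (sign p) * (\<Prod>c\<in>insert b B. inner (T c) (p c)))"
    unfolding det_sum_def
  proof (rule sum.mono_neutral_right)
    show "finite {p. p permutes insert b B}" using assms by (simp add: finite_permutations)
    show "{p. p permutes B} \<subseteq> {p. p permutes insert b B}" by (auto intro: permutes_subset)
    show "\<forall>p\<in>{p. p permutes insert b B} - {p. p permutes B}.
        of_int (sign p) * (\<Prod>c\<in>insert b B. inner (T c) (p c)) = 0"
    proof
      fix p assume p: "p \<in> {p. p permutes insert b B} - {p. p permutes B}"
      then have "p b \<noteq> b" using permutes_superset[of p "insert b B" B] by auto
      moreover obtain c where c: "p c = b" using p permutes_surj[of p "insert b B"] by (metis DiffD1 mem_Collect_eq surjD)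
      moreover have "c \<in> insert b B" using p c permutes_in_image[of p "insert b B" c] by simp
      ultimately have "c \<in> B" by auto
      then have "(\<Prod>c\<in>insert b B. inner (T c) (p c)) = 0"
        using b[of c] c assms(1) by (auto intro!: prod_zero)
      then show "of_int (sign p) * (\<Prod>c\<in>insert b B. inner (T c) (p c)) = 0" by simp
    qed
  qed
  also have "\<dots> = det_sum B T"
    unfolding det_sum_def using assms by (auto intro!: sum.cong simp: permutes_not_in)
  finally show ?thesis .
qed

lemma det_sum_bound:
  assumes "finite B" and C: "\<And>a b. a \<in> B \<Longrightarrow> b \<in> B \<Longrightarrow> \<bar>inner (T a) b\<bar> \<le> C"
  shows "\<bar>det_sum B T\<bar> \<le> fact (card B) * C ^ card B"
proof -
  have "\<bar>det_sum B T\<bar> \<le> (\<Sum>p | p permutes B. \<bar>of_int (sign p) * (\<Prod>b\<in>B. inner (T b) (p b))\<bar>)"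
    unfolding det_sum_def by (rule sum_abs)
  also have "\<dots> \<le> (\<Sum>p | p permutes B. C ^ card B)"
  proof (rule sum_mono)
    fix p assume p: "p \<in> {p. p permutes B}"
    have "\<bar>of_int (sign p) * (\<Prod>b\<in>B. inner (T b) (p b))\<bar> = (\<Prod>b\<in>B. \<bar>inner (T b) (p b)\<bar>)"
      by (simp add: abs_mult abs_prod sign_def)
    also have "\<dots> \<le> (\<Prod>b\<in>B. C)"
      using p C by (intro prod_mono) (auto simp: permutes_in_image)
    finally show "\<bar>of_int (sign p) * (\<Prod>b\<in>B. inner (T b) (p b))\<bar> \<le> C ^ card B" by simp
  qed
  also have "\<dots> = fact (card B) * C ^ card B" using assms by (simp add: card_permutations)
  finally show ?thesis .
qed

section \<open>The modulus of the parabolic subgroup\<close>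

lemma subspace_nilradical: "subspace (nilradical e :: ('r::{real_inner,ring_1}^'n::finite^'n) set)"
  by (auto simp: subspace_def nilradical_def)

lemma linear_Ad: "linear (Ad (g :: 'r::{euclidean_space,real_normed_div_algebra}^'n::finite^'n))"
proof -
  interpret bounded_bilinear "\<lambda>(A::'r^'n^'n) B::'r^'n^'n. A ** B" by (rule bounded_bilinear_matrix_mult)
  show ?thesis unfolding Ad_def by (auto intro!: linearI simp: add_right add_left scaleR_left scaleR_right)
qed

lemma nilradical_mult_left:
  fixes x X :: "'r::ring_1^'n::finite^'n"
  assumes "x \<in> parabolic e" "X \<in> nilradical e"
  shows "(x ** X) $ i $ j = (if i = e then x $ e $ e * X $ e $ j else 0)"
proof -
  have "(x ** X) $ i $ j = (\<Sum>l\<in>UNIV. x $ i $ l * X $ l $ j)" by (simp add: matrix_matrix_mult_def)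
  also have "\<dots> = (\<Sum>l\<in>{e}. x $ i $ l * X $ l $ j)"
    using assms(2) by (intro sum.mono_neutral_right) (auto simp: nilradical_def)
  finally show ?thesis using assms(1) by (simp add: parabolic_def)
qed

lemma nilradical_mult_right:
  fixes x X :: "'r::ring_1^'n::finite^'n"
  assumes "x \<in> parabolic e" "X \<in> nilradical e"
  shows "X ** x \<in> nilradical e"
proof -
  have "(X ** x) $ i $ j = 0" if "i \<noteq> e" for i j
    using assms that by (simp add: matrix_matrix_mult_def nilradical_def)
  moreover have "(X ** x) $ e $ e = 0"
    using assms by (simp add: parabolic_column) (simp add: nilradical_def)
  ultimately show ?thesis by (simp add: nilradical_def) metis
qed

lemma Ad_nilradical:
  fixes x X :: "'r::division_ring^'n::finite^'n"
  assumes x: "x \<in> parabolic e" and X: "X \<in> nilradical e"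
  shows "Ad x X \<in> nilradical e"
proof -
  have "x ** X \<in> nilradical e"
    using X by (auto simp: nilradical_def nilradical_mult_left[OF x X])
  then show ?thesis
    unfolding Ad_def by (rule nilradical_mult_right[OF parabolic_inv(1)[OF x]])
qed

lemma modulus_basis:
  fixes e :: "'n::finite"
  shows "\<exists>B. onb B (nilradical e) \<and>
    (\<forall>x::'r::{euclidean_space,real_normed_div_algebra}^'n^'n. modulus e x = \<bar>det_sum B (Ad x)\<bar>)"
proof -
  have "subspace (nilradical e :: ('r^'n^'n) set)" by (rule subspace_nilradical)
  from det_on_eq_det_sum[OF this] show ?thesis unfolding modulus_def by metis
qed

lemma modulus_eq:
  fixes x :: "'r::{euclidean_space,real_normed_div_algebra}^'n::finite^'n"
  assumes B: "onb B (nilradical e)" and x: "x \<in> parabolic e"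
  shows "modulus e x = \<bar>det_sum B (Ad x)\<bar>"
proof -
  obtain C where C: "onb C (nilradical e)" "modulus e x = \<bar>det_sum C (Ad x)\<bar>"
    using modulus_basis[of e] by metis
  have "det_sum C (Ad x) = det_sum B (Ad x)"
    by (rule det_sum_isometry[OF C(1) B, where \<phi>="\<lambda>x. x"])
      (auto simp: linear_Ad Ad_nilradical[OF x] linear_ident)
  with C show ?thesis by simp
qed

lemma Ad_mult:
  "x \<in> GL \<Longrightarrow> y \<in> GL \<Longrightarrow> Ad (x ** y) X = Ad x (Ad y X)"
  by (simp add: Ad_def matrix_inv_mult matrix_mul_assoc)

lemma modulus_mult:
  fixes x y :: "'r::{euclidean_space,real_normed_div_algebra}^'n::finite^'n"
  assumes x: "x \<in> parabolic e" and y: "y \<in> parabolic e"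
  shows "modulus e (x ** y) = modulus e x * modulus e y"
proof -
  obtain B where B: "onb B (nilradical e :: ('r^'n^'n) set)" using onb_exists[OF subspace_nilradical] .
  have "det_sum B (Ad (x ** y)) = det_sum B (\<lambda>X. Ad x (Ad y X))"
    using Ad_mult[OF parabolic_GL[OF x] parabolic_GL[OF y]] by presburger
  also have "\<dots> = det_sum B (Ad x) * det_sum B (Ad y)"
    by (rule det_sum_comp[OF B linear_Ad Ad_nilradical[OF y]])
  finally show ?thesis using x y by (simp add: modulus_eq[OF B] parabolic_mult abs_mult)
qed

lemma one_in_parabolic: "mat 1 \<in> parabolic e"
  by (simp add: parabolic_def one_in_GL) (simp add: mat_def)

lemma modulus_one: "modulus e (mat 1 :: 'r::{euclidean_space,real_normed_div_algebra}^'n::finite^'n) = 1"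
proof -
  obtain B where B: "onb B (nilradical e :: ('r^'n^'n) set)" using onb_exists[OF subspace_nilradical] .
  have "Ad (mat 1 :: 'r^'n^'n) = (\<lambda>X. X)"
    using matrix_inv_eqI[of "mat 1 :: 'r^'n^'n" "mat 1"] by (simp add: Ad_def fun_eq_iff)
  then show ?thesis using modulus_eq[OF B one_in_parabolic] det_sum_id[OF B] by simp
qed

lemma modulus_inv:
  fixes x :: "'r::{euclidean_space,real_normed_div_algebra}^'n::finite^'n"
  assumes x: "x \<in> parabolic e"
  shows "modulus e (matrix_inv x) * modulus e x = 1"
  using modulus_mult[OF parabolic_inv(1)[OF x] x]
  by (simp add: GL_inv_cancel[OF parabolic_GL[OF x]] modulus_one)

lemma modulus_pos:
  fixes x :: "'r::{euclidean_space,real_normed_div_algebra}^'n::finite^'n"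
  assumes x: "x \<in> parabolic e" shows "modulus e x > 0"
proof -
  have "modulus e x \<noteq> 0" using modulus_inv[OF x] by auto
  moreover have "modulus e x \<ge> 0" by (simp add: modulus_def)
  ultimately show ?thesis by simp
qed

lemma continuous_on_modulus:
  "continuous_on GL (modulus e :: 'r::{euclidean_space,real_normed_div_algebra}^'n::finite^'n \<Rightarrow> real)"
proof -
  obtain B where B: "onb B (nilradical e :: ('r^'n^'n) set)"
    "\<And>x::'r^'n^'n. modulus e x = \<bar>det_sum B (Ad x)\<bar>" using modulus_basis[of e] by blast
  show ?thesis unfolding B(2) det_sum_def Ad_def
    by (intro continuous_intros continuous_on_matrix_inv matrix_mult_bounded_bilinear_facts)
qed

text \<open>The compact group has bounded matrix entries, so its modulus is bounded, hence trivial.\<close>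

lemma isometry_group_mult:
  "x \<in> isometry_group \<Longrightarrow> y \<in> isometry_group \<Longrightarrow> x ** y \<in> isometry_group"
  by (simp add: isometry_group_def GL_mult flip: matrix_vector_mul_assoc)

lemma isometry_group_GL: "x \<in> isometry_group \<Longrightarrow> x \<in> GL" by (simp add: isometry_group_def)

lemma isometry_group_inv:
  assumes "x \<in> isometry_group" shows "matrix_inv x \<in> isometry_group"
proof -
  have "norm (matrix_inv x *v v) = norm (x *v (matrix_inv x *v v))" for v
    using assms by (simp add: isometry_group_def)
  then show ?thesis
    using assms by (simp add: isometry_group_def GL_inv matrix_vector_mul_assoc GL_inv_cancel)
qed

lemma one_in_isometry_group: "mat 1 \<in> isometry_group"
  by (simp add: isometry_group_def one_in_GL)

lemma isometry_group_norm_le: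
  fixes x :: "'r::{euclidean_space,real_normed_div_algebra}^'n::finite^'n"
  assumes "x \<in> isometry_group" shows "norm x \<le> (\<Sum>i\<in>(UNIV::'n set). \<Sum>j\<in>(UNIV::'n set). 1)"
proof -
  have entry: "norm (x $ i $ j) \<le> 1" for i j
  proof -
    have "norm ((x *v axis j 1) $ i) \<le> norm (x *v axis j 1)" by (rule Finite_Cartesian_Product.norm_nth_le)
    also have "\<dots> = norm (axis j (1::'r) :: 'r^'n)" using assms by (simp add: isometry_group_def)
    also have "\<dots> = 1" unfolding norm_eq_sqrt_inner inner_axis_axis by (simp flip: norm_eq_sqrt_inner)
    finally show ?thesis by (simp add: axis_mult_vec)
  qed
  have "norm x \<le> (\<Sum>i\<in>UNIV. norm (x $ i))" unfolding norm_vec_def by (rule L2_set_le_sum) simp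
  also have "\<dots> \<le> (\<Sum>i\<in>UNIV. \<Sum>j\<in>UNIV. norm (x $ i $ j))"
    by (rule sum_mono) (unfold norm_vec_def, rule L2_set_le_sum, simp)
  also have "\<dots> \<le> (\<Sum>i\<in>(UNIV::'n set). \<Sum>j\<in>(UNIV::'n set). 1)" by (intro sum_mono entry)
  finally show ?thesis .
qed

lemma modulus_isometry:
  fixes x :: "'r::{euclidean_space,real_normed_div_algebra}^'n::finite^'n"
  assumes x: "x \<in> isometry_group" "x \<in> parabolic e"
  shows "modulus e x = 1"
proof -
  interpret bounded_bilinear "\<lambda>(A::'r^'n^'n) B::'r^'n^'n. A ** B" by (rule bounded_bilinear_matrix_mult)
  obtain K where K: "K > 0" "\<And>(A::'r^'n^'n) (B::'r^'n^'n). norm (A ** B) \<le> norm A * norm B * K"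
    using pos_bounded by blast
  obtain B where B: "onb B (nilradical e :: ('r^'n^'n) set)" using onb_exists[OF subspace_nilradical] .
  define c where "c = (\<Sum>i\<in>(UNIV::'n set). \<Sum>j\<in>(UNIV::'n set). (1::real))"
  define C where "C = (c * 1 * K) * c * K"
  have c0: "c \<ge> 0" by (simp add: c_def)
  have bound: "modulus e y \<le> fact (card B) * C ^ card B"
    if y: "y \<in> isometry_group" "y \<in> parabolic e" for y :: "'r^'n^'n"
  proof -
    have "\<bar>inner (Ad y a) b\<bar> \<le> C" if ab: "a \<in> B" "b \<in> B" for a b
    proof -
      have "\<bar>inner (Ad y a) b\<bar> \<le> norm (Ad y a) * norm b" by (rule Cauchy_Schwarz_ineq2)
      also have "\<dots> = norm (y ** a ** matrix_inv y)" using B ab by (simp add: onb_def Ad_def)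
      also have "\<dots> \<le> norm (y ** a) * norm (matrix_inv y) * K" by (rule K)
      also have "\<dots> \<le> (norm y * norm a * K) * norm (matrix_inv y) * K"
        using K by (intro mult_right_mono) auto
      also have "\<dots> \<le> (c * 1 * K) * c * K"
        using K(1) c0 isometry_group_norm_le[OF y(1)] isometry_group_norm_le[OF isometry_group_inv[OF y(1)]] B ab
        by (intro mult_right_mono mult_mono) (auto simp: c_def onb_def)
      finally show ?thesis by (simp add: C_def)
    qed
    then show ?thesis
      using modulus_eq[OF B y(2)] det_sum_bound[of B "Ad y" C] B by (simp add: onb_def)
  qed
  have le1: "modulus e y \<le> 1" if y: "y \<in> isometry_group" "y \<in> parabolic e" for y :: "'r^'n^'n"
  proof (rule ccontr)
    assume "\<not> modulus e y \<le> 1"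
    then obtain n where n: "modulus e y ^ n > fact (card B) * C ^ card B"
      using real_arch_pow[of "modulus e y"] by force
    have "\<exists>z::'r^'n^'n. z \<in> isometry_group \<inter> parabolic e \<and> modulus e z = modulus e y ^ n" for n
    proof (induction n)
      case 0
      show ?case
        using modulus_one[of e] one_in_isometry_group one_in_parabolic
        by (intro exI[of _ "mat 1"]) auto
    next
      case (Suc n)
      then obtain z :: "'r^'n^'n" where "z \<in> isometry_group \<inter> parabolic e" "modulus e z = modulus e y ^ n" by blast
      with y show ?case
        by (intro exI[of _ "y ** z"]) (auto simp: modulus_mult isometry_group_mult parabolic_mult)
    qed
    then obtain z :: "'r^'n^'n" where "z \<in> isometry_group \<inter> parabolic e" "modulus e z = modulus e y ^ n" by blast
    with bound[of z] n show False by simp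
  qed
  have 1: "modulus e (matrix_inv x) \<le> 1" "modulus e x \<le> 1"
    using le1[OF isometry_group_inv[OF x(1)] parabolic_inv(1)[OF x(2)]] le1[OF x] by simp_all
  have "1 = modulus e (matrix_inv x) * modulus e x" by (rule modulus_inv[OF x(2), symmetric])
  also have "\<dots> \<le> 1 * modulus e x" using 1 modulus_pos[OF x(2)] by (intro mult_right_mono) auto
  finally show ?thesis using 1 by simp
qed

text \<open>
  The nilradical over \<open>\<complex>\<close> splits off the line spanned by the entry at \<open>(Inl e, Inr e)\<close>, where \<open>Ad\<close>
  acts by the quotient of two equal diagonal entries, and what remains is isometric to the nilradical
  over the quaternions by taking row \<open>Inl e\<close> of the complex matrix.
\<close>

definition top_row :: "'m \<Rightarrow> quat^'m::finite^'m \<Rightarrow> complex^('m + 'm)^('m + 'm)" where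
  "top_row e X = (\<chi> s t. if s = Inl e then quat_matrix_embed X $ s $ t else 0)"

lemma quat_matrix_embed_parabolic:
  assumes p: "p \<in> parabolic e" and w: "p $ e $ e = quat_of_complex w"
  shows "quat_matrix_embed p \<in> parabolic (Inl e)" "quat_matrix_embed p $ Inl e $ Inl e = w"
proof -
  have "quat_matrix_embed p $ s $ Inl e = 0" if "s \<noteq> Inl e" for s
  proof (cases s)
    case (Inl i)
    then show ?thesis using that p by (simp add: quat_matrix_embed_entries parabolic_def zero_quat_def Complex_eq_0)
  next
    case (Inr i)
    then show ?thesis using p w
      by (cases "i = e") (simp_all add: quat_matrix_embed_entries parabolic_def zero_quat_def quat_of_complex_def Complex_eq_0)
  qed
  then show "quat_matrix_embed p \<in> parabolic (Inl e)"
    using quat_matrix_embed_GL[OF parabolic_GL[OF p]] by (simp add: parabolic_def)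
  show "quat_matrix_embed p $ Inl e $ Inl e = w"
    by (simp add: quat_matrix_embed_entries w quat_of_complex_def)
qed

lemma top_row_mult: "top_row e X ** quat_matrix_embed A = top_row e (X ** A)"
  by (simp add: vec_eq_iff top_row_def quat_matrix_embed_hom) (simp add: matrix_matrix_mult_def)

lemma modulus_quat_matrix_embed_real:
  fixes p :: "quat^'m::finite^'m"
  assumes p: "p \<in> parabolic e" and r: "p $ e $ e = of_real r"
  shows "modulus (Inl e) (quat_matrix_embed p) = modulus e p"
proof -
  let ?N = "nilradical e :: (quat^'m^'m) set" and ?\<phi> = "top_row e :: quat^'m^'m \<Rightarrow> _"
  let ?N' = "nilradical (Inl e) :: (complex^('m + 'm)^('m + 'm)) set"
  let ?p = "quat_matrix_embed p"
  have r': "p $ e $ e = quat_of_complex (of_real r)" by (simp add: r of_real_quat quat_of_complex_def)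
  have P: "?p \<in> parabolic (Inl e)" "?p $ Inl e $ Inl e = of_real r"
    using quat_matrix_embed_parabolic[OF p r'] by auto
  have r0: "r \<noteq> 0" using parabolic_ee_nonzero[OF p] r by auto
  obtain B where B: "onb B ?N" using onb_exists[OF subspace_nilradical] .
  have entry: "?\<phi> X $ s $ t = (if s = Inl e then (case t of
      Inl j \<Rightarrow> Complex (q1 (X $ e $ j)) (qi (X $ e $ j))
    | Inr j \<Rightarrow> Complex (- qj (X $ e $ j)) (- qk (X $ e $ j))) else 0)" for X s t
    by (simp add: top_row_def quat_matrix_embed_entries split: sum.split)
  have lin: "linear ?\<phi>"
    by (rule linearI) (simp_all add: vec_eq_iff entry plus_quat_def scaleR_quat_def complex_eq_iff split: sum.split)
  have inn: "inner (?\<phi> X) (?\<phi> Y) = inner X Y" if "X \<in> ?N" "Y \<in> ?N" for X Y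
  proof -
    have "inner (?\<phi> X) (?\<phi> Y) = (\<Sum>s\<in>{Inl e}. inner (?\<phi> X $ s) (?\<phi> Y $ s))"
      unfolding inner_vec_def[of "?\<phi> X"] by (rule sum.mono_neutral_right) (auto simp: top_row_def inner_vec_def)
    also have "\<dots> = inner (X $ e) (Y $ e)"
      by (simp add: inner_vec_def sum_UNIV_Plus sum.distrib[symmetric] top_row_def quat_matrix_embed_entries
          inner_complex_def inner_quat_def add.assoc)
    also have "\<dots> = (\<Sum>i\<in>{e}. inner (X $ i) (Y $ i))" by simp
    also have "\<dots> = inner X Y"
      unfolding inner_vec_def[of X] using that
      by (intro sum.mono_neutral_left) (auto simp: nilradical_def inner_vec_def)
    finally show ?thesis .
  qed
  define E where "E z = (\<chi> s t. if s = Inl e \<and> t = Inr e then z else 0 :: complex^('m+'m)^('m+'m))"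
    for z :: complex
  have innE: "inner (E z) Y = inner z (Y $ Inl e $ Inr e)" for z Y
  proof -
    have "inner (E z) Y = (\<Sum>s\<in>{Inl e}. \<Sum>t\<in>{Inr e}. inner (E z $ s $ t) (Y $ s $ t))"
      unfolding inner_vec_def by (intro sum.mono_neutral_cong_right) (auto simp: E_def)
    then show ?thesis by (simp add: E_def)
  qed
  have \<phi>0: "?\<phi> X $ Inl e $ Inr e = 0" if "X \<in> ?N" for X
    using that by (simp add: entry nilradical_def zero_quat_def complex_eq_iff)
  have BN: "b \<in> B \<Longrightarrow> b \<in> ?N" for b by (rule onb_subset[OF B])
  have inj: "inj_on ?\<phi> ?N"
  proof (rule inj_onI)
    fix X Y assume X: "X \<in> ?N" and Y: "Y \<in> ?N" and eq: "?\<phi> X = ?\<phi> Y"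
    have XY: "X - Y \<in> ?N" using X Y by (auto simp: nilradical_def)
    have "inner (X - Y) (X - Y) = inner (?\<phi> (X - Y)) (?\<phi> (X - Y))" using inn[OF XY XY] by simp
    also have "\<dots> = 0" by (simp add: linear_diff[OF lin] eq)
    finally show "X = Y" by simp
  qed
  define N2 where "N2 = ?\<phi> ` ?N"
  have onb2: "onb (?\<phi> ` B) N2"
  proof -
    have "span (?\<phi> ` B) = ?\<phi> ` span B" by (rule linear_span_image[OF lin])
    moreover have "pairwise orthogonal (?\<phi> ` B)"
      using B BN by (auto simp: onb_def pairwise_def orthogonal_def inn) 
    moreover have "norm (?\<phi> b) = 1" if "b \<in> B" for b
      using B BN that inn[of b b] by (simp add: onb_def norm_eq_1)
    ultimately show ?thesis using B by (auto simp: onb_def N2_def)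
  qed
  have E_norm: "norm (E 1) = 1" "norm (E \<i>) = 1" "inner (E 1) (E \<i>) = 0"
    by (simp_all add: norm_eq_1 innE) (simp_all add: E_def inner_complex_def)
  have E\<phi>: "inner (E z) (?\<phi> b) = 0" if "b \<in> B" for z b
    using \<phi>0[OF BN[OF that]] by (simp add: innE)
  have onb': "onb (insert (E 1) (insert (E \<i>) (?\<phi> ` B))) ?N'"
    unfolding onb_def
  proof (intro conjI)
    show "finite (insert (E 1) (insert (E \<i>) (?\<phi> ` B)))" using B by (simp add: onb_def)
    show "pairwise orthogonal (insert (E 1) (insert (E \<i>) (?\<phi> ` B)))"
      using onb2 E_norm E\<phi> by (auto simp: pairwise_insert onb_def orthogonal_def inner_commute)
    show "\<forall>b\<in>insert (E 1) (insert (E \<i>) (?\<phi> ` B)). norm b = 1"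
      using onb2 E_norm by (auto simp: onb_def)
    have "Y \<in> span (insert (E 1) (insert (E \<i>) (?\<phi> ` B)))" (is "_ \<in> ?S") if Y: "Y \<in> ?N'" for Y
    proof -
      define X where "X = (\<chi> i j. if i = e \<and> j \<noteq> e then Quat (Re (Y $ Inl e $ Inl j)) (Im (Y $ Inl e $ Inl j))
          (- Re (Y $ Inl e $ Inr j)) (- Im (Y $ Inl e $ Inr j)) else 0 :: quat^'m^'m)"
      have "X \<in> ?N" by (simp add: X_def nilradical_def)
      then have "?\<phi> X \<in> span (?\<phi> ` B)" using onb2 by (auto simp: onb_def N2_def)
      then have "?\<phi> X \<in> ?S" using span_mono[of "?\<phi> ` B" "insert (E 1) (insert (E \<i>) (?\<phi> ` B))"] by blast
      moreover have "E 1 \<in> ?S" "E \<i> \<in> ?S" by (simp_all add: span_base)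
      ultimately have "Re (Y $ Inl e $ Inr e) *\<^sub>R E 1 + Im (Y $ Inl e $ Inr e) *\<^sub>R E \<i> + ?\<phi> X \<in> ?S"
        by (intro span_add span_scale)
      moreover have "Re (Y $ Inl e $ Inr e) *\<^sub>R E 1 + Im (Y $ Inl e $ Inr e) *\<^sub>R E \<i> + ?\<phi> X = Y"
        using Y unfolding vec_eq_iff
        by (auto simp: entry X_def E_def nilradical_def complex_eq_iff zero_quat_def split: sum.split)
      ultimately show ?thesis by simp
    qed
    moreover have "insert (E 1) (insert (E \<i>) (?\<phi> ` B)) \<subseteq> ?N'"
      using BN by (auto simp: E_def nilradical_def entry zero_quat_def complex_eq_iff split: sum.split)
    then have "span (insert (E 1) (insert (E \<i>) (?\<phi> ` B))) \<subseteq> ?N'"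
      by (rule span_minimal[OF _ subspace_nilradical])
    ultimately show "span (insert (E 1) (insert (E \<i>) (?\<phi> ` B))) = ?N'" by blast
  qed
  let ?T = "Ad ?p"
  have pinv: "matrix_inv p \<in> parabolic e" "matrix_inv p $ e $ e = of_real (inverse r)"
    using parabolic_inv[OF p] r by (auto simp: of_real_inverse)
  have colr: "quat_matrix_embed (matrix_inv p) $ s $ Inr e = (if s = Inr e then of_real (inverse r) else 0)" for s
  proof (cases s)
    case (Inl i)
    then show ?thesis using pinv
      by (cases "i = e") (simp_all add: quat_matrix_embed_entries parabolic_def zero_quat_def of_real_quat complex_eq_iff del: of_real_inverse)
  next
    case (Inr i)
    then show ?thesis using pinv
      by (cases "i = e") (simp_all add: quat_matrix_embed_entries parabolic_def zero_quat_def of_real_quat complex_eq_iff del: of_real_inverse)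
  qed
  have N'mult: "?p ** Y = r *\<^sub>R Y" if "Y \<in> ?N'" for Y
    using that by (auto simp: vec_eq_iff nilradical_mult_left[OF P(1) that] P(2) nilradical_def
        simp flip: scaleR_conv_of_real)
  have corner: "?T Y $ Inl e $ Inr e = Y $ Inl e $ Inr e" if Y: "Y \<in> ?N'" for Y
  proof -
    have "?T Y $ Inl e $ Inr e = (\<Sum>s\<in>UNIV. of_real r * Y $ Inl e $ s * quat_matrix_embed (matrix_inv p) $ s $ Inr e)"
      unfolding Ad_def N'mult[OF Y] quat_matrix_embed_GL(2)[OF parabolic_GL[OF p]]
      by (simp add: matrix_matrix_mult_def flip: scaleR_conv_of_real)
    also have "\<dots> = (\<Sum>s\<in>{Inr e}. of_real r * Y $ Inl e $ s * quat_matrix_embed (matrix_inv p) $ s $ Inr e)"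
      by (rule sum.mono_neutral_right) (auto simp: colr)
    also have "\<dots> = Y $ Inl e $ Inr e" using r0 by (simp add: colr)
    finally show ?thesis .
  qed
  have E1: "E 1 \<in> ?N'" "E \<i> \<in> ?N'" "\<And>b. b \<in> B \<Longrightarrow> ?\<phi> b \<in> ?N'"
    using onb_subset[OF onb'] by blast+
  have "det_sum (insert (E 1) (insert (E \<i>) (?\<phi> ` B))) ?T = det_sum (insert (E \<i>) (?\<phi> ` B)) ?T"
  proof (rule det_sum_insert)
    show "finite (insert (E \<i>) (?\<phi> ` B))" using B by (simp add: onb_def)
    show "E 1 \<notin> insert (E \<i>) (?\<phi> ` B)" using E\<phi>[of _ 1] E_norm by (auto simp: norm_eq_1)
    show "inner (?T (E 1)) (E 1) = 1"
      by (subst inner_commute) (simp add: innE corner E1, simp add: E_def)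
    fix c assume "c \<in> insert (E \<i>) (?\<phi> ` B)"
    then show "inner (?T c) (E 1) = 0"
      by (subst inner_commute) (auto simp: innE corner E1 \<phi>0 BN, auto simp: E_def inner_complex_def)
  qed
  also have "\<dots> = det_sum (?\<phi> ` B) ?T"
  proof (rule det_sum_insert)
    show "finite (?\<phi> ` B)" using B by (simp add: onb_def)
    show "E \<i> \<notin> ?\<phi> ` B" using E\<phi>[of _ \<i>] E_norm by (auto simp: norm_eq_1)
    show "inner (?T (E \<i>)) (E \<i>) = 1"
      by (subst inner_commute) (simp add: innE corner E1, simp add: E_def inner_complex_def)
    fix c assume "c \<in> ?\<phi> ` B"
    then show "inner (?T c) (E \<i>) = 0"
      by (subst inner_commute) (auto simp: innE corner E1 \<phi>0 BN)
  qed
  also have "\<dots> = det_sum B (Ad p)"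
  proof (rule det_sum_isometry[OF B onb2 lin, symmetric])
    show "inner (?\<phi> x) (?\<phi> y) = inner x y" if "x \<in> ?N" "y \<in> ?N" for x y by (rule inn[OF that])
    show "?\<phi> ` ?N = N2" by (simp add: N2_def)
    show "linear ?T" by (rule linear_Ad)
    show "Ad p x \<in> ?N" if "x \<in> ?N" for x by (rule Ad_nilradical[OF p that])
    fix X assume X: "X \<in> ?N"
    have "?\<phi> X \<in> ?N'"
      using X by (auto simp: nilradical_def entry zero_quat_def complex_eq_iff split: sum.split)
    then have "?T (?\<phi> X) = r *\<^sub>R ?\<phi> X ** quat_matrix_embed (matrix_inv p)"
      by (simp add: Ad_def N'mult quat_matrix_embed_GL(2)[OF parabolic_GL[OF p]])
    also have "\<dots> = ?\<phi> (r *\<^sub>R X ** matrix_inv p)"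
      by (simp add: linear_cmul[OF lin, symmetric] top_row_mult)
    also have "r *\<^sub>R X = p ** X"
      using X by (auto simp: vec_eq_iff nilradical_mult_left[OF p X] r nilradical_def
          simp flip: scaleR_conv_of_real)
    finally show "?\<phi> (Ad p X) = ?T (?\<phi> X)" by (simp add: Ad_def)
  qed
  finally show ?thesis
    by (simp add: modulus_eq[OF B p] modulus_eq[OF onb' P(1)])
qed

section \<open>Unit quaternions and reflections in the quaternionic group\<close>

definition diag_at :: "'m \<Rightarrow> quat \<Rightarrow> quat^'m::finite^'m" where
  "diag_at e q = (\<chi> i j. if i = j then (if i = e then q else 1) else 0)"

lemma diag_at_mult_vec: "(diag_at e q *v x) $ i = (if i = e then q * x $ i else x $ i)"
proof -
  have "(\<Sum>j\<in>UNIV. diag_at e q $ i $ j * x $ j) = (\<Sum>j\<in>{i}. diag_at e q $ i $ j * x $ j)"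
    by (rule sum.mono_neutral_right) (auto simp: diag_at_def)
  then show ?thesis by (simp add: matrix_vector_mult_def diag_at_def)
qed

lemma diag_at_one: "diag_at e 1 = mat 1"
  by (simp add: diag_at_def mat_def vec_eq_iff)

lemma diag_at_mult: "diag_at e p ** diag_at e q = diag_at e (p * q)"
  by (simp add: matrix_eq vec_eq_iff diag_at_mult_vec mult.assoc flip: matrix_vector_mul_assoc)

lemma diag_at_inverse:
  "q \<noteq> 0 \<Longrightarrow> diag_at e q ** diag_at e (inverse q) = mat 1"
  "q \<noteq> 0 \<Longrightarrow> diag_at e (inverse q) ** diag_at e q = mat 1"
  by (simp_all add: diag_at_mult diag_at_one)

lemma diag_at_GL: "q \<noteq> 0 \<Longrightarrow> diag_at e q \<in> GL"
  by (rule GL_I[OF diag_at_inverse])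

lemma diag_at_ee [simp]: "diag_at e q $ e $ e = q" by (simp add: diag_at_def)

lemma diag_at_parabolic: "q \<noteq> 0 \<Longrightarrow> diag_at e q \<in> parabolic e"
  by (simp add: parabolic_def diag_at_GL) (simp add: diag_at_def)

lemma diag_at_isometry: "norm q = 1 \<Longrightarrow> diag_at e q \<in> isometry_group"
proof -
  assume q: "norm q = 1"
  then have "norm ((diag_at e q *v v) $ i) = norm (v $ i)" for v i
    by (simp add: diag_at_mult_vec norm_mult)
  then have "norm (diag_at e q *v v) = norm v" for v by (simp add: norm_vec_def)
  moreover have "q \<noteq> 0" using q by auto
  ultimately show ?thesis by (simp add: isometry_group_def diag_at_GL)
qed

lemma continuous_on_vec_lambda2:
  "(\<And>i j. continuous_on S (\<lambda>x. f x i j)) \<Longrightarrow> continuous_on S (\<lambda>x. \<chi> i j. f x i j)"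
  by (intro continuous_on_vec_lambda) auto

lemma continuous_on_diag_at: "continuous_on S (diag_at e)"
  unfolding diag_at_def
proof (rule continuous_on_vec_lambda2)
  fix i j
  show "continuous_on S (\<lambda>q. if i = j then if i = e then q else 1 else 0)"
    by (cases "i = j"; cases "i = e") auto
qed

lemma norm_quat_of_complex: "norm (quat_of_complex w) = cmod w"
  by (simp add: norm_quat_def inner_quat_def quat_of_complex_def cmod_def power2_eq_square)

lemma quat_of_complex_mult: "quat_of_complex (z * w) = quat_of_complex z * quat_of_complex w"
  by (simp add: quat_of_complex_def times_quat_def)

lemma quat_of_complex_of_real: "quat_of_complex (of_real r) = of_real r"
  by (simp add: of_real_quat quat_of_complex_def)

text \<open>
  Dividing by the phase of \<open>w\<close>, an isometry in both groups, reduces the claim to a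
  real corner entry.
\<close>

lemma modulus_quat_matrix_embed:
  fixes p :: "quat^'m::finite^'m"
  assumes p: "p \<in> parabolic e" and w: "p $ e $ e = quat_of_complex w"
  shows "modulus (Inl e) (quat_matrix_embed p) = modulus e p"
proof -
  have w0: "w \<noteq> 0" using parabolic_ee_nonzero[OF p] w by (auto simp: quat_of_complex_def zero_quat_def)
  define u where "u = w / of_real (cmod w)"
  have u: "cmod u = 1" "u \<noteq> 0" using w0 by (auto simp: u_def norm_divide)
  let ?d = "\<lambda>u. diag_at e (quat_of_complex u)"
  have n: "norm (quat_of_complex u) = 1" "norm (quat_of_complex (inverse u)) = 1"
    using u by (simp_all add: norm_quat_of_complex norm_inverse)
  then have q0: "quat_of_complex u \<noteq> 0" "quat_of_complex (inverse u) \<noteq> 0" by auto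
  define p' where "p' = ?d (inverse u) ** p"
  have p': "p' \<in> parabolic e" unfolding p'_def by (rule parabolic_mult[OF diag_at_parabolic[OF q0(2)] p])
  have "p' $ e $ e = quat_of_complex (inverse u * w)"
    using p by (simp add: p'_def parabolic_column w quat_of_complex_mult)
  also have "inverse u * w = of_real (cmod w)" using w0 by (simp add: u_def)
  finally have ee: "p' $ e $ e = of_real (cmod w)" by (simp add: quat_of_complex_of_real)
  have pp: "p = ?d u ** p'"
    using u by (simp add: p'_def matrix_mul_assoc diag_at_mult flip: quat_of_complex_mult)
      (simp add: quat_of_complex_of_real[of 1, simplified] diag_at_one)
  have d: "?d u \<in> parabolic e" "?d u \<in> isometry_group" using diag_at_parabolic[OF q0(1)] diag_at_isometry[OF n(1)] by auto
  have "modulus (Inl e) (quat_matrix_embed p)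
      = modulus (Inl e) (quat_matrix_embed (?d u)) * modulus (Inl e) (quat_matrix_embed p')"
    unfolding pp quat_matrix_embed_hom
    by (rule modulus_mult)
      (use quat_matrix_embed_parabolic[OF d(1)] quat_matrix_embed_parabolic[OF p', of "of_real (cmod w)"] ee in
        \<open>simp_all add: quat_of_complex_of_real\<close>)
  also have "\<dots> = 1 * modulus e p'"
    using modulus_isometry[OF quat_matrix_embed_isometry[OF d(2)]] quat_matrix_embed_parabolic[OF d(1)]
    by (simp add: modulus_quat_matrix_embed_real[OF p' ee])
  also have "\<dots> = modulus e p"
    using modulus_isometry[OF d(2,1)] by (simp add: pp modulus_mult[OF d(1) p'])
  finally show ?thesis .
qed

definition qinner :: "quat^'m::finite \<Rightarrow> quat^'m \<Rightarrow> quat" where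
  "qinner u x = (\<Sum>j\<in>UNIV. quat_conj (u $ j) * x $ j)"

definition outer :: "quat^'m::finite \<Rightarrow> quat^'m^'m" where
  "outer u = (\<chi> i j. u $ i * quat_conj (u $ j))"

definition reflection :: "quat^'m::finite \<Rightarrow> quat^'m^'m" where
  "reflection u = mat 1 - (2 / (norm u)\<^sup>2) *\<^sub>R outer u"

lemma reflection_mult_vec:
  "(reflection u *v x) $ i = x $ i - u $ i * ((2 / (norm u)\<^sup>2) *\<^sub>R qinner u x)"
proof -
  have "(outer u *v x) $ i = u $ i * qinner u x"
    by (simp add: outer_def qinner_def matrix_vector_mult_def sum_distrib_left mult.assoc)
  moreover have "(c *\<^sub>R outer u *v x) $ i = c *\<^sub>R (outer u *v x) $ i" for c
    by (simp add: matrix_vector_mult_def scaleR_sum_right)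
  ultimately show ?thesis
    by (simp add: reflection_def matrix_vector_mult_diff_rdistrib)
qed

lemma qinner_reflection:
  assumes "u \<noteq> 0" shows "qinner u (reflection u *v x) = - qinner u x"
proof -
  have "qinner u (reflection u *v x) = qinner u x - (\<Sum>j\<in>UNIV. quat_conj (u $ j) * u $ j) * ((2 / (norm u)\<^sup>2) *\<^sub>R qinner u x)"
    by (simp add: qinner_def reflection_mult_vec right_diff_distrib sum_subtractf sum_distrib_right mult.assoc
        scaleR_sum_right)
  also have "(\<Sum>j\<in>UNIV. quat_conj (u $ j) * u $ j) = of_real ((norm u)\<^sup>2)"
    by (simp add: quat_mult_conj norm_vec_def L2_set_def sum_nonneg)
  finally show ?thesis using assms by (simp add: of_real_def scaleR_2)
qed

lemma norm_vec_square: "(norm (x :: 'r::real_normed_vector^'n::finite))\<^sup>2 = (\<Sum>i\<in>UNIV. (norm (x $ i))\<^sup>2)"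
  by (simp add: norm_vec_def L2_set_def sum_nonneg)

lemma reflection_isometry: "reflection u \<in> isometry_group"
proof -
  have inv: "reflection u ** reflection u = mat 1"
  proof (cases "u = 0")
    case True
    then show ?thesis by (simp add: reflection_def)
  next
    case False
    then show ?thesis
      by (simp add: matrix_eq vec_eq_iff reflection_mult_vec qinner_reflection flip: matrix_vector_mul_assoc)
  qed
  have "(norm (reflection u *v x))\<^sup>2 = (norm x)\<^sup>2" for x
  proof -
    define t where "t = 2 / (norm u)\<^sup>2"
    define a where "a = qinner u x"
    have "(norm (reflection u *v x))\<^sup>2 = (\<Sum>i\<in>UNIV. (norm (x $ i))\<^sup>2 - 2 * inner (u $ i * (t *\<^sub>R a)) (x $ i) + (norm (u $ i))\<^sup>2 * (t * norm a)\<^sup>2)"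
      unfolding norm_vec_square
    proof (rule sum.cong[OF refl])
      fix i
      have "(norm (y - z))\<^sup>2 = (norm y)\<^sup>2 - 2 * inner z y + (norm z)\<^sup>2" for y z :: quat
        by (simp add: power2_norm_eq_inner inner_diff_left inner_diff_right inner_commute)
      moreover have "(reflection u *v x) $ i = x $ i - u $ i * (t *\<^sub>R a)"
        by (simp add: reflection_mult_vec t_def a_def)
      ultimately show "(norm ((reflection u *v x) $ i))\<^sup>2
          = (norm (x $ i))\<^sup>2 - 2 * inner (u $ i * (t *\<^sub>R a)) (x $ i) + (norm (u $ i))\<^sup>2 * (t * norm a)\<^sup>2"
        by (simp add: norm_mult power_mult_distrib)
    qed
    also have "\<dots> = (norm x)\<^sup>2 - 2 * t * (norm a)\<^sup>2 + (norm u)\<^sup>2 * (t * norm a)\<^sup>2"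
    proof -
      have "(\<Sum>i\<in>UNIV. inner (u $ i * (t *\<^sub>R a)) (x $ i)) = inner (t *\<^sub>R a) (\<Sum>i\<in>UNIV. quat_conj (u $ i) * x $ i)"
        by (simp add: inner_quat_mult_left inner_sum_right)
      also have "\<dots> = t * (norm a)\<^sup>2" by (simp add: a_def qinner_def power2_norm_eq_inner)
      finally show ?thesis
        by (simp add: sum.distrib sum_subtractf norm_vec_square sum_distrib_right sum_distrib_left[symmetric])
    qed
    also have "\<dots> = (norm x)\<^sup>2"
      by (cases "u = 0") (simp_all add: t_def power2_eq_square field_simps)
    finally show ?thesis .
  qed
  then have "norm (reflection u *v x) = norm x" for x by (metis norm_ge_zero power2_eq_imp_eq)
  then show ?thesis using GL_I[OF inv inv] by (simp add: isometry_group_def)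
qed

text \<open>
  A unit vector \<open>v\<close> is the reflection in \<open>v - e b\<close> of \<open>e b\<close>, where the unit \<open>b\<close> is chosen to make the
  inner product of the two vectors real. This gives a Borel section of \<open>g \<mapsto> g e\<close>.
\<close>

definition phase :: "quat \<Rightarrow> quat" where
  "phase q = (if q = 0 then 1 else (1 / norm q) *\<^sub>R q)"

definition column_section :: "'m \<Rightarrow> quat^'m::finite \<Rightarrow> quat^'m^'m" where
  "column_section e v = (let b = phase (v $ e); v' = (1 / norm v) *\<^sub>R v in
     norm v *\<^sub>R (reflection (v' - axis e b) ** diag_at e b))"

lemma norm_phase [simp]: "norm (phase q) = 1" by (simp add: phase_def)

lemma phase_eq: "norm q *\<^sub>R phase q = q" by (simp add: phase_def)

lemma phase_scaleR: "c > 0 \<Longrightarrow> phase (c *\<^sub>R q) = phase q" by (simp add: phase_def)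

lemma column_section_unit:
  assumes "norm v = 1"
  shows "column_section e v \<in> isometry_group" "column_section e v $ i $ e = v $ i"
proof -
  define b where "b = phase (v $ e)"
  define u where "u = v - axis e b"
  have k: "column_section e v = reflection u ** diag_at e b"
    using assms by (simp add: column_section_def Let_def b_def u_def)
  have b1: "norm b = 1" by (simp add: b_def)
  then have b0: "b \<noteq> 0" by auto
  show "column_section e v \<in> isometry_group"
    unfolding k by (intro isometry_group_mult reflection_isometry diag_at_isometry b1)
  have ve: "v $ e = norm (v $ e) *\<^sub>R b" using phase_eq[of "v $ e"] by (simp add: b_def)
  have qi: "qinner u (axis e b) = of_real (norm (v $ e) - 1)"
  proof -
    have "qinner u (axis e b) = (\<Sum>j\<in>{e}. quat_conj (u $ j) * axis e b $ j)"
      unfolding qinner_def by (rule sum.mono_neutral_right) (auto simp: axis_def)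
    also have "\<dots> = quat_conj ((norm (v $ e) - 1) *\<^sub>R b) * b"
      by (simp add: u_def axis_def) (metis ve scaleR_left_diff_distrib scaleR_one)
    also have "\<dots> = (norm (v $ e) - 1) *\<^sub>R (quat_conj b * b)"
      by (simp add: linear_cmul[OF linear_quat_conj])
    finally show ?thesis by (simp add: quat_mult_conj b1 of_real_def)
  qed
  have nu: "(norm u)\<^sup>2 = 2 - 2 * norm (v $ e)"
  proof -
    have "inner v (axis e b) = inner (v $ e) b" by (rule inner_axis)
    also have "\<dots> = norm (v $ e) * inner b b" by (metis ve inner_scaleR_left)
    finally have *: "inner v (axis e b) = norm (v $ e)" using b1 by (simp add: norm_eq_1)
    have "inner v v = 1" "inner (axis e b) (axis e b) = 1"
      using assms b1 by (simp_all add: norm_eq_1 inner_axis_axis)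
    then show ?thesis using * by (simp add: u_def power2_norm_eq_inner inner_diff_left inner_diff_right inner_commute)
  qed
  have refl: "reflection u *v axis e b = v"
  proof (cases "u = 0")
    case True
    then show ?thesis by (simp add: reflection_def u_def)
  next
    case False
    then have "norm (v $ e) \<noteq> 1" using nu by auto
    then have "2 / (2 - 2 * norm (v $ e)) * (norm (v $ e) - 1) = - 1" by (simp add: field_simps)
    then show ?thesis
      by (simp add: vec_eq_iff reflection_mult_vec qi nu of_real_def) (simp add: u_def)
  qed
  have "column_section e v $ i $ e = (reflection u *v axis e b) $ i"
    using parabolic_column[OF diag_at_parabolic[OF b0], where A="reflection u" and i=i] by (simp add: k axis_mult_vec)
  then show "column_section e v $ i $ e = v $ i" by (simp add: refl)
qed

lemma column_section:
  assumes "v \<noteq> 0"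
  shows "column_section e v \<in> GL" "column_section e v $ i $ e = v $ i"
proof -
  let ?v = "(1 / norm v) *\<^sub>R v"
  have n: "norm ?v = 1" using assms by simp
  have eq: "column_section e v = norm v *\<^sub>R column_section e ?v"
    using assms by (simp add: column_section_def Let_def phase_scaleR)
  show "column_section e v \<in> GL"
    using isometry_group_GL[OF column_section_unit(1)[OF n, of e]] assms
    by (simp add: eq GL_def scalar_invertible)
  show "column_section e v $ i $ e = v $ i"
    using column_section_unit(2)[OF n, of e i] assms by (simp add: eq)
qed

lemma borel_measurable_column_section: "column_section e \<in> borel_measurable borel"
proof -
  have ph: "phase \<in> borel_measurable borel" unfolding phase_def by measurable
  have out: "outer \<in> borel_measurable (borel :: (quat^'a) measure)"
    unfolding outer_def
    by (intro borel_measurable_continuous_onI continuous_on_vec_lambda2 continuous_intros)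
  have refl: "reflection \<in> borel_measurable (borel :: (quat^'a) measure)"
    unfolding reflection_def using out by measurable
  have ax: "axis e \<in> borel_measurable (borel :: quat measure)"
  proof (intro borel_measurable_continuous_onI)
    have "continuous_on UNIV (\<lambda>x::quat. if i = e then x else 0)" for i by (cases "i = e") auto
    then show "continuous_on UNIV (axis e :: quat \<Rightarrow> _)"
      unfolding axis_def by (rule continuous_on_vec_lambda)
  qed
  have dg: "diag_at e \<in> borel_measurable borel"
    by (intro borel_measurable_continuous_onI continuous_on_diag_at)
  have comp: "(\<lambda>v::quat^'a. v $ e) \<in> borel_measurable borel"
    by (intro borel_measurable_continuous_onI continuous_intros)
  have mm: "(\<lambda>x. f x ** g x) \<in> borel_measurable M"
    if "f \<in> borel_measurable M" "g \<in> borel_measurable M" for f g :: "quat^'a \<Rightarrow> quat^'a^'a" and M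
    using that by (rule borel_measurable_continuous_Pair) (intro continuous_intros matrix_mult_bounded_bilinear_facts)
  have b: "(\<lambda>v::quat^'a. phase (v $ e)) \<in> borel_measurable borel"
    using measurable_compose[OF comp ph] .
  show ?thesis unfolding column_section_def Let_def
    by (intro borel_measurable_scaleR mm measurable_compose[OF _ refl] measurable_compose[OF b dg]
        borel_measurable_diff measurable_compose[OF b ax] borel_measurable_norm) measurable
qed

section \<open>Left invariant probabilities\<close>

text \<open>
  The identity for \<open>iv\<close> reads \<open>(x\<inverse> y)\<inverse> = y\<inverse>
  x\<close>.
\<close>

locale left_invariant_prob = prob_space M for M :: "'a measure" +
  fixes mul :: "'a \<Rightarrow> 'a \<Rightarrow> 'a" and iv :: "'a \<Rightarrow> 'a"
  assumes measurable_mul: "(\<lambda>(x, y). mul x y) \<in> measurable (M \<Otimes>\<^sub>M M) M"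
    and measurable_inv: "iv \<in> measurable M M"
    and inv_anti: "x \<in> space M \<Longrightarrow> y \<in> space M \<Longrightarrow> iv (mul (iv x) y) = mul (iv y) x"
    and left: "x \<in> space M \<Longrightarrow> distr M M (mul x) = M"
begin

lemma measurable_mul_compose:
  "f \<in> measurable N M \<Longrightarrow> g \<in> measurable N M \<Longrightarrow> (\<lambda>x. mul (f x) (g x)) \<in> measurable N M"
  using measurable_compose[OF measurable_Pair measurable_mul] by simp

lemma inv_closed: "x \<in> space M \<Longrightarrow> iv x \<in> space M"
  by (rule measurable_space[OF measurable_inv])

lemma measurable_mul_left: "x \<in> space M \<Longrightarrow> mul x \<in> measurable M M"
  by (rule measurable_mul_compose) auto

lemma measurable_mul_right: "x \<in> space M \<Longrightarrow> (\<lambda>y. mul y x) \<in> measurable M M"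
  by (rule measurable_mul_compose) auto

lemma nn_integral_left:
  assumes "f \<in> borel_measurable M" "x \<in> space M"
  shows "(\<integral>\<^sup>+y. f (mul x y) \<partial>M) = (\<integral>\<^sup>+y. f y \<partial>M)"
  using nn_integral_distr[OF measurable_mul_left[OF assms(2)], of f] assms by (simp add: left)

text \<open>
  The double integral of \<open>f (x\<inverse> y)\<close> is \<open>\<integral>f\<close> by left invariance in \<open>y\<close>. As \<open>x\<inverse> y = (y\<inverse> x)\<inverse>\<close>, it is
  also \<open>\<integral>f (x\<inverse>)\<close> by left invariance in \<open>x\<close>.
\<close>

lemma nn_integral_inv:
  assumes f: "f \<in> borel_measurable M"
  shows "(\<integral>\<^sup>+x. f (iv x) \<partial>M) = (\<integral>\<^sup>+x. f x \<partial>M)"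
proof -
  interpret P: pair_sigma_finite M M ..
  have meas: "(\<lambda>(x, y). f (mul (iv x) y)) \<in> borel_measurable (M \<Otimes>\<^sub>M M)"
    unfolding case_prod_beta
    by (intro measurable_compose[OF measurable_mul_compose f] measurable_compose[OF measurable_fst measurable_inv])
      measurable
  have "(\<integral>\<^sup>+x. f x \<partial>M) = (\<integral>\<^sup>+x. (\<integral>\<^sup>+y. f (mul (iv x) y) \<partial>M) \<partial>M)"
    by (simp add: nn_integral_left[OF f inv_closed] emeasure_space_1 cong: nn_integral_cong)
  also have "\<dots> = (\<integral>\<^sup>+y. (\<integral>\<^sup>+x. f (mul (iv x) y) \<partial>M) \<partial>M)"
    by (rule P.Fubini'[OF meas, symmetric])
  also have "\<dots> = (\<integral>\<^sup>+y. (\<integral>\<^sup>+x. f (iv (mul (iv y) x)) \<partial>M) \<partial>M)"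
    by (intro nn_integral_cong) (simp add: inv_anti)
  also have "\<dots> = (\<integral>\<^sup>+y. (\<integral>\<^sup>+x. f (iv x) \<partial>M) \<partial>M)"
    by (intro nn_integral_cong nn_integral_left[of "\<lambda>x. f (iv x)"] inv_closed measurable_compose[OF measurable_inv f])
  also have "\<dots> = (\<integral>\<^sup>+x. f (iv x) \<partial>M)" by (simp add: emeasure_space_1)
  finally show ?thesis by simp
qed

lemma nn_integral_right:
  assumes f: "f \<in> borel_measurable M" and k: "k \<in> space M"
  shows "(\<integral>\<^sup>+x. f (mul x k) \<partial>M) = (\<integral>\<^sup>+x. f x \<partial>M)"
proof -
  have "(\<integral>\<^sup>+x. f (mul x k) \<partial>M) = (\<integral>\<^sup>+x. f (mul (iv x) k) \<partial>M)"
    using nn_integral_inv[OF measurable_compose[OF measurable_mul_right[OF k] f]] by simp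
  also have "\<dots> = (\<integral>\<^sup>+x. f (iv (mul (iv k) x)) \<partial>M)"
    by (intro nn_integral_cong) (simp add: inv_anti k)
  also have "\<dots> = (\<integral>\<^sup>+x. f (iv x) \<partial>M)"
    by (intro nn_integral_left[of "\<lambda>x. f (iv x)"] inv_closed k measurable_compose[OF measurable_inv f])
  also have "\<dots> = (\<integral>\<^sup>+x. f x \<partial>M)" by (rule nn_integral_inv[OF f])
  finally show ?thesis .
qed

lemma distr_eqI:
  assumes g: "g \<in> measurable M M"
    and nn: "\<And>f. f \<in> borel_measurable M \<Longrightarrow> (\<integral>\<^sup>+x. f (g x) \<partial>M) = (\<integral>\<^sup>+x. f x \<partial>M)"
  shows "distr M M g = M"
proof (rule measure_eqI)
  fix A assume A: "A \<in> sets (distr M M g)"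
  then have "emeasure (distr M M g) A = (\<integral>\<^sup>+x. indicator A (g x) \<partial>M)"
    by (simp add: nn_integral_distr[OF g, symmetric])
  also have "\<dots> = (\<integral>\<^sup>+x. indicator A x \<partial>M)" by (rule nn) (use A in simp)
  finally show "emeasure (distr M M g) A = emeasure M A" using A by simp
qed simp

lemma distr_right: "k \<in> space M \<Longrightarrow> distr M M (\<lambda>x. mul x k) = M"
  by (rule distr_eqI[OF measurable_mul_right nn_integral_right])

lemma integral_left:
  fixes f :: "'a \<Rightarrow> 'b::{banach,second_countable_topology}"
  assumes "f \<in> borel_measurable M" "k \<in> space M"
  shows "(\<integral>x. f (mul k x) \<partial>M) = (\<integral>x. f x \<partial>M)"
  using integral_distr[OF measurable_mul_left[OF assms(2)], of f] assms by (simp add: left)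

lemma integral_right:
  fixes f :: "'a \<Rightarrow> 'b::{banach,second_countable_topology}"
  assumes "f \<in> borel_measurable M" "k \<in> space M"
  shows "(\<integral>x. f (mul x k) \<partial>M) = (\<integral>x. f x \<partial>M)"
  using integral_distr[OF measurable_mul_right[OF assms(2)], of f] assms by (simp add: distr_right)

end

section \<open>The Haar measures of the compact groups\<close>

lemma haar_space:
  assumes "is_haar_prob K \<mu>"
  shows "space \<mu> = K" "sets \<mu> = sets (restrict_space borel K)" "prob_space \<mu>"
proof -
  show s: "sets \<mu> = sets (restrict_space borel K)" using assms by (simp add: is_haar_prob_def)
  show "space \<mu> = K" using sets_eq_imp_space_eq[OF s] by (simp add: space_restrict_space)
  then show "prob_space \<mu>" using assms by (auto intro!: prob_spaceI simp: is_haar_prob_def)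
qed

lemma haar_measurable_from:
  assumes "is_haar_prob K \<mu>" "f \<in> measurable (restrict_space borel K) N"
  shows "f \<in> measurable \<mu> N"
  using assms measurable_cong_sets[OF haar_space(2)[OF assms(1)] refl, of N] by simp

lemma haar_measurable_to:
  assumes "is_haar_prob K \<mu>" "f \<in> borel_measurable N" "\<And>x. x \<in> space N \<Longrightarrow> f x \<in> K"
  shows "f \<in> measurable N \<mu>"
  using assms measurable_cong_sets[OF refl haar_space(2)[OF assms(1)], of N]
    measurable_restrict_space2[of f N K borel] by auto

lemma measurable_matrix_mult:
  fixes f g :: "'a \<Rightarrow> 'r::{euclidean_space,real_normed_div_algebra}^'n::finite^'n"
  assumes "f \<in> borel_measurable M" "g \<in> borel_measurable M"
  shows "(\<lambda>x. f x ** g x) \<in> borel_measurable M"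
  using assms by (rule borel_measurable_continuous_Pair)
    (intro continuous_intros matrix_mult_bounded_bilinear_facts)

lemma haar_left_invariant_prob:
  fixes \<mu> :: "('r::{euclidean_space,real_normed_div_algebra}^'n::finite^'n) measure"
  assumes h: "is_haar_prob isometry_group \<mu>"
  shows "left_invariant_prob \<mu> (**) matrix_inv"
proof -
  note sp = haar_space[OF h]
  interpret prob_space \<mu> by (rule sp(3))
  have id: "(\<lambda>x. x) \<in> borel_measurable \<mu>"
    by (rule haar_measurable_from[OF h measurable_restrict_space1]) simp
  show ?thesis
  proof
    have "(\<lambda>p. fst p ** snd p) \<in> borel_measurable (\<mu> \<Otimes>\<^sub>M \<mu>)"
      by (intro measurable_matrix_mult measurable_compose[OF measurable_fst id] measurable_compose[OF measurable_snd id])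
    then show "(\<lambda>(x, y). x ** y) \<in> measurable (\<mu> \<Otimes>\<^sub>M \<mu>) \<mu>"
      unfolding case_prod_beta
      by (rule haar_measurable_to[OF h]) (auto simp: space_pair_measure sp isometry_group_mult)
    have "matrix_inv \<in> borel_measurable (restrict_space borel isometry_group :: ('r^'n^'n) measure)"
      by (rule borel_measurable_continuous_on_restrict, rule continuous_on_subset[OF continuous_on_matrix_inv])
        (auto simp: isometry_group_def)
    then have "matrix_inv \<in> borel_measurable \<mu>" by (rule haar_measurable_from[OF h])
    then show "matrix_inv \<in> measurable \<mu> \<mu>"
      by (rule haar_measurable_to[OF h]) (simp add: sp isometry_group_inv)
    show "matrix_inv (matrix_inv x ** y) = matrix_inv y ** x" if "x \<in> space \<mu>" "y \<in> space \<mu>" for x y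
      using that by (simp add: sp matrix_inv_mult GL_inv isometry_group_GL matrix_inv_inv)
    show "distr \<mu> \<mu> ((**) x) = \<mu>" if "x \<in> space \<mu>" for x
      using h that by (simp add: is_haar_prob_def sp)
  qed
qed

text \<open>
  \<open>Sp(m)\<close> already acts transitively on the unit sphere of \<open>\<complex>\<^sup>2\<^sup>m\<close>. Hence averaging a function of the
  column \<open>u e\<close> first over \<open>Sp(m)\<close> leaves a constant.
\<close>

lemma quat_matrix_embed_column:
  "quat_matrix_embed A $ s $ Inl e = quat_to_complex_vec (\<chi> i. A $ i $ e) $ s"
  by (cases s) (simp_all add: quat_matrix_embed_entries quat_to_complex_vec_def)

lemma nn_integral_unitary_eq_symplectic:
  fixes \<mu> :: "(complex^('m::finite + 'm)^('m + 'm)) measure" and \<nu> :: "(quat^'m^'m) measure"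
  assumes \<mu>: "is_haar_prob isometry_group \<mu>" and \<nu>: "is_haar_prob isometry_group \<nu>"
    and \<phi>: "\<phi> \<in> borel_measurable \<mu>"
    and col: "\<And>u u'. u \<in> isometry_group \<Longrightarrow> u' \<in> isometry_group \<Longrightarrow>
      (\<And>s. u $ s $ Inl e = u' $ s $ Inl e) \<Longrightarrow> \<phi> u = \<phi> u'"
  shows "(\<integral>\<^sup>+u. \<phi> u \<partial>\<mu>) = (\<integral>\<^sup>+k. \<phi> (quat_matrix_embed k) \<partial>\<nu>)"
proof -
  interpret G: left_invariant_prob \<mu> "(**)" matrix_inv by (rule haar_left_invariant_prob[OF \<mu>])
  interpret H: left_invariant_prob \<nu> "(**)" matrix_inv by (rule haar_left_invariant_prob[OF \<nu>])
  interpret P: pair_sigma_finite \<nu> \<mu> ..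
  note sp = haar_space[OF \<mu>] haar_space[OF \<nu>]
  have "quat_matrix_embed \<in> borel_measurable (borel :: (quat^'m^'m) measure)"
    by (intro borel_measurable_continuous_onI continuous_on_quat_matrix_embed)
  then have "quat_matrix_embed \<in> borel_measurable \<nu>"
    using measurable_cong_sets[OF sp(5) refl] measurable_restrict_space1 by blast
  then have emb: "quat_matrix_embed \<in> measurable \<nu> \<mu>"
    using measurable_cong_sets[OF refl sp(2), of \<nu>] measurable_restrict_space2[of quat_matrix_embed \<nu> isometry_group borel]
    by (auto simp: sp quat_matrix_embed_isometry)
  have meas: "(\<lambda>(k, u). \<phi> (quat_matrix_embed k ** u)) \<in> borel_measurable (\<nu> \<Otimes>\<^sub>M \<mu>)"
    unfolding case_prod_beta
    by (intro measurable_compose[OF G.measurable_mul_compose \<phi>] measurable_compose[OF measurable_fst emb]) measurable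
  have "(\<integral>\<^sup>+u. \<phi> u \<partial>\<mu>) = (\<integral>\<^sup>+k. (\<integral>\<^sup>+u. \<phi> (quat_matrix_embed k ** u) \<partial>\<mu>) \<partial>\<nu>)"
    using measurable_space[OF emb]
    by (simp add: G.nn_integral_left[OF \<phi>] H.emeasure_space_1 cong: nn_integral_cong)
  also have "\<dots> = (\<integral>\<^sup>+u. (\<integral>\<^sup>+k. \<phi> (quat_matrix_embed k ** u) \<partial>\<nu>) \<partial>\<mu>)"
    by (rule P.Fubini'[OF meas, symmetric])
  also have "\<dots> = (\<integral>\<^sup>+u. (\<integral>\<^sup>+k. \<phi> (quat_matrix_embed k) \<partial>\<nu>) \<partial>\<mu>)"
  proof (rule nn_integral_cong)
    fix u assume "u \<in> space \<mu>"
    then have u: "u \<in> isometry_group" by (simp add: sp)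
    define v where "v = complex_to_quat_vec (\<chi> s. u $ s $ Inl e)"
    have ax: "(\<chi> s. u $ s $ Inl e) = u *v axis (Inl e) 1" by (simp add: axis_mult_vec)
    have "norm (u *v axis (Inl e) 1) = norm (axis (Inl e :: 'm + 'm) (1::complex))" using u by (simp add: isometry_group_def)
    also have "\<dots> = 1" unfolding norm_eq_sqrt_inner inner_axis_axis by (simp flip: norm_eq_sqrt_inner)
    finally have nv: "norm v = 1" by (simp add: v_def norm_complex_to_quat_vec ax)
    define g where "g = column_section e v"
    have g: "g \<in> isometry_group" "(\<chi> i. g $ i $ e) = v"
      using column_section_unit[OF nv, of e] by (simp_all add: g_def vec_eq_iff)
    have gcol: "quat_matrix_embed g $ s $ Inl e = u $ s $ Inl e" for s
      by (simp add: quat_matrix_embed_column g(2) v_def)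
    have "\<phi> (quat_matrix_embed k ** u) = \<phi> (quat_matrix_embed (k ** g))" if "k \<in> space \<nu>" for k
    proof (rule col)
      show "quat_matrix_embed k ** u \<in> isometry_group" "quat_matrix_embed (k ** g) \<in> isometry_group"
        using that u g by (simp_all add: sp isometry_group_mult quat_matrix_embed_isometry)
      show "(quat_matrix_embed k ** u) $ s $ Inl e = quat_matrix_embed (k ** g) $ s $ Inl e" for s
        by (simp add: quat_matrix_embed_hom) (simp add: matrix_matrix_mult_def gcol)
    qed
    then have "(\<integral>\<^sup>+k. \<phi> (quat_matrix_embed k ** u) \<partial>\<nu>) = (\<integral>\<^sup>+k. \<phi> (quat_matrix_embed (k ** g)) \<partial>\<nu>)"
      by (intro nn_integral_cong)
    also have "\<dots> = (\<integral>\<^sup>+k. \<phi> (quat_matrix_embed k) \<partial>\<nu>)"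
      by (rule H.nn_integral_right[OF measurable_compose[OF emb \<phi>]]) (simp add: sp g)
    finally show "(\<integral>\<^sup>+k. \<phi> (quat_matrix_embed k ** u) \<partial>\<nu>) = (\<integral>\<^sup>+k. \<phi> (quat_matrix_embed k) \<partial>\<nu>)" .
  qed
  also have "\<dots> = (\<integral>\<^sup>+k. \<phi> (quat_matrix_embed k) \<partial>\<nu>)" by (simp add: G.emeasure_space_1)
  finally show ?thesis .
qed

text \<open>
  The corner entry of a random element of \<open>Sp(m)\<close>, normalized to length \<open>1\<close>, has an invariant law
  on the unit quaternions. It vanishes with positive probability at most: otherwise, by symmetry, the
  whole column \<open>e\<close> would vanish almost surely.
\<close>

locale unit_quaternion_haar = prob_space \<sigma> for \<sigma> :: "quat measure" +
  assumes sets_eq: "sets \<sigma> = sets (restrict_space borel Sp1)"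
    and left_inv: "\<And>u. u \<in> Sp1 \<Longrightarrow> distr \<sigma> \<sigma> ((*) u) = \<sigma>"

lemma reflection_swap:
  assumes "i \<noteq> e"
  shows "(reflection (axis e 1 - axis i 1) *v x) $ e = x $ i"
proof -
  let ?u = "axis e 1 - axis i 1 :: quat^'a"
  have "inner ?u ?u = 2"
    using assms by (simp add: inner_diff_left inner_diff_right inner_axis_axis) (simp add: inner_quat_def one_quat_def)
  then have n: "(norm ?u)\<^sup>2 = 2" by (simp add: power2_norm_eq_inner)
  have "qinner ?u x = (\<Sum>j\<in>{e, i}. quat_conj (?u $ j) * x $ j)"
    unfolding qinner_def
    by (rule sum.mono_neutral_right) (auto simp: axis_def linear_0[OF linear_quat_conj])
  also have "\<dots> = x $ e - x $ i"
    using assms by (auto simp: axis_def quat_conj_def one_quat_def zero_quat_def uminus_quat_def minus_quat_def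
        times_quat_def plus_quat_def quat_eq_iff)
  finally show ?thesis using assms by (simp add: reflection_mult_vec n) (simp add: axis_def)
qed

lemma unit_quaternion_haar_exists:
  fixes \<nu> :: "(quat^'m::finite^'m) measure"
  assumes \<nu>: "is_haar_prob isometry_group \<nu>"
  shows "\<exists>\<sigma>. unit_quaternion_haar \<sigma>"
proof -
  interpret H: left_invariant_prob \<nu> "(**)" matrix_inv by (rule haar_left_invariant_prob[OF \<nu>])
  note sp = haar_space[OF \<nu>]
  obtain e :: 'm where True by simp
  have entry: "(\<lambda>k. k $ i $ e) \<in> borel_measurable \<nu>" for i
  proof -
    have "(\<lambda>k::quat^'m^'m. k $ i $ e) \<in> borel_measurable borel"
      by (intro borel_measurable_continuous_onI continuous_intros)
    then show ?thesis using measurable_cong_sets[OF sp(2) refl] measurable_restrict_space1 by blast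
  qed
  define A where "A i = {k \<in> space \<nu>. k $ i $ e \<noteq> 0}" for i
  have Asets: "A i \<in> sets \<nu>" for i unfolding A_def using entry[of i] by measurable
  have emeasure_left: "emeasure \<nu> {k \<in> space \<nu>. g ** k \<in> S} = emeasure \<nu> S"
    if "g \<in> isometry_group" "S \<in> sets \<nu>" for g S
  proof -
    have g: "g \<in> space \<nu>" using that by (simp add: sp)
    have "emeasure \<nu> S = emeasure (distr \<nu> \<nu> ((**) g)) S" by (simp add: H.left[OF g])
    also have "\<dots> = emeasure \<nu> ((**) g -` S \<inter> space \<nu>)"
      by (rule emeasure_distr[OF H.measurable_mul_left[OF g] that(2)])
    finally show ?thesis by (simp add: vimage_def Int_def conj_commute)
  qed
  have pos: "emeasure \<nu> (A e) \<noteq> 0"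
  proof
    assume 0: "emeasure \<nu> (A e) = 0"
    have "emeasure \<nu> (A i) = 0" for i
    proof (cases "i = e")
      case False
      let ?r = "reflection (axis e 1 - axis i 1) :: quat^'m^'m"
      have "(?r ** k) $ e $ e = k $ i $ e" for k
      proof -
        have "(?r ** k) $ e $ e = (?r *v (\<chi> j. k $ j $ e)) $ e"
          by (simp add: matrix_matrix_mult_def matrix_vector_mult_def)
        then show ?thesis by (simp add: reflection_swap[OF False])
      qed
      then have "A i = {k \<in> space \<nu>. ?r ** k \<in> A e}"
        by (auto simp: A_def sp isometry_group_mult reflection_isometry)
      then show ?thesis using emeasure_left[OF reflection_isometry Asets[of e]] 0 by simp
    qed (simp add: 0)
    then have "emeasure \<nu> (\<Union>i\<in>UNIV. A i) = 0"
      using emeasure_subadditive_finite[of UNIV A \<nu>] Asets by (simp add: image_subset_iff)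
    moreover have "space \<nu> \<subseteq> (\<Union>i\<in>UNIV. A i)"
    proof
      fix k assume k: "k \<in> space \<nu>"
      show "k \<in> (\<Union>i\<in>UNIV. A i)"
      proof (rule ccontr)
        assume "k \<notin> (\<Union>i\<in>UNIV. A i)"
        then have "k *v axis e 1 = 0" using k by (simp add: A_def axis_mult_vec vec_eq_iff)
        moreover have "norm (k *v axis e 1) = norm (axis e (1::quat))" using k by (simp add: sp isometry_group_def)
        ultimately show False by (simp add: axis_eq_0_iff)
      qed
    qed
    moreover have "(\<Union>i\<in>UNIV. A i) \<in> sets \<nu>" using Asets by (intro sets.finite_UN) auto
    ultimately have "emeasure \<nu> (space \<nu>) = 0" by (metis emeasure_mono le_zero_eq)
    then show False by (simp add: H.emeasure_space_1)
  qed
  define \<sigma> where "\<sigma> = distr (uniform_measure \<nu> (A e)) (restrict_space borel Sp1) (\<lambda>k. phase (k $ e $ e))"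
  have ph: "phase \<in> borel_measurable borel" unfolding phase_def by measurable
  have phm: "(\<lambda>k. phase (k $ e $ e)) \<in> measurable (uniform_measure \<nu> (A e)) (restrict_space borel Sp1)"
  proof (rule measurable_restrict_space2)
    show "(\<lambda>k. phase (k $ e $ e)) \<in> space (uniform_measure \<nu> (A e)) \<rightarrow> Sp1" by (simp add: Sp1_def)
    show "(\<lambda>k. phase (k $ e $ e)) \<in> borel_measurable (uniform_measure \<nu> (A e))"
      using measurable_compose[OF entry ph] by simp
  qed
  have setsS: "sets \<sigma> = sets (restrict_space borel Sp1)" by (simp add: \<sigma>_def)
  have spS: "space \<sigma> = Sp1" using sets_eq_imp_space_eq[OF setsS] by (simp add: space_restrict_space)
  have prob: "prob_space \<sigma>"
    unfolding \<sigma>_def using pos H.emeasure_finite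
    by (intro prob_space.prob_space_distr[OF prob_space_uniform_measure] phm) auto
  have em: "emeasure \<sigma> S = emeasure \<nu> {k \<in> A e. phase (k $ e $ e) \<in> S} / emeasure \<nu> (A e)" if S: "S \<in> sets \<sigma>" for S
  proof -
    have "emeasure \<sigma> S = emeasure (uniform_measure \<nu> (A e)) ((\<lambda>k. phase (k $ e $ e)) -` S \<inter> space (uniform_measure \<nu> (A e)))"
      unfolding \<sigma>_def by (rule emeasure_distr[OF phm]) (use S setsS in simp)
    also have "\<dots> = emeasure \<nu> (A e \<inter> ((\<lambda>k. phase (k $ e $ e)) -` S \<inter> space \<nu>)) / emeasure \<nu> (A e)"
      using measurable_sets[OF phm, of S] S setsS Asets[of e] by simp
    also have "A e \<inter> ((\<lambda>k. phase (k $ e $ e)) -` S \<inter> space \<nu>) = {k \<in> A e. phase (k $ e $ e) \<in> S}"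
      by (auto simp: A_def)
    finally show ?thesis .
  qed
  have "unit_quaternion_haar \<sigma>"
    unfolding unit_quaternion_haar_def unit_quaternion_haar_axioms_def
  proof (intro conjI allI impI prob setsS)
    fix u :: quat assume "u \<in> Sp1"
    then have u: "norm u = 1" "u \<noteq> 0" by (auto simp: Sp1_def)
    have um: "(*) u \<in> measurable \<sigma> \<sigma>"
    proof -
      have "(*) u \<in> measurable (restrict_space borel Sp1) (restrict_space borel Sp1)"
        by (rule measurable_restrict_space2)
          (auto simp: space_restrict_space Sp1_def norm_mult u intro!: measurable_restrict_space1 borel_measurable_continuous_onI continuous_intros)
      then show ?thesis using measurable_cong_sets[OF setsS setsS] by simp
    qed
    show "distr \<sigma> \<sigma> ((*) u) = \<sigma>"
    proof (rule measure_eqI)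
      fix S assume "S \<in> sets (distr \<sigma> \<sigma> ((*) u))"
      then have S: "S \<in> sets \<sigma>" by simp
      have "phase (u * q) = u * phase q" if "q \<noteq> 0" for q
        using that u by (simp add: phase_def norm_mult)
      moreover have "(diag_at e u ** k) $ e $ e = u * k $ e $ e" for k
      proof -
        have "(diag_at e u ** k) $ e $ e = (diag_at e u *v (\<chi> j. k $ j $ e)) $ e"
          by (simp add: matrix_matrix_mult_def matrix_vector_mult_def)
        then show ?thesis by (simp add: diag_at_mult_vec)
      qed
      ultimately have eq: "{k \<in> A e. u * phase (k $ e $ e) \<in> S} =
          {k \<in> space \<nu>. diag_at e u ** k \<in> {k \<in> A e. phase (k $ e $ e) \<in> S}}"
        using u by (auto simp: A_def sp isometry_group_mult diag_at_isometry)
      have T: "{k \<in> A e. phase (k $ e $ e) \<in> S} \<in> sets \<nu>"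
      proof -
        have "{k \<in> A e. phase (k $ e $ e) \<in> S} = A e \<inter> ((\<lambda>k. phase (k $ e $ e)) -` S \<inter> space (uniform_measure \<nu> (A e)))"
          by (auto simp: A_def)
        then show ?thesis using measurable_sets[OF phm, of S] S setsS Asets[of e] by auto
      qed
      have T': "(*) u -` S \<inter> space \<sigma> \<in> sets \<sigma>" by (rule measurable_sets[OF um S])
      have "emeasure (distr \<sigma> \<sigma> ((*) u)) S = emeasure \<sigma> ((*) u -` S \<inter> space \<sigma>)"
        by (rule emeasure_distr[OF um S])
      also have "\<dots> = emeasure \<nu> {k \<in> A e. u * phase (k $ e $ e) \<in> S} / emeasure \<nu> (A e)"
        unfolding em[OF T'] by (simp add: spS Sp1_def)
      also have "\<dots> = emeasure \<sigma> S"
        unfolding eq emeasure_left[OF diag_at_isometry[OF u(1)] T] by (rule em[OF S, symmetric])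
      finally show "emeasure (distr \<sigma> \<sigma> ((*) u)) S = emeasure \<sigma> S" .
    qed simp
  qed
  then show ?thesis by blast
qed

hide_const (open) Module.smult

section \<open>The representations on binary forms\<close>

definition quat_x :: "quat \<Rightarrow> complex" where "quat_x q = Complex (q1 q) (qi q)"
definition quat_y :: "quat \<Rightarrow> complex" where "quat_y q = Complex (qj q) (- qk q)"

text \<open>
  Writing \<open>q = x + j y\<close>, left multiplication on \<open>\<complex>\<^sup>2\<close> has the matrix with rows \<open>(x, - cnj y)\<close> and
  \<open>(y, cnj x)\<close>. Substituting these rows for the variables of a binary form of degree \<open>j\<close>, here
  dehomogenized, gives the representation of dimension \<open>j + 1\<close>.
\<close>

definition form_A :: "quat \<Rightarrow> complex poly" where "form_A q = [:quat_x q, - cnj (quat_y q):]"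
definition form_B :: "quat \<Rightarrow> complex poly" where "form_B q = [:quat_y q, cnj (quat_x q):]"

definition form_coeff :: "nat \<Rightarrow> quat \<Rightarrow> nat \<Rightarrow> nat \<Rightarrow> complex" where
  "form_coeff j q r s = coeff (form_A q ^ (j - r) * form_B q ^ r) s"

lemma quat_x_mult: "quat_x (p * q) = quat_x p * quat_x q - cnj (quat_y p) * quat_y q"
  and quat_y_mult: "quat_y (p * q) = quat_y p * quat_x q + cnj (quat_x p) * quat_y q"
  by (simp_all add: quat_x_def quat_y_def times_quat_def complex_eq_iff algebra_simps)

lemma quat_xy_norm: "norm q = 1 \<Longrightarrow> cnj (quat_x q) * quat_x q + cnj (quat_y q) * quat_y q = 1"
proof -
  assume "norm q = 1"
  then have "(q1 q)\<^sup>2 + (qi q)\<^sup>2 + (qj q)\<^sup>2 + (qk q)\<^sup>2 = 1" using quat_norm2[of q] by simp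
  then show ?thesis
    by (simp add: quat_x_def quat_y_def complex_eq_iff power2_eq_square algebra_simps)
qed

lemma degree_linear_prod: "degree ([:a, b:] ^ m * [:c, d:] ^ n :: complex poly) \<le> m + n"
proof -
  have "degree ([:a, b:] ^ m) \<le> m" for a b :: complex and m
    using degree_power_le[of "[:a, b:]" m] by (simp split: if_splits)
  then show ?thesis using degree_mult_le[of "[:a, b:] ^ m" "[:c, d:] ^ n"] by (meson add_mono order_trans)
qed

lemma form_coeff_eq_0:
  assumes "r \<le> j" "j < s" shows "form_coeff j q r s = 0"
proof -
  have "degree (form_A q ^ (j - r) * form_B q ^ r) \<le> j - r + r"
    unfolding form_A_def form_B_def by (rule degree_linear_prod)
  then show ?thesis unfolding form_coeff_def using assms by (intro coeff_eq_0) simp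
qed

text \<open>
  The substitution of \<open>(X, Y)\<close> for the variables of the binary form of degree
  \<open>n\<close> whose dehomogenized polynomial is \<open>P\<close>.
\<close>

definition homogenize :: "complex poly \<Rightarrow> nat \<Rightarrow> complex poly \<Rightarrow> complex poly \<Rightarrow> complex poly" where
  "homogenize P n X Y = (\<Sum>t\<le>n. smult (coeff P t) (X ^ (n - t) * Y ^ t))"

lemma homogenize_step:
  assumes "degree P \<le> n"
  shows "homogenize ([:a, b:] * P) (Suc n) X Y = (smult a X + smult b Y) * homogenize P n X Y"
proof -
  have c: "coeff ([:a, b:] * P) t = a * coeff P t + (case t of 0 \<Rightarrow> 0 | Suc t' \<Rightarrow> b * coeff P t')" for t
    by (simp add: coeff_pCons split: nat.split)
  have 0: "coeff P (Suc n) = 0" using assms by (intro coeff_eq_0) simp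
  have "homogenize ([:a, b:] * P) (Suc n) X Y =
      (\<Sum>t\<le>Suc n. smult (a * coeff P t) (X ^ (Suc n - t) * Y ^ t)) +
      (\<Sum>t\<le>Suc n. smult (case t of 0 \<Rightarrow> 0 | Suc t' \<Rightarrow> b * coeff P t') (X ^ (Suc n - t) * Y ^ t))"
    unfolding homogenize_def c smult_add_left sum.distrib ..
  also have "(\<Sum>t\<le>Suc n. smult (a * coeff P t) (X ^ (Suc n - t) * Y ^ t)) = smult a X * homogenize P n X Y"
    by (simp add: 0 homogenize_def sum_distrib_left Suc_diff_le mult_ac cong: sum.cong_simp)
  also have "(\<Sum>t\<le>Suc n. smult (case t of 0 \<Rightarrow> 0 | Suc t' \<Rightarrow> b * coeff P t') (X ^ (Suc n - t) * Y ^ t)) = smult b Y * homogenize P n X Y"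
    unfolding sum.atMost_Suc_shift
    by (simp add: homogenize_def sum_distrib_left mult_ac cong: sum.cong_simp)
  finally show ?thesis by (simp add: algebra_simps)
qed

lemma homogenize_linear_prod:
  "homogenize ([:a, b:] ^ m * [:c, d:] ^ n) (m + n) X Y =
    (smult a X + smult b Y) ^ m * (smult c X + smult d Y) ^ n"
proof (induction m)
  case 0
  show ?case
  proof (induction n)
    case 0
    show ?case by (simp add: homogenize_def)
  next
    case (Suc n)
    have "homogenize ([:c, d:] * [:c, d:] ^ n) (Suc n) X Y = (smult c X + smult d Y) * homogenize ([:c, d:] ^ n) n X Y"
      by (rule homogenize_step) (use degree_linear_prod[of a b 0 c d n] in simp)
    with Suc show ?case by simp
  qed
next
  case (Suc m)
  have "homogenize ([:a, b:] * ([:a, b:] ^ m * [:c, d:] ^ n)) (Suc (m + n)) X Y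
      = (smult a X + smult b Y) * homogenize ([:a, b:] ^ m * [:c, d:] ^ n) (m + n) X Y"
    by (rule homogenize_step[OF degree_linear_prod])
  with Suc show ?case by (simp only: power_Suc mult.assoc add_Suc)
qed

text \<open>
  Substituting linear forms twice is substituting for the product matrix.
\<close>

lemma form_coeff_mult:
  assumes "r \<le> j"
  shows "form_coeff j (p * q) r s = (\<Sum>t\<le>j. form_coeff j p r t * form_coeff j q t s)"
proof -
  have A: "smult (quat_x p) (form_A q) + smult (- cnj (quat_y p)) (form_B q) = form_A (p * q)"
    by (simp add: form_A_def form_B_def quat_x_mult quat_y_mult algebra_simps)
  have B: "smult (quat_y p) (form_A q) + smult (cnj (quat_x p)) (form_B q) = form_B (p * q)"
    by (simp add: form_A_def form_B_def quat_x_mult quat_y_mult algebra_simps)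
  have "form_A (p * q) ^ (j - r) * form_B (p * q) ^ r
      = homogenize (form_A p ^ (j - r) * form_B p ^ r) (j - r + r) (form_A q) (form_B q)"
    unfolding A[symmetric] B[symmetric] form_A_def[of p] form_B_def[of p] by (rule homogenize_linear_prod[symmetric])
  also have "\<dots> = (\<Sum>t\<le>j. smult (form_coeff j p r t) (form_A q ^ (j - t) * form_B q ^ t))"
    using assms by (simp add: homogenize_def form_coeff_def)
  finally show ?thesis by (simp add: form_coeff_def[of j "p * q"] coeff_sum form_coeff_def[of j q])
qed

lemma form_coeff_torus:
  assumes "r \<le> j"
  shows "form_coeff j (quat_of_complex w) r s = (if s = r then w ^ (j - r) * cnj w ^ r else 0)"
proof -
  have "form_A (quat_of_complex w) = [:w:]" "form_B (quat_of_complex w) = monom (cnj w) 1"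
    by (simp_all add: form_A_def form_B_def quat_x_def quat_y_def quat_of_complex_def monom_altdef complex_eq_iff)
  then show ?thesis
    by (simp add: form_coeff_def monom_power poly_const_pow mult.commute)
qed

lemma form_coeff_one: "r \<le> j \<Longrightarrow> form_coeff j 1 r s = (if s = r then 1 else 0)"
  using form_coeff_torus[of r j 1 s] by (simp add: quat_of_complex_def one_quat_def)

lemma form_coeff_row_0: "form_coeff j q 0 s = of_nat (j choose s) * (- cnj (quat_y q)) ^ s * quat_x q ^ (j - s)"
  using coeff_linear_poly_power[of s j "quat_x q" "- cnj (quat_y q)"] form_coeff_eq_0[of 0 j s q]
  by (cases "s \<le> j") (simp_all add: form_coeff_def form_A_def binomial_eq_0)

lemma form_coeff_column_0: "form_coeff j q r 0 = quat_x q ^ (j - r) * quat_y q ^ r"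
  by (simp add: form_coeff_def coeff_mult coeff_0_power form_A_def form_B_def)

lemma continuous_on_form_coeff: "continuous_on S (\<lambda>q. form_coeff j q r s)"
proof -
  have x: "continuous_on S quat_x" "continuous_on S quat_y"
    unfolding quat_x_def quat_y_def Complex_eq by (intro continuous_intros)+
  have "continuous_on S (\<lambda>q. coeff (form_A q ^ m * form_B q ^ n) s)" for m n s
  proof (induction m arbitrary: s)
    case 0
    show ?case
    proof (induction n arbitrary: s)
      case 0
      show ?case by simp
    next
      case (Suc n)
      have "continuous_on S (\<lambda>q. coeff (form_B q * form_B q ^ n) s)"
        using Suc x by (cases s) (auto simp: form_B_def coeff_pCons intro!: continuous_intros)
      then show ?case by simp
    qed
  next
    case (Suc m)
    have "continuous_on S (\<lambda>q. coeff (form_A q * (form_A q ^ m * form_B q ^ n)) s)"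
      using Suc x by (cases s) (auto simp: form_A_def coeff_pCons intro!: continuous_intros)
    then show ?case by (simp add: mult.assoc)
  qed
  then show ?thesis unfolding form_coeff_def .
qed

text \<open>
  Multiplying a coefficient by a coordinate of \<open>q\<close> gives coefficients of the two neighbouring degrees
  (the Clebsch-Gordan rule for the product with the standard representation). For \<open>|q| = 1\<close> it is read off from
  the derivatives of the products \<open>A\<^sup>m B\<^sup>n\<close> and from \<open>cnj x A + cnj y B = 1\<close>.
\<close>

lemma form_relation: "norm q = 1 \<Longrightarrow> smult (cnj (quat_x q)) (form_A q) + smult (cnj (quat_y q)) (form_B q) = 1"
  using quat_xy_norm[of q] by (simp add: form_A_def form_B_def one_pCons)

lemma pderiv_form_product:
  "pderiv (form_A q ^ m * form_B q ^ n) =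
     smult (of_nat n * cnj (quat_x q)) (form_A q ^ m * form_B q ^ (n - 1))
     - smult (of_nat m * cnj (quat_y q)) (form_A q ^ (m - 1) * form_B q ^ n)"
proof -
  have "pderiv (form_A q) = [:- cnj (quat_y q):]" "pderiv (form_B q) = [:cnj (quat_x q):]"
    by (simp_all add: form_A_def form_B_def pderiv_pCons)
  then show ?thesis
    by (simp add: pderiv_mult pderiv_power algebra_simps)
qed

lemma form_coeff_mult_cnj_y:
  assumes q: "norm q = 1" and r: "r \<le> j"
  shows "of_nat (j + 1) * (cnj (quat_y q) * form_coeff j q r s) =
    of_nat r * form_coeff (j - 1) q (r - 1) s - of_nat (s + 1) * form_coeff (j + 1) q r (s + 1)"
proof -
  define P where "P = form_A q ^ (j - r) * form_B q ^ r"
  define Q where "Q = form_A q ^ (j - r) * form_B q ^ (r - 1)"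
  have "pderiv (form_A q ^ (j + 1 - r) * form_B q ^ r) =
      smult (of_nat r) (smult (cnj (quat_x q)) (form_A q) * Q) - smult (of_nat (j + 1 - r) * cnj (quat_y q)) P"
    unfolding pderiv_form_product P_def Q_def using r by (simp add: Suc_diff_le mult.assoc)
  also have "smult (cnj (quat_x q)) (form_A q) * Q = Q - smult (cnj (quat_y q)) (form_B q * Q)"
    using form_relation[OF q] by (metis (no_types, lifting) add_diff_cancel_right' left_diff_distrib mult_1 mult_smult_left)
  also have "smult (of_nat r) (Q - smult (cnj (quat_y q)) (form_B q * Q)) = smult (of_nat r) Q - smult (of_nat r * cnj (quat_y q)) P"
    by (cases r) (simp_all add: P_def Q_def smult_diff_right mult.left_commute)
  finally have "smult (of_nat (j + 1) * cnj (quat_y q)) P = smult (of_nat r) Q - pderiv (form_A q ^ (j + 1 - r) * form_B q ^ r)"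
    using r by (simp add: of_nat_diff algebra_simps flip: smult_add_left)
  then have "coeff (smult (of_nat (j + 1) * cnj (quat_y q)) P) s = coeff (smult (of_nat r) Q - pderiv (form_A q ^ (j + 1 - r) * form_B q ^ r)) s"
    by simp
  moreover have "of_nat r * coeff Q s = of_nat r * form_coeff (j - 1) q (r - 1) s"
    using r by (cases r) (auto simp: Q_def form_coeff_def)
  ultimately show ?thesis by (simp add: coeff_pderiv form_coeff_def P_def mult.assoc)
qed

lemma form_coeff_mult_cnj_x:
  assumes q: "norm q = 1" and r: "r \<le> j"
  shows "of_nat (j + 1) * (cnj (quat_x q) * form_coeff j q r s) =
    of_nat (j - r) * form_coeff (j - 1) q r s + of_nat (s + 1) * form_coeff (j + 1) q (r + 1) (s + 1)"
proof -
  define P where "P = form_A q ^ (j - r) * form_B q ^ r"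
  define Q where "Q = form_A q ^ (j - r - 1) * form_B q ^ r"
  have "pderiv (form_A q ^ (j - r) * form_B q ^ (r + 1)) =
      smult (of_nat (r + 1) * cnj (quat_x q)) P - smult (of_nat (j - r)) (smult (cnj (quat_y q)) (form_B q) * Q)"
    unfolding pderiv_form_product P_def Q_def by (simp add: mult_ac)
  also have "smult (cnj (quat_y q)) (form_B q) * Q = Q - smult (cnj (quat_x q)) (form_A q * Q)"
    using form_relation[OF q] by (metis (no_types, lifting) add_diff_cancel_left' left_diff_distrib mult_1 mult_smult_left)
  also have "smult (of_nat (j - r)) (Q - smult (cnj (quat_x q)) (form_A q * Q)) = smult (of_nat (j - r)) Q - smult (of_nat (j - r) * cnj (quat_x q)) P"
    by (cases "j - r") (simp_all add: P_def Q_def smult_diff_right mult.assoc)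
  finally have "smult (of_nat (j + 1) * cnj (quat_x q)) P = smult (of_nat (j - r)) Q + pderiv (form_A q ^ (j - r) * form_B q ^ (r + 1))"
    using r by (simp add: of_nat_diff algebra_simps flip: smult_add_left)
  then have "coeff (smult (of_nat (j + 1) * cnj (quat_x q)) P) s = coeff (smult (of_nat (j - r)) Q + pderiv (form_A q ^ (j - r) * form_B q ^ (r + 1))) s"
    by simp
  moreover have "of_nat (j - r) * coeff Q s = of_nat (j - r) * form_coeff (j - 1) q r s"
    by (simp add: Q_def form_coeff_def)
  ultimately show ?thesis by (simp add: coeff_pderiv form_coeff_def P_def mult.assoc)
qed

lemma form_coeff_split_x:
  assumes "r \<le> j"
  shows "quat_x q * form_coeff j q r s = form_coeff (j + 1) q r s + (case s of 0 \<Rightarrow> 0 | Suc t \<Rightarrow> cnj (quat_y q) * form_coeff j q r t)"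
proof -
  have "form_A q ^ (j + 1 - r) * form_B q ^ r = form_A q * (form_A q ^ (j - r) * form_B q ^ r)"
    using assms by (simp add: Suc_diff_le)
  then show ?thesis
    unfolding form_coeff_def by (simp add: form_A_def coeff_pCons split: nat.split)
qed

lemma form_coeff_split_y:
  "quat_y q * form_coeff j q r s = form_coeff (j + 1) q (r + 1) s - (case s of 0 \<Rightarrow> 0 | Suc t \<Rightarrow> cnj (quat_x q) * form_coeff j q r t)"
proof -
  have "form_A q ^ (j + 1 - (r + 1)) * form_B q ^ (r + 1) = form_B q * (form_A q ^ (j - r) * form_B q ^ r)"
    by simp
  then show ?thesis
    unfolding form_coeff_def by (simp add: form_B_def coeff_pCons split: nat.split)
qed

inductive_set coef_span :: "(quat \<Rightarrow> complex) set" where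
  zero: "(\<lambda>_. 0) \<in> coef_span"
| add: "f \<in> coef_span \<Longrightarrow> g \<in> coef_span \<Longrightarrow> (\<lambda>q. f q + g q) \<in> coef_span"
| coef: "r \<le> j \<Longrightarrow> s \<le> j \<Longrightarrow> (\<lambda>q. a * form_coeff j q r s) \<in> coef_span"
| cong: "f \<in> coef_span \<Longrightarrow> (\<And>q. q \<in> Sp1 \<Longrightarrow> g q = f q) \<Longrightarrow> g \<in> coef_span"

lemma coef_span_coef: "r \<le> j \<Longrightarrow> (\<lambda>q. a * form_coeff j q r s) \<in> coef_span"
  using coef_span.coef[of r j s a] coef_span.cong[OF coef_span.zero, of "\<lambda>q. a * form_coeff j q r s"]
  by (cases "s \<le> j") (auto simp: form_coeff_eq_0)

lemma coef_span_scale: "f \<in> coef_span \<Longrightarrow> (\<lambda>q. c * f q) \<in> coef_span"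
proof (induction rule: coef_span.induct)
  case zero
  show ?case using coef_span.zero by simp
next
  case (add f g)
  then show ?case using coef_span.add by (simp add: ring_distribs)
next
  case (coef r j s a)
  then show ?case using coef_span.coef[of r j s "c * a"] by (simp add: mult.assoc)
next
  case (cong f g)
  then show ?case by (auto intro: coef_span.cong)
qed

lemma coef_span_mult_coordinate:
  assumes "f \<in> coef_span"
  shows "(\<lambda>q. cnj (quat_x q) * f q) \<in> coef_span \<and> (\<lambda>q. cnj (quat_y q) * f q) \<in> coef_span \<and>
    (\<lambda>q. quat_x q * f q) \<in> coef_span \<and> (\<lambda>q. quat_y q * f q) \<in> coef_span"
  using assms
proof (induction rule: coef_span.induct)
  case zero
  show ?case using coef_span.zero by simp
next
  case (add f g)
  then show ?case by (auto simp: ring_distribs intro!: coef_span.add)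
next
  case (cong f g)
  then show ?case by (auto intro: coef_span.cong)
next
  case (coef r j s a)
  have cx: "(\<lambda>q. b * (cnj (quat_x q) * form_coeff j q r s)) \<in> coef_span" for s b
  proof (rule coef_span.cong)
    have "(\<lambda>q. (b * of_nat (j - r) / of_nat (j + 1)) * form_coeff (j - 1) q r s) \<in> coef_span"
    proof (cases "r = j")
      case True
      then show ?thesis using coef_span.zero by simp
    next
      case False
      then show ?thesis using coef(1) by (intro coef_span_coef) simp
    qed
    then show "(\<lambda>q. (b * of_nat (j - r) / of_nat (j + 1)) * form_coeff (j - 1) q r s
        + (b * of_nat (s + 1) / of_nat (j + 1)) * form_coeff (j + 1) q (r + 1) (s + 1)) \<in> coef_span"
      by (rule coef_span.add[OF _ coef_span_coef]) (use coef(1) in simp)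
    show "b * (cnj (quat_x q) * form_coeff j q r s) = (b * of_nat (j - r) / of_nat (j + 1)) * form_coeff (j - 1) q r s
        + (b * of_nat (s + 1) / of_nat (j + 1)) * form_coeff (j + 1) q (r + 1) (s + 1)" if "q \<in> Sp1" for q
    proof -
      have n0: "of_nat (j + 1) \<noteq> (0::complex)" by (metis of_nat_eq_0_iff Suc_eq_plus1 Suc_neq_Zero)
      have "of_nat (j + 1) * (cnj (quat_x q) * form_coeff j q r s) = of_nat (j - r) * form_coeff (j - 1) q r s + of_nat (s + 1) * form_coeff (j + 1) q (r + 1) (s + 1)"
        using form_coeff_mult_cnj_x[OF _ coef(1)] that by (simp only: Sp1_def mem_Collect_eq)
      then have "cnj (quat_x q) * form_coeff j q r s = (of_nat (j - r) * form_coeff (j - 1) q r s + of_nat (s + 1) * form_coeff (j + 1) q (r + 1) (s + 1)) / of_nat (j + 1)"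
        using n0 by (metis nonzero_mult_div_cancel_left)
      then show ?thesis by (simp only:) (simp add: add_divide_distrib diff_divide_distrib distrib_left right_diff_distrib mult.assoc del: of_nat_add of_nat_Suc)
    qed
  qed
  have cy: "(\<lambda>q. b * (cnj (quat_y q) * form_coeff j q r s)) \<in> coef_span" for s b
  proof (rule coef_span.cong)
    have "(\<lambda>q. (b * of_nat r / of_nat (j + 1)) * form_coeff (j - 1) q (r - 1) s) \<in> coef_span"
      using coef(1) by (intro coef_span_coef) simp
    then show "(\<lambda>q. (b * of_nat r / of_nat (j + 1)) * form_coeff (j - 1) q (r - 1) s
        + (- b * of_nat (s + 1) / of_nat (j + 1)) * form_coeff (j + 1) q r (s + 1)) \<in> coef_span"
      by (rule coef_span.add[OF _ coef_span_coef]) (use coef(1) in simp)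
    show "b * (cnj (quat_y q) * form_coeff j q r s) = (b * of_nat r / of_nat (j + 1)) * form_coeff (j - 1) q (r - 1) s
        + (- b * of_nat (s + 1) / of_nat (j + 1)) * form_coeff (j + 1) q r (s + 1)" if "q \<in> Sp1" for q
    proof -
      have n0: "of_nat (j + 1) \<noteq> (0::complex)" by (metis of_nat_eq_0_iff Suc_eq_plus1 Suc_neq_Zero)
      have "of_nat (j + 1) * (cnj (quat_y q) * form_coeff j q r s) = of_nat r * form_coeff (j - 1) q (r - 1) s - of_nat (s + 1) * form_coeff (j + 1) q r (s + 1)"
        using form_coeff_mult_cnj_y[OF _ coef(1)] that by (simp only: Sp1_def mem_Collect_eq)
      then have "cnj (quat_y q) * form_coeff j q r s = (of_nat r * form_coeff (j - 1) q (r - 1) s - of_nat (s + 1) * form_coeff (j + 1) q r (s + 1)) / of_nat (j + 1)"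
        using n0 by (metis nonzero_mult_div_cancel_left)
      then show ?thesis by (simp only:) (simp add: add_divide_distrib diff_divide_distrib distrib_left right_diff_distrib mult.assoc del: of_nat_add of_nat_Suc)
    qed
  qed
  have x: "(\<lambda>q. a * (quat_x q * form_coeff j q r s)) \<in> coef_span"
    unfolding form_coeff_split_x[OF coef(1)] distrib_left using coef(1)
    by (cases s) (auto intro!: coef_span.add coef_span_coef cy simp del: of_nat_add)
  have y: "(\<lambda>q. a * (quat_y q * form_coeff j q r s)) \<in> coef_span"
    unfolding form_coeff_split_y right_diff_distrib using coef(1)
    using coef_span.add[OF coef_span_coef[of "r + 1" "j + 1" a s] cx[of "- a"]]
      coef_span_coef[of "r + 1" "j + 1" a s]
    by (cases s) auto
  show ?case using x y cx[of a s] cy[of a s] by (simp only: mult.left_commute[of a])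
qed

lemma coef_span_one: "(\<lambda>_. 1) \<in> coef_span"
proof -
  have "(\<lambda>q. 1 * form_coeff 0 q 0 0) \<in> coef_span" by (rule coef_span_coef) simp
  then show ?thesis by (simp add: form_coeff_def)
qed

lemma coef_span_coordinates:
  assumes f: "f \<in> coef_span"
  shows "(\<lambda>q. of_real (q1 q) * f q) \<in> coef_span" "(\<lambda>q. of_real (qi q) * f q) \<in> coef_span"
    "(\<lambda>q. of_real (qj q) * f q) \<in> coef_span" "(\<lambda>q. of_real (qk q) * f q) \<in> coef_span"
proof -
  note m = coef_span_mult_coordinate[OF f]
  have c: "(\<lambda>q. a * (u q * f q) + b * (v q * f q)) \<in> coef_span"
    if "(\<lambda>q. u q * f q) \<in> coef_span" "(\<lambda>q. v q * f q) \<in> coef_span" for a b u v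
    using that by (intro coef_span.add coef_span_scale)
  have e: "of_real (q1 q) * z = 1/2 * (quat_x q * z) + 1/2 * (cnj (quat_x q) * z)"
    "of_real (qi q) * z = (- \<i>/2) * (quat_x q * z) + (\<i>/2) * (cnj (quat_x q) * z)"
    "of_real (qj q) * z = 1/2 * (quat_y q * z) + 1/2 * (cnj (quat_y q) * z)"
    "of_real (qk q) * z = (\<i>/2) * (quat_y q * z) + (- \<i>/2) * (cnj (quat_y q) * z)" for q z
    by (simp_all add: quat_x_def quat_y_def complex_eq_iff field_simps)
  show "(\<lambda>q. of_real (q1 q) * f q) \<in> coef_span" unfolding e by (intro c) (use m in auto)
  show "(\<lambda>q. of_real (qi q) * f q) \<in> coef_span" unfolding e by (intro c) (use m in auto)
  show "(\<lambda>q. of_real (qj q) * f q) \<in> coef_span" unfolding e by (intro c) (use m in auto)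
  show "(\<lambda>q. of_real (qk q) * f q) \<in> coef_span" unfolding e by (intro c) (use m in auto)
qed

lemma coef_span_mult_polynomial:
  assumes "real_polynomial_function p" "f \<in> coef_span"
  shows "(\<lambda>q. of_real (p q) * f q) \<in> coef_span"
  using assms
proof (induction arbitrary: f rule: real_polynomial_function.induct)
  case (linear p f)
  note fs = linear(2)
  from linear(1) interpret bounded_linear p by simp
  have "q = q1 q *\<^sub>R Quat 1 0 0 0 + qi q *\<^sub>R Quat 0 1 0 0 + qj q *\<^sub>R Quat 0 0 1 0 + qk q *\<^sub>R Quat 0 0 0 1" for q
    by (simp add: quat_eq_iff scaleR_quat_def plus_quat_def)
  then have "p q = p (q1 q *\<^sub>R Quat 1 0 0 0 + qi q *\<^sub>R Quat 0 1 0 0 + qj q *\<^sub>R Quat 0 0 1 0 + qk q *\<^sub>R Quat 0 0 0 1)" for q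
    by (rule arg_cong)
  then have e: "p q = q1 q * p (Quat 1 0 0 0) + qi q * p (Quat 0 1 0 0) + qj q * p (Quat 0 0 1 0) + qk q * p (Quat 0 0 0 1)" for q
    unfolding add scale real_scaleR_def .
  have eq: "of_real (p q) * f q = of_real (p (Quat 1 0 0 0)) * (of_real (q1 q) * f q) + of_real (p (Quat 0 1 0 0)) * (of_real (qi q) * f q)
      + of_real (p (Quat 0 0 1 0)) * (of_real (qj q) * f q) + of_real (p (Quat 0 0 0 1)) * (of_real (qk q) * f q)" for q
    by (subst e[of q]) (simp add: algebra_simps)
  have mem: "(\<lambda>q. of_real (p (Quat 1 0 0 0)) * (of_real (q1 q) * f q) + of_real (p (Quat 0 1 0 0)) * (of_real (qi q) * f q)
      + of_real (p (Quat 0 0 1 0)) * (of_real (qj q) * f q) + of_real (p (Quat 0 0 0 1)) * (of_real (qk q) * f q)) \<in> coef_span"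
    by (rule coef_span.add[OF coef_span.add[OF coef_span.add]]; rule coef_span_scale; rule coef_span_coordinates[OF fs])
  show ?case by (rule coef_span.cong[OF mem eq])
next
  case (const c)
  then show ?case by (rule coef_span_scale)
next
  case (add p1 p2)
  then show ?case using coef_span.add by (simp add: ring_distribs)
next
  case (mult p1 p2)
  then show ?case by (simp add: mult.assoc)
qed

lemma compact_Sp1: "compact Sp1"
proof -
  have "Sp1 = sphere 0 1" unfolding Sp1_def sphere_def by (simp only: dist_0_norm)
  moreover have "compact (sphere (0::quat) 1)" by (rule compact_sphere)
  ultimately show ?thesis by simp
qed

text \<open>
  Every real polynomial in the four coordinates of \<open>q\<close> lies in the span, because
  the span is stable under multiplication by coordinates, and polynomials are dense.
\<close>

lemma coef_span_dense:
  assumes f: "continuous_on Sp1 f" and e0: "\<epsilon> > 0"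
  obtains g where "g \<in> coef_span" "\<And>q. q \<in> Sp1 \<Longrightarrow> cmod (f q - g q) < \<epsilon>"
proof -
  have c: "continuous_on Sp1 (\<lambda>q. Re (f q))" "continuous_on Sp1 (\<lambda>q. Im (f q))"
    by (rule continuous_on_Re[OF f], rule continuous_on_Im[OF f])
  have e: "\<epsilon>/2 > 0" by (rule half_gt_zero[OF e0])
  obtain u where u: "real_polynomial_function u" "\<And>q. q \<in> Sp1 \<Longrightarrow> \<bar>Re (f q) - u q\<bar> < \<epsilon>/2"
    by (rule Stone_Weierstrass_real_polynomial_function[OF compact_Sp1 c(1) e]) (rule that)
  obtain v where v: "real_polynomial_function v" "\<And>q. q \<in> Sp1 \<Longrightarrow> \<bar>Im (f q) - v q\<bar> < \<epsilon>/2"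
    by (rule Stone_Weierstrass_real_polynomial_function[OF compact_Sp1 c(2) e]) (rule that)
  define g where "g q = of_real (u q) * 1 + \<i> * (of_real (v q) * 1)" for q
  have uv: "(\<lambda>q. of_real (u q) * 1) \<in> coef_span" "(\<lambda>q. of_real (v q) * 1) \<in> coef_span"
    by (rule coef_span_mult_polynomial[OF u(1) coef_span_one], rule coef_span_mult_polynomial[OF v(1) coef_span_one])
  have "g \<in> coef_span"
    unfolding g_def[abs_def] by (rule coef_span.add[OF uv(1) coef_span_scale[OF uv(2)]])
  moreover have "cmod (f q - g q) < \<epsilon>" if "q \<in> Sp1" for q
  proof -
    have "cmod (f q - g q) \<le> \<bar>Re (f q) - u q\<bar> + \<bar>Im (f q) - v q\<bar>"
    proof -
      have "Re (f q - g q) = Re (f q) - u q" "Im (f q - g q) = Im (f q) - v q" by (simp_all add: g_def)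
      with cmod_le[of "f q - g q"] show ?thesis by (simp only:)
    qed
    also have "\<dots> < \<epsilon>" using u(2)[OF that] v(2)[OF that] by simp
    finally show ?thesis .
  qed
  ultimately show thesis by (rule that)
qed

section \<open>Intertwining matrices and Schur's lemma\<close>

definition unit_cvec :: "nat \<Rightarrow> nat \<Rightarrow> complex" where
  "unit_cvec b = (\<lambda>i. if i = b then 1 else 0)"

definition mat_act :: "nat \<Rightarrow> nat \<Rightarrow> (nat \<Rightarrow> nat \<Rightarrow> complex) \<Rightarrow> (nat \<Rightarrow> complex) \<Rightarrow> nat \<Rightarrow> complex" where
  "mat_act m n A v = (\<lambda>i. if i < m then \<Sum>b<n. A i b * v b else 0)"

definition mat_prod :: "nat \<Rightarrow> (nat \<Rightarrow> nat \<Rightarrow> complex) \<Rightarrow> (nat \<Rightarrow> nat \<Rightarrow> complex) \<Rightarrow> nat \<Rightarrow> nat \<Rightarrow> complex" where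
  "mat_prod n A B = (\<lambda>i j. \<Sum>k<n. A i k * B k j)"

lemma unit_cvec_in_cvec: "b < d \<Longrightarrow> unit_cvec b \<in> cvec d"
  by (simp add: unit_cvec_def cvec_def)

lemma mat_act_cvec: "mat_act m n A v \<in> cvec m"
  by (simp add: mat_act_def cvec_def)

lemma mat_act_unit: "b < n \<Longrightarrow> i < m \<Longrightarrow> mat_act m n A (unit_cvec b) i = A i b"
  by (simp add: mat_act_def unit_cvec_def if_distrib sum.delta cong: if_cong)

lemma mat_act_prod: "mat_act m n A (mat_act n p B v) = mat_act m p (mat_prod n A B) v"
proof -
  have "(\<Sum>k<n. A i k * (\<Sum>b<p. B k b * v b)) = (\<Sum>b<p. (\<Sum>k<n. A i k * B k b) * v b)" for i
    by (simp add: sum_distrib_left sum_distrib_right mult.assoc) (rule sum.swap)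
  then show ?thesis by (simp add: mat_act_def mat_prod_def fun_eq_iff cong: sum.cong_simp)
qed

lemma mat_act_cong:
  "(\<And>i b. i < m \<Longrightarrow> b < n \<Longrightarrow> A i b = B i b) \<Longrightarrow> mat_act m n A v = mat_act m n B v"
  by (auto simp: mat_act_def intro!: sum.cong)

lemma mat_act_add: "mat_act m n A (\<lambda>i. u i + v i) = (\<lambda>i. mat_act m n A u i + mat_act m n A v i)"
  by (auto simp: mat_act_def ring_distribs sum.distrib)

lemma mat_act_scale: "mat_act m n A (\<lambda>i. c * v i) = (\<lambda>i. c * mat_act m n A v i)"
  by (auto simp: mat_act_def sum_distrib_left mult_ac)

lemma mat_act_zero: "mat_act m n A (\<lambda>i. 0) = (\<lambda>i. 0)"
  by (simp add: mat_act_def fun_eq_iff)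

lemma mat_act_one:
  assumes "v \<in> cvec d" "\<And>i b. i < d \<Longrightarrow> b < d \<Longrightarrow> A i b = (if i = b then 1 else 0)"
  shows "mat_act d d A v = v"
proof
  fix i
  have "(\<Sum>b<d. A i b * v b) = v i" if "i < d"
  proof -
    have "(\<Sum>b<d. A i b * v b) = (\<Sum>b<d. if b = i then v b else 0)"
      using assms(2) that by (intro sum.cong) auto
    then show ?thesis using that by simp
  qed
  then show "mat_act d d A v i = v i" using assms(1) by (auto simp: mat_act_def cvec_def)
qed

definition matrix_rep :: "nat \<Rightarrow> (quat \<Rightarrow> nat \<Rightarrow> nat \<Rightarrow> complex) \<Rightarrow> bool" where
  "matrix_rep d R \<longleftrightarrow>
     (\<forall>p\<in>Sp1. \<forall>q\<in>Sp1. \<forall>a<d. \<forall>b<d. R (p * q) a b = mat_prod d (R p) (R q) a b) \<and>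
     (\<forall>a<d. \<forall>b<d. R 1 a b = (if a = b then 1 else 0)) \<and>
     (\<forall>a<d. \<forall>b<d. continuous_on Sp1 (\<lambda>q. R q a b))"

definition irreducible_matrix_rep :: "nat \<Rightarrow> (quat \<Rightarrow> nat \<Rightarrow> nat \<Rightarrow> complex) \<Rightarrow> bool" where
  "irreducible_matrix_rep d R \<longleftrightarrow> matrix_rep d R \<and>
     (\<forall>W. cvec_subspace d W \<and> (\<forall>q\<in>Sp1. \<forall>v\<in>W. mat_act d d (R q) v \<in> W) \<longrightarrow> W = {\<lambda>i. 0} \<or> W = cvec d)"

definition intertwines where
  "intertwines d R d' R' X \<longleftrightarrow>
     (\<forall>q\<in>Sp1. \<forall>r<d'. \<forall>a<d. mat_prod d' (R' q) X r a = mat_prod d X (R q) r a)"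

definition mutually_inverse where
  "mutually_inverse d X Y \<longleftrightarrow>
     (\<forall>r<d. \<forall>s<d. mat_prod d X Y r s = (if r = s then 1 else 0)) \<and>
     (\<forall>r<d. \<forall>s<d. mat_prod d Y X r s = (if r = s then 1 else 0))"

lemma intertwines_act:
  assumes "intertwines d R d' R' X" "q \<in> Sp1"
  shows "mat_act d' d X (mat_act d d (R q) v) = mat_act d' d' (R' q) (mat_act d' d X v)"
  unfolding mat_act_prod
  by (rule mat_act_cong) (use assms in \<open>simp add: intertwines_def\<close>)

lemma cvec_subspace_D:
  assumes "cvec_subspace d W"
  shows "W \<subseteq> cvec d" "(\<lambda>i. 0) \<in> W" "\<And>u v. u \<in> W \<Longrightarrow> v \<in> W \<Longrightarrow> (\<lambda>i. u i + v i) \<in> W"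
    "\<And>c v. v \<in> W \<Longrightarrow> (\<lambda>i. c * v i) \<in> W"
  using assms by (auto simp: cvec_subspace_def)

text \<open>
  A nonzero intertwining matrix has no kernel and full image. Then it is invertible, and comparing
  the traces of \<open>X Y\<close> and \<open>Y X\<close> shows that it is square.
\<close>

lemma intertwiner_invertible:
  assumes R: "irreducible_matrix_rep d R" and R': "irreducible_matrix_rep d' R'"
    and X: "intertwines d R d' R' X" and nz: "r0 < d'" "a0 < d" "X r0 a0 \<noteq> 0"
  shows "d = d'" "\<exists>Y. mutually_inverse d X Y"
proof -
  let ?X = "mat_act d' d X"
  have Xnz: "?X (unit_cvec a0) \<noteq> (\<lambda>i. 0)"
  proof
    assume "?X (unit_cvec a0) = (\<lambda>i. 0)"
    with mat_act_unit[OF nz(2,1), of X] nz(3) show False by simp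
  qed
  define K where "K = {v \<in> cvec d. ?X v = (\<lambda>i. 0)}"
  have "cvec_subspace d K"
    by (auto simp: cvec_subspace_def K_def mat_act_zero mat_act_add mat_act_scale cvec_def)
  moreover have "mat_act d d (R q) v \<in> K" if "q \<in> Sp1" "v \<in> K" for q v
    using that by (simp add: K_def mat_act_cvec intertwines_act[OF X] mat_act_zero)
  ultimately have "K = {\<lambda>i. 0} \<or> K = cvec d"
    using R unfolding irreducible_matrix_rep_def by blast
  moreover have "unit_cvec a0 \<in> cvec d" "unit_cvec a0 \<notin> K"
    using Xnz nz(2) by (auto simp: K_def unit_cvec_in_cvec)
  ultimately have K0: "K = {\<lambda>i. 0}" by blast
  have inj: "u = v" if "u \<in> cvec d" "v \<in> cvec d" "?X u = ?X v" for u v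
  proof -
    have "?X (\<lambda>i. u i + (- 1) * v i) = (\<lambda>i. 0)"
      unfolding mat_act_add mat_act_scale using that by simp
    then have "(\<lambda>i. u i + (- 1) * v i) \<in> K"
      using that unfolding K_def cvec_def by simp
    then have "(\<lambda>i. u i - v i) = (\<lambda>i. 0)" using K0 by simp
    then show ?thesis by (simp add: fun_eq_iff)
  qed
  have "cvec_subspace d' (?X ` cvec d)"
    unfolding cvec_subspace_def
  proof (intro conjI ballI allI)
    show "?X ` cvec d \<subseteq> cvec d'" by (auto simp: mat_act_cvec)
    show "(\<lambda>i. 0) \<in> ?X ` cvec d" by (rule image_eqI[of _ _ "\<lambda>i. 0"]) (simp_all add: mat_act_zero cvec_def)
    fix u assume u: "u \<in> ?X ` cvec d"
    then obtain u' where u': "u' \<in> cvec d" "u = ?X u'" by blast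
    show "(\<lambda>i. c * u i) \<in> ?X ` cvec d" for c
      by (rule image_eqI[of _ _ "\<lambda>i. c * u' i"]) (use u' in \<open>simp_all add: mat_act_scale cvec_def\<close>)
    fix v assume v: "v \<in> ?X ` cvec d"
    then obtain v' where v': "v' \<in> cvec d" "v = ?X v'" by blast
    show "(\<lambda>i. u i + v i) \<in> ?X ` cvec d"
      by (rule image_eqI[of _ _ "\<lambda>i. u' i + v' i"]) (use u' v' in \<open>simp_all add: mat_act_add cvec_def\<close>)
  qed
  moreover have "mat_act d' d' (R' q) v \<in> ?X ` cvec d" if "q \<in> Sp1" "v \<in> ?X ` cvec d" for q v
    using that intertwines_act[OF X that(1), symmetric] by (auto simp: mat_act_cvec)
  ultimately have "?X ` cvec d = {\<lambda>i. 0} \<or> ?X ` cvec d = cvec d'"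
    using R' unfolding irreducible_matrix_rep_def by blast
  then have surj: "?X ` cvec d = cvec d'" using Xnz unit_cvec_in_cvec[OF nz(2)] by blast
  have "\<exists>u. u \<in> cvec d \<and> ?X u = unit_cvec s" if "s < d'" for s
    using unit_cvec_in_cvec[OF that] surj by (metis imageE)
  then obtain u where u: "\<And>s. s < d' \<Longrightarrow> u s \<in> cvec d \<and> ?X (u s) = unit_cvec s" by metis
  define Y where "Y a s = u s a" for a s
  have XY: "mat_prod d X Y r s = (if r = s then 1 else 0)" if "r < d'" "s < d'" for r s
  proof -
    have "mat_prod d X Y r s = ?X (u s) r" using that by (simp add: mat_prod_def mat_act_def Y_def)
    then show ?thesis using u[OF that(2)] by (simp add: unit_cvec_def)
  qed
  have YX: "mat_prod d' Y X a b = (if a = b then 1 else 0)" if "a < d" "b < d" for a b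
  proof -
    have "?X (mat_act d d' Y (?X (unit_cvec b))) = mat_act d' d' (mat_prod d X Y) (?X (unit_cvec b))"
      by (rule mat_act_prod)
    also have "\<dots> = ?X (unit_cvec b)"
      by (rule mat_act_one[OF mat_act_cvec XY])
    finally have "mat_act d d' Y (?X (unit_cvec b)) = unit_cvec b"
      by (rule inj[OF mat_act_cvec unit_cvec_in_cvec[OF that(2)]])
    then have "mat_act d d (mat_prod d' Y X) (unit_cvec b) a = unit_cvec b a" by (simp add: mat_act_prod)
    then show ?thesis using that by (simp add: mat_act_unit) (simp add: unit_cvec_def)
  qed
  have "of_nat d' = (\<Sum>r<d'. mat_prod d X Y r r)" by (simp add: XY)
  also have "\<dots> = (\<Sum>a<d. mat_prod d' Y X a a)"
    unfolding mat_prod_def by (subst sum.swap) (simp add: mult.commute)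
  also have "\<dots> = of_nat d" by (simp add: YX)
  finally have "of_nat d' = (of_nat d :: complex)" .
  then show dd: "d = d'" by (simp only: of_nat_eq_iff)
  show "\<exists>Y. mutually_inverse d X Y"
    using XY YX unfolding mutually_inverse_def dd[symmetric] by blast
qed

lemma mat_prod_assoc: "mat_prod n A (mat_prod m B C) i j = mat_prod m (mat_prod n A B) C i j"
  by (simp add: mat_prod_def sum_distrib_left sum_distrib_right mult.assoc) (rule sum.swap)

lemma mat_prod_cong:
  "(\<And>k. k < n \<Longrightarrow> A i k = A' i k) \<Longrightarrow> (\<And>k. k < n \<Longrightarrow> B k j = B' k j) \<Longrightarrow> mat_prod n A B i j = mat_prod n A' B' i j"
  by (simp add: mat_prod_def)

lemma mat_prod_one_left:
  assumes "i < n" "\<And>k. k < n \<Longrightarrow> A i k = (if i = k then 1 else 0)"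
  shows "mat_prod n A B i j = B i j"
proof -
  have "mat_prod n A B i j = (\<Sum>k<n. if k = i then B k j else 0)"
    unfolding mat_prod_def using assms by (intro sum.cong) auto
  then show ?thesis using assms by simp
qed

lemma mat_prod_one_right:
  assumes "j < n" "\<And>k. k < n \<Longrightarrow> B k j = (if k = j then 1 else 0)"
  shows "mat_prod n A B i j = A i j"
proof -
  have "mat_prod n A B i j = (\<Sum>k<n. if k = j then A i k else 0)"
    unfolding mat_prod_def using assms by (intro sum.cong) auto
  then show ?thesis using assms by simp
qed

lemma intertwines_comp:
  assumes X: "intertwines d R d' R' X" and Z: "intertwines d' R' d'' R'' Z"
  shows "intertwines d R d'' R'' (mat_prod d' Z X)"
  unfolding intertwines_def
proof (intro ballI allI impI)
  fix q r a assume q: "q \<in> Sp1" and ra: "r < d''" "a < d"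
  have "mat_prod d'' (R'' q) (mat_prod d' Z X) r a = mat_prod d' (mat_prod d'' (R'' q) Z) X r a" by (rule mat_prod_assoc)
  also have "\<dots> = mat_prod d' (mat_prod d' Z (R' q)) X r a"
    by (rule mat_prod_cong) (use Z q ra in \<open>simp_all add: intertwines_def\<close>)
  also have "\<dots> = mat_prod d' Z (mat_prod d' (R' q) X) r a" by (rule mat_prod_assoc[symmetric])
  also have "\<dots> = mat_prod d' Z (mat_prod d X (R q)) r a"
    by (rule mat_prod_cong) (use X q ra in \<open>simp_all add: intertwines_def\<close>)
  also have "\<dots> = mat_prod d (mat_prod d' Z X) (R q) r a" by (rule mat_prod_assoc)
  finally show "mat_prod d'' (R'' q) (mat_prod d' Z X) r a = mat_prod d (mat_prod d' Z X) (R q) r a" .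
qed

lemma intertwines_inverse:
  assumes X: "intertwines d R d R' X" and XY: "mutually_inverse d X Y"
  shows "intertwines d R' d R Y"
  unfolding intertwines_def
proof (intro ballI allI impI)
  fix q r a assume q: "q \<in> Sp1" and ra: "r < d" "a < d"
  have "mat_prod d (R q) Y r a = mat_prod d (mat_prod d (mat_prod d Y X) (R q)) Y r a"
    by (rule mat_prod_cong) (use XY ra in \<open>simp_all add: mutually_inverse_def mat_prod_one_left\<close>)
  also have "\<dots> = mat_prod d (mat_prod d Y (mat_prod d X (R q))) Y r a"
    by (rule mat_prod_cong) (simp_all add: mat_prod_assoc)
  also have "\<dots> = mat_prod d (mat_prod d Y (mat_prod d (R' q) X)) Y r a"
    by (rule mat_prod_cong, rule mat_prod_cong) (use X q in \<open>simp_all add: intertwines_def\<close>)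
  also have "\<dots> = mat_prod d (mat_prod d (mat_prod d Y (R' q)) X) Y r a"
    by (rule mat_prod_cong) (simp_all add: mat_prod_assoc)
  also have "\<dots> = mat_prod d (mat_prod d Y (R' q)) (mat_prod d X Y) r a" by (rule mat_prod_assoc[symmetric])
  also have "\<dots> = mat_prod d Y (R' q) r a"
    by (rule mat_prod_one_right) (use XY ra in \<open>simp_all add: mutually_inverse_def\<close>)
  finally show "mat_prod d (R q) Y r a = mat_prod d Y (R' q) r a" .
qed

section \<open>Irreducibility of the representations on forms\<close>

lemma Sp1_mult: "p \<in> Sp1 \<Longrightarrow> q \<in> Sp1 \<Longrightarrow> p * q \<in> Sp1"
  by (simp add: Sp1_def norm_mult)

lemma norm_quat_conj [simp]: "norm (quat_conj q) = norm q"
  by (simp add: norm_quat_def inner_quat_def quat_conj_def)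

lemma Sp1_conj: "q \<in> Sp1 \<Longrightarrow> quat_conj q \<in> Sp1"
  by (simp add: Sp1_def)

lemma Sp1_conj_cancel: "q \<in> Sp1 \<Longrightarrow> q * quat_conj q = 1" "q \<in> Sp1 \<Longrightarrow> quat_conj q * q = 1"
  by (simp_all add: Sp1_def quat_mult_conj)

lemma one_in_Sp1: "1 \<in> Sp1" by (simp add: Sp1_def)

lemma cis_in_Sp1: "quat_of_complex (cis t) \<in> Sp1"
  by (simp add: Sp1_def norm_quat_of_complex)

lemma matrix_rep_form: "matrix_rep (Suc j) (form_coeff j)"
  by (auto simp: matrix_rep_def mat_prod_def form_coeff_mult form_coeff_one lessThan_Suc_atMost
      continuous_on_form_coeff)

definition weight :: "nat \<Rightarrow> nat \<Rightarrow> int" where "weight j r = int j - 2 * int r"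

lemma form_coeff_cis:
  assumes "r \<le> j"
  shows "form_coeff j (quat_of_complex (cis t)) r s = (if s = r then cis (of_int (weight j r) * t) else 0)"
proof -
  have "cis t ^ (j - r) * cnj (cis t) ^ r = cis (of_int (weight j r) * t)"
    using assms by (simp add: Complex.DeMoivre cis_cnj cis_mult weight_def of_nat_diff algebra_simps)
  then show ?thesis by (simp add: form_coeff_torus[OF assms])
qed

text \<open>Two different weights of one form are separated by the sign at a suitable angle.\<close>

lemma separate_weights:
  assumes "r \<noteq> s"
  obtains t where "cis (of_int (weight j r) * t) = - cis (of_int (weight j s) * t)"
proof -
  define t where "t = pi / (2 * (real s - real r))"
  have "of_int (weight j r) * t = of_int (weight j s) * t + pi"
    using assms by (simp add: weight_def t_def field_simps)
  then have "cis (of_int (weight j r) * t) = - cis (of_int (weight j s) * t)"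
    by (simp add: cis_mult[symmetric])
  then show thesis by (rule that)
qed

text \<open>
  A unit quaternion for which no entry in the first row or the first column of its action on
  forms vanishes; it connects every weight vector with the extreme one.
\<close>

definition generic_unit :: quat where "generic_unit = Quat (sqrt (1/2)) 0 (sqrt (1/2)) 0"

lemma generic_unit: "generic_unit \<in> Sp1" "quat_x generic_unit \<noteq> 0" "quat_y generic_unit \<noteq> 0"
  by (simp_all add: generic_unit_def Sp1_def norm_quat_def inner_quat_def quat_x_def quat_y_def complex_eq_iff)

lemma form_row_0_nonzero: "s \<le> j \<Longrightarrow> form_coeff j generic_unit 0 s \<noteq> 0"
  using generic_unit by (simp add: form_coeff_row_0)

lemma form_column_0_nonzero: "form_coeff j generic_unit r 0 \<noteq> 0"
  using generic_unit by (simp add: form_coeff_column_0)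

text \<open>
  Among the vectors of \<open>W\<close> with nonzero entry at \<open>r\<close>, one of least
  support has no other entry: a second one could be removed by subtracting a multiple of the
  vector from its image under the torus.
\<close>

lemma form_invariant_unit:
  assumes W: "cvec_subspace (Suc j) W" and inv: "\<And>q v. q \<in> Sp1 \<Longrightarrow> v \<in> W \<Longrightarrow> mat_act (Suc j) (Suc j) (form_coeff j q) v \<in> W"
    and v: "v \<in> W" "v r \<noteq> 0"
  shows "unit_cvec r \<in> W"
proof -
  define n where "n = (LEAST n. \<exists>v\<in>W. v r \<noteq> 0 \<and> card {s. v s \<noteq> 0} = n)"
  have ex: "\<exists>n. \<exists>v\<in>W. v r \<noteq> 0 \<and> card {s. v s \<noteq> 0} = n" using v by blast
  obtain u where u: "u \<in> W" "u r \<noteq> 0" "card {s. u s \<noteq> 0} = n"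
    using LeastI_ex[OF ex] unfolding n_def by blast
  have uc: "u \<in> cvec (Suc j)" using cvec_subspace_D(1)[OF W] u(1) by blast
  have supp: "s \<le> j" if "u s \<noteq> 0" for s
  proof (rule ccontr)
    assume "\<not> s \<le> j"
    then show False using uc that by (simp add: cvec_def)
  qed
  have fin: "finite {s. u s \<noteq> 0}" by (rule finite_subset[of _ "{..j}"]) (use supp in auto)
  have "u s = 0" if s: "s \<noteq> r" for s
  proof (rule ccontr)
    assume us: "u s \<noteq> 0"
    obtain t where t: "cis (of_int (weight j r) * t) = - cis (of_int (weight j s) * t)"
      using separate_weights[OF s[symmetric]] .
    let ?c = "cis (of_int (weight j s) * t)"
    \<comment> \<open>Subtracting the eigenvalue at \<open>s\<close> removes the entry there and doubles the absolute value of the one at \<open>r\<close>.\<close>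
    define u' where "u' = (\<lambda>i. mat_act (Suc j) (Suc j) (form_coeff j (quat_of_complex (cis t))) u i + (- ?c) * u i)"
    have "mat_act (Suc j) (Suc j) (form_coeff j (quat_of_complex (cis t))) u i = cis (of_int (weight j i) * t) * u i" for i
    proof (cases "i \<le> j")
      case True
      then have "(\<Sum>b<Suc j. form_coeff j (quat_of_complex (cis t)) i b * u b) = (\<Sum>b<Suc j. if b = i then cis (of_int (weight j i) * t) * u i else 0)"
        by (intro sum.cong) (simp_all add: form_coeff_cis)
      then show ?thesis using True by (simp add: mat_act_def del: sum.lessThan_Suc)
    next
      case False
      then show ?thesis using supp[of i] by (auto simp: mat_act_def)
    qed
    then have u'_eq: "u' i = (cis (of_int (weight j i) * t) - ?c) * u i" for i
      by (simp add: u'_def left_diff_distrib)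
    have "u' \<in> W"
      unfolding u'_def using u(1) inv[OF cis_in_Sp1 u(1)] cvec_subspace_D(3,4)[OF W] by blast
    moreover have "u' r \<noteq> 0" using u(2) t by (simp add: u'_eq)
    moreover have "card {s. u' s \<noteq> 0} < n"
      unfolding u(3)[symmetric]
    proof (rule psubset_card_mono[OF fin])
      show "{s. u' s \<noteq> 0} \<subset> {s. u s \<noteq> 0}" using us by (auto simp: u'_eq)
    qed
    ultimately show False using not_less_Least[of "card {s. u' s \<noteq> 0}"] unfolding n_def by blast
  qed
  then have "unit_cvec r = (\<lambda>i. inverse (u r) * u i)" using u(2) by (auto simp: unit_cvec_def)
  then show ?thesis using cvec_subspace_D(4)[OF W u(1)] by simp
qed

text \<open>
  A nonzero invariant subspace contains a weight vector, hence with the help of one generic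
  element the extreme weight vector and then all others.
\<close>

lemma irreducible_form: "irreducible_matrix_rep (Suc j) (form_coeff j)"
  unfolding irreducible_matrix_rep_def
proof (intro conjI allI impI matrix_rep_form)
  fix W assume "cvec_subspace (Suc j) W \<and> (\<forall>q\<in>Sp1. \<forall>v\<in>W. mat_act (Suc j) (Suc j) (form_coeff j q) v \<in> W)"
  then have W: "cvec_subspace (Suc j) W"
    and inv': "\<forall>q\<in>Sp1. \<forall>v\<in>W. mat_act (Suc j) (Suc j) (form_coeff j q) v \<in> W" by (rule conjunct1, rule conjunct2)
  have inv: "mat_act (Suc j) (Suc j) (form_coeff j q) v \<in> W" if "q \<in> Sp1" "v \<in> W" for q v
    using inv' that by simp
  note Wc = cvec_subspace_D[OF W]
  have col: "unit_cvec r \<in> W"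
    if "form_coeff j generic_unit r s \<noteq> 0" "unit_cvec s \<in> W" "r \<le> j" "s \<le> j" for r s
  proof (rule form_invariant_unit[OF W inv])
    show "mat_act (Suc j) (Suc j) (form_coeff j generic_unit) (unit_cvec s) \<in> W"
      by (rule inv[OF generic_unit(1) that(2)])
    show "mat_act (Suc j) (Suc j) (form_coeff j generic_unit) (unit_cvec s) r \<noteq> 0"
      using that mat_act_unit[of s "Suc j" r "Suc j" "form_coeff j generic_unit"] by simp
  qed
  show "W = {\<lambda>i. 0} \<or> W = cvec (Suc j)"
  proof (cases "W = {\<lambda>i. 0}")
    case False
    have "\<not> W \<subseteq> {\<lambda>i. 0}"
    proof
      assume "W \<subseteq> {\<lambda>i. 0}"
      then have "W = {\<lambda>i. 0}" using Wc(2) by (simp add: subset_singleton_iff) auto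
      with False show False by simp
    qed
    then obtain v where v: "v \<in> W" "v \<noteq> (\<lambda>i. 0)" by auto
    have "\<exists>r. v r \<noteq> 0"
    proof (rule ccontr)
      assume "\<not> (\<exists>r. v r \<noteq> 0)"
      then have "v = (\<lambda>i. 0)" by (simp add: fun_eq_iff)
      with v show False by simp
    qed
    then obtain r where r: "v r \<noteq> 0" ..
    have rj: "r \<le> j"
    proof (rule ccontr)
      assume "\<not> r \<le> j"
      moreover have "v \<in> cvec (Suc j)" using v Wc(1) by blast
      ultimately show False using r by (simp add: cvec_def)
    qed
    have "unit_cvec r \<in> W" by (rule form_invariant_unit[OF W inv v(1) r])
    then have "unit_cvec 0 \<in> W" using col[of 0 r] form_row_0_nonzero[OF rj] rj by simp
    then have unit: "unit_cvec s \<in> W" if "s \<le> j" for s using col[of s 0] form_column_0_nonzero that by simp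
    have "w \<in> W" if w: "w \<in> cvec (Suc j)" for w
    proof -
      have part: "(\<lambda>i. \<Sum>s<n. w s * unit_cvec s i) \<in> W" if "n \<le> Suc j" for n
        using that
      proof (induction n)
        case 0
        show ?case using Wc(2) by simp
      next
        case (Suc n)
        then have "(\<lambda>i. (\<Sum>s<n. w s * unit_cvec s i) + w n * unit_cvec n i) \<in> W"
          by (intro Wc(3) Wc(4) unit) auto
        then show ?case by simp
      qed
      have "(\<lambda>i. \<Sum>s<Suc j. w s * unit_cvec s i) = w"
      proof
        fix i
        have "(\<Sum>s<Suc j. w s * unit_cvec s i) = (\<Sum>s<Suc j. if s = i then w s else 0)"
          by (intro sum.cong) (auto simp: unit_cvec_def)
        then show "(\<Sum>s<Suc j. w s * unit_cvec s i) = w i"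
          using w by (simp add: cvec_def del: sum.lessThan_Suc)
      qed
      with part[OF order_refl] show ?thesis by (simp only:)
    qed
    then have "cvec (Suc j) \<subseteq> W" by (rule subsetI)
    with Wc(1) have "W = cvec (Suc j)" by (rule subset_antisym)
    then show ?thesis ..
  qed simp
qed

text \<open>
  The torus forces \<open>X\<close> to be diagonal, and the first row at a generic element
  identifies the diagonal entries.
\<close>

lemma form_commutant_scalar:
  assumes X: "intertwines (Suc j) (form_coeff j) (Suc j) (form_coeff j) X" and rs: "r \<le> j" "s \<le> j"
  shows "X r s = (if r = s then X 0 0 else 0)"
proof -
  have torus: "X r s = 0" if rs: "r \<le> j" "s \<le> j" "r \<noteq> s" for r s
  proof -
    obtain t where t: "cis (of_int (weight j r) * t) = - cis (of_int (weight j s) * t)"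
      using separate_weights[OF rs(3)] .
    let ?w = "quat_of_complex (cis t)"
    have m1: "mat_prod (Suc j) (form_coeff j ?w) X r s = (\<Sum>k<Suc j. if k = r then cis (of_int (weight j r) * t) * X r s else 0)"
      unfolding mat_prod_def using rs by (intro sum.cong) (simp_all add: form_coeff_cis)
    have m2: "mat_prod (Suc j) X (form_coeff j ?w) r s = (\<Sum>k<Suc j. if k = s then X r s * cis (of_int (weight j s) * t) else 0)"
      unfolding mat_prod_def using rs by (intro sum.cong) (auto simp: form_coeff_cis)
    have "cis (of_int (weight j r) * t) * X r s = mat_prod (Suc j) (form_coeff j ?w) X r s"
      unfolding m1 using rs by (simp del: sum.lessThan_Suc)
    also have "\<dots> = mat_prod (Suc j) X (form_coeff j ?w) r s"
      using X rs cis_in_Sp1 unfolding intertwines_def by simp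
    also have "\<dots> = X r s * cis (of_int (weight j s) * t)"
      unfolding m2 using rs by (simp del: sum.lessThan_Suc)
    finally have "cis (of_int (weight j r) * t) * X r s = X r s * cis (of_int (weight j s) * t)" .
    then show ?thesis by (simp add: t)
  qed
  have diag: "X s s = X 0 0" if s: "s \<le> j" for s
  proof -
    have m1: "mat_prod (Suc j) (form_coeff j generic_unit) X 0 s = (\<Sum>k<Suc j. if k = s then form_coeff j generic_unit 0 s * X s s else 0)"
      unfolding mat_prod_def using s by (intro sum.cong) (auto simp: torus)
    have m2: "mat_prod (Suc j) X (form_coeff j generic_unit) 0 s = (\<Sum>k<Suc j. if k = 0 then X 0 0 * form_coeff j generic_unit 0 s else 0)"
      unfolding mat_prod_def using s by (intro sum.cong) (auto simp: torus)
    have "form_coeff j generic_unit 0 s * X s s = mat_prod (Suc j) (form_coeff j generic_unit) X 0 s"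
      unfolding m1 using s by (simp del: sum.lessThan_Suc)
    also have "\<dots> = mat_prod (Suc j) X (form_coeff j generic_unit) 0 s"
      using X s generic_unit(1) unfolding intertwines_def by simp
    also have "\<dots> = X 0 0 * form_coeff j generic_unit 0 s"
      unfolding m2 using s by (simp del: sum.lessThan_Suc)
    finally have "form_coeff j generic_unit 0 s * X s s = X 0 0 * form_coeff j generic_unit 0 s" .
    then show ?thesis using form_row_0_nonzero[OF s] by simp
  qed
  show ?thesis
  proof (cases "r = s")
    case True
    then show ?thesis using diag[OF rs(2)] by (simp only: if_True simp_thms)
  next
    case False
    then show ?thesis using torus[OF rs False] by (simp only: if_False simp_thms)
  qed
qed

section \<open>Averaging over the unit quaternions\<close>

lemma quat_conj_conj [simp]: "quat_conj (quat_conj q) = q"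
  by (simp add: quat_conj_def quat_eq_iff)

lemma (in unit_quaternion_haar) space_eq: "space \<sigma> = Sp1"
  using sets_eq_imp_space_eq[OF sets_eq] by (simp add: space_restrict_space)

lemma (in unit_quaternion_haar) measurable_toI:
  assumes "f \<in> borel_measurable N" "f \<in> space N \<rightarrow> Sp1"
  shows "f \<in> measurable N \<sigma>"
  using measurable_restrict_space2[OF assms(2,1)] unfolding measurable_cong_sets[OF refl sets_eq] .

lemma (in unit_quaternion_haar) measurable_fromI:
  assumes "f \<in> measurable (restrict_space borel Sp1) N"
  shows "f \<in> measurable \<sigma> N"
  using assms unfolding measurable_cong_sets[OF sets_eq refl] .

sublocale unit_quaternion_haar \<subseteq> left_invariant_prob \<sigma> "(*)" quat_conj
proof
  have id: "(\<lambda>x. x) \<in> borel_measurable \<sigma>"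
    by (rule measurable_fromI[OF measurable_restrict_space1[OF measurable_ident_sets[OF refl]]])
  have "(\<lambda>p. fst p * snd p) \<in> borel_measurable (\<sigma> \<Otimes>\<^sub>M \<sigma>)"
    by (rule borel_measurable_times[OF measurable_compose[OF measurable_fst id] measurable_compose[OF measurable_snd id]])
  moreover have "(\<lambda>p. fst p * snd p) \<in> space (\<sigma> \<Otimes>\<^sub>M \<sigma>) \<rightarrow> Sp1"
    by (simp add: space_pair_measure space_eq Sp1_mult Pi_def)
  ultimately show "(\<lambda>(x, y). x * y) \<in> measurable (\<sigma> \<Otimes>\<^sub>M \<sigma>) \<sigma>"
    unfolding case_prod_beta by (rule measurable_toI)
  have "quat_conj \<in> borel_measurable borel"
    by (rule borel_measurable_continuous_onI[OF continuous_on_quat_conj[OF continuous_on_id]])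
  then have "quat_conj \<in> borel_measurable \<sigma>"
    by (rule measurable_compose[OF id])
  then show "quat_conj \<in> measurable \<sigma> \<sigma>"
    by (rule measurable_toI) (simp add: space_eq Sp1_conj Pi_def)
  show "quat_conj (quat_conj x * y) = quat_conj y * x" for x y by (simp only: quat_conj_mult quat_conj_conj)
  show "distr \<sigma> \<sigma> ((*) x) = \<sigma>" if "x \<in> space \<sigma>" for x
    using that unfolding space_eq by (rule left_inv)
qed

context unit_quaternion_haar
begin

lemma measurable_continuous:
  fixes f :: "quat \<Rightarrow> 'b::real_normed_vector"
  assumes "continuous_on Sp1 f" shows "f \<in> borel_measurable \<sigma>"
  by (rule measurable_fromI[OF borel_measurable_continuous_on_restrict[OF assms]])

lemma integrable_continuous:
  fixes f :: "quat \<Rightarrow> complex"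
  assumes f: "continuous_on Sp1 f" shows "integrable \<sigma> f"
proof -
  have "compact (f ` Sp1)" by (rule compact_continuous_image[OF f compact_Sp1])
  then obtain B where "\<And>x. x \<in> f ` Sp1 \<Longrightarrow> norm x \<le> B"
    using compact_imp_bounded bounded_iff by metis
  then show ?thesis
    by (intro integrable_const_bound[of _ B] measurable_continuous f AE_I2) (simp add: space_eq)
qed

lemma continuous_conj: "continuous_on Sp1 f \<Longrightarrow> continuous_on Sp1 (\<lambda>q. f (quat_conj q))"
  by (rule continuous_on_compose2[of Sp1 f]) (auto intro: continuous_intros simp: Sp1_conj)

lemma matrix_rep_continuous:
  assumes "matrix_rep d R" "a < d" "b < d"
  shows "continuous_on Sp1 (\<lambda>q. R q a b)"
  using assms by (simp add: matrix_rep_def)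

text \<open>
  The integral is the average over the group of the conjugates of a matrix unit.
\<close>

lemma average_intertwines:
  assumes R: "matrix_rep d R" and R': "matrix_rep d' R'" and s: "s < d'" "b < d"
  shows "intertwines d R d' R' (\<lambda>r a. \<integral>q. R' (quat_conj q) r s * R q b a \<partial>\<sigma>)"
  unfolding intertwines_def
proof (intro ballI allI impI)
  fix p r a assume p: "p \<in> Sp1" and ra: "r < d'" "a < d"
  let ?X = "\<lambda>r a. \<integral>q. R' (quat_conj q) r s * R q b a \<partial>\<sigma>"
  have cont: "continuous_on Sp1 (\<lambda>q. R' (quat_conj q) r s * R q b a)" if "r < d'" "a < d" for r a
    using that s by (intro continuous_intros continuous_conj[of "\<lambda>q. R' q r s"] matrix_rep_continuous[OF R] matrix_rep_continuous[OF R'])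
  have "mat_prod d' (R' p) ?X r a = (\<Sum>k<d'. \<integral>q. R' p r k * (R' (quat_conj q) k s * R q b a) \<partial>\<sigma>)"
    by (simp add: mat_prod_def)
  also have "\<dots> = (\<integral>q. (\<Sum>k<d'. R' p r k * (R' (quat_conj q) k s * R q b a)) \<partial>\<sigma>)"
    by (rule Bochner_Integration.integral_sum[symmetric]) (intro integrable_mult_right integrable_continuous cont, use ra in auto)
  also have "\<dots> = (\<integral>q. R' (p * quat_conj q) r s * R q b a \<partial>\<sigma>)"
  proof (rule Bochner_Integration.integral_cong[OF refl])
    fix q assume "q \<in> space \<sigma>"
    then have "R' (p * quat_conj q) r s = mat_prod d' (R' p) (R' (quat_conj q)) r s"
      using R' p ra s Sp1_conj unfolding matrix_rep_def space_eq by simp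
    then show "(\<Sum>k<d'. R' p r k * (R' (quat_conj q) k s * R q b a)) = R' (p * quat_conj q) r s * R q b a"
      by (simp add: mat_prod_def sum_distrib_right mult.assoc)
  qed
  also have "\<dots> = (\<integral>q. R' (p * quat_conj (q * p)) r s * R (q * p) b a \<partial>\<sigma>)"
  proof (rule integral_right[symmetric])
    have "continuous_on Sp1 (\<lambda>q. R' (p * quat_conj q) r s * R q b a)"
    proof (intro continuous_intros matrix_rep_continuous[OF R] s ra)
      show "continuous_on Sp1 (\<lambda>q. R' (p * quat_conj q) r s)"
        by (rule continuous_on_compose2[OF matrix_rep_continuous[OF R' ra(1) s(1)]])
          (auto intro!: continuous_intros Sp1_mult Sp1_conj p)
    qed
    then show "(\<lambda>q. R' (p * quat_conj q) r s * R q b a) \<in> borel_measurable \<sigma>" by (rule measurable_continuous)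
    show "p \<in> space \<sigma>" using p by (simp add: space_eq)
  qed
  also have "\<dots> = (\<integral>q. (\<Sum>k<d. R' (quat_conj q) r s * R q b k * R p k a) \<partial>\<sigma>)"
  proof (rule Bochner_Integration.integral_cong[OF refl])
    fix q assume "q \<in> space \<sigma>"
    then have "R (q * p) b a = mat_prod d (R q) (R p) b a"
      using R p ra s unfolding matrix_rep_def space_eq by simp
    moreover have "p * quat_conj (q * p) = quat_conj q"
      using Sp1_conj_cancel(1)[OF p] by (simp add: quat_conj_mult mult.assoc[symmetric])
    ultimately show "R' (p * quat_conj (q * p)) r s * R (q * p) b a = (\<Sum>k<d. R' (quat_conj q) r s * R q b k * R p k a)"
      by (simp add: mat_prod_def sum_distrib_left mult.assoc)
  qed
  also have "\<dots> = (\<Sum>k<d. \<integral>q. R' (quat_conj q) r s * R q b k * R p k a \<partial>\<sigma>)"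
    by (rule Bochner_Integration.integral_sum) (intro integrable_mult_left integrable_continuous cont, use ra in auto)
  also have "\<dots> = mat_prod d ?X (R p) r a" by (simp add: mat_prod_def)
  finally show "mat_prod d' (R' p) ?X r a = mat_prod d ?X (R p) r a" .
qed

end

section \<open>Irreducible unitary representations of the unit quaternions\<close>

definition rep_matrix :: "(quat \<Rightarrow> (nat \<Rightarrow> complex) \<Rightarrow> nat \<Rightarrow> complex) \<Rightarrow> quat \<Rightarrow> nat \<Rightarrow> nat \<Rightarrow> complex" where
  "rep_matrix \<tau> q a b = \<tau> q (unit_cvec b) a"

lemma unitary_rep_D:
  assumes "unitary_rep_on Sp1 d \<tau>" "q \<in> Sp1"
  shows "v \<in> cvec d \<Longrightarrow> \<tau> q v \<in> cvec d"
    "u \<in> cvec d \<Longrightarrow> v \<in> cvec d \<Longrightarrow> \<tau> q (\<lambda>i. u i + v i) = (\<lambda>i. \<tau> q u i + \<tau> q v i)"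
    "v \<in> cvec d \<Longrightarrow> \<tau> q (\<lambda>i. c * v i) = (\<lambda>i. c * \<tau> q v i)"
    "v \<in> cvec d \<Longrightarrow> \<tau> 1 v = v"
    "p \<in> Sp1 \<Longrightarrow> v \<in> cvec d \<Longrightarrow> \<tau> (p * q) v = \<tau> p (\<tau> q v)"
    "u \<in> cvec d \<Longrightarrow> v \<in> cvec d \<Longrightarrow> cinner d (\<tau> q u) (\<tau> q v) = cinner d u v"
    "v \<in> cvec d \<Longrightarrow> continuous_on Sp1 (\<lambda>g. \<tau> g v i)"
  using assms unfolding unitary_rep_on_def by blast+

lemma sum_unit_cvec:
  assumes "v \<in> cvec d" shows "(\<lambda>i. \<Sum>s<d. v s * unit_cvec s i) = v"
proof
  fix i
  have "(\<Sum>s<d. v s * unit_cvec s i) = (\<Sum>s<d. if s = i then v s else 0)"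
    by (intro sum.cong) (auto simp: unit_cvec_def)
  then show "(\<Sum>s<d. v s * unit_cvec s i) = v i"
    using assms by (simp add: cvec_def)
qed

lemma rep_matrix_act:
  assumes \<tau>: "unitary_rep_on Sp1 d \<tau>" and q: "q \<in> Sp1" and v: "v \<in> cvec d"
  shows "\<tau> q v = mat_act d d (rep_matrix \<tau> q) v"
proof -
  have part: "\<tau> q (\<lambda>i. \<Sum>s<n. v s * unit_cvec s i) = (\<lambda>i. \<Sum>s<n. rep_matrix \<tau> q i s * v s)
      \<and> (\<lambda>i. \<Sum>s<n. v s * unit_cvec s i) \<in> cvec d" if "n \<le> d" for n
    using that
  proof (induction n)
    case 0
    have z: "(\<lambda>i. 0) \<in> cvec d" by (simp add: cvec_def)
    have "\<tau> q (\<lambda>i. 0 * (0::complex)) = (\<lambda>i. 0 * \<tau> q (\<lambda>i. 0) i)" by (rule unitary_rep_D(3)[OF \<tau> q z])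
    then show ?case using z by simp
  next
    case (Suc n)
    have e: "unit_cvec n \<in> cvec d" using Suc by (intro unit_cvec_in_cvec) simp
    then have e': "(\<lambda>i. v n * unit_cvec n i) \<in> cvec d" by (simp add: cvec_def)
    have IH: "\<tau> q (\<lambda>i. \<Sum>s<n. v s * unit_cvec s i) = (\<lambda>i. \<Sum>s<n. rep_matrix \<tau> q i s * v s)"
      "(\<lambda>i. \<Sum>s<n. v s * unit_cvec s i) \<in> cvec d" using Suc by simp_all
    have "\<tau> q (\<lambda>i. (\<Sum>s<n. v s * unit_cvec s i) + v n * unit_cvec n i)
        = (\<lambda>i. \<tau> q (\<lambda>i. \<Sum>s<n. v s * unit_cvec s i) i + \<tau> q (\<lambda>i. v n * unit_cvec n i) i)"
      by (rule unitary_rep_D(2)[OF \<tau> q IH(2) e'])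
    also have "\<tau> q (\<lambda>i. v n * unit_cvec n i) = (\<lambda>i. v n * \<tau> q (unit_cvec n) i)"
      by (rule unitary_rep_D(3)[OF \<tau> q e])
    finally have 1: "\<tau> q (\<lambda>i. \<Sum>s<Suc n. v s * unit_cvec s i) = (\<lambda>i. \<Sum>s<Suc n. rep_matrix \<tau> q i s * v s)"
      by (simp add: IH(1) rep_matrix_def mult.commute)
    have "(\<lambda>i. \<Sum>s<Suc n. v s * unit_cvec s i) \<in> cvec d"
      using IH(2) e' by (simp add: cvec_def)
    with 1 show ?case by simp
  qed
  have "\<tau> q v = (\<lambda>i. \<Sum>s<d. rep_matrix \<tau> q i s * v s)"
    using part[OF order_refl] unfolding sum_unit_cvec[OF v] by simp
  moreover have "\<tau> q v i = 0" if "\<not> i < d" for i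
    using unitary_rep_D(1)[OF \<tau> q v] that by (simp add: cvec_def)
  ultimately show ?thesis by (auto simp: mat_act_def fun_eq_iff)
qed

lemma matrix_rep_rep_matrix:
  assumes \<tau>: "unitary_rep_on Sp1 d \<tau>" shows "matrix_rep d (rep_matrix \<tau>)"
  unfolding matrix_rep_def
proof (intro conjI ballI allI impI)
  fix p q a b assume p: "p \<in> Sp1" "q \<in> Sp1" and ab: "a < d" "b < d"
  have e: "unit_cvec b \<in> cvec d" by (rule unit_cvec_in_cvec[OF ab(2)])
  have "rep_matrix \<tau> (p * q) a b = \<tau> p (\<tau> q (unit_cvec b)) a"
    by (simp add: rep_matrix_def unitary_rep_D(5)[OF \<tau> p(2) p(1) e])
  also have "\<dots> = mat_act d d (rep_matrix \<tau> p) (\<tau> q (unit_cvec b)) a"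
    by (simp add: rep_matrix_act[OF \<tau> p(1) unitary_rep_D(1)[OF \<tau> p(2) e]])
  also have "\<dots> = mat_prod d (rep_matrix \<tau> p) (rep_matrix \<tau> q) a b"
    using ab by (simp add: mat_act_def mat_prod_def) (simp add: rep_matrix_def)
  finally show "rep_matrix \<tau> (p * q) a b = mat_prod d (rep_matrix \<tau> p) (rep_matrix \<tau> q) a b" .
next
  fix a b assume ab: "a < d" "b < d"
  have e: "unit_cvec b \<in> cvec d" by (rule unit_cvec_in_cvec[OF ab(2)])
  show "rep_matrix \<tau> 1 a b = (if a = b then 1 else 0)"
    unfolding rep_matrix_def unitary_rep_D(4)[OF \<tau> one_in_Sp1 e] by (simp add: unit_cvec_def)
  show "continuous_on Sp1 (\<lambda>q. rep_matrix \<tau> q a b)"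
    unfolding rep_matrix_def by (rule unitary_rep_D(7)[OF \<tau> one_in_Sp1 e])
qed

lemma cinner_unit_right: "b < d \<Longrightarrow> cinner d v (unit_cvec b) = v b"
proof -
  assume b: "b < d"
  have "cinner d v (unit_cvec b) = (\<Sum>i<d. if i = b then v i else 0)"
    unfolding cinner_def by (intro sum.cong) (auto simp: unit_cvec_def)
  then show ?thesis using b by simp
qed

lemma cinner_commute: "cinner d u v = cnj (cinner d v u)"
  by (simp add: cinner_def mult.commute)

lemma rep_matrix_conj:
  assumes \<tau>: "unitary_rep_on Sp1 d \<tau>" and q: "q \<in> Sp1" and ab: "a < d" "b < d"
  shows "rep_matrix \<tau> (quat_conj q) a b = cnj (rep_matrix \<tau> q b a)"
proof -
  note e = unit_cvec_in_cvec[OF ab(1)] unit_cvec_in_cvec[OF ab(2)]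
  have qc: "quat_conj q \<in> Sp1" by (rule Sp1_conj[OF q])
  note v = unitary_rep_D(1)[OF \<tau> qc e(2)]
  have "rep_matrix \<tau> (quat_conj q) a b = cinner d (\<tau> (quat_conj q) (unit_cvec b)) (unit_cvec a)"
    by (simp add: rep_matrix_def cinner_unit_right[OF ab(1)])
  also have "\<dots> = cinner d (\<tau> q (\<tau> (quat_conj q) (unit_cvec b))) (\<tau> q (unit_cvec a))"
    by (rule unitary_rep_D(6)[OF \<tau> q v e(1), symmetric])
  also have "\<tau> q (\<tau> (quat_conj q) (unit_cvec b)) = unit_cvec b"
    using unitary_rep_D(5)[OF \<tau> qc q e(2)] unitary_rep_D(4)[OF \<tau> one_in_Sp1 e(2)] Sp1_conj_cancel(1)[OF q] by simp
  also have "cinner d (unit_cvec b) (\<tau> q (unit_cvec a)) = cnj (rep_matrix \<tau> q b a)"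
    by (subst cinner_commute) (simp add: cinner_unit_right[OF ab(2)] rep_matrix_def)
  finally show ?thesis .
qed

lemma rep_matrix_column_norm:
  assumes \<tau>: "unitary_rep_on Sp1 d \<tau>" and q: "q \<in> Sp1" and a: "a < d"
  shows "(\<Sum>i<d. (cmod (rep_matrix \<tau> q i a))\<^sup>2) = 1"
proof -
  note e = unit_cvec_in_cvec[OF a]
  have "complex_of_real (\<Sum>i<d. (cmod (rep_matrix \<tau> q i a))\<^sup>2) = (\<Sum>i<d. complex_of_real ((cmod (rep_matrix \<tau> q i a))\<^sup>2))"
    by (rule of_real_sum)
  also have "\<dots> = cinner d (\<tau> q (unit_cvec a)) (\<tau> q (unit_cvec a))"
    unfolding cinner_def rep_matrix_def by (intro sum.cong refl complex_norm_square)
  also have "\<dots> = cinner d (unit_cvec a) (unit_cvec a)" by (rule unitary_rep_D(6)[OF \<tau> q e e])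
  also have "\<dots> = unit_cvec a a" by (rule cinner_unit_right[OF a])
  also have "\<dots> = complex_of_real 1" by (simp add: unit_cvec_def)
  finally show ?thesis by (simp only: of_real_eq_iff)
qed

lemma irreducible_rep_matrix:
  assumes "irreducible_unitary_rep_on Sp1 d \<tau>"
  shows "irreducible_matrix_rep d (rep_matrix \<tau>)"
  unfolding irreducible_matrix_rep_def
proof (intro conjI allI impI)
  have \<tau>: "unitary_rep_on Sp1 d \<tau>" using assms by (simp add: irreducible_unitary_rep_on_def)
  show "matrix_rep d (rep_matrix \<tau>)" by (rule matrix_rep_rep_matrix[OF \<tau>])
  fix W assume W: "cvec_subspace d W \<and> (\<forall>q\<in>Sp1. \<forall>v\<in>W. mat_act d d (rep_matrix \<tau> q) v \<in> W)"
  have "\<tau> q v \<in> W" if q: "q \<in> Sp1" and v: "v \<in> W" for q v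
  proof -
    have "v \<in> cvec d" using cvec_subspace_D(1)[OF conjunct1[OF W]] v by (rule subsetD)
    then have "\<tau> q v = mat_act d d (rep_matrix \<tau> q) v" by (rule rep_matrix_act[OF \<tau> q])
    then show ?thesis using conjunct2[OF W] q v by simp
  qed
  then show "W = {\<lambda>i. 0} \<or> W = cvec d"
    using assms conjunct1[OF W] unfolding irreducible_unitary_rep_on_def by simp
qed

context unit_quaternion_haar
begin

text \<open>
  If no average against a form representation were nonzero, every entry of \<open>\<tau>\<close> would be orthogonal
  to all polynomials, hence zero; but the rows of \<open>\<tau> q\<close> have length \<open>1\<close>.
\<close>

lemma average_form_nonzero:
  assumes \<tau>: "unitary_rep_on Sp1 d \<tau>" and d: "0 < d"
  shows "\<exists>j r s b a. r \<le> j \<and> s \<le> j \<and> b < d \<and> a < d \<and>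
    (\<integral>q. form_coeff j (quat_conj q) r s * rep_matrix \<tau> q b a \<partial>\<sigma>) \<noteq> 0"
proof (rule ccontr)
  assume neg: "\<not> ?thesis"
  note R = matrix_rep_rep_matrix[OF \<tau>]
  have ort: "(\<integral>q. g (quat_conj q) * rep_matrix \<tau> q b a \<partial>\<sigma>) = 0 \<and> integrable \<sigma> (\<lambda>q. g (quat_conj q) * rep_matrix \<tau> q b a)"
    if "g \<in> coef_span" "a < d" "b < d" for g a b
    using that
  proof (induction rule: coef_span.induct)
    case zero
    show ?case by simp
  next
    case (add f g)
    then show ?case by (simp add: distrib_right)
  next
    case (coef r j s c)
    have "continuous_on Sp1 (\<lambda>q. form_coeff j (quat_conj q) r s)"
      by (rule continuous_conj[OF continuous_on_form_coeff])
    then have "integrable \<sigma> (\<lambda>q. form_coeff j (quat_conj q) r s * rep_matrix \<tau> q b a)"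
      by (intro integrable_continuous continuous_intros matrix_rep_continuous[OF R] coef)
    moreover have "(\<integral>q. form_coeff j (quat_conj q) r s * rep_matrix \<tau> q b a \<partial>\<sigma>) = 0"
      using neg coef by blast
    ultimately show ?case by (simp add: mult.assoc)
  next
    case (cong f g)
    have eq: "g (quat_conj q) * rep_matrix \<tau> q b a = f (quat_conj q) * rep_matrix \<tau> q b a" if "q \<in> space \<sigma>" for q
      using cong(2)[OF Sp1_conj] that by (simp add: space_eq)
    have "(\<integral>q. g (quat_conj q) * rep_matrix \<tau> q b a \<partial>\<sigma>) = (\<integral>q. f (quat_conj q) * rep_matrix \<tau> q b a \<partial>\<sigma>)"
      by (rule Bochner_Integration.integral_cong[OF refl eq])
    moreover have "integrable \<sigma> (\<lambda>q. g (quat_conj q) * rep_matrix \<tau> q b a)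
        \<longleftrightarrow> integrable \<sigma> (\<lambda>q. f (quat_conj q) * rep_matrix \<tau> q b a)"
      by (rule Bochner_Integration.integrable_cong[OF refl eq])
    ultimately show ?case using cong(3)[OF cong(4,5)] by simp
  qed
  have "(\<integral>q. (cmod (rep_matrix \<tau> q b a))\<^sup>2 \<partial>\<sigma>) = 0" if ab: "a < d" "b < d" for a b
  proof -
    let ?f = "\<lambda>q. rep_matrix \<tau> q b a"
    have cf: "continuous_on Sp1 ?f" by (rule matrix_rep_continuous[OF R ab(2,1)])
    have le1: "cmod (?f q) \<le> 1" if q: "q \<in> Sp1" for q
    proof -
      have "(\<Sum>i<d. (cmod (rep_matrix \<tau> q i a))\<^sup>2) = 1" by (rule rep_matrix_column_norm[OF \<tau> q ab(1)])
      moreover have "(cmod (?f q))\<^sup>2 \<le> (\<Sum>i<d. (cmod (rep_matrix \<tau> q i a))\<^sup>2)"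
        by (rule member_le_sum) (use ab in auto)
      ultimately have "(cmod (?f q))\<^sup>2 \<le> 1\<^sup>2" by simp
      then show ?thesis by (rule power2_le_imp_le) simp
    qed
    have "(\<integral>q. (cmod (?f q))\<^sup>2 \<partial>\<sigma>) \<le> \<epsilon>" if e: "\<epsilon> > 0" for \<epsilon>
    proof -
      have "continuous_on Sp1 (\<lambda>q. cnj (rep_matrix \<tau> (quat_conj q) b a))"
        using continuous_conj[OF cf] by (rule continuous_on_cnj)
      then obtain g where g: "g \<in> coef_span" "\<And>q. q \<in> Sp1 \<Longrightarrow> cmod (cnj (rep_matrix \<tau> (quat_conj q) b a) - g q) < \<epsilon>"
        by (rule coef_span_dense[OF _ e]) (rule that)
      have g': "cmod (cnj (?f q) - g (quat_conj q)) \<le> \<epsilon>" if "q \<in> Sp1" for q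
        using g(2)[OF Sp1_conj[OF that]] by simp
      have int: "integrable \<sigma> (\<lambda>q. cnj (?f q) * ?f q)"
        by (intro integrable_continuous continuous_intros cf)
      have "cnj (?f q) * ?f q = of_real ((cmod (?f q))\<^sup>2)" for q
        by (simp add: complex_norm_square mult.commute del: of_real_power)
      then have "of_real (\<integral>q. (cmod (?f q))\<^sup>2 \<partial>\<sigma>) = (\<integral>q. cnj (?f q) * ?f q \<partial>\<sigma>)"
        by (simp only: integral_complex_of_real)
      also have "\<dots> = (\<integral>q. cnj (?f q) * ?f q - g (quat_conj q) * ?f q \<partial>\<sigma>)"
        using ort[OF g(1) ab] int by simp
      finally have eq: "of_real (\<integral>q. (cmod (?f q))\<^sup>2 \<partial>\<sigma>) = (\<integral>q. (cnj (?f q) - g (quat_conj q)) * ?f q \<partial>\<sigma>)"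
        by (simp add: left_diff_distrib)
      have "(\<integral>q. (cmod (?f q))\<^sup>2 \<partial>\<sigma>) \<le> cmod (of_real (\<integral>q. (cmod (?f q))\<^sup>2 \<partial>\<sigma>))" by simp
      also have "\<dots> \<le> (\<integral>q. cmod ((cnj (?f q) - g (quat_conj q)) * ?f q) \<partial>\<sigma>)"
        unfolding eq by (rule integral_norm_bound)
      also have "\<dots> \<le> (\<integral>q. \<epsilon> \<partial>\<sigma>)"
      proof (rule integral_mono)
        show "integrable \<sigma> (\<lambda>q. cmod ((cnj (?f q) - g (quat_conj q)) * ?f q))"
          using ort[OF g(1) ab] int by (intro integrable_norm) (simp add: left_diff_distrib)
        fix q assume "q \<in> space \<sigma>"
        then have "q \<in> Sp1" by (simp add: space_eq)
        then have "cmod (cnj (?f q) - g (quat_conj q)) * cmod (?f q) \<le> \<epsilon> * 1"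
          using e by (intro mult_mono g' le1) auto
        then show "cmod ((cnj (?f q) - g (quat_conj q)) * ?f q) \<le> \<epsilon>" by (simp add: norm_mult)
      qed simp
      finally show ?thesis by (simp add: prob_space)
    qed
    then have "(\<integral>q. (cmod (?f q))\<^sup>2 \<partial>\<sigma>) \<le> 0" by (rule field_le_epsilon[of _ 0, simplified])
    moreover have "(\<integral>q. (cmod (?f q))\<^sup>2 \<partial>\<sigma>) \<ge> 0" by simp
    ultimately show ?thesis by (rule order_antisym)
  qed
  note z = this
  have int: "integrable \<sigma> (\<lambda>q. (cmod (rep_matrix \<tau> q b 0))\<^sup>2)" if "b < d" for b
  proof -
    have "integrable \<sigma> (\<lambda>q. cmod (rep_matrix \<tau> q b 0 * rep_matrix \<tau> q b 0))"
      using that d by (intro integrable_norm integrable_continuous continuous_intros matrix_rep_continuous[OF R])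
    then show ?thesis by (simp add: norm_mult power2_eq_square)
  qed
  have "1 = (\<integral>q. (\<Sum>b<d. (cmod (rep_matrix \<tau> q b 0))\<^sup>2) \<partial>\<sigma>)"
  proof -
    have "(\<Sum>b<d. (cmod (rep_matrix \<tau> q b 0))\<^sup>2) = 1" if q: "q \<in> Sp1" for q
      by (rule rep_matrix_column_norm[OF \<tau> q d])
    then have "(\<integral>q. (\<Sum>b<d. (cmod (rep_matrix \<tau> q b 0))\<^sup>2) \<partial>\<sigma>) = (\<integral>q. 1 \<partial>\<sigma>)"
      by (intro Bochner_Integration.integral_cong refl) (simp add: space_eq)
    then show ?thesis by (simp add: prob_space)
  qed
  also have "\<dots> = (\<Sum>b<d. \<integral>q. (cmod (rep_matrix \<tau> q b 0))\<^sup>2 \<partial>\<sigma>)"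
    by (rule Bochner_Integration.integral_sum) (use int in auto)
  also have "\<dots> = 0" using z d by simp
  finally show False by simp
qed

text \<open>
  Some averaged matrix unit is a nonzero intertwiner to the forms of some degree, hence
  invertible; the dimension leaves only the degree \<open>j\<close>.
\<close>

lemma rep_equivalent_form:
  assumes \<tau>: "irreducible_unitary_rep_on Sp1 (Suc j) \<tau>"
  obtains X Y where "intertwines (Suc j) (rep_matrix \<tau>) (Suc j) (form_coeff j) X" "mutually_inverse (Suc j) X Y"
proof -
  have u: "unitary_rep_on Sp1 (Suc j) \<tau>" using \<tau> by (simp add: irreducible_unitary_rep_on_def)
  obtain i r s b a where i: "r \<le> i" "s \<le> i" "b < Suc j" "a < Suc j"
    and nz: "(\<integral>q. form_coeff i (quat_conj q) r s * rep_matrix \<tau> q b a \<partial>\<sigma>) \<noteq> 0"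
    using average_form_nonzero[OF u zero_less_Suc] by (elim exE conjE) (rule that)
  define X where "X = (\<lambda>r a. \<integral>q. form_coeff i (quat_conj q) r s * rep_matrix \<tau> q b a \<partial>\<sigma>)"
  have X: "intertwines (Suc j) (rep_matrix \<tau>) (Suc i) (form_coeff i) X"
    unfolding X_def using i by (intro average_intertwines matrix_rep_rep_matrix[OF u] matrix_rep_form) auto
  have nz': "r < Suc i" "a < Suc j" "X r a \<noteq> 0" using i nz by (simp_all add: X_def)
  note inv = intertwiner_invertible[OF irreducible_rep_matrix[OF \<tau>] irreducible_form X nz']
  have "i = j" using inv(1) by simp
  obtain Y where "mutually_inverse (Suc j) X Y" using inv(2) ..
  with X show thesis unfolding \<open>i = j\<close> by (rule that)
qed

text \<open>The orthogonality relations of Schur.\<close>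

lemma schur_orthogonality_neq:
  assumes \<tau>: "irreducible_unitary_rep_on Sp1 d \<tau>" and \<tau>': "irreducible_unitary_rep_on Sp1 d' \<tau>'" and dd: "d \<noteq> d'"
    and ab: "a < d" "b < d" "r < d'" "s < d'"
  shows "(\<integral>q. rep_matrix \<tau> q b a * cnj (rep_matrix \<tau>' q s r) \<partial>\<sigma>) = 0"
proof -
  have u: "unitary_rep_on Sp1 d \<tau>" "unitary_rep_on Sp1 d' \<tau>'" using \<tau> \<tau>' by (simp_all add: irreducible_unitary_rep_on_def)
  have X: "intertwines d (rep_matrix \<tau>) d' (rep_matrix \<tau>') (\<lambda>r a. \<integral>q. rep_matrix \<tau>' (quat_conj q) r s * rep_matrix \<tau> q b a \<partial>\<sigma>)"
    using ab by (intro average_intertwines matrix_rep_rep_matrix u)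
  have "(\<integral>q. rep_matrix \<tau>' (quat_conj q) r s * rep_matrix \<tau> q b a \<partial>\<sigma>) = 0"
  proof (rule ccontr)
    assume "(\<integral>q. rep_matrix \<tau>' (quat_conj q) r s * rep_matrix \<tau> q b a \<partial>\<sigma>) \<noteq> 0"
    from intertwiner_invertible(1)[OF irreducible_rep_matrix[OF \<tau>] irreducible_rep_matrix[OF \<tau>'] X ab(3,1) this]
    show False using dd by contradiction
  qed
  moreover have "(\<integral>q. rep_matrix \<tau> q b a * cnj (rep_matrix \<tau>' q s r) \<partial>\<sigma>) = (\<integral>q. rep_matrix \<tau>' (quat_conj q) r s * rep_matrix \<tau> q b a \<partial>\<sigma>)"
    by (intro Bochner_Integration.integral_cong refl) (simp add: space_eq rep_matrix_conj[OF u(2)] ab)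
  ultimately show ?thesis by simp
qed

lemma schur_orthogonality_eq:
  assumes \<tau>: "irreducible_unitary_rep_on Sp1 (Suc j) \<tau>" and ab: "a \<le> j" "b \<le> j" "r \<le> j" "s \<le> j"
  shows "(\<integral>q. rep_matrix \<tau> q b a * cnj (rep_matrix \<tau> q s r) \<partial>\<sigma>) = (if a = r \<and> b = s then 1 / of_nat (Suc j) else 0)"
proof -
  let ?R = "rep_matrix \<tau>" let ?d = "Suc j"
  have u: "unitary_rep_on Sp1 ?d \<tau>" using \<tau> by (simp add: irreducible_unitary_rep_on_def)
  note R = matrix_rep_rep_matrix[OF u]
  define T where "T = (\<lambda>r a. \<integral>q. ?R (quat_conj q) r s * ?R q b a \<partial>\<sigma>)"
  have T: "intertwines ?d ?R ?d ?R T"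
    unfolding T_def using ab by (intro average_intertwines R) auto
  obtain X Y where X: "intertwines ?d ?R ?d (form_coeff j) X" and XY: "mutually_inverse ?d X Y"
    by (rule rep_equivalent_form[OF \<tau>]) (rule that)
  have Y: "intertwines ?d (form_coeff j) ?d ?R Y" by (rule intertwines_inverse[OF X XY])
  define Z where "Z = mat_prod ?d X (mat_prod ?d T Y)"
  have Z: "intertwines ?d (form_coeff j) ?d (form_coeff j) Z"
    unfolding Z_def by (rule intertwines_comp[OF intertwines_comp[OF Y T] X])
  have Zs: "Z r s = (if r = s then Z 0 0 else 0)" if "r < ?d" "s < ?d" for r s
    by (rule form_commutant_scalar[OF Z]) (use that in simp_all)
  define c where "c = Z 0 0"
  have XT: "mat_prod ?d X T r a = c * X r a" if "r < ?d" "a < ?d" for r a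
  proof -
    have "mat_prod ?d X T r a = mat_prod ?d (mat_prod ?d X T) (mat_prod ?d Y X) r a"
      by (rule mat_prod_one_right[symmetric]) (use XY that in \<open>simp_all add: mutually_inverse_def\<close>)
    also have "\<dots> = mat_prod ?d (mat_prod ?d (mat_prod ?d X T) Y) X r a" by (rule mat_prod_assoc)
    also have "\<dots> = mat_prod ?d Z X r a"
      by (rule mat_prod_cong) (simp_all add: Z_def mat_prod_assoc)
    also have "\<dots> = (\<Sum>k<?d. if k = r then c * X r a else 0)"
      unfolding mat_prod_def[of _ Z]
    proof (rule sum.cong[OF refl])
      fix k assume "k \<in> {..<?d}"
      then have "k < ?d" by simp
      then have "Z r k = (if r = k then c else 0)" unfolding c_def by (rule Zs[OF that(1)])
      then show "Z r k * X k a = (if k = r then c * X r a else 0)" by simp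
    qed
    also have "\<dots> = c * X r a" using that by (simp del: sum.lessThan_Suc)
    finally show ?thesis .
  qed
  have Ts: "T r a = (if r = a then c else 0)" if ra: "r < ?d" "a < ?d" for r a
  proof -
    have "T r a = mat_prod ?d (mat_prod ?d Y X) T r a"
      by (rule mat_prod_one_left[symmetric]) (use XY ra in \<open>simp_all add: mutually_inverse_def\<close>)
    also have "\<dots> = mat_prod ?d Y (mat_prod ?d X T) r a" by (rule mat_prod_assoc[symmetric])
    also have "\<dots> = mat_prod ?d Y (\<lambda>i j. c * X i j) r a"
      by (rule mat_prod_cong[OF refl]) (rule XT[OF _ ra(2)])
    also have "\<dots> = c * mat_prod ?d Y X r a"
      by (simp add: mat_prod_def sum_distrib_left mult.left_commute del: sum.lessThan_Suc)
    also have "\<dots> = (if r = a then c else 0)" using XY ra by (simp add: mutually_inverse_def)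
    finally show ?thesis .
  qed
  have "of_nat ?d * c = (\<Sum>k<?d. T k k)" using Ts by (simp del: sum.lessThan_Suc)
  also have "\<dots> = (\<integral>q. (\<Sum>k<?d. ?R (quat_conj q) k s * ?R q b k) \<partial>\<sigma>)"
    unfolding T_def
  proof (rule Bochner_Integration.integral_sum[symmetric])
    fix k assume "k \<in> {..<?d}"
    then show "integrable \<sigma> (\<lambda>q. ?R (quat_conj q) k s * ?R q b k)"
      using ab by (intro integrable_continuous continuous_intros continuous_conj[of "\<lambda>q. ?R q k s"] matrix_rep_continuous[OF R]) auto
  qed
  also have "\<dots> = (\<integral>q. (if b = s then 1 else 0) \<partial>\<sigma>)"
  proof (rule Bochner_Integration.integral_cong[OF refl])
    fix q assume "q \<in> space \<sigma>"
    then have q: "q \<in> Sp1" by (simp add: space_eq)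
    have "?R (q * quat_conj q) b s = mat_prod ?d (?R q) (?R (quat_conj q)) b s"
      using R q Sp1_conj[OF q] ab unfolding matrix_rep_def by simp
    moreover have "?R 1 b s = (if b = s then 1 else 0)" using R ab unfolding matrix_rep_def by simp
    ultimately show "(\<Sum>k<?d. ?R (quat_conj q) k s * ?R q b k) = (if b = s then 1 else 0)"
      unfolding Sp1_conj_cancel(1)[OF q] by (simp add: mat_prod_def mult.commute del: sum.lessThan_Suc)
  qed
  also have "\<dots> = (if b = s then 1 else 0)" by (simp add: prob_space)
  finally have dc: "of_nat ?d * c = (if b = s then 1 else 0)" .
  have "of_nat ?d \<noteq> (0::complex)" unfolding of_nat_eq_0_iff by (rule Suc_not_Zero)
  then have "c = (of_nat ?d * c) / of_nat ?d" by (rule nonzero_mult_div_cancel_left[symmetric])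
  then have c: "c = (if b = s then 1 else 0) / of_nat ?d" unfolding dc .
  have "(\<integral>q. ?R q b a * cnj (?R q s r) \<partial>\<sigma>) = T r a"
    unfolding T_def
  proof (rule Bochner_Integration.integral_cong[OF refl])
    fix q assume "q \<in> space \<sigma>"
    then have "?R (quat_conj q) r s = cnj (?R q s r)"
      using ab by (intro rep_matrix_conj[OF u]) (auto simp: space_eq)
    then show "?R q b a * cnj (?R q s r) = ?R (quat_conj q) r s * ?R q b a"
      by (simp only: mult.commute)
  qed
  also have "\<dots> = (if r = a then c else 0)" by (rule Ts) (use ab in auto)
  also have "\<dots> = (if a = r \<and> b = s then 1 / of_nat ?d else 0)"
    by (cases "a = r"; cases "b = s") (simp_all del: of_nat_Suc add: c)
  finally show ?thesis .
qed

end

section \<open>Square integrable functions\<close>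

definition L2 :: "'a measure \<Rightarrow> ('a \<Rightarrow> complex) \<Rightarrow> bool" where
  "L2 M f \<longleftrightarrow> f \<in> borel_measurable M \<and> integrable M (\<lambda>x. (cmod (f x))\<^sup>2)"

abbreviation sqnorm :: "'a measure \<Rightarrow> ('a \<Rightarrow> complex) \<Rightarrow> real" where
  "sqnorm M f \<equiv> (\<integral>x. (cmod (f x))\<^sup>2 \<partial>M)"

abbreviation l2_inner :: "'a measure \<Rightarrow> ('a \<Rightarrow> complex) \<Rightarrow> ('a \<Rightarrow> complex) \<Rightarrow> complex" where
  "l2_inner M f g \<equiv> (\<integral>x. f x * cnj (g x) \<partial>M)"

lemma cmod_add_square_le: "(cmod (a + b))\<^sup>2 \<le> 2 * (cmod a)\<^sup>2 + 2 * (cmod b)\<^sup>2"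
proof -
  have "(cmod (a + b))\<^sup>2 \<le> (cmod a + cmod b)\<^sup>2" by (intro power_mono norm_triangle_ineq) simp
  also have "\<dots> \<le> (cmod a + cmod b)\<^sup>2 + (cmod a - cmod b)\<^sup>2" by simp
  also have "\<dots> = 2 * (cmod a)\<^sup>2 + 2 * (cmod b)\<^sup>2" by (simp add: power2_eq_square algebra_simps)
  finally show ?thesis .
qed

lemma L2_measurable: "L2 M f \<Longrightarrow> f \<in> borel_measurable M" by (simp add: L2_def)
lemma L2_integrable: "L2 M f \<Longrightarrow> integrable M (\<lambda>x. (cmod (f x))\<^sup>2)" by (simp add: L2_def)

lemma L2_scale: "L2 M f \<Longrightarrow> L2 M (\<lambda>x. c * f x)"
  unfolding L2_def by (auto simp: norm_mult power_mult_distrib intro!: borel_measurable_times)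

lemma L2_add:
  assumes "L2 M f" "L2 M g" shows "L2 M (\<lambda>x. f x + g x)"
  unfolding L2_def
proof
  have m: "f \<in> borel_measurable M" "g \<in> borel_measurable M" using assms by (simp_all add: L2_def)
  show a: "(\<lambda>x. f x + g x) \<in> borel_measurable M" by (rule borel_measurable_add[OF m])
  show "integrable M (\<lambda>x. (cmod (f x + g x))\<^sup>2)"
  proof (rule Bochner_Integration.integrable_bound)
    show "integrable M (\<lambda>x. 2 * (cmod (f x))\<^sup>2 + 2 * (cmod (g x))\<^sup>2)"
      by (intro Bochner_Integration.integrable_add integrable_mult_right L2_integrable assms)
    show "(\<lambda>x. (cmod (f x + g x))\<^sup>2) \<in> borel_measurable M" using a by measurable
    show "AE x in M. norm ((cmod (f x + g x))\<^sup>2) \<le> norm (2 * (cmod (f x))\<^sup>2 + 2 * (cmod (g x))\<^sup>2)"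
    proof (rule AE_I2)
      fix x
      have "norm ((cmod (f x + g x))\<^sup>2) = (cmod (f x + g x))\<^sup>2" by simp
      also have "\<dots> \<le> 2 * (cmod (f x))\<^sup>2 + 2 * (cmod (g x))\<^sup>2" by (rule cmod_add_square_le)
      finally show "norm ((cmod (f x + g x))\<^sup>2) \<le> norm (2 * (cmod (f x))\<^sup>2 + 2 * (cmod (g x))\<^sup>2)" by simp
    qed
  qed
qed

lemma L2_zero: "L2 M (\<lambda>x. 0)" by (simp add: L2_def)

lemma L2_diff: "L2 M f \<Longrightarrow> L2 M g \<Longrightarrow> L2 M (\<lambda>x. f x - g x)"
  using L2_add[of M f "\<lambda>x. - 1 * g x"] L2_scale[of M g "- 1"] by simp

lemma L2_sum: "(\<And>i. i \<in> I \<Longrightarrow> L2 M (f i)) \<Longrightarrow> L2 M (\<lambda>x. \<Sum>i\<in>I. f i x)"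
proof (induction I rule: infinite_finite_induct)
  case (insert i I)
  then show ?case using L2_add[of M "f i" "\<lambda>x. \<Sum>i\<in>I. f i x"] by simp
qed (simp_all add: L2_zero)

lemma L2_cnj: "L2 M f \<Longrightarrow> L2 M (\<lambda>x. cnj (f x))"
  unfolding L2_def by (auto intro: borel_measurable_continuous_on[OF continuous_on_cnj[OF continuous_on_id]])

lemma L2_mult_integrable:
  assumes "L2 M f" "L2 M g" shows "integrable M (\<lambda>x. f x * cnj (g x))"
proof (rule Bochner_Integration.integrable_bound)
  show "integrable M (\<lambda>x. (cmod (f x))\<^sup>2 + (cmod (g x))\<^sup>2)"
    by (intro Bochner_Integration.integrable_add L2_integrable assms)
  show "(\<lambda>x. f x * cnj (g x)) \<in> borel_measurable M"
    by (intro borel_measurable_times L2_measurable assms L2_cnj)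
  show "AE x in M. norm (f x * cnj (g x)) \<le> norm ((cmod (f x))\<^sup>2 + (cmod (g x))\<^sup>2)"
  proof (rule AE_I2)
    fix x
    have "0 \<le> (cmod (f x) - cmod (g x))\<^sup>2 + (cmod (f x))\<^sup>2 + (cmod (g x))\<^sup>2" by simp
    then have "2 * (cmod (f x) * cmod (g x)) \<le> 2 * ((cmod (f x))\<^sup>2 + (cmod (g x))\<^sup>2)"
      by (simp add: power2_eq_square algebra_simps)
    then show "norm (f x * cnj (g x)) \<le> norm ((cmod (f x))\<^sup>2 + (cmod (g x))\<^sup>2)" by (simp add: norm_mult)
  qed
qed

lemma l2_inner_self: "l2_inner M f f = of_real (sqnorm M f)"
proof -
  have "f x * cnj (f x) = of_real ((cmod (f x))\<^sup>2)" for x by (rule complex_norm_square[symmetric])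
  then show ?thesis by (simp only: integral_complex_of_real)
qed

lemma l2_inner_cnj: "cnj (l2_inner M f g) = l2_inner M g f"
proof -
  have "cnj (l2_inner M f g) = (\<integral>x. cnj (f x * cnj (g x)) \<partial>M)" by (rule Bochner_Integration.integral_cnj[symmetric])
  also have "\<dots> = l2_inner M g f" by (simp only: complex_cnj_mult complex_cnj_cnj mult.commute)
  finally show ?thesis .
qed

lemma l2_inner_sum_left:
  assumes "\<And>i. i \<in> I \<Longrightarrow> L2 M (f i)" "L2 M g"
  shows "l2_inner M (\<lambda>x. \<Sum>i\<in>I. c i * f i x) g = (\<Sum>i\<in>I. c i * l2_inner M (f i) g)"
proof -
  have "l2_inner M (\<lambda>x. \<Sum>i\<in>I. c i * f i x) g = (\<integral>x. (\<Sum>i\<in>I. c i * (f i x * cnj (g x))) \<partial>M)"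
    by (simp only: sum_distrib_right mult.assoc)
  also have "\<dots> = (\<Sum>i\<in>I. (\<integral>x. c i * (f i x * cnj (g x)) \<partial>M))"
    by (rule Bochner_Integration.integral_sum) (intro integrable_mult_right L2_mult_integrable assms)
  finally show ?thesis by simp
qed

lemma l2_inner_diff:
  assumes "L2 M f" "L2 M g" "L2 M h"
  shows "l2_inner M (\<lambda>x. f x - g x) h = l2_inner M f h - l2_inner M g h"
  using Bochner_Integration.integral_diff[OF L2_mult_integrable[OF assms(1,3)] L2_mult_integrable[OF assms(2,3)]]
  by (simp only: left_diff_distrib)

text \<open>
  For a finite orthonormal family, the distance of \<open>\<phi>\<close> to a combination is least for the Fourier
  coefficients.
\<close>

lemma best_approximation:
  assumes I: "finite I" and \<Psi>: "\<And>i. i \<in> I \<Longrightarrow> L2 M (\<Psi> i)" and \<phi>: "L2 M \<phi>"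
    and on: "\<And>i j. i \<in> I \<Longrightarrow> j \<in> I \<Longrightarrow> l2_inner M (\<Psi> i) (\<Psi> j) = (if i = j then 1 else 0)"
  shows "sqnorm M (\<lambda>x. \<phi> x - (\<Sum>i\<in>I. c i * \<Psi> i x)) =
    sqnorm M \<phi> - (\<Sum>i\<in>I. (cmod (l2_inner M \<phi> (\<Psi> i)))\<^sup>2) + (\<Sum>i\<in>I. (cmod (c i - l2_inner M \<phi> (\<Psi> i)))\<^sup>2)"
proof -
  let ?S = "\<lambda>x. \<Sum>i\<in>I. c i * \<Psi> i x"
  let ?a = "\<lambda>i. l2_inner M \<phi> (\<Psi> i)"
  have S: "L2 M ?S" by (intro L2_sum L2_scale \<Psi>)
  have D: "L2 M (\<lambda>x. \<phi> x - ?S x)" by (rule L2_diff[OF \<phi> S])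
  have S\<phi>: "l2_inner M ?S \<phi> = (\<Sum>i\<in>I. c i * cnj (?a i))"
    by (subst l2_inner_sum_left[OF \<Psi> \<phi>]) (simp_all only: l2_inner_cnj)
  have \<phi>S: "l2_inner M \<phi> ?S = (\<Sum>i\<in>I. cnj (c i) * ?a i)"
    by (subst l2_inner_cnj[symmetric]) (simp add: S\<phi>)
  have \<Psi>S: "l2_inner M (\<Psi> i) ?S = cnj (c i)" if i: "i \<in> I" for i
  proof -
    have "l2_inner M ?S (\<Psi> i) = (\<Sum>j\<in>I. c j * l2_inner M (\<Psi> j) (\<Psi> i))"
      by (rule l2_inner_sum_left[OF \<Psi> \<Psi>[OF i]])
    also have "\<dots> = (\<Sum>j\<in>I. if j = i then c i else 0)"
      by (rule sum.cong[OF refl]) (use on i in auto)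
    also have "\<dots> = c i" using I i by simp
    finally have "cnj (l2_inner M ?S (\<Psi> i)) = cnj (c i)" by (rule arg_cong)
    then show ?thesis by (simp only: l2_inner_cnj)
  qed
  have SS: "l2_inner M ?S ?S = (\<Sum>i\<in>I. c i * cnj (c i))"
  proof -
    have "l2_inner M ?S ?S = (\<Sum>i\<in>I. c i * l2_inner M (\<Psi> i) ?S)" by (rule l2_inner_sum_left[OF \<Psi> S])
    also have "\<dots> = (\<Sum>i\<in>I. c i * cnj (c i))" by (rule sum.cong[OF refl]) (simp only: \<Psi>S)
    finally show ?thesis .
  qed
  have "of_real (sqnorm M (\<lambda>x. \<phi> x - ?S x)) = l2_inner M (\<lambda>x. \<phi> x - ?S x) (\<lambda>x. \<phi> x - ?S x)"
    by (rule l2_inner_self[symmetric])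
  also have "\<dots> = l2_inner M \<phi> (\<lambda>x. \<phi> x - ?S x) - l2_inner M ?S (\<lambda>x. \<phi> x - ?S x)"
    by (rule l2_inner_diff[OF \<phi> S D])
  also have "l2_inner M \<phi> (\<lambda>x. \<phi> x - ?S x) = cnj (l2_inner M (\<lambda>x. \<phi> x - ?S x) \<phi>)"
    by (rule l2_inner_cnj[symmetric])
  also have "l2_inner M (\<lambda>x. \<phi> x - ?S x) \<phi> = l2_inner M \<phi> \<phi> - l2_inner M ?S \<phi>"
    by (rule l2_inner_diff[OF \<phi> S \<phi>])
  also have "l2_inner M ?S (\<lambda>x. \<phi> x - ?S x) = cnj (l2_inner M (\<lambda>x. \<phi> x - ?S x) ?S)"
    by (rule l2_inner_cnj[symmetric])
  also have "l2_inner M (\<lambda>x. \<phi> x - ?S x) ?S = l2_inner M \<phi> ?S - l2_inner M ?S ?S"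
    by (rule l2_inner_diff[OF \<phi> S S])
  also have "cnj (l2_inner M \<phi> \<phi> - l2_inner M ?S \<phi>) - cnj (l2_inner M \<phi> ?S - l2_inner M ?S ?S)
      = of_real (sqnorm M \<phi>) - (\<Sum>i\<in>I. cnj (c i) * ?a i) - (\<Sum>i\<in>I. c i * cnj (?a i)) + (\<Sum>i\<in>I. c i * cnj (c i))"
    unfolding S\<phi> \<phi>S SS unfolding l2_inner_self by (simp add: mult.commute)
  also have "\<dots> = of_real (sqnorm M \<phi>) - (\<Sum>i\<in>I. ?a i * cnj (?a i)) + (\<Sum>i\<in>I. (c i - ?a i) * cnj (c i - ?a i))"
  proof -
    have "(\<Sum>i\<in>I. (c i - ?a i) * cnj (c i - ?a i)) =
        (\<Sum>i\<in>I. c i * cnj (c i)) - (\<Sum>i\<in>I. c i * cnj (?a i)) - (\<Sum>i\<in>I. cnj (c i) * ?a i) + (\<Sum>i\<in>I. ?a i * cnj (?a i))"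
      unfolding sum_subtractf[symmetric] sum.distrib[symmetric]
      by (rule sum.cong[OF refl]) (simp add: left_diff_distrib right_diff_distrib mult.commute)
    then show ?thesis by simp
  qed
  also have "\<dots> = of_real (sqnorm M \<phi> - (\<Sum>i\<in>I. (cmod (?a i))\<^sup>2) + (\<Sum>i\<in>I. (cmod (c i - ?a i))\<^sup>2))"
    by (simp only: of_real_add of_real_diff of_real_sum complex_norm_square)
  finally show ?thesis by (simp only: of_real_eq_iff)
qed

lemma parseval_limit:
  assumes I: "\<And>N. finite (I N)" "incseq I" and \<Psi>: "\<And>N i. i \<in> I N \<Longrightarrow> L2 M (\<Psi> i)" and \<phi>: "L2 M \<phi>"
    and on: "\<And>N i j. i \<in> I N \<Longrightarrow> j \<in> I N \<Longrightarrow> l2_inner M (\<Psi> i) (\<Psi> j) = (if i = j then 1 else 0)"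
    and dense: "\<And>\<epsilon>. \<epsilon> > 0 \<Longrightarrow> \<exists>N c. sqnorm M (\<lambda>x. \<phi> x - (\<Sum>i\<in>I N. c i * \<Psi> i x)) \<le> \<epsilon>"
  shows "(\<lambda>N. \<Sum>i\<in>I N. (cmod (l2_inner M \<phi> (\<Psi> i)))\<^sup>2) \<longlonglongrightarrow> sqnorm M \<phi>"
proof (rule LIMSEQ_I)
  let ?s = "\<lambda>N. \<Sum>i\<in>I N. (cmod (l2_inner M \<phi> (\<Psi> i)))\<^sup>2"
  fix r :: real assume r: "r > 0"
  note ba = best_approximation[OF I(1) \<Psi> \<phi> on]
  have le: "?s N \<le> sqnorm M \<phi>" for N
  proof -
    have "0 \<le> sqnorm M (\<lambda>x. \<phi> x - (\<Sum>i\<in>I N. l2_inner M \<phi> (\<Psi> i) * \<Psi> i x))" by simp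
    also have "\<dots> = sqnorm M \<phi> - ?s N" by (subst ba) simp_all
    finally show ?thesis by simp
  qed
  obtain N c where N: "sqnorm M (\<lambda>x. \<phi> x - (\<Sum>i\<in>I N. c i * \<Psi> i x)) \<le> r / 2" using dense[of "r / 2"] r by auto
  have "sqnorm M \<phi> - ?s N \<le> sqnorm M (\<lambda>x. \<phi> x - (\<Sum>i\<in>I N. c i * \<Psi> i x))"
    by (subst ba) (simp_all add: sum_nonneg)
  with N have N': "sqnorm M \<phi> - ?s N \<le> r / 2" by linarith
  show "\<exists>no. \<forall>n\<ge>no. norm (?s n - sqnorm M \<phi>) < r"
  proof (intro exI allI impI)
    fix n assume "N \<le> n"
    then have "?s N \<le> ?s n" using I by (intro sum_mono2) (auto simp: incseq_def)
    with N' le[of n] r show "norm (?s n - sqnorm M \<phi>) < r" by (simp add: abs_le_iff)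
  qed
qed

text \<open>
  A Cauchy sequence in \<open>L\<^sup>2\<close> of a probability space has a subsequence converging almost everywhere:
  pass to one whose successive differences have summable mean.
\<close>

lemma L2_nn: "L2 M f \<Longrightarrow> (\<integral>\<^sup>+x. ennreal ((cmod (f x))\<^sup>2) \<partial>M) = ennreal (sqnorm M f)"
  by (rule nn_integral_eq_integral) (auto simp: L2_def)

lemma L2_nnI:
  assumes "f \<in> borel_measurable M" "(\<integral>\<^sup>+x. ennreal ((cmod (f x))\<^sup>2) \<partial>M) < \<infinity>"
  shows "L2 M f"
  unfolding L2_def using assms by (auto intro!: integrableI_bounded)

lemma (in prob_space) L2_cauchy_subsequence:
  assumes s: "\<And>n. L2 M (s n)"
    and cauchy: "\<And>\<epsilon>. \<epsilon> > 0 \<Longrightarrow> \<exists>N. \<forall>m\<ge>N. \<forall>n\<ge>N. sqnorm M (\<lambda>x. s m x - s n x) \<le> \<epsilon>"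
  shows "\<exists>r::nat \<Rightarrow> nat. strict_mono r \<and> (AE x in M. convergent (\<lambda>i. s (r i) x))"
proof -
  have "\<exists>N. \<forall>m\<ge>N. \<forall>n\<ge>N. sqnorm M (\<lambda>x. s m x - s n x) \<le> (1/4) ^ i" for i :: nat
    by (rule cauchy) simp
  then obtain N where N: "\<And>i m n. m \<ge> N i \<Longrightarrow> n \<ge> N i \<Longrightarrow> sqnorm M (\<lambda>x. s m x - s n x) \<le> (1/4) ^ i"
    by metis
  define r where "r = rec_nat (N 0) (\<lambda>i k. Suc (max k (N (Suc i))))"
  have rS: "r (Suc i) = Suc (max (r i) (N (Suc i)))" for i by (simp add: r_def)
  have mono: "strict_mono r" by (rule strict_mono_Suc_iff[THEN iffD2]) (simp add: rS less_Suc_eq_le)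
  have rN: "r i \<ge> N i" for i
  proof (cases i)
    case 0 then show ?thesis by (simp add: r_def)
  next
    case (Suc j) then show ?thesis by (simp add: rS le_SucI)
  qed
  define d where "d i x = s (r (Suc i)) x - s (r i) x" for i x
  have dL: "L2 M (d i)" for i unfolding d_def by (intro L2_diff s)
  have dn: "sqnorm M (d i) \<le> (1/4) ^ i" for i
  proof -
    have "r (Suc i) \<ge> N i" using rN[of i] strict_monoD[OF mono, of i "Suc i"] by simp
    then show ?thesis unfolding d_def by (rule N[OF _ rN])
  qed
  have dm: "(\<lambda>x. ennreal (cmod (d i x))) \<in> borel_measurable M" for i
    using L2_measurable[OF dL[of i]] by measurable
  have one: "(\<integral>\<^sup>+x. ennreal (cmod (d i x)) \<partial>M) \<le> ennreal ((1/2) ^ i)" for i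
  proof -
    have int: "integrable M (\<lambda>x. (2 ^ i * (cmod (d i x))\<^sup>2 + (1/2) ^ i) / 2)"
      using L2_integrable[OF dL[of i]] by simp
    have "(\<integral>\<^sup>+x. ennreal (cmod (d i x)) \<partial>M) \<le> (\<integral>\<^sup>+x. ennreal ((2 ^ i * (cmod (d i x))\<^sup>2 + (1/2) ^ i) / 2) \<partial>M)"
    proof (intro nn_integral_mono ennreal_leI)
      fix x
      have "0 \<le> 2 ^ i * (cmod (d i x) - (1/2) ^ i)\<^sup>2" by simp
      also have "\<dots> = 2 ^ i * (cmod (d i x))\<^sup>2 - 2 * (2 ^ i * (1/2) ^ i) * cmod (d i x) + (2 ^ i * (1/2) ^ i) * (1/2) ^ i"
        by (simp add: power2_eq_square algebra_simps)
      also have "2 ^ i * (1/2) ^ i = (1::real)" by (simp add: power_mult_distrib[symmetric])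
      finally show "cmod (d i x) \<le> (2 ^ i * (cmod (d i x))\<^sup>2 + (1/2) ^ i) / 2" by simp
    qed
    also have "\<dots> = ennreal (\<integral>x. (2 ^ i * (cmod (d i x))\<^sup>2 + (1/2) ^ i) / 2 \<partial>M)"
      by (rule nn_integral_eq_integral[OF int]) simp
    also have "(\<integral>x. (2 ^ i * (cmod (d i x))\<^sup>2 + (1/2) ^ i) / 2 \<partial>M) = (2 ^ i * sqnorm M (d i) + (1/2) ^ i) / 2"
      using L2_integrable[OF dL[of i]] by (simp add: prob_space)
    also have "\<dots> \<le> (2 ^ i * (1/4) ^ i + (1/2) ^ i) / 2"
      using mult_left_mono[OF dn[of i], of "2 ^ i"] by simp
    also have "2 ^ i * (1/4) ^ i = ((1/2) ^ i :: real)" by (simp add: power_mult_distrib[symmetric])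
    finally show ?thesis by (simp add: ennreal_leI)
  qed
  have "(\<integral>\<^sup>+x. (\<Sum>i. ennreal (cmod (d i x))) \<partial>M) = (\<Sum>i. (\<integral>\<^sup>+x. ennreal (cmod (d i x)) \<partial>M))"
    by (rule nn_integral_suminf[OF dm])
  also have "\<dots> \<le> (\<Sum>i. ennreal ((1/2) ^ i))" by (rule suminf_le[OF one]) auto
  also have "\<dots> < \<infinity>"
    by (subst suminf_ennreal2) (auto intro!: summable_geometric)
  finally have "AE x in M. (\<Sum>i. ennreal (cmod (d i x))) \<noteq> \<infinity>"
    using dm by (intro nn_integral_PInf_AE) auto
  then have "AE x in M. convergent (\<lambda>i. s (r i) x)"
  proof (rule AE_mp, intro AE_I2 impI)
    fix x assume "(\<Sum>i. ennreal (cmod (d i x))) \<noteq> \<infinity>"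
    then have "summable (\<lambda>i. cmod (d i x))" by (intro summable_suminf_not_top) auto
    then have "summable (\<lambda>i. d i x)" by (rule summable_norm_cancel)
    then have "convergent (\<lambda>n. \<Sum>i<n. d i x)" by (rule summable_iff_convergent[THEN iffD1])
    moreover have "(\<Sum>i<n. d i x) = s (r n) x - s (r 0) x" for n
      unfolding d_def by (rule sum_lessThan_telescope)
    ultimately have "convergent (\<lambda>n. s (r n) x - s (r 0) x + s (r 0) x)"
      by (intro convergent_add) (simp_all add: convergent_const)
    then show "convergent (\<lambda>i. s (r i) x)" by simp
  qed
  with mono show ?thesis by blast
qed

lemma (in prob_space) L2_limit:
  assumes s: "\<And>n. L2 M (s n)" and r: "strict_mono (r :: nat \<Rightarrow> nat)"
    and f: "f \<in> borel_measurable M" "AE x in M. (\<lambda>i. s (r i) x) \<longlonglongrightarrow> f x"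
    and N: "\<And>m n. m \<ge> N \<Longrightarrow> n \<ge> N \<Longrightarrow> sqnorm M (\<lambda>x. s m x - s n x) \<le> \<epsilon>" and n: "n \<ge> N"
  shows "L2 M (\<lambda>x. f x - s n x)" "sqnorm M (\<lambda>x. f x - s n x) \<le> \<epsilon>"
proof -
  have "(\<integral>\<^sup>+x. ennreal ((cmod (f x - s n x))\<^sup>2) \<partial>M) = (\<integral>\<^sup>+x. liminf (\<lambda>i. ennreal ((cmod (s (r i) x - s n x))\<^sup>2)) \<partial>M)"
  proof (rule nn_integral_cong_AE, rule AE_mp[OF f(2)], intro AE_I2 impI)
    fix x assume "(\<lambda>i. s (r i) x) \<longlonglongrightarrow> f x"
    then have "(\<lambda>i. ennreal ((cmod (s (r i) x - s n x))\<^sup>2)) \<longlonglongrightarrow> ennreal ((cmod (f x - s n x))\<^sup>2)"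
      by (intro tendsto_ennrealI tendsto_intros)
    then show "ennreal ((cmod (f x - s n x))\<^sup>2) = liminf (\<lambda>i. ennreal ((cmod (s (r i) x - s n x))\<^sup>2))"
      by (intro lim_imp_Liminf[symmetric]) auto
  qed
  also have "\<dots> \<le> liminf (\<lambda>i. (\<integral>\<^sup>+x. ennreal ((cmod (s (r i) x - s n x))\<^sup>2) \<partial>M))"
  proof (rule nn_integral_liminf)
    fix i show "(\<lambda>x. ennreal ((cmod (s (r i) x - s n x))\<^sup>2)) \<in> borel_measurable M"
      using L2_measurable[OF L2_diff[OF s[of "r i"] s[of n]]] by measurable
  qed
  also have "\<dots> \<le> ennreal \<epsilon>"
  proof (rule Liminf_le)
    show "\<forall>\<^sub>F i in sequentially. (\<integral>\<^sup>+x. ennreal ((cmod (s (r i) x - s n x))\<^sup>2) \<partial>M) \<le> ennreal \<epsilon>"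
      using eventually_ge_at_top[of N]
    proof eventually_elim
      case (elim i)
      then have "r i \<ge> N" using seq_suble[OF r, of i] by simp
      then show ?case unfolding L2_nn[OF L2_diff[OF s s]] by (intro ennreal_leI N n)
    qed
  qed simp
  finally have le: "(\<integral>\<^sup>+x. ennreal ((cmod (f x - s n x))\<^sup>2) \<partial>M) \<le> ennreal \<epsilon>" .
  show L: "L2 M (\<lambda>x. f x - s n x)"
  proof (rule L2_nnI)
    show "(\<lambda>x. f x - s n x) \<in> borel_measurable M" by (rule borel_measurable_diff[OF f(1) L2_measurable[OF s]])
    show "(\<integral>\<^sup>+x. ennreal ((cmod (f x - s n x))\<^sup>2) \<partial>M) < \<infinity>" by (rule le_less_trans[OF le]) simp
  qed
  have "0 \<le> sqnorm M (\<lambda>x. s n x - s n x)" by simp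
  also have "\<dots> \<le> \<epsilon>" by (rule N[OF n n])
  finally have "0 \<le> \<epsilon>" .
  then show "sqnorm M (\<lambda>x. f x - s n x) \<le> \<epsilon>" using le unfolding L2_nn[OF L] by simp
qed

section \<open>The Fourier expansion on the unit quaternions\<close>

text \<open>
  The last clause records that the coefficients of the forms of degree \<open>j\<close> are
  combinations of those of \<open>\<tau>\<close> on the basis, so that density passes from the
  former to the latter.
\<close>

definition weight_basis :: "nat \<Rightarrow> (quat \<Rightarrow> (nat \<Rightarrow> complex) \<Rightarrow> nat \<Rightarrow> complex) \<Rightarrow> (nat \<Rightarrow> nat \<Rightarrow> complex) \<Rightarrow> bool" where
  "weight_basis j \<tau> e \<longleftrightarrow>
     (\<forall>r\<le>j. e r \<in> cvec (Suc j)) \<and>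
     (\<forall>r\<le>j. \<forall>s\<le>j. cinner (Suc j) (e r) (e s) = (if r = s then 1 else 0)) \<and>
     (\<forall>r\<le>j. \<forall>t. \<tau> (quat_of_complex (cis t)) (e r) = (\<lambda>i. cis (of_int (weight j r) * t) * e r i)) \<and>
     (\<exists>X. \<forall>q\<in>Sp1. \<forall>r\<le>j. \<forall>s\<le>j. form_coeff j q r s = (\<Sum>a<Suc j. X r a s * \<tau> q (e s) a))"

lemma cinner_scale: "cinner d (\<lambda>i. a * u i) (\<lambda>i. b * v i) = a * cnj b * cinner d u v"
  by (simp add: cinner_def sum_distrib_left mult_ac)

lemma cinner_self: "cinner d v v = of_real (\<Sum>i<d. (cmod (v i))\<^sup>2)"
  unfolding cinner_def of_real_sum by (rule sum.cong[OF refl], rule complex_norm_square[symmetric])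

text \<open>
  The images of the monomials under an equivalence with the forms are weight vectors. Vectors of
  different weight are orthogonal, and each is normalized.
\<close>

lemma (in unit_quaternion_haar) weight_basis_exists:
  assumes \<tau>: "irreducible_unitary_rep_on Sp1 (Suc j) \<tau>"
  shows "\<exists>e. weight_basis j \<tau> e"
proof -
  let ?d = "Suc j"
  have u: "unitary_rep_on Sp1 ?d \<tau>" using \<tau> by (simp add: irreducible_unitary_rep_on_def)
  obtain X Y where X: "intertwines ?d (rep_matrix \<tau>) ?d (form_coeff j) X" and XY: "mutually_inverse ?d X Y"
    by (rule rep_equivalent_form[OF \<tau>]) (rule that)
  have Y: "intertwines ?d (form_coeff j) ?d (rep_matrix \<tau>) Y" by (rule intertwines_inverse[OF X XY])
  define y where "y r = (\<lambda>i. if i < ?d then Y i r else 0)" for r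
  have yc: "y r \<in> cvec ?d" for r by (simp add: y_def cvec_def)
  have \<tau>y: "\<tau> q (y r) i = mat_prod ?d (rep_matrix \<tau> q) Y i r" if "q \<in> Sp1" "i < ?d" for q r i
    unfolding rep_matrix_act[OF u that(1) yc] mat_act_def mat_prod_def using that(2)
    by (simp add: y_def del: sum.lessThan_Suc)
  have eig: "\<tau> (quat_of_complex (cis t)) (y r) = (\<lambda>i. cis (of_int (weight j r) * t) * y r i)" if r: "r \<le> j" for r t
  proof
    fix i
    show "\<tau> (quat_of_complex (cis t)) (y r) i = cis (of_int (weight j r) * t) * y r i"
    proof (cases "i < ?d")
      case True
      have "\<tau> (quat_of_complex (cis t)) (y r) i = mat_prod ?d Y (form_coeff j (quat_of_complex (cis t))) i r"
        unfolding \<tau>y[OF cis_in_Sp1 True] using Y cis_in_Sp1 True r unfolding intertwines_def by simp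
      also have "\<dots> = (\<Sum>k<?d. if k = r then Y i r * cis (of_int (weight j r) * t) else 0)"
        unfolding mat_prod_def by (rule sum.cong[OF refl]) (auto simp: form_coeff_cis)
      also have "\<dots> = Y i r * cis (of_int (weight j r) * t)" using r by (simp del: sum.lessThan_Suc)
      finally show ?thesis using True by (simp add: y_def mult.commute)
    next
      case False
      have "\<tau> (quat_of_complex (cis t)) (y r) \<in> cvec ?d" by (rule unitary_rep_D(1)[OF u cis_in_Sp1 yc])
      then show ?thesis using False by (simp add: y_def cvec_def)
    qed
  qed
  have ort: "cinner ?d (y r) (y s) = 0" if rs: "r \<le> j" "s \<le> j" "r \<noteq> s" for r s
  proof -
    obtain t where t: "cis (of_int (weight j r) * t) = - cis (of_int (weight j s) * t)"
      by (rule separate_weights[OF rs(3), of j]) (rule that)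
    let ?w = "cis (of_int (weight j s) * t)"
    have "cinner ?d (y r) (y s) = cinner ?d (\<tau> (quat_of_complex (cis t)) (y r)) (\<tau> (quat_of_complex (cis t)) (y s))"
      by (rule unitary_rep_D(6)[OF u cis_in_Sp1 yc yc, symmetric])
    also have "\<dots> = (- ?w) * cnj ?w * cinner ?d (y r) (y s)"
      unfolding eig[OF rs(1)] eig[OF rs(2)] t by (rule cinner_scale)
    also have "(- ?w) * cnj ?w = - 1" by (simp add: cis_cnj cis_mult)
    finally show ?thesis by simp
  qed
  define n where "n r = (\<Sum>i<?d. (cmod (y r i))\<^sup>2)" for r
  have npos: "n r > 0" if r: "r \<le> j" for r
  proof (rule ccontr)
    assume "\<not> n r > 0"
    moreover have "n r \<ge> 0" unfolding n_def by (rule sum_nonneg) simp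
    ultimately have "n r = 0" by simp
    then have "\<forall>i\<in>{..<?d}. (cmod (y r i))\<^sup>2 = 0"
      unfolding n_def by (subst (asm) sum_nonneg_eq_0_iff) auto
    then have "Y i r = 0" if "i < ?d" for i using that by (simp add: y_def)
    then have "mat_prod ?d X Y r r = 0" unfolding mat_prod_def by (intro sum.neutral) simp
    then show False using XY r by (simp add: mutually_inverse_def)
  qed
  define c where "c r = complex_of_real (sqrt (n r))" for r
  have c0: "c r \<noteq> 0" if "r \<le> j" for r using npos[OF that] by (simp add: c_def)
  define e where "e r = (\<lambda>i. inverse (c r) * y r i)" for r
  have ec: "e r \<in> cvec ?d" for r using yc[of r] by (simp add: e_def cvec_def)
  have "cinner ?d (e r) (e s) = (if r = s then 1 else 0)" if rs: "r \<le> j" "s \<le> j" for r s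
  proof (cases "r = s")
    case True
    have "cinner ?d (e r) (e r) = inverse (c r) * cnj (inverse (c r)) * of_real (n r)"
      unfolding e_def cinner_scale cinner_self n_def ..
    also have "of_real (n r) = c r * c r"
      using npos[OF rs(1)] by (simp add: c_def flip: of_real_mult)
    also have "cnj (inverse (c r)) = inverse (c r)" by (simp add: c_def)
    also have "inverse (c r) * inverse (c r) * (c r * c r) = 1"
      using c0[OF rs(1)] by (simp add: field_simps)
    finally show ?thesis using True by simp
  next
    case False
    then show ?thesis unfolding e_def cinner_scale using ort[OF rs False] by simp
  qed
  moreover have "\<tau> (quat_of_complex (cis t)) (e r) = (\<lambda>i. cis (of_int (weight j r) * t) * e r i)" if r: "r \<le> j" for r t
    unfolding e_def unitary_rep_D(3)[OF u cis_in_Sp1 yc] eig[OF r] by (simp add: mult_ac)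
  moreover have "form_coeff j q r s = (\<Sum>a<?d. (X r a * c s) * \<tau> q (e s) a)"
    if q: "q \<in> Sp1" and rs: "r \<le> j" "s \<le> j" for q r s
  proof -
    have "form_coeff j q r s = mat_prod ?d (form_coeff j q) (mat_prod ?d X Y) r s"
      by (rule mat_prod_one_right[symmetric]) (use XY rs in \<open>simp_all add: mutually_inverse_def\<close>)
    also have "\<dots> = mat_prod ?d (mat_prod ?d (form_coeff j q) X) Y r s" by (rule mat_prod_assoc)
    also have "\<dots> = mat_prod ?d (mat_prod ?d X (rep_matrix \<tau> q)) Y r s"
      by (rule mat_prod_cong[OF _ refl]) (use X q rs in \<open>simp add: intertwines_def\<close>)
    also have "\<dots> = mat_prod ?d X (mat_prod ?d (rep_matrix \<tau> q) Y) r s" by (rule mat_prod_assoc[symmetric])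
    also have "\<dots> = (\<Sum>a<?d. X r a * \<tau> q (y s) a)"
      unfolding mat_prod_def[of _ X] by (rule sum.cong[OF refl]) (simp add: \<tau>y[OF q])
    also have "\<dots> = (\<Sum>a<?d. (X r a * c s) * \<tau> q (e s) a)"
    proof (rule sum.cong[OF refl])
      fix a
      have "c s * (inverse (c s) * z) = z" for z using c0[OF rs(2)] by (simp add: mult.assoc[symmetric])
      then show "X r a * \<tau> q (y s) a = (X r a * c s) * \<tau> q (e s) a"
        unfolding e_def unitary_rep_D(3)[OF u q yc] by (simp add: mult.assoc)
    qed
    finally show ?thesis .
  qed
  ultimately have "weight_basis j \<tau> e"
    unfolding weight_basis_def using ec by (intro conjI allI impI exI[of _ "\<lambda>r a s. X r a * c s"] ballI) simp_all
  then show ?thesis by (rule exI[of _ e])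
qed

context unit_quaternion_haar
begin

text \<open>
  Density of the continuous functions in \<open>L\<^sup>2\<close>, proved for indicators, simple
  functions and limits.
\<close>

definition approximable :: "(quat \<Rightarrow> complex) \<Rightarrow> bool" where
  "approximable f \<longleftrightarrow> f \<in> borel_measurable \<sigma> \<and>
    (\<forall>\<epsilon>>0. \<exists>g. continuous_on Sp1 g \<and> (\<integral>\<^sup>+q. ennreal ((cmod (f q - g q))\<^sup>2) \<partial>\<sigma>) \<le> ennreal \<epsilon>)"

lemma approximableD:
  "approximable f \<Longrightarrow> \<epsilon> > 0 \<Longrightarrow>
    \<exists>g. continuous_on Sp1 g \<and> (\<integral>\<^sup>+q. ennreal ((cmod (f q - g q))\<^sup>2) \<partial>\<sigma>) \<le> ennreal \<epsilon>"
  by (simp add: approximable_def)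

lemma approximable_limit:
  assumes f: "f \<in> borel_measurable \<sigma>"
    and h: "\<And>\<epsilon>. \<epsilon> > 0 \<Longrightarrow> \<exists>h. approximable h \<and> (\<integral>\<^sup>+q. ennreal ((cmod (f q - h q))\<^sup>2) \<partial>\<sigma>) \<le> ennreal \<epsilon>"
  shows "approximable f"
  unfolding approximable_def
proof (intro conjI f allI impI)
  fix \<epsilon> :: real assume e: "\<epsilon> > 0"
  then have e4: "\<epsilon> / 4 > 0" by simp
  obtain h where h: "approximable h" "(\<integral>\<^sup>+q. ennreal ((cmod (f q - h q))\<^sup>2) \<partial>\<sigma>) \<le> ennreal (\<epsilon> / 4)"
    using h[OF e4] by (elim exE conjE)
  obtain g where g: "continuous_on Sp1 g" "(\<integral>\<^sup>+q. ennreal ((cmod (h q - g q))\<^sup>2) \<partial>\<sigma>) \<le> ennreal (\<epsilon> / 4)"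
    using approximableD[OF h(1) e4] by (elim exE conjE) (rule that)
  have hm: "h \<in> borel_measurable \<sigma>" using h(1) by (simp add: approximable_def)
  have gm: "g \<in> borel_measurable \<sigma>" by (rule measurable_continuous[OF g(1)])
  have m: "(\<lambda>q. ennreal ((cmod (f q - h q))\<^sup>2)) \<in> borel_measurable \<sigma>" "(\<lambda>q. ennreal ((cmod (h q - g q))\<^sup>2)) \<in> borel_measurable \<sigma>"
    using f hm gm by measurable
  have "(\<integral>\<^sup>+q. ennreal ((cmod (f q - g q))\<^sup>2) \<partial>\<sigma>) \<le> (\<integral>\<^sup>+q. 2 * ennreal ((cmod (f q - h q))\<^sup>2) + 2 * ennreal ((cmod (h q - g q))\<^sup>2) \<partial>\<sigma>)"
  proof (rule nn_integral_mono)
    fix q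
    have "(cmod (f q - g q))\<^sup>2 \<le> 2 * (cmod (f q - h q))\<^sup>2 + 2 * (cmod (h q - g q))\<^sup>2"
      using cmod_add_square_le[of "f q - h q" "h q - g q"] by simp
    then have "ennreal ((cmod (f q - g q))\<^sup>2) \<le> ennreal (2 * (cmod (f q - h q))\<^sup>2 + 2 * (cmod (h q - g q))\<^sup>2)" by (rule ennreal_leI)
    then show "ennreal ((cmod (f q - g q))\<^sup>2) \<le> 2 * ennreal ((cmod (f q - h q))\<^sup>2) + 2 * ennreal ((cmod (h q - g q))\<^sup>2)"
      by (simp add: ennreal_plus ennreal_mult)
  qed
  also have "\<dots> = 2 * (\<integral>\<^sup>+q. ennreal ((cmod (f q - h q))\<^sup>2) \<partial>\<sigma>) + 2 * (\<integral>\<^sup>+q. ennreal ((cmod (h q - g q))\<^sup>2) \<partial>\<sigma>)"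
    using m by (simp add: nn_integral_add nn_integral_cmult)
  also have "\<dots> \<le> 2 * ennreal (\<epsilon> / 4) + 2 * ennreal (\<epsilon> / 4)"
    by (intro add_mono mult_left_mono h g) auto
  also have "\<dots> = ennreal \<epsilon>"
  proof -
    have "2 * ennreal (\<epsilon> / 4) = ennreal 2 * ennreal (\<epsilon> / 4)" by simp
    also have "\<dots> = ennreal (2 * (\<epsilon> / 4))" using e by (intro ennreal_mult[symmetric]) auto
    finally have "2 * ennreal (\<epsilon> / 4) = ennreal (2 * (\<epsilon> / 4))" .
    then show ?thesis using e by (simp flip: ennreal_plus)
  qed
  finally have "(\<integral>\<^sup>+q. ennreal ((cmod (f q - g q))\<^sup>2) \<partial>\<sigma>) \<le> ennreal \<epsilon>" .
  with g(1) have "continuous_on Sp1 g \<and> (\<integral>\<^sup>+q. ennreal ((cmod (f q - g q))\<^sup>2) \<partial>\<sigma>) \<le> ennreal \<epsilon>" by (rule conjI)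
  then show "\<exists>g. continuous_on Sp1 g \<and> (\<integral>\<^sup>+q. ennreal ((cmod (f q - g q))\<^sup>2) \<partial>\<sigma>) \<le> ennreal \<epsilon>"
    by (rule exI[of _ g])
qed

lemma approximable_zero: "approximable (\<lambda>q. 0)"
proof -
  have "continuous_on Sp1 (\<lambda>q. 0::complex) \<and> (\<integral>\<^sup>+q. ennreal ((cmod (0 - 0))\<^sup>2) \<partial>\<sigma>) \<le> ennreal \<epsilon>" for \<epsilon> by simp
  then have "\<exists>g. continuous_on Sp1 g \<and> (\<integral>\<^sup>+q. ennreal ((cmod (0 - g q))\<^sup>2) \<partial>\<sigma>) \<le> ennreal \<epsilon>" for \<epsilon>
    by (rule exI[of _ "\<lambda>q. 0"])
  then show ?thesis by (simp only: approximable_def borel_measurable_const simp_thms)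
qed

lemma approximable_add_scaled:
  assumes f: "approximable f" and h: "approximable h"
  shows "approximable (\<lambda>q. f q + c * h q)"
  unfolding approximable_def
proof (intro conjI allI impI)
  have fm: "f \<in> borel_measurable \<sigma>" and hm: "h \<in> borel_measurable \<sigma>" using f h by (simp_all add: approximable_def)
  then show "(\<lambda>q. f q + c * h q) \<in> borel_measurable \<sigma>" by measurable
  fix \<epsilon> :: real assume e: "\<epsilon> > 0"
  define C where "C = 4 * ((cmod c)\<^sup>2 + 1)"
  have C: "C \<ge> 4" "2 * (cmod c)\<^sup>2 \<le> C / 2" by (simp_all add: C_def)
  then have eC: "\<epsilon> / C > 0" "\<epsilon> / 4 > 0" using e by simp_all
  obtain g where g: "continuous_on Sp1 g" "(\<integral>\<^sup>+q. ennreal ((cmod (f q - g q))\<^sup>2) \<partial>\<sigma>) \<le> ennreal (\<epsilon> / 4)"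
    using approximableD[OF f eC(2)] by (elim exE conjE) (rule that)
  obtain k where k: "continuous_on Sp1 k" "(\<integral>\<^sup>+q. ennreal ((cmod (h q - k q))\<^sup>2) \<partial>\<sigma>) \<le> ennreal (\<epsilon> / C)"
    using approximableD[OF h eC(1)] by (elim exE conjE) (rule that)
  have gm: "g \<in> borel_measurable \<sigma>" "k \<in> borel_measurable \<sigma>" by (rule measurable_continuous[OF g(1)], rule measurable_continuous[OF k(1)])
  have m: "(\<lambda>q. ennreal ((cmod (f q - g q))\<^sup>2)) \<in> borel_measurable \<sigma>" "(\<lambda>q. ennreal ((cmod (h q - k q))\<^sup>2)) \<in> borel_measurable \<sigma>"
    using fm hm gm by measurable
  have "(\<integral>\<^sup>+q. ennreal ((cmod (f q + c * h q - (g q + c * k q)))\<^sup>2) \<partial>\<sigma>)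
      \<le> (\<integral>\<^sup>+q. 2 * ennreal ((cmod (f q - g q))\<^sup>2) + ennreal (2 * (cmod c)\<^sup>2) * ennreal ((cmod (h q - k q))\<^sup>2) \<partial>\<sigma>)"
  proof (rule nn_integral_mono)
    fix q
    have "(cmod (f q + c * h q - (g q + c * k q)))\<^sup>2 \<le> 2 * (cmod (f q - g q))\<^sup>2 + 2 * (cmod c)\<^sup>2 * (cmod (h q - k q))\<^sup>2"
    proof -
      have "f q + c * h q - (g q + c * k q) = (f q - g q) + c * (h q - k q)" by (simp add: algebra_simps)
      then show ?thesis using cmod_add_square_le[of "f q - g q" "c * (h q - k q)"]
        by (simp only: norm_mult power_mult_distrib mult.assoc)
    qed
    then have "ennreal ((cmod (f q + c * h q - (g q + c * k q)))\<^sup>2) \<le> ennreal (2 * (cmod (f q - g q))\<^sup>2 + 2 * (cmod c)\<^sup>2 * (cmod (h q - k q))\<^sup>2)"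
      by (rule ennreal_leI)
    then show "ennreal ((cmod (f q + c * h q - (g q + c * k q)))\<^sup>2)
        \<le> 2 * ennreal ((cmod (f q - g q))\<^sup>2) + ennreal (2 * (cmod c)\<^sup>2) * ennreal ((cmod (h q - k q))\<^sup>2)"
      by (simp add: ennreal_plus ennreal_mult)
  qed
  also have "\<dots> = 2 * (\<integral>\<^sup>+q. ennreal ((cmod (f q - g q))\<^sup>2) \<partial>\<sigma>) + ennreal (2 * (cmod c)\<^sup>2) * (\<integral>\<^sup>+q. ennreal ((cmod (h q - k q))\<^sup>2) \<partial>\<sigma>)"
    using m by (simp add: nn_integral_add nn_integral_cmult)
  also have "\<dots> \<le> 2 * ennreal (\<epsilon> / 4) + ennreal (C / 2) * ennreal (\<epsilon> / C)"
    using C by (intro add_mono mult_mono g k ennreal_leI) auto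
  also have "\<dots> = ennreal \<epsilon>"
  proof -
    have "2 * ennreal (\<epsilon> / 4) = ennreal 2 * ennreal (\<epsilon> / 4)" by simp
    also have "\<dots> = ennreal (2 * (\<epsilon> / 4))" using e by (intro ennreal_mult[symmetric]) auto
    finally have "2 * ennreal (\<epsilon> / 4) = ennreal (2 * (\<epsilon> / 4))" .
    moreover have "ennreal (C / 2) * ennreal (\<epsilon> / C) = ennreal (C / 2 * (\<epsilon> / C))" using e C by (intro ennreal_mult[symmetric]) auto
    moreover have "C / 2 * (\<epsilon> / C) = \<epsilon> / 2" using C by simp
    ultimately show ?thesis using e by (simp flip: ennreal_plus)
  qed
  finally have "(\<integral>\<^sup>+q. ennreal ((cmod (f q + c * h q - (g q + c * k q)))\<^sup>2) \<partial>\<sigma>) \<le> ennreal \<epsilon>" .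
  moreover have "continuous_on Sp1 (\<lambda>q. g q + c * k q)"
    by (rule continuous_on_add[OF g(1) continuous_on_mult[OF continuous_on_const k(1)]])
  ultimately have "continuous_on Sp1 (\<lambda>q. g q + c * k q) \<and> (\<integral>\<^sup>+q. ennreal ((cmod (f q + c * h q - (g q + c * k q)))\<^sup>2) \<partial>\<sigma>) \<le> ennreal \<epsilon>"
    by (rule conjI[rotated])
  then show "\<exists>g. continuous_on Sp1 g \<and> (\<integral>\<^sup>+q. ennreal ((cmod (f q + c * h q - g q))\<^sup>2) \<partial>\<sigma>) \<le> ennreal \<epsilon>"
    by (rule exI[of _ "\<lambda>q. g q + c * k q"])
qed

text \<open>
  Regularity of the measure encloses the set between a compact and an open set of almost the
  same measure, and Urysohn's lemma interpolates.
\<close>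

lemma approximable_indicator:
  assumes A: "A \<in> sets \<sigma>" shows "approximable (indicator A)"
  unfolding approximable_def
proof (intro conjI allI impI)
  show "indicator A \<in> borel_measurable \<sigma>" using A by measurable
  fix \<epsilon> :: real assume e: "\<epsilon> > 0"
  define \<sigma>' where "\<sigma>' = distr \<sigma> borel (\<lambda>q. q)"
  have id: "(\<lambda>q. q) \<in> measurable \<sigma> borel"
    by (rule measurable_fromI[OF measurable_restrict_space1[OF measurable_ident_sets[OF refl]]])
  obtain B where B: "B \<in> sets borel" "A = B \<inter> Sp1"
    using A unfolding sets_eq sets_restrict_space by auto
  have em: "emeasure \<sigma>' C = emeasure \<sigma> (C \<inter> Sp1)" if "C \<in> sets borel" for C
    unfolding \<sigma>'_def using emeasure_distr[OF id that] by (simp add: space_eq)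
  have fin: "emeasure \<sigma>' C \<noteq> \<infinity>" if "C \<in> sets borel" for C
    unfolding em[OF that] using emeasure_finite by simp
  have s': "sets \<sigma>' = sets borel" by (simp add: \<sigma>'_def)
  have f': "finite_measure \<sigma>'" unfolding \<sigma>'_def by (rule finite_measure_distr[OF id])
  have sp': "emeasure \<sigma>' (space \<sigma>') \<noteq> \<infinity>" using finite_measure.emeasure_finite[OF f'] by simp
  have e2: "\<epsilon> / 2 > 0" using e by simp
  have "\<exists>K\<in>{K. K \<subseteq> B \<and> compact K}. emeasure \<sigma>' B < emeasure \<sigma>' K + ennreal (\<epsilon> / 2)"
    by (rule SUP_approx_ennreal[OF e2 _ inner_regular[OF s' sp' B(1)]])
      (use fin[OF B(1)] in \<open>auto intro: exI[of _ "{}"]\<close>)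
  then obtain K where K: "K \<subseteq> B" "compact K" "emeasure \<sigma>' B < emeasure \<sigma>' K + ennreal (\<epsilon> / 2)"
    by (elim bexE CollectE conjE) (rule that)
  have "\<exists>U\<in>{U. B \<subseteq> U \<and> open U}. emeasure \<sigma>' U < emeasure \<sigma>' B + ennreal (\<epsilon> / 2)"
    by (rule INF_approx_ennreal[OF e2 outer_regular[OF s' sp' B(1)]]) (use fin[OF B(1)] in simp)
  then obtain U where U: "B \<subseteq> U" "open U" "emeasure \<sigma>' U < emeasure \<sigma>' B + ennreal (\<epsilon> / 2)"
    by (elim bexE CollectE conjE) (rule that)
  have KU: "K \<subseteq> U" using K U by blast
  obtain h :: "quat \<Rightarrow> real" where h: "continuous_on UNIV h" "\<And>x. h x \<in> closed_segment 1 0" "\<And>x. x \<in> K \<Longrightarrow> h x = 1" "\<And>x. x \<in> - U \<Longrightarrow> h x = 0"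
    by (rule Urysohn[of K "- U" 1 "0::real"]) (use K U KU in \<open>auto intro: compact_imp_closed\<close>)
  have h01: "0 \<le> h x \<and> h x \<le> 1" for x using h(2)[of x] by (simp add: closed_segment_eq_real_ivl)
  have UK: "U - K \<in> sets borel" "K \<in> sets borel" "U \<in> sets borel"
    using borel_compact[OF K(2)] borel_open[OF U(2)] by auto
  have "emeasure \<sigma>' U \<le> emeasure \<sigma>' K + ennreal \<epsilon>"
  proof -
    have "emeasure \<sigma>' U \<le> emeasure \<sigma>' B + ennreal (\<epsilon> / 2)" using U by simp
    also have "\<dots> \<le> (emeasure \<sigma>' K + ennreal (\<epsilon> / 2)) + ennreal (\<epsilon> / 2)" using K by (intro add_right_mono) simp
    also have "\<dots> = emeasure \<sigma>' K + ennreal \<epsilon>" using e by (simp add: add.assoc flip: ennreal_plus)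
    finally show ?thesis .
  qed
  then have small: "emeasure \<sigma>' (U - K) \<le> ennreal \<epsilon>"
    using emeasure_Diff[of \<sigma>' K U] fin[OF UK(2)] KU UK s' by (simp add: ennreal_minus_le_iff)
  have "(\<integral>\<^sup>+q. ennreal ((cmod (indicator A q - complex_of_real (h q)))\<^sup>2) \<partial>\<sigma>) \<le> (\<integral>\<^sup>+q. indicator ((U - K) \<inter> Sp1) q \<partial>\<sigma>)"
  proof (rule nn_integral_mono)
    fix q assume "q \<in> space \<sigma>"
    then have q: "q \<in> Sp1" by (simp add: space_eq)
    show "ennreal ((cmod (indicator A q - complex_of_real (h q)))\<^sup>2) \<le> indicator ((U - K) \<inter> Sp1) q"
    proof (cases "q \<in> U - K")
      case True
      have "cmod (indicator A q - complex_of_real (h q)) = \<bar>indicator A q - h q\<bar>"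
      proof -
        have "indicator A q - complex_of_real (h q) = complex_of_real (indicator A q - h q)" by (simp add: indicator_def)
        then show ?thesis by (simp only: norm_of_real)
      qed
      also have "\<dots> \<le> 1" using h01[of q] by (simp add: indicator_def)
      finally have "(cmod (indicator A q - complex_of_real (h q)))\<^sup>2 \<le> 1" by (simp add: power_le_one)
      then show ?thesis using True q by simp
    next
      case False
      then have "indicator A q = complex_of_real (h q)"
        using h(3)[of q] h(4)[of q] K U B q by (cases "q \<in> K") (auto simp: indicator_def)
      then show ?thesis by simp
    qed
  qed
  also have "\<dots> = emeasure \<sigma> ((U - K) \<inter> Sp1)"
    by (rule nn_integral_indicator) (use UK in \<open>auto simp: sets_eq sets_restrict_space\<close>)
  also have "\<dots> \<le> ennreal \<epsilon>" using small unfolding em[OF UK(1)] .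
  finally have "(\<integral>\<^sup>+q. ennreal ((cmod (indicator A q - complex_of_real (h q)))\<^sup>2) \<partial>\<sigma>) \<le> ennreal \<epsilon>" .
  moreover have "continuous_on Sp1 (\<lambda>q. complex_of_real (h q))"
    by (rule continuous_on_of_real[OF continuous_on_subset[OF h(1) subset_UNIV]])
  ultimately have "continuous_on Sp1 (\<lambda>q. complex_of_real (h q)) \<and> (\<integral>\<^sup>+q. ennreal ((cmod (indicator A q - complex_of_real (h q)))\<^sup>2) \<partial>\<sigma>) \<le> ennreal \<epsilon>"
    by (rule conjI[rotated])
  then show "\<exists>g. continuous_on Sp1 g \<and> (\<integral>\<^sup>+q. ennreal ((cmod (indicator A q - g q))\<^sup>2) \<partial>\<sigma>) \<le> ennreal \<epsilon>"
    by (rule exI[of _ "\<lambda>q. complex_of_real (h q)"])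
qed

lemma approximable_simple:
  assumes f: "simple_function \<sigma> f" shows "approximable f"
proof -
  have fin: "finite (f ` space \<sigma>)" by (rule simple_functionD(1)[OF f])
  have sum: "approximable (\<lambda>q. \<Sum>y\<in>Y. y * indicator (f -` {y} \<inter> space \<sigma>) q)" if "finite Y" for Y
    using that
  proof (induction Y)
    case empty
    show ?case by (simp add: approximable_zero)
  next
    case (insert y Y)
    have "approximable (indicator (f -` {y} \<inter> space \<sigma>))"
      by (rule approximable_indicator[OF simple_functionD(2)[OF f]])
    from approximable_add_scaled[OF insert.IH this, of y] show ?case
      by (simp only: sum.insert[OF insert.hyps] add.commute)
  qed
  have rep: "f q = (\<Sum>y\<in>f ` space \<sigma>. y * indicator (f -` {y} \<inter> space \<sigma>) q)" if "q \<in> space \<sigma>" for q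
  proof -
    have "(\<Sum>y\<in>f ` space \<sigma>. y * indicator (f -` {y} \<inter> space \<sigma>) q) = (\<Sum>y\<in>f ` space \<sigma>. if y = f q then f q else 0)"
      by (rule sum.cong[OF refl]) (use that in \<open>auto simp: indicator_def\<close>)
    then show ?thesis using fin that by simp
  qed
  have eq: "(\<integral>\<^sup>+q. ennreal ((cmod (f q - (\<Sum>y\<in>f ` space \<sigma>. y * indicator (f -` {y} \<inter> space \<sigma>) q)))\<^sup>2) \<partial>\<sigma>) = (\<integral>\<^sup>+q. 0 \<partial>\<sigma>)"
  proof (rule nn_integral_cong)
    fix q assume "q \<in> space \<sigma>"
    from rep[OF this, symmetric]
    show "ennreal ((cmod (f q - (\<Sum>y\<in>f ` space \<sigma>. y * indicator (f -` {y} \<inter> space \<sigma>) q)))\<^sup>2) = 0"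
      by (simp only: diff_self norm_zero zero_power2 ennreal_0)
  qed
  show ?thesis
  proof (rule approximable_limit[OF borel_measurable_simple_function[OF f]])
    fix \<epsilon> :: real assume "\<epsilon> > 0"
    show "\<exists>h. approximable h \<and> (\<integral>\<^sup>+q. ennreal ((cmod (f q - h q))\<^sup>2) \<partial>\<sigma>) \<le> ennreal \<epsilon>"
    proof (rule exI, rule conjI)
      show "approximable (\<lambda>q. \<Sum>y\<in>f ` space \<sigma>. y * indicator (f -` {y} \<inter> space \<sigma>) q)" by (rule sum[OF fin])
      show "(\<integral>\<^sup>+q. ennreal ((cmod (f q - (\<Sum>y\<in>f ` space \<sigma>. y * indicator (f -` {y} \<inter> space \<sigma>) q)))\<^sup>2) \<partial>\<sigma>) \<le> ennreal \<epsilon>"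
        unfolding eq by simp
    qed
  qed
qed

lemma L2_approximable:
  assumes f: "L2 \<sigma> f" shows "approximable f"
proof (rule approximable_limit[OF L2_measurable[OF f]])
  fix \<epsilon> :: real assume e: "\<epsilon> > 0"
  obtain F where F': "\<forall>i. simple_function \<sigma> (F i)" "\<forall>x\<in>space \<sigma>. (\<lambda>i. F i x) \<longlonglongrightarrow> f x"
    "\<forall>i. \<forall>x\<in>space \<sigma>. dist (F i x) 0 \<le> 2 * dist (f x) 0"
    using borel_measurable_implies_sequence_metric[OF L2_measurable[OF f], of 0] by (elim exE conjE) (rule that)
  have F: "simple_function \<sigma> (F i)" "x \<in> space \<sigma> \<Longrightarrow> (\<lambda>i. F i x) \<longlonglongrightarrow> f x"
    "x \<in> space \<sigma> \<Longrightarrow> dist (F i x) 0 \<le> 2 * dist (f x) 0" for i x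
    using F' by simp_all
  have Fm: "F i \<in> borel_measurable \<sigma>" for i by (rule borel_measurable_simple_function[OF F(1)])
  have "(\<lambda>i. \<integral>x. (cmod (f x - F i x))\<^sup>2 \<partial>\<sigma>) \<longlonglongrightarrow> (\<integral>x. 0 \<partial>\<sigma>)"
  proof (rule integral_dominated_convergence[where w="\<lambda>x. 9 * (cmod (f x))\<^sup>2"])
    show "integrable \<sigma> (\<lambda>x. 9 * (cmod (f x))\<^sup>2)" using L2_integrable[OF f] by simp
    show "(\<lambda>x. (cmod (f x - F i x))\<^sup>2) \<in> borel_measurable \<sigma>" for i
      using L2_measurable[OF f] Fm[of i] by measurable
    show "AE x in \<sigma>. (\<lambda>i. (cmod (f x - F i x))\<^sup>2) \<longlonglongrightarrow> 0"
    proof (rule AE_I2)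
      fix x assume "x \<in> space \<sigma>"
      then have "(\<lambda>i. (cmod (f x - F i x))\<^sup>2) \<longlonglongrightarrow> (cmod (f x - f x))\<^sup>2" by (intro tendsto_intros F(2))
      then show "(\<lambda>i. (cmod (f x - F i x))\<^sup>2) \<longlonglongrightarrow> 0" by simp
    qed
    show "AE x in \<sigma>. norm ((cmod (f x - F i x))\<^sup>2) \<le> 9 * (cmod (f x))\<^sup>2" for i
    proof (rule AE_I2)
      fix x assume "x \<in> space \<sigma>"
      then have "cmod (F i x) \<le> 2 * cmod (f x)" using F(3)[of x i] by simp
      then have "cmod (f x - F i x) \<le> 3 * cmod (f x)" using norm_triangle_ineq4[of "f x" "F i x"] by linarith
      then have "(cmod (f x - F i x))\<^sup>2 \<le> (3 * cmod (f x))\<^sup>2" by (rule power_mono) (rule norm_ge_zero)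
      also have "\<dots> = 9 * (cmod (f x))\<^sup>2" by (simp add: power2_eq_square)
      finally show "norm ((cmod (f x - F i x))\<^sup>2) \<le> 9 * (cmod (f x))\<^sup>2"
        by (simp only: real_norm_def abs_of_nonneg zero_le_power2)
    qed
  qed simp
  then have "\<forall>\<^sub>F i in sequentially. (\<integral>x. (cmod (f x - F i x))\<^sup>2 \<partial>\<sigma>) < \<epsilon>"
    by (intro order_tendstoD(2)[of _ "\<integral>x. 0 \<partial>\<sigma>"]) (use e in auto)
  then have "\<exists>i. (\<integral>x. (cmod (f x - F i x))\<^sup>2 \<partial>\<sigma>) < \<epsilon>"
    using eventually_happens sequentially_bot by blast
  then obtain i where i: "(\<integral>x. (cmod (f x - F i x))\<^sup>2 \<partial>\<sigma>) < \<epsilon>" ..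
  have "L2 \<sigma> (F i)"
    unfolding L2_def
  proof
    show "F i \<in> borel_measurable \<sigma>" by (rule Fm)
    show "integrable \<sigma> (\<lambda>x. (cmod (F i x))\<^sup>2)"
    proof (rule Bochner_Integration.integrable_bound)
      show "integrable \<sigma> (\<lambda>x. 4 * (cmod (f x))\<^sup>2)" using L2_integrable[OF f] by simp
      show "(\<lambda>x. (cmod (F i x))\<^sup>2) \<in> borel_measurable \<sigma>" using Fm[of i] by measurable
      show "AE x in \<sigma>. norm ((cmod (F i x))\<^sup>2) \<le> norm (4 * (cmod (f x))\<^sup>2)"
      proof (rule AE_I2)
        fix x assume "x \<in> space \<sigma>"
        then have "cmod (F i x) \<le> 2 * cmod (f x)" using F(3)[of x i] by simp
        then have "(cmod (F i x))\<^sup>2 \<le> (2 * cmod (f x))\<^sup>2" by (rule power_mono) (rule norm_ge_zero)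
        also have "\<dots> = 4 * (cmod (f x))\<^sup>2" by (simp add: power2_eq_square)
        finally show "norm ((cmod (F i x))\<^sup>2) \<le> norm (4 * (cmod (f x))\<^sup>2)"
          by (simp only: real_norm_def abs_of_nonneg zero_le_power2 mult_nonneg_nonneg zero_le_numeral)
      qed
    qed
  qed
  from L2_nn[OF L2_diff[OF f this]] i
  have "(\<integral>\<^sup>+q. ennreal ((cmod (f q - F i q))\<^sup>2) \<partial>\<sigma>) \<le> ennreal \<epsilon>" by (simp add: ennreal_leI)
  then show "\<exists>h. approximable h \<and> (\<integral>\<^sup>+q. ennreal ((cmod (f q - h q))\<^sup>2) \<partial>\<sigma>) \<le> ennreal \<epsilon>"
    using approximable_simple[OF F(1)] by (intro exI conjI)
qed

lemma L2_continuous: "continuous_on Sp1 g \<Longrightarrow> L2 \<sigma> g"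
proof -
  assume g: "continuous_on Sp1 g"
  have "integrable \<sigma> (\<lambda>q. Re (g q * cnj (g q)))"
    by (intro integrable_Re integrable_continuous continuous_intros g)
  moreover have "Re (g q * cnj (g q)) = (cmod (g q))\<^sup>2" for q
    by (simp only: complex_norm_square[symmetric] Re_complex_of_real)
  ultimately show ?thesis by (simp only: L2_def measurable_continuous[OF g] simp_thms)
qed

lemma coef_span_continuous: "g \<in> coef_span \<Longrightarrow> continuous_on Sp1 g"
proof (induction rule: coef_span.induct)
  case (cong f g)
  then show ?case using continuous_on_cong[of Sp1 Sp1 g f] by simp
qed (auto intro!: continuous_intros continuous_on_form_coeff)

lemma L2_coef_span_dense:
  assumes f: "L2 \<sigma> f" and e: "\<epsilon> > 0"
  shows "\<exists>g\<in>coef_span. sqnorm \<sigma> (\<lambda>q. f q - g q) \<le> \<epsilon>"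
proof -
  have e4: "\<epsilon> / 4 > 0" "sqrt (\<epsilon> / 4) > 0" using e by simp_all
  obtain h where h: "continuous_on Sp1 h" "(\<integral>\<^sup>+q. ennreal ((cmod (f q - h q))\<^sup>2) \<partial>\<sigma>) \<le> ennreal (\<epsilon> / 4)"
    using approximableD[OF L2_approximable[OF f] e4(1)] by (elim exE conjE) (rule that)
  obtain g where g: "g \<in> coef_span" "\<And>q. q \<in> Sp1 \<Longrightarrow> cmod (h q - g q) < sqrt (\<epsilon> / 4)"
    by (rule coef_span_dense[OF h(1) e4(2)]) (rule that)
  have hL: "L2 \<sigma> h" by (rule L2_continuous[OF h(1)])
  have gL: "L2 \<sigma> g" by (rule L2_continuous[OF coef_span_continuous[OF g(1)]])
  have 1: "sqnorm \<sigma> (\<lambda>q. f q - h q) \<le> \<epsilon> / 4"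
    using h(2) e4 unfolding L2_nn[OF L2_diff[OF f hL]] by simp
  have "sqnorm \<sigma> (\<lambda>q. h q - g q) \<le> (\<integral>q. \<epsilon> / 4 \<partial>\<sigma>)"
  proof (rule integral_mono)
    show "integrable \<sigma> (\<lambda>q. (cmod (h q - g q))\<^sup>2)" by (rule L2_integrable[OF L2_diff[OF hL gL]])
    fix q assume "q \<in> space \<sigma>"
    then have "cmod (h q - g q) \<le> sqrt (\<epsilon> / 4)" using g(2)[of q] by (simp add: space_eq)
    then have "(cmod (h q - g q))\<^sup>2 \<le> (sqrt (\<epsilon> / 4))\<^sup>2" by (rule power_mono) simp
    then show "(cmod (h q - g q))\<^sup>2 \<le> \<epsilon> / 4" using e by simp
  qed simp
  then have 2: "sqnorm \<sigma> (\<lambda>q. h q - g q) \<le> \<epsilon> / 4" by (simp add: prob_space)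
  have "sqnorm \<sigma> (\<lambda>q. f q - g q) \<le> (\<integral>q. 2 * (cmod (f q - h q))\<^sup>2 + 2 * (cmod (h q - g q))\<^sup>2 \<partial>\<sigma>)"
  proof (rule integral_mono)
    show "integrable \<sigma> (\<lambda>q. (cmod (f q - g q))\<^sup>2)" by (rule L2_integrable[OF L2_diff[OF f gL]])
    show "integrable \<sigma> (\<lambda>q. 2 * (cmod (f q - h q))\<^sup>2 + 2 * (cmod (h q - g q))\<^sup>2)"
      using L2_integrable[OF L2_diff[OF f hL]] L2_integrable[OF L2_diff[OF hL gL]] by simp
    show "(cmod (f q - g q))\<^sup>2 \<le> 2 * (cmod (f q - h q))\<^sup>2 + 2 * (cmod (h q - g q))\<^sup>2" for q
      using cmod_add_square_le[of "f q - h q" "h q - g q"] by simp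
  qed
  also have "\<dots> = 2 * sqnorm \<sigma> (\<lambda>q. f q - h q) + 2 * sqnorm \<sigma> (\<lambda>q. h q - g q)"
    using L2_integrable[OF L2_diff[OF f hL]] L2_integrable[OF L2_diff[OF hL gL]] by simp
  also have "\<dots> \<le> \<epsilon>" using 1 2 by simp
  finally show ?thesis using g(1) by (rule bexI)
qed

end

text \<open>
  All matrix coefficients of the representations \<open>\<tau> j\<close> in their weight bases, normalized, form an
  orthonormal basis. A function of weight \<open>- k\<close> under right translations sees one weight vector in
  each \<open>\<tau> j\<close> with \<open>j \<ge> \<bar>k\<bar>\<close> of the parity of \<open>k\<close>.
\<close>

locale all_irreducibles = unit_quaternion_haar \<sigma> for \<sigma> :: "quat measure" +
  fixes \<tau> :: "nat \<Rightarrow> quat \<Rightarrow> (nat \<Rightarrow> complex) \<Rightarrow> nat \<Rightarrow> complex"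
  assumes irreducible: "irreducible_unitary_rep_on Sp1 (Suc j) (\<tau> j)"
begin

definition weight_vec :: "nat \<Rightarrow> nat \<Rightarrow> nat \<Rightarrow> complex" where
  "weight_vec j = (SOME e. weight_basis j (\<tau> j) e)"

lemma weight_basis: "weight_basis j (\<tau> j) (weight_vec j)"
  unfolding weight_vec_def by (rule someI_ex[OF weight_basis_exists[OF irreducible]])

lemma unitary: "unitary_rep_on Sp1 (Suc j) (\<tau> j)"
  using irreducible[of j] by (simp add: irreducible_unitary_rep_on_def)

lemma weight_vec_cvec: "r \<le> j \<Longrightarrow> weight_vec j r \<in> cvec (Suc j)"
  using weight_basis[of j] by (simp add: weight_basis_def)

lemma weight_vec_orthonormal:
  "r \<le> j \<Longrightarrow> s \<le> j \<Longrightarrow> cinner (Suc j) (weight_vec j r) (weight_vec j s) = (if r = s then 1 else 0)"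
  using weight_basis[of j] by (simp add: weight_basis_def)

lemma weight_vec_torus:
  "r \<le> j \<Longrightarrow> \<tau> j (quat_of_complex (cis t)) (weight_vec j r) = (\<lambda>i. cis (of_int (weight j r) * t) * weight_vec j r i)"
  using weight_basis[of j] unfolding weight_basis_def by blast

definition matrix_coeff :: "nat \<times> nat \<times> nat \<Rightarrow> quat \<Rightarrow> complex" where
  "matrix_coeff = (\<lambda>(j, r, a) q. of_real (sqrt (Suc j)) * \<tau> j q (weight_vec j r) a)"

definition coeff_index :: "nat \<Rightarrow> (nat \<times> nat \<times> nat) set" where
  "coeff_index N = Sigma {..<N} (\<lambda>j. {..j} \<times> {..j})"

lemma matrix_coeff_continuous: "r \<le> j \<Longrightarrow> continuous_on Sp1 (matrix_coeff (j, r, a))"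
  unfolding matrix_coeff_def prod.case
  by (intro continuous_on_mult continuous_on_const unitary_rep_D(7)[OF unitary one_in_Sp1 weight_vec_cvec])

lemma matrix_coeff_L2: "r \<le> j \<Longrightarrow> L2 \<sigma> (matrix_coeff (j, r, a))"
  by (rule L2_continuous[OF matrix_coeff_continuous])

lemma rep_coeff_L2: "a \<le> j \<Longrightarrow> b \<le> j \<Longrightarrow> L2 \<sigma> (\<lambda>q. rep_matrix (\<tau> j) q a b)"
  by (rule L2_continuous[OF matrix_rep_continuous[OF matrix_rep_rep_matrix[OF unitary[of j]]]]) simp_all

lemma l2_inner_cong:
  assumes "\<And>q. q \<in> Sp1 \<Longrightarrow> f q = f' q" "\<And>q. q \<in> Sp1 \<Longrightarrow> g q = g' q"
  shows "l2_inner \<sigma> f g = l2_inner \<sigma> f' g'"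
  by (rule Bochner_Integration.integral_cong[OF refl]) (simp add: space_eq assms)

lemma rep_coeff_inner:
  assumes "a \<le> j" "b \<le> j" "a' \<le> j'" "b' \<le> j'"
  shows "l2_inner \<sigma> (\<lambda>q. rep_matrix (\<tau> j) q a b) (\<lambda>q. rep_matrix (\<tau> j') q a' b') =
    (if j = j' \<and> a = a' \<and> b = b' then 1 / of_nat (Suc j) else 0)"
proof (cases "j = j'")
  case True
  then show ?thesis using schur_orthogonality_eq[OF irreducible[of j], of b a b' a'] assms by (auto simp del: of_nat_Suc)
next
  case False
  then show ?thesis using schur_orthogonality_neq[OF irreducible[of j] irreducible[of j'], of b a b' a'] assms by simp
qed

lemma matrix_coeff_orthonormal:
  assumes rs: "r \<le> j" "a \<le> j" "r' \<le> j'" "a' \<le> j'"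
  shows "l2_inner \<sigma> (matrix_coeff (j, r, a)) (matrix_coeff (j', r', a')) = (if (j, r, a) = (j', r', a') then 1 else 0)"
proof -
  let ?e = "\<lambda>b. weight_vec j r b" and ?e' = "\<lambda>b. weight_vec j' r' b"
  let ?s = "complex_of_real (sqrt (Suc j))" and ?s' = "complex_of_real (sqrt (Suc j'))"
  let ?R = "\<lambda>b q. rep_matrix (\<tau> j) q a b" and ?R' = "\<lambda>b q. rep_matrix (\<tau> j') q a' b"
  have act: "matrix_coeff (j, r, a) q = (\<Sum>b<Suc j. of_real (sqrt (Suc j)) * weight_vec j r b * rep_matrix (\<tau> j) q a b)" if "q \<in> Sp1" "r \<le> j" "a \<le> j" for q j r a
  proof -
    have "\<tau> j q (weight_vec j r) a = (\<Sum>b<Suc j. rep_matrix (\<tau> j) q a b * weight_vec j r b)"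
      using that by (subst rep_matrix_act[OF unitary that(1) weight_vec_cvec]) (simp_all add: mat_act_def del: sum.lessThan_Suc)
    then show ?thesis unfolding matrix_coeff_def prod.case by (simp only: sum_distrib_left mult_ac)
  qed
  have L: "L2 \<sigma> (?R b)" if "b \<in> {..<Suc j}" for b by (rule rep_coeff_L2) (use that rs in auto)
  have L': "L2 \<sigma> (?R' b)" if "b \<in> {..<Suc j'}" for b by (rule rep_coeff_L2) (use that rs in auto)
  have LS': "L2 \<sigma> (\<lambda>q. \<Sum>b<Suc j'. ?s' * ?e' b * ?R' b q)" by (intro L2_sum L2_scale L')
  have inner: "l2_inner \<sigma> (?R b) (\<lambda>q. \<Sum>c<Suc j'. ?s' * ?e' c * ?R' c q)
      = (if j = j' \<and> a = a' then ?s' * cnj (?e' b) / of_nat (Suc j) else 0)" if b: "b \<in> {..<Suc j}" for b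
  proof -
    have "l2_inner \<sigma> (\<lambda>q. \<Sum>c<Suc j'. ?s' * ?e' c * ?R' c q) (?R b)
        = (\<Sum>c<Suc j'. ?s' * ?e' c * l2_inner \<sigma> (?R' c) (?R b))"
      by (rule l2_inner_sum_left[OF L' L[OF b]])
    also have "\<dots> = (\<Sum>c<Suc j'. if c = b then (if j = j' \<and> a = a' then ?s' * ?e' b / of_nat (Suc j) else 0) else 0)"
    proof (rule sum.cong[OF refl])
      fix c assume "c \<in> {..<Suc j'}"
      then have "l2_inner \<sigma> (?R' c) (?R b) = (if j' = j \<and> a' = a \<and> c = b then 1 / of_nat (Suc j') else 0)"
        using b rs by (intro rep_coeff_inner) auto
      then show "?s' * ?e' c * l2_inner \<sigma> (?R' c) (?R b) = (if c = b then (if j = j' \<and> a = a' then ?s' * ?e' b / of_nat (Suc j) else 0) else 0)"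
        by (simp only:) (auto simp del: of_nat_Suc)
    qed
    also have "\<dots> = (if j = j' \<and> a = a' then ?s' * ?e' b / of_nat (Suc j) else 0)"
      using b by (auto simp del: sum.lessThan_Suc of_nat_Suc)
    finally have "cnj (l2_inner \<sigma> (\<lambda>q. \<Sum>c<Suc j'. ?s' * ?e' c * ?R' c q) (?R b)) = cnj (if j = j' \<and> a = a' then ?s' * ?e' b / of_nat (Suc j) else 0)"
      by (rule arg_cong)
    then show ?thesis unfolding l2_inner_cnj by (simp only: if_distrib[of cnj] complex_cnj_mult complex_cnj_divide complex_cnj_of_nat complex_cnj_complex_of_real complex_cnj_zero)
  qed
  have "l2_inner \<sigma> (matrix_coeff (j, r, a)) (matrix_coeff (j', r', a'))
      = l2_inner \<sigma> (\<lambda>q. \<Sum>b<Suc j. ?s * ?e b * ?R b q) (\<lambda>q. \<Sum>c<Suc j'. ?s' * ?e' c * ?R' c q)"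
    by (rule l2_inner_cong) (rule act[OF _ rs(1,2)], assumption, rule act[OF _ rs(3,4)], assumption)
  also have "\<dots> = (\<Sum>b<Suc j. ?s * ?e b * l2_inner \<sigma> (?R b) (\<lambda>q. \<Sum>c<Suc j'. ?s' * ?e' c * ?R' c q))"
    by (rule l2_inner_sum_left[OF L LS'])
  also have "\<dots> = (\<Sum>b<Suc j. ?s * ?e b * (if j = j' \<and> a = a' then ?s' * cnj (?e' b) / of_nat (Suc j) else 0))"
    by (rule sum.cong[OF refl]) (simp only: inner)
  also have "\<dots> = (if (j, r, a) = (j', r', a') then 1 else 0)"
  proof (cases "j = j' \<and> a = a'")
    case True
    have ss: "?s * ?s = of_nat (Suc j)" by (simp flip: of_real_mult del: of_nat_Suc)
    have n0: "of_nat (Suc j) \<noteq> (0::complex)" unfolding of_nat_eq_0_iff by (rule Suc_not_Zero)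
    have "(\<Sum>b<Suc j. ?s * ?e b * (?s * cnj (weight_vec j r' b) / of_nat (Suc j)))
        = (\<Sum>b<Suc j. (?s * ?s / of_nat (Suc j)) * (?e b * cnj (weight_vec j r' b)))"
      by (rule sum.cong[OF refl]) (simp only: mult_ac times_divide_eq_right times_divide_eq_left)
    also have "\<dots> = cinner (Suc j) (weight_vec j r) (weight_vec j r')"
      unfolding ss cinner_def divide_self[OF n0] mult_1 ..
    also have "\<dots> = (if r = r' then 1 else 0)" by (rule weight_vec_orthonormal) (use rs True in auto)
    finally show ?thesis using True by (simp only: if_True prod.inject simp_thms)
  next
    case False
    then have "(j, r, a) \<noteq> (j', r', a')" by auto
    with False show ?thesis by (simp only: if_False mult_zero_right sum.neutral_const)
  qed
  finally show ?thesis .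
qed

lemma coeff_indexE:
  assumes "i \<in> coeff_index N"
  obtains j r a where "i = (j, r, a)" "j < N" "r \<le> j" "a \<le> j"
  using assms unfolding coeff_index_def by auto

lemma coeff_index_mono: "N \<le> N' \<Longrightarrow> coeff_index N \<subseteq> coeff_index N'"
  by (auto simp: coeff_index_def)

lemma finite_coeff_index: "finite (coeff_index N)"
  by (simp add: coeff_index_def)

definition coeff_combination :: "(quat \<Rightarrow> complex) \<Rightarrow> bool" where
  "coeff_combination g \<longleftrightarrow> (\<exists>N c. \<forall>q\<in>Sp1. g q = (\<Sum>i\<in>coeff_index N. c i * matrix_coeff i q))"

lemma coeff_combination_add:
  assumes "coeff_combination f" "coeff_combination g" shows "coeff_combination (\<lambda>q. f q + g q)"
proof -
  obtain N c where f: "\<forall>q\<in>Sp1. f q = (\<Sum>i\<in>coeff_index N. c i * matrix_coeff i q)"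
    using assms(1) unfolding coeff_combination_def by (elim exE) (rule that)
  obtain N' c' where g: "\<forall>q\<in>Sp1. g q = (\<Sum>i\<in>coeff_index N'. c' i * matrix_coeff i q)"
    using assms(2) unfolding coeff_combination_def by (elim exE) (rule that)
  let ?M = "max N N'"
  define d where "d i = (if i \<in> coeff_index N then c i else 0) + (if i \<in> coeff_index N' then c' i else 0)" for i
  have ext: "(\<Sum>i\<in>coeff_index K. b i * matrix_coeff i q) = (\<Sum>i\<in>coeff_index ?M. (if i \<in> coeff_index K then b i else 0) * matrix_coeff i q)"
    if "K \<le> ?M" for K b q
    by (rule sum.mono_neutral_cong_left[OF finite_coeff_index coeff_index_mono[OF that]]) auto
  have "f q + g q = (\<Sum>i\<in>coeff_index ?M. d i * matrix_coeff i q)" if q: "q \<in> Sp1" for q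
  proof -
    have "f q + g q = (\<Sum>i\<in>coeff_index N. c i * matrix_coeff i q) + (\<Sum>i\<in>coeff_index N'. c' i * matrix_coeff i q)"
      using f g q by (simp only:)
    also have "\<dots> = (\<Sum>i\<in>coeff_index ?M. d i * matrix_coeff i q)"
      unfolding ext[OF max.cobounded1] ext[OF max.cobounded2] d_def distrib_right sum.distrib ..
    finally show ?thesis .
  qed
  then show ?thesis unfolding coeff_combination_def by (intro exI ballI)
qed

lemma coeff_combination_single:
  assumes "r \<le> j" "a \<le> j" shows "coeff_combination (\<lambda>q. x * \<tau> j q (weight_vec j r) a)"
proof -
  have i: "(j, r, a) \<in> coeff_index (Suc j)" using assms by (simp add: coeff_index_def)
  have s0: "complex_of_real (sqrt (Suc j)) \<noteq> 0" by simp
  have "x * \<tau> j q (weight_vec j r) a =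
      (\<Sum>i\<in>coeff_index (Suc j). (if i = (j, r, a) then x / of_real (sqrt (Suc j)) else 0) * matrix_coeff i q)" for q
  proof -
    have "(\<Sum>i\<in>coeff_index (Suc j). (if i = (j, r, a) then x / of_real (sqrt (Suc j)) else 0) * matrix_coeff i q)
        = (\<Sum>i\<in>coeff_index (Suc j). if i = (j, r, a) then x / of_real (sqrt (Suc j)) * matrix_coeff (j, r, a) q else 0)"
      by (rule sum.cong[OF refl]) auto
    also have "\<dots> = x / of_real (sqrt (Suc j)) * matrix_coeff (j, r, a) q"
      using i finite_coeff_index by (simp del: of_nat_Suc)
    also have "\<dots> = x * \<tau> j q (weight_vec j r) a"
      unfolding matrix_coeff_def prod.case using s0 by (simp del: of_nat_Suc)
    finally show ?thesis by (rule sym)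
  qed
  then show ?thesis unfolding coeff_combination_def by (intro exI ballI)
qed

lemma coeff_combination_zero: "coeff_combination (\<lambda>q. 0)"
  unfolding coeff_combination_def by (intro exI[of _ 0] exI[of _ "\<lambda>i. 0"]) simp

lemma coef_span_coeff_combination: "g \<in> coef_span \<Longrightarrow> coeff_combination g"
proof (induction rule: coef_span.induct)
  case zero
  show ?case by (rule coeff_combination_zero)
next
  case (add f g)
  then show ?case by (intro coeff_combination_add)
next
  case (cong f g)
  then show ?case unfolding coeff_combination_def by (simp cong: ball_cong)
next
  case (coef r j s x)
  obtain X where X: "\<forall>q\<in>Sp1. \<forall>r\<le>j. \<forall>s\<le>j. form_coeff j q r s = (\<Sum>a<Suc j. X r a s * \<tau> j q (weight_vec j s) a)"
    using weight_basis[of j] unfolding weight_basis_def by blast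
  have part: "coeff_combination (\<lambda>q. \<Sum>a<n. (x * X r a s) * \<tau> j q (weight_vec j s) a)" if "n \<le> Suc j" for n
    using that
  proof (induction n)
    case 0
    show ?case by (simp add: coeff_combination_zero)
  next
    case (Suc n)
    then have "coeff_combination (\<lambda>q. (\<Sum>a<n. (x * X r a s) * \<tau> j q (weight_vec j s) a) + (x * X r n s) * \<tau> j q (weight_vec j s) n)"
      using coef by (intro coeff_combination_add coeff_combination_single) auto
    then show ?case by simp
  qed
  have "x * form_coeff j q r s = (\<Sum>a<Suc j. (x * X r a s) * \<tau> j q (weight_vec j s) a)" if "q \<in> Sp1" for q
    using X that coef by (simp add: sum_distrib_left mult.assoc del: sum.lessThan_Suc)
  then show ?case using part[OF order_refl] unfolding coeff_combination_def by (simp cong: ball_cong del: sum.lessThan_Suc)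
qed

lemma parseval_all:
  assumes \<phi>: "L2 \<sigma> \<phi>"
  shows "(\<lambda>N. \<Sum>i\<in>coeff_index N. (cmod (l2_inner \<sigma> \<phi> (matrix_coeff i)))\<^sup>2) \<longlonglongrightarrow> sqnorm \<sigma> \<phi>"
proof (rule parseval_limit[OF finite_coeff_index])
  show "incseq coeff_index" by (rule incseq_SucI, rule coeff_index_mono) simp
  show "L2 \<sigma> (matrix_coeff i)" if "i \<in> coeff_index N" for N i
    using that by (elim coeff_indexE) (simp add: matrix_coeff_L2)
  show "L2 \<sigma> \<phi>" by (rule \<phi>)
  show "l2_inner \<sigma> (matrix_coeff i) (matrix_coeff i') = (if i = i' then 1 else 0)"
    if i0: "i \<in> coeff_index N" and i1: "i' \<in> coeff_index N" for N i i'
  proof -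
    obtain j r a where i: "i = (j, r, a)" "j < N" "r \<le> j" "a \<le> j" by (rule coeff_indexE[OF i0])
    obtain j' r' a' where i': "i' = (j', r', a')" "j' < N" "r' \<le> j'" "a' \<le> j'" by (rule coeff_indexE[OF i1])
    show ?thesis unfolding i(1) i'(1) by (rule matrix_coeff_orthonormal[OF i(3,4) i'(3,4)])
  qed
  fix \<epsilon> :: real assume e: "\<epsilon> > 0"
  obtain g where g: "g \<in> coef_span" "sqnorm \<sigma> (\<lambda>q. \<phi> q - g q) \<le> \<epsilon>"
    using L2_coef_span_dense[OF \<phi> e] by (elim bexE) (rule that)
  obtain N c where c: "\<forall>q\<in>Sp1. g q = (\<Sum>i\<in>coeff_index N. c i * matrix_coeff i q)"
    using coef_span_coeff_combination[OF g(1)] unfolding coeff_combination_def by (elim exE) (rule that)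
  have "sqnorm \<sigma> (\<lambda>q. \<phi> q - (\<Sum>i\<in>coeff_index N. c i * matrix_coeff i q)) = sqnorm \<sigma> (\<lambda>q. \<phi> q - g q)"
    by (rule Bochner_Integration.integral_cong[OF refl]) (use c in \<open>simp add: space_eq\<close>)
  then have "sqnorm \<sigma> (\<lambda>q. \<phi> q - (\<Sum>i\<in>coeff_index N. c i * matrix_coeff i q)) \<le> \<epsilon>" using g(2) by (simp only:)
  then show "\<exists>N c. sqnorm \<sigma> (\<lambda>q. \<phi> q - (\<Sum>i\<in>coeff_index N. c i * matrix_coeff i q)) \<le> \<epsilon>" by (intro exI)
qed

definition admissible :: "int \<Rightarrow> nat set" where
  "admissible k = {j. \<bar>k\<bar> \<le> int j \<and> even (int j - k)}"

definition weight_position :: "int \<Rightarrow> nat \<Rightarrow> nat" where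
  "weight_position k j = nat ((int j - k) div 2)"

lemma weight_position:
  assumes "j \<in> admissible k"
  shows "weight_position k j \<le> j" "weight j (weight_position k j) = k"
proof -
  have "even (int j - k)" using assms unfolding admissible_def by (simp only: mem_Collect_eq)
  then obtain l where l: "int j - k = 2 * l" by (rule evenE)
  have "l \<ge> 0" "l \<le> int j" using assms l unfolding admissible_def by auto
  then show "weight_position k j \<le> j" "weight j (weight_position k j) = k"
    using l by (simp_all add: weight_position_def weight_def)
qed

lemma weight_admissible:
  assumes "r \<le> j" "weight j r = k" shows "j \<in> admissible k" "r = weight_position k j"
  using assms by (auto simp: admissible_def weight_def weight_position_def)

definition coeff_vec :: "int \<Rightarrow> nat \<Rightarrow> nat \<Rightarrow> complex" where
  "coeff_vec k j = weight_vec j (weight_position k j)"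

text \<open>
  Translating by a suitable element of the torus changes the sign of the integrand.
\<close>

lemma matrix_coeff_vanishes:
  assumes \<phi>: "L2 \<sigma> \<phi>" and w: "\<And>q t. q \<in> Sp1 \<Longrightarrow> \<phi> (q * quat_of_complex (cis t)) = cis (- of_int k * t) * \<phi> q"
    and r: "r \<le> j" and k: "weight j r \<noteq> k"
  shows "(\<integral>q. \<phi> q * matrix_coeff (j, r, a) q \<partial>\<sigma>) = 0"
proof -
  \<comment> \<open>At this angle the two characters differ by the factor \<open>- 1\<close>.\<close>
  define t where "t = pi / of_int (weight j r - k)"
  have "of_int (weight j r) * t - of_int k * t = of_int (weight j r - k) * t" by (simp add: left_diff_distrib)
  also have "\<dots> = pi" using k by (simp add: t_def)
  finally have t: "- of_int k * t + of_int (weight j r) * t = pi" by simp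
  let ?w = "quat_of_complex (cis t)"
  have m: "(\<lambda>q. \<phi> q * matrix_coeff (j, r, a) q) \<in> borel_measurable \<sigma>"
    by (intro borel_measurable_times L2_measurable \<phi> matrix_coeff_L2[OF r])
  have "(\<integral>q. \<phi> q * matrix_coeff (j, r, a) q \<partial>\<sigma>) = (\<integral>q. \<phi> (q * ?w) * matrix_coeff (j, r, a) (q * ?w) \<partial>\<sigma>)"
    by (rule integral_right[OF m, symmetric]) (simp add: space_eq cis_in_Sp1)
  also have "\<dots> = (\<integral>q. - (\<phi> q * matrix_coeff (j, r, a) q) \<partial>\<sigma>)"
  proof (rule Bochner_Integration.integral_cong[OF refl])
    fix q assume "q \<in> space \<sigma>"
    then have q: "q \<in> Sp1" by (simp add: space_eq)
    have "\<tau> j (q * ?w) (weight_vec j r) = \<tau> j q (\<tau> j ?w (weight_vec j r))"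
      by (rule unitary_rep_D(5)[OF unitary cis_in_Sp1 q weight_vec_cvec[OF r]])
    also have "\<dots> = (\<lambda>i. cis (of_int (weight j r) * t) * \<tau> j q (weight_vec j r) i)"
      unfolding weight_vec_torus[OF r] by (rule unitary_rep_D(3)[OF unitary q weight_vec_cvec[OF r]])
    finally have "matrix_coeff (j, r, a) (q * ?w) = cis (of_int (weight j r) * t) * matrix_coeff (j, r, a) q"
      unfolding matrix_coeff_def prod.case by (simp only: mult_ac)
    then have "\<phi> (q * ?w) * matrix_coeff (j, r, a) (q * ?w)
        = (cis (- of_int k * t) * cis (of_int (weight j r) * t)) * (\<phi> q * matrix_coeff (j, r, a) q)"
      unfolding w[OF q] by (simp only: mult_ac)
    also have "cis (- of_int k * t) * cis (of_int (weight j r) * t) = - 1" unfolding cis_mult t by simp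
    finally show "\<phi> (q * ?w) * matrix_coeff (j, r, a) (q * ?w) = - (\<phi> q * matrix_coeff (j, r, a) q)" by simp
  qed
  also have "\<dots> = - (\<integral>q. \<phi> q * matrix_coeff (j, r, a) q \<partial>\<sigma>)" by (rule Bochner_Integration.integral_minus)
  finally show ?thesis by simp
qed

text \<open>
  Of the full expansion only the coefficients of weight \<open>k\<close> survive, one column in
  each admissible \<open>\<tau> j\<close>.
\<close>

lemma parseval_weight:
  assumes \<phi>: "L2 \<sigma> \<phi>" and w: "\<And>q t. q \<in> Sp1 \<Longrightarrow> \<phi> (q * quat_of_complex (cis t)) = cis (- of_int k * t) * \<phi> q"
  shows "(\<lambda>j. if j \<in> admissible k then
      \<Sum>a<Suc j. (cmod (of_real (sqrt (Suc j)) * (\<integral>q. \<phi> q * \<tau> j q (coeff_vec k j) a \<partial>\<sigma>)))\<^sup>2 else 0) sums sqnorm \<sigma> \<phi>"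
proof -
  let ?c = "\<lambda>i. (cmod (\<integral>q. \<phi> q * matrix_coeff i q \<partial>\<sigma>))\<^sup>2"
  have cc: "(cmod (l2_inner \<sigma> (\<lambda>q. cnj (\<phi> q)) (matrix_coeff i)))\<^sup>2 = ?c i" for i
  proof -
    have "l2_inner \<sigma> (\<lambda>q. cnj (\<phi> q)) (matrix_coeff i) = (\<integral>q. cnj (\<phi> q * matrix_coeff i q) \<partial>\<sigma>)" by simp
    also have "\<dots> = cnj (\<integral>q. \<phi> q * matrix_coeff i q \<partial>\<sigma>)" by (rule Bochner_Integration.integral_cnj)
    finally show ?thesis by (simp only: complex_mod_cnj)
  qed
  have "(\<lambda>N. \<Sum>i\<in>coeff_index N. ?c i) \<longlonglongrightarrow> sqnorm \<sigma> \<phi>"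
    using parseval_all[OF L2_cnj[OF \<phi>]] unfolding cc complex_mod_cnj .
  moreover have "(\<Sum>i\<in>coeff_index N. ?c i) = (\<Sum>j<N. if j \<in> admissible k then
      \<Sum>a<Suc j. (cmod (of_real (sqrt (Suc j)) * (\<integral>q. \<phi> q * \<tau> j q (coeff_vec k j) a \<partial>\<sigma>)))\<^sup>2 else 0)" for N
  proof -
    have "(\<Sum>i\<in>coeff_index N. ?c i) = (\<Sum>j<N. \<Sum>r\<le>j. \<Sum>a\<le>j. ?c (j, r, a))"
    proof -
      have "(\<Sum>j<N. \<Sum>r\<le>j. \<Sum>a\<le>j. ?c (j, r, a)) = (\<Sum>j<N. \<Sum>p\<in>{..j} \<times> {..j}. ?c (j, p))"
        by (rule sum.cong[OF refl]) (simp only: sum.cartesian_product split_def prod.collapse)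
      also have "\<dots> = (\<Sum>i\<in>coeff_index N. ?c i)"
        unfolding coeff_index_def by (subst sum.Sigma) (simp_all only: finite_lessThan finite_cartesian_product finite_atMost split_def prod.collapse ball_simps simp_thms ball_triv)
      finally show ?thesis by (rule sym)
    qed
    also have "\<dots> = (\<Sum>j<N. if j \<in> admissible k then \<Sum>a\<le>j. ?c (j, weight_position k j, a) else 0)"
    proof (rule sum.cong[OF refl])
      fix j
      have "(\<Sum>a\<le>j. ?c (j, r, a)) = (if r = weight_position k j \<and> j \<in> admissible k then \<Sum>a\<le>j. ?c (j, weight_position k j, a) else 0)"
        if r: "r \<in> {..j}" for r
      proof (cases "weight j r = k")
        case True
        then show ?thesis using weight_admissible[OF _ True] r by simp
      next
        case False
        then have "\<not> (r = weight_position k j \<and> j \<in> admissible k)" using weight_position(2) by blast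
        moreover have "(\<Sum>a\<le>j. ?c (j, r, a)) = 0"
          using matrix_coeff_vanishes[OF \<phi> w _ False] r by (intro sum.neutral) simp
        ultimately show ?thesis by (simp only: if_False)
      qed
      then have "(\<Sum>r\<le>j. \<Sum>a\<le>j. ?c (j, r, a)) = (\<Sum>r\<le>j. if r = weight_position k j \<and> j \<in> admissible k then \<Sum>a\<le>j. ?c (j, weight_position k j, a) else 0)"
        by (rule sum.cong[OF refl])
      also have "\<dots> = (if j \<in> admissible k then \<Sum>a\<le>j. ?c (j, weight_position k j, a) else 0)"
        using weight_position(1)[of j k] by (cases "j \<in> admissible k") simp_all
      finally show "(\<Sum>r\<le>j. \<Sum>a\<le>j. ?c (j, r, a)) = (if j \<in> admissible k then \<Sum>a\<le>j. ?c (j, weight_position k j, a) else 0)" .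
    qed
    also have "\<dots> = (\<Sum>j<N. if j \<in> admissible k then
      \<Sum>a<Suc j. (cmod (of_real (sqrt (Suc j)) * (\<integral>q. \<phi> q * \<tau> j q (coeff_vec k j) a \<partial>\<sigma>)))\<^sup>2 else 0)"
    proof -
      have "(\<integral>q. \<phi> q * matrix_coeff (j, weight_position k j, a) q \<partial>\<sigma>) =
          of_real (sqrt (Suc j)) * (\<integral>q. \<phi> q * \<tau> j q (coeff_vec k j) a \<partial>\<sigma>)" for j a
        unfolding matrix_coeff_def prod.case coeff_vec_def mult.left_commute[of "\<phi> _" "of_real _"]
        by (rule Bochner_Integration.integral_mult_right_zero)
      then show ?thesis unfolding lessThan_Suc_atMost by (simp only:)
    qed
    finally show ?thesis .
  qed
  ultimately show ?thesis unfolding sums_def by (simp only:)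
qed

text \<open>
  Orthonormality of the matrix coefficients recovers \<open>v\<close> from the scalar function
  that it defines.
\<close>

lemma coeff_inversion:
  assumes v: "v \<in> cvec (Suc j)" and j: "j \<in> admissible k" and i: "i \<in> admissible k"
  shows "of_real (sqrt (Suc i)) * (\<integral>q. (of_real (sqrt (Suc j)) * cinner (Suc j) v (\<tau> j q (coeff_vec k j))) * \<tau> i q (coeff_vec k i) a \<partial>\<sigma>)
    = (if i = j \<and> a < Suc i then v a else 0)"
proof (cases "a < Suc i")
  case False
  have "\<tau> i q (coeff_vec k i) a = 0" if "q \<in> Sp1" for q
    using unitary_rep_D(1)[OF unitary that weight_vec_cvec[OF weight_position(1)[OF i]]] False
    by (simp add: coeff_vec_def cvec_def)
  then have "(\<integral>q. (of_real (sqrt (Suc j)) * cinner (Suc j) v (\<tau> j q (coeff_vec k j))) * \<tau> i q (coeff_vec k i) a \<partial>\<sigma>) = (\<integral>q. 0 \<partial>\<sigma>)"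
    by (intro Bochner_Integration.integral_cong refl) (simp add: space_eq)
  with False show ?thesis by simp
next
  case True
  let ?m = "\<lambda>b. matrix_coeff (j, weight_position k j, b)" and ?n = "matrix_coeff (i, weight_position k i, a)"
  have Lm: "L2 \<sigma> (?m b)" for b by (rule matrix_coeff_L2[OF weight_position(1)[OF j]])
  have Ln: "L2 \<sigma> ?n" by (rule matrix_coeff_L2[OF weight_position(1)[OF i]])
  have "of_real (sqrt (Suc i)) * (\<integral>q. (of_real (sqrt (Suc j)) * cinner (Suc j) v (\<tau> j q (coeff_vec k j))) * \<tau> i q (coeff_vec k i) a \<partial>\<sigma>)
      = (\<integral>q. of_real (sqrt (Suc i)) * ((of_real (sqrt (Suc j)) * cinner (Suc j) v (\<tau> j q (coeff_vec k j))) * \<tau> i q (coeff_vec k i) a) \<partial>\<sigma>)"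
    by (rule Bochner_Integration.integral_mult_right_zero[symmetric])
  also have "\<dots> = (\<integral>q. (\<Sum>b<Suc j. v b * (?n q * cnj (?m b q))) \<partial>\<sigma>)"
    by (rule Bochner_Integration.integral_cong[OF refl])
      (simp add: cinner_def matrix_coeff_def coeff_vec_def sum_distrib_left sum_distrib_right mult_ac del: sum.lessThan_Suc of_nat_Suc)
  also have "\<dots> = (\<Sum>b<Suc j. \<integral>q. v b * (?n q * cnj (?m b q)) \<partial>\<sigma>)"
    by (rule Bochner_Integration.integral_sum) (intro integrable_mult_right L2_mult_integrable Ln Lm)
  also have "\<dots> = (\<Sum>b<Suc j. if b = a then (if i = j then v a else 0) else 0)"
  proof (rule sum.cong[OF refl])
    fix b assume b: "b \<in> {..<Suc j}"
    have "l2_inner \<sigma> ?n (?m b) = (if (i, weight_position k i, a) = (j, weight_position k j, b) then 1 else 0)"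
      by (rule matrix_coeff_orthonormal) (use weight_position(1) i j True b in auto)
    then have "(\<integral>q. v b * (?n q * cnj (?m b q)) \<partial>\<sigma>) = v b * (if (i, weight_position k i, a) = (j, weight_position k j, b) then 1 else 0)"
      by (simp only: Bochner_Integration.integral_mult_right_zero)
    then show "(\<integral>q. v b * (?n q * cnj (?m b q)) \<partial>\<sigma>) = (if b = a then (if i = j then v a else 0) else 0)"
      by (simp only:) auto
  qed
  also have "\<dots> = (if i = j \<and> a < Suc i then v a else 0)" using True by (cases "i = j") (simp_all del: sum.lessThan_Suc)
  finally show ?thesis .
qed

end

section \<open>Covariant functions and their fibre coefficients\<close>

text \<open>
  The factor by which an element of the induced representation is multiplied under right translation
  by a quaternionic parabolic element with corner entry \<open>w \<in> \<complex>\<^sup>\<times>\<close>. Such elements are exactly the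
  quaternionic ones in the complex parabolic subgroup, and the two modulus functions agree on them.
\<close>

definition torus_factor :: "'m::finite \<Rightarrow> real \<Rightarrow> int \<Rightarrow> quat^'m^'m \<Rightarrow> complex \<Rightarrow> complex" where
  "torus_factor e lam k p w = of_real (modulus e p powr (- 1 / 2)) *
     inverse (of_real (norm w) powr (\<i> * of_real lam) * (w / of_real (norm w)) powi k)"

lemma Sp1_norm: "q \<in> Sp1 \<Longrightarrow> norm q = 1" and Sp1_nonzero: "q \<in> Sp1 \<Longrightarrow> q \<noteq> 0"
  by (auto simp: Sp1_def)

text \<open>
  A parabolic element moves past a unit quaternion in the corner at the cost of rotating it by the
  direction \<open>u\<close> of its own corner entry; what remains has a positive real corner entry.
\<close>

definition corner_unit :: "'m::finite \<Rightarrow> quat^'m^'m \<Rightarrow> quat" where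
  "corner_unit e p = (1 / norm (p $ e $ e)) *\<^sub>R (p $ e $ e)"

lemma corner_unit_Sp1: "p \<in> parabolic e \<Longrightarrow> corner_unit e p \<in> Sp1"
  using parabolic_ee_nonzero[of p e] by (simp add: corner_unit_def Sp1_def)

lemma parabolic_slide:
  fixes p :: "quat^'m::finite^'m"
  assumes p: "p \<in> parabolic e" and q: "q \<in> Sp1"
  shows "\<exists>p'\<in>parabolic e. p ** diag_at e q = diag_at e (corner_unit e p * q) ** p' \<and>
     p' $ e $ e = quat_of_complex (of_real (norm (p $ e $ e))) \<and> modulus e p' = modulus e p"
proof -
  let ?a = "p $ e $ e" and ?u = "corner_unit e p"
  have a: "?a \<noteq> 0" by (rule parabolic_ee_nonzero[OF p])
  have uq: "?u * q \<in> Sp1" by (rule Sp1_mult[OF corner_unit_Sp1[OF p] q])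
  have iuq: "inverse (?u * q) \<in> Sp1" using uq by (simp add: Sp1_def norm_inverse)
  let ?d = "diag_at e (inverse (?u * q))" and ?p' = "diag_at e (inverse (?u * q)) ** (p ** diag_at e q)"
  have dq: "diag_at e q \<in> parabolic e" "?d \<in> parabolic e" "p ** diag_at e q \<in> parabolic e"
    by (rule diag_at_parabolic[OF Sp1_nonzero[OF q]], rule diag_at_parabolic[OF Sp1_nonzero[OF iuq]],
        rule parabolic_mult[OF p diag_at_parabolic[OF Sp1_nonzero[OF q]]])
  have "modulus e ?p' = modulus e p"
    using dq p by (simp add: modulus_mult modulus_isometry diag_at_isometry Sp1_norm q iuq)
  moreover have "?p' $ e $ e = quat_of_complex (of_real (norm ?a))"
  proof -
    have "?p' $ e $ e = inverse (?u * q) * (?a * q)"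
      unfolding parabolic_column[OF dq(3)] parabolic_column[OF dq(1)] diag_at_ee ..
    also have "?a * q = norm ?a *\<^sub>R (?u * q)" using a by (simp add: corner_unit_def)
    also have "inverse (?u * q) * (norm ?a *\<^sub>R (?u * q)) = norm ?a *\<^sub>R (inverse (?u * q) * (?u * q))"
      by (rule mult_scaleR_right)
    also have "inverse (?u * q) * (?u * q) = 1" by (rule left_inverse[OF Sp1_nonzero[OF uq]])
    finally show ?thesis by (simp only: quat_of_complex_of_real of_real_def[where 'a = quat])
  qed
  moreover have "p ** diag_at e q = diag_at e (?u * q) ** ?p'"
    unfolding matrix_mul_assoc diag_at_inverse(1)[OF Sp1_nonzero[OF uq]] matrix_mul_lid ..
  moreover have "?p' \<in> parabolic e" by (rule parabolic_mult[OF dq(2,3)])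
  ultimately show ?thesis by blast
qed

locale branching = all_irreducibles \<sigma> \<tau>
  for \<sigma> :: "quat measure" and \<tau> :: "nat \<Rightarrow> quat \<Rightarrow> (nat \<Rightarrow> complex) \<Rightarrow> nat \<Rightarrow> complex" +
  fixes e :: "'m::finite" and lam :: real and k :: int and \<nu> :: "(quat^'m^'m) measure"
  assumes haar: "is_haar_prob isometry_group \<nu>"
begin

sublocale H: left_invariant_prob \<nu> "(**)" matrix_inv
  by (rule haar_left_invariant_prob[OF haar])

lemma space_nu: "space \<nu> = isometry_group" by (rule haar_space(1)[OF haar])

lemma space_nu_GL: "h \<in> space \<nu> \<Longrightarrow> h \<in> GL" unfolding space_nu by (rule isometry_group_GL)

abbreviation GLb :: "(quat^'m^'m) measure" where "GLb \<equiv> restrict_space borel GL"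

lemma space_GLb: "space GLb = GL" by (simp add: space_restrict_space)

text \<open>
  The functions on the quaternionic group that are restrictions of elements of the big induced
  representation.
\<close>

definition covariant :: "(quat^'m^'m \<Rightarrow> complex) \<Rightarrow> bool" where
  "covariant f \<longleftrightarrow> f \<in> borel_measurable GLb \<and> (\<forall>h\<in>GL. \<forall>p\<in>parabolic e. \<forall>w.
     p $ e $ e = quat_of_complex w \<longrightarrow> f (h ** p) = torus_factor e lam k p w * f h)"

lemma covariant_measurable: "covariant f \<Longrightarrow> f \<in> borel_measurable GLb"
  unfolding covariant_def by (rule conjunct1)

lemma covariantD: "covariant f \<Longrightarrow> h \<in> GL \<Longrightarrow> p \<in> parabolic e \<Longrightarrow> p $ e $ e = quat_of_complex w \<Longrightarrow>
    f (h ** p) = torus_factor e lam k p w * f h"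
  unfolding covariant_def by (drule conjunct2) (drule bspec, assumption, drule bspec, assumption, drule spec, drule mp, assumption+)

lemma covariant_lincomb:
  assumes f: "covariant f" and g: "covariant g" shows "covariant (\<lambda>h. a * f h + b * g h)"
  unfolding covariant_def
proof (intro conjI ballI allI impI)
  show "(\<lambda>h. a * f h + b * g h) \<in> borel_measurable GLb"
    by (intro borel_measurable_add borel_measurable_times borel_measurable_const covariant_measurable f g)
  fix h p :: "quat^'m^'m" and w assume *: "h \<in> GL" "p \<in> parabolic e" "p $ e $ e = quat_of_complex w"
  show "a * f (h ** p) + b * g (h ** p) = torus_factor e lam k p w * (a * f h + b * g h)"
    unfolding covariantD[OF f *] covariantD[OF g *] by (simp only: distrib_left mult_ac)
qed

lemma covariant_zero: "covariant (\<lambda>h. 0)" by (simp add: covariant_def)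

lemma inclusion_measurable: "(\<lambda>h. h) \<in> \<nu> \<rightarrow>\<^sub>M GLb"
  by (rule measurable_restrict_space2)
    (auto intro: space_nu_GL haar_measurable_from[OF haar] borel_measurable_continuous_on_restrict continuous_on_id)

lemma measurable_nu: "f \<in> borel_measurable GLb \<Longrightarrow> f \<in> borel_measurable \<nu>"
  by (rule measurable_compose[OF inclusion_measurable])

definition fibre :: "(quat^'m^'m \<Rightarrow> complex) \<Rightarrow> quat^'m^'m \<Rightarrow> quat \<Rightarrow> complex" where
  "fibre f h q = f (h ** diag_at e q)"

lemma diag_Sp1_GL: "h \<in> GL \<Longrightarrow> q \<in> Sp1 \<Longrightarrow> h ** diag_at e q \<in> GL"
  by (rule GL_mult) (simp_all add: diag_at_GL Sp1_nonzero)

lemma fibre_pair_measurable: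
  assumes "f \<in> borel_measurable GLb"
  shows "(\<lambda>x. fibre f (fst x) (snd x)) \<in> borel_measurable (GLb \<Otimes>\<^sub>M \<sigma>)"
proof -
  have "(\<lambda>x. fst x ** diag_at e (snd x)) \<in> (GLb \<Otimes>\<^sub>M \<sigma>) \<rightarrow>\<^sub>M GLb"
  proof (rule measurable_restrict_space2)
    show "(\<lambda>x. fst x ** diag_at e (snd x)) \<in> space (GLb \<Otimes>\<^sub>M \<sigma>) \<rightarrow> GL"
      by (auto simp: space_pair_measure space_GLb space_eq intro: diag_Sp1_GL)
    have 1: "(\<lambda>h. h) \<in> borel_measurable GLb"
      by (rule borel_measurable_continuous_on_restrict[OF continuous_on_id])
    have 2: "diag_at e \<in> borel_measurable \<sigma>"
      by (rule measurable_fromI[OF borel_measurable_continuous_on_restrict[OF continuous_on_diag_at]])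
    show "(\<lambda>x. fst x ** diag_at e (snd x)) \<in> borel_measurable (GLb \<Otimes>\<^sub>M \<sigma>)"
      by (rule measurable_matrix_mult[OF measurable_compose[OF measurable_fst 1] measurable_compose[OF measurable_snd 2]])
  qed
  from measurable_compose[OF this assms] show ?thesis unfolding fibre_def .
qed

lemma fibre_measurable:
  assumes f: "f \<in> borel_measurable GLb" and h: "h \<in> GL" shows "fibre f h \<in> borel_measurable \<sigma>"
  using measurable_compose[OF measurable_Pair1' fibre_pair_measurable[OF f], of h] h by (simp add: space_GLb)

lemma fibre_pair_measurable_nu:
  assumes "f \<in> borel_measurable GLb"
  shows "(\<lambda>x. fibre f (fst x) (snd x)) \<in> borel_measurable (\<nu> \<Otimes>\<^sub>M \<sigma>)"
  using measurable_compose[OF measurable_Pair[OF measurable_compose[OF measurable_fst inclusion_measurable] measurable_snd]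
      fibre_pair_measurable[OF assms]] by simp

lemma fibre_torus:
  assumes f: "covariant f" and h: "h \<in> GL" and q: "q \<in> Sp1"
  shows "fibre f h (q * quat_of_complex (cis t)) = cis (- of_int k * t) * fibre f h q"
proof -
  let ?z = "quat_of_complex (cis t)"
  have z: "?z \<in> Sp1" by (rule cis_in_Sp1)
  have p: "diag_at e ?z \<in> parabolic e" by (rule diag_at_parabolic[OF Sp1_nonzero[OF z]])
  have "modulus e (diag_at e ?z) = 1" by (rule modulus_isometry[OF diag_at_isometry[OF Sp1_norm[OF z]] p])
  then have "torus_factor e lam k (diag_at e ?z) (cis t) = cis (- of_int k * t)"
    by (simp add: torus_factor_def cis_power_int)
  then show ?thesis
    unfolding fibre_def diag_at_mult[symmetric] matrix_mul_assoc
    using covariantD[OF f diag_Sp1_GL[OF h q] p diag_at_ee] by simp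
qed

text \<open>
  The default \<open>0\<close> on fibres that are not square integrable is stable under the
  parabolic subgroup, since right translation by it only rotates and scales fibres. The
  equivariance of the coefficients thus holds at every point of the group and not merely almost
  everywhere.
\<close>

definition fibre_coeff :: "(quat^'m^'m \<Rightarrow> complex) \<Rightarrow> nat \<Rightarrow> quat^'m^'m \<Rightarrow> nat \<Rightarrow> complex" where
  "fibre_coeff f j h = (\<lambda>i. if L2 \<sigma> (fibre f h)
     then of_real (sqrt (Suc j)) * (\<integral>q. fibre f h q * \<tau> j q (coeff_vec k j) i \<partial>\<sigma>) else 0)"

lemma coeff_vec_cvec: "j \<in> admissible k \<Longrightarrow> coeff_vec k j \<in> cvec (Suc j)"
  unfolding coeff_vec_def by (rule weight_vec_cvec[OF weight_position(1)])

lemma rep_coeff_vec_L2: "j \<in> admissible k \<Longrightarrow> L2 \<sigma> (\<lambda>q. \<tau> j q (coeff_vec k j) i)"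
  by (rule L2_continuous[OF unitary_rep_D(7)[OF unitary one_in_Sp1 coeff_vec_cvec]])

lemma rep_coeff_vec_integrable:
  assumes "L2 \<sigma> x" "j \<in> admissible k" shows "complex_integrable \<sigma> (\<lambda>q. x q * \<tau> j q (coeff_vec k j) i)"
  using L2_mult_integrable[OF assms(1) L2_cnj[OF rep_coeff_vec_L2[OF assms(2), of i]]] by simp

lemma L2_iff_nn: "h \<in> GL \<Longrightarrow> f \<in> borel_measurable GLb \<Longrightarrow>
    L2 \<sigma> (fibre f h) \<longleftrightarrow> (\<integral>\<^sup>+q. ennreal ((cmod (fibre f h q))\<^sup>2) \<partial>\<sigma>) < \<infinity>"
  using L2_nn[of \<sigma> "fibre f h"] L2_nnI[OF fibre_measurable[of f h]] by auto

lemma coeff_measurable: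
  assumes f: "f \<in> borel_measurable GLb" and j: "j \<in> admissible k"
  shows "(\<lambda>h. fibre_coeff f j h i) \<in> borel_measurable GLb"
proof -
  note m = fibre_pair_measurable[OF f]
  have mt: "(\<lambda>q. \<tau> j q (coeff_vec k j) i) \<in> borel_measurable \<sigma>" by (rule L2_measurable[OF rep_coeff_vec_L2[OF j]])
  have 1: "(\<lambda>h. \<integral>\<^sup>+q. ennreal ((cmod (fibre f h q))\<^sup>2) \<partial>\<sigma>) \<in> borel_measurable GLb"
    by (rule borel_measurable_nn_integral) (use m in \<open>simp add: split_beta'\<close>)
  have 2: "(\<lambda>h. \<integral>q. fibre f h q * \<tau> j q (coeff_vec k j) i \<partial>\<sigma>) \<in> borel_measurable GLb"
    by (rule borel_measurable_lebesgue_integral)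
      (unfold split_beta', rule borel_measurable_times[OF m measurable_compose[OF measurable_snd mt]])
  have "(\<lambda>h. if (\<integral>\<^sup>+q. ennreal ((cmod (fibre f h q))\<^sup>2) \<partial>\<sigma>) < \<infinity>
     then of_real (sqrt (Suc j)) * (\<integral>q. fibre f h q * \<tau> j q (coeff_vec k j) i \<partial>\<sigma>) else 0) \<in> borel_measurable GLb"
    by (rule measurable_If) (use 1 2 in measurable)
  then show ?thesis
    by (subst measurable_cong[where g = "\<lambda>h. if (\<integral>\<^sup>+q. ennreal ((cmod (fibre f h q))\<^sup>2) \<partial>\<sigma>) < \<infinity>
       then of_real (sqrt (Suc j)) * (\<integral>q. fibre f h q * \<tau> j q (coeff_vec k j) i \<partial>\<sigma>) else 0"])
      (simp_all only: space_GLb fibre_coeff_def L2_iff_nn[OF _ f])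
qed

lemma coeff_cvec:
  assumes j: "j \<in> admissible k" shows "fibre_coeff f j h \<in> cvec (Suc j)"
  unfolding cvec_def
proof (intro CollectI allI impI)
  fix i assume i: "Suc j \<le> i"
  have "(\<integral>q. fibre f h q * \<tau> j q (coeff_vec k j) i \<partial>\<sigma>) = (\<integral>q. 0 \<partial>\<sigma>)"
  proof (rule Bochner_Integration.integral_cong[OF refl])
    fix q assume "q \<in> space \<sigma>"
    then have "\<tau> j q (coeff_vec k j) \<in> cvec (Suc j)" unfolding space_eq by (rule unitary_rep_D(1)[OF unitary _ coeff_vec_cvec[OF j]])
    then show "fibre f h q * \<tau> j q (coeff_vec k j) i = 0" using i by (simp add: cvec_def)
  qed
  then show "fibre_coeff f j h i = 0" by (simp add: fibre_coeff_def)
qed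

lemma omega_inverse:
  assumes p: "p \<in> parabolic e" and v: "v \<in> cvec (Suc j)"
  shows "inv_into (cvec (Suc j)) (omega e lam (\<tau> j) p) v =
    (\<lambda>i. inverse (of_real (norm (p $ e $ e)) powr (\<i> * of_real lam)) * \<tau> j (quat_conj (corner_unit e p)) v i)"
proof -
  let ?u = "corner_unit e p" and ?c = "complex_of_real (norm (p $ e $ e)) powr (\<i> * of_real lam)"
  have c: "?c \<noteq> 0" using parabolic_ee_nonzero[OF p] by simp
  have u: "?u \<in> Sp1" by (rule corner_unit_Sp1[OF p])
  note u' = Sp1_conj[OF u]
  have om: "omega e lam (\<tau> j) p x = (\<lambda>i. ?c * \<tau> j ?u x i)" for x
    by (simp add: omega_def Let_def corner_unit_def)
  have undo1: "\<tau> j (quat_conj ?u) (\<tau> j ?u x) = x" if "x \<in> cvec (Suc j)" for x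
    unfolding unitary_rep_D(5)[OF unitary u u' that, symmetric] Sp1_conj_cancel(2)[OF u]
    by (rule unitary_rep_D(4)[OF unitary u that])
  have undo2: "\<tau> j ?u (\<tau> j (quat_conj ?u) x) = x" if "x \<in> cvec (Suc j)" for x
    unfolding unitary_rep_D(5)[OF unitary u' u that, symmetric] Sp1_conj_cancel(1)[OF u]
    by (rule unitary_rep_D(4)[OF unitary u that])
  show ?thesis
  proof (rule inv_into_f_eq)
    show "inj_on (omega e lam (\<tau> j) p) (cvec (Suc j))"
    proof (rule inj_onI)
      fix x y assume x: "x \<in> cvec (Suc j)" and y: "y \<in> cvec (Suc j)" and "omega e lam (\<tau> j) p x = omega e lam (\<tau> j) p y"
      then have "\<tau> j ?u x = \<tau> j ?u y" using c unfolding om fun_eq_iff by simp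
      then have "\<tau> j (quat_conj ?u) (\<tau> j ?u x) = \<tau> j (quat_conj ?u) (\<tau> j ?u y)" by (rule arg_cong)
      then show "x = y" unfolding undo1[OF x] undo1[OF y] .
    qed
    have 1: "\<tau> j (quat_conj ?u) v \<in> cvec (Suc j)" by (rule unitary_rep_D(1)[OF unitary u' v])
    then show "(\<lambda>i. inverse ?c * \<tau> j (quat_conj ?u) v i) \<in> cvec (Suc j)" by (simp add: cvec_def)
    show "omega e lam (\<tau> j) p (\<lambda>i. inverse ?c * \<tau> j (quat_conj ?u) v i) = v"
      unfolding om unitary_rep_D(3)[OF unitary u 1] undo2[OF v] using c by (simp flip: mult.assoc)
  qed
qed

lemma fibre_parabolic:
  assumes f: "covariant f" and h: "h \<in> GL" and p: "p \<in> parabolic e" and q: "q \<in> Sp1"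
  shows "fibre f (h ** p) q = of_real (modulus e p powr (- 1 / 2)) *
    inverse (of_real (norm (p $ e $ e)) powr (\<i> * of_real lam)) * fibre f h (corner_unit e p * q)"
proof -
  obtain p' where p': "p' \<in> parabolic e" "p ** diag_at e q = diag_at e (corner_unit e p * q) ** p'"
     "p' $ e $ e = quat_of_complex (of_real (norm (p $ e $ e)))" "modulus e p' = modulus e p"
    using parabolic_slide[OF p q] by (elim bexE conjE) (rule that)
  have "torus_factor e lam k p' (of_real (norm (p $ e $ e))) = of_real (modulus e p powr (- 1 / 2)) *
    inverse (of_real (norm (p $ e $ e)) powr (\<i> * of_real lam))"
    using parabolic_ee_nonzero[OF p] by (simp add: torus_factor_def p'(4))
  then show ?thesis
    unfolding fibre_def matrix_mul_assoc[symmetric] p'(2)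
    using covariantD[OF f diag_Sp1_GL[OF h Sp1_mult[OF corner_unit_Sp1[OF p] q]] p'(1,3)]
    by (simp only: matrix_mul_assoc)
qed

lemma L2_translate:
  assumes x: "L2 \<sigma> x" and u: "u \<in> Sp1" shows "L2 \<sigma> (\<lambda>q. x (u * q))"
proof (rule L2_nnI)
  show "(\<lambda>q. x (u * q)) \<in> borel_measurable \<sigma>"
    by (rule measurable_compose[OF measurable_mul_left L2_measurable[OF x]]) (simp add: space_eq u)
  have "(\<integral>\<^sup>+q. ennreal ((cmod (x (u * q)))\<^sup>2) \<partial>\<sigma>) = (\<integral>\<^sup>+q. ennreal ((cmod (x q))\<^sup>2) \<partial>\<sigma>)"
    by (rule nn_integral_left[of "\<lambda>q. ennreal ((cmod (x q))\<^sup>2)"]) (use L2_measurable[OF x] u in \<open>simp_all add: space_eq\<close>)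
  then show "(\<integral>\<^sup>+q. ennreal ((cmod (x (u * q)))\<^sup>2) \<partial>\<sigma>) < \<infinity>" unfolding L2_nn[OF x] by simp
qed

lemma L2_cong: "(\<And>q. q \<in> Sp1 \<Longrightarrow> x q = y q) \<Longrightarrow> L2 \<sigma> x \<longleftrightarrow> L2 \<sigma> y"
  unfolding L2_def by (intro arg_cong2[where f = "(\<and>)"] measurable_cong Bochner_Integration.integrable_cong refl) (simp_all add: space_eq)

lemma L2_fibre_parabolic:
  assumes f: "covariant f" and h: "h \<in> GL" and p: "p \<in> parabolic e" and L: "L2 \<sigma> (fibre f h)"
  shows "L2 \<sigma> (fibre f (h ** p))"
proof -
  have eq: "L2 \<sigma> (fibre f (h ** p)) \<longleftrightarrow> L2 \<sigma> (\<lambda>q. of_real (modulus e p powr (- 1 / 2)) *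
      inverse (of_real (norm (p $ e $ e)) powr (\<i> * of_real lam)) * fibre f h (corner_unit e p * q))"
    by (rule L2_cong) (rule fibre_parabolic[OF f h p])
  show ?thesis unfolding eq by (rule L2_scale[OF L2_translate[OF L corner_unit_Sp1[OF p]]])
qed

text \<open>
  Under a parabolic element the fibre is rotated from the left, and left rotation acts on the
  coefficients through the representation itself.
\<close>

lemma fibre_coeff_parabolic:
  assumes f: "covariant f" and h: "h \<in> GL" and p: "p \<in> parabolic e" and j: "j \<in> admissible k"
  shows "fibre_coeff f j (h ** p) = (\<lambda>i. of_real (modulus e p powr (- 1 / 2)) *
    inv_into (cvec (Suc j)) (omega e lam (\<tau> j) p) (fibre_coeff f j h) i)"
proof
  fix i
  let ?u = "corner_unit e p" let ?c = "inverse (complex_of_real (norm (p $ e $ e)) powr (\<i> * of_real lam))"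
  let ?m = "complex_of_real (modulus e p powr (- 1 / 2))" let ?R = "rep_matrix (\<tau> j) (quat_conj ?u)"
  let ?s = "complex_of_real (sqrt (Suc j))" let ?t = "\<lambda>q. \<tau> j q (coeff_vec k j)"
  have u: "?u \<in> Sp1" by (rule corner_unit_Sp1[OF p])
  note u' = Sp1_conj[OF u] and ev = coeff_vec_cvec[OF j]
  have L: "L2 \<sigma> (fibre f (h ** p)) \<longleftrightarrow> L2 \<sigma> (fibre f h)"
    using L2_fibre_parabolic[OF f h p] L2_fibre_parabolic[OF f GL_mult[OF h parabolic_GL[OF p]] parabolic_inv(1)[OF p]]
    by (auto simp: GL_cancel_right[OF parabolic_GL[OF p]])
  have rhs: "?m * inv_into (cvec (Suc j)) (omega e lam (\<tau> j) p) (fibre_coeff f j h) i = ?m * (?c * mat_act (Suc j) (Suc j) ?R (fibre_coeff f j h) i)"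
    unfolding omega_inverse[OF p coeff_cvec[OF j]] rep_matrix_act[OF unitary u' coeff_cvec[OF j]] ..
  show "fibre_coeff f j (h ** p) i = ?m * inv_into (cvec (Suc j)) (omega e lam (\<tau> j) p) (fibre_coeff f j h) i"
  proof (cases "L2 \<sigma> (fibre f h) \<and> i < Suc j")
    case False
    have z: "fibre_coeff f j h' i = 0" if "\<not> i < Suc j" for h'
      using coeff_cvec[OF j, of f h'] that by (simp add: cvec_def)
    show ?thesis
    proof (cases "i < Suc j")
      case True
      then have "\<not> L2 \<sigma> (fibre f h)" using False by blast
      then show ?thesis unfolding rhs using L by (simp add: fibre_coeff_def mat_act_def del: sum.lessThan_Suc)
    next
      case False
      then show ?thesis unfolding rhs mat_act_def z[OF False] by simp
    qed
  next
    case True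
    then have Lh: "L2 \<sigma> (fibre f h)" and i: "i < Suc j" by simp_all
    have "(\<integral>q. fibre f (h ** p) q * ?t q i \<partial>\<sigma>) = (\<integral>q. (?m * ?c) * (fibre f h (?u * q) * \<tau> j (quat_conj ?u * (?u * q)) (coeff_vec k j) i) \<partial>\<sigma>)"
    proof (rule Bochner_Integration.integral_cong[OF refl])
      fix q assume "q \<in> space \<sigma>"
      then have q: "q \<in> Sp1" by (simp add: space_eq)
      have "quat_conj ?u * (?u * q) = q" using Sp1_conj_cancel[OF u] by (simp flip: mult.assoc)
      then show "fibre f (h ** p) q * ?t q i = (?m * ?c) * (fibre f h (?u * q) * \<tau> j (quat_conj ?u * (?u * q)) (coeff_vec k j) i)"
        unfolding fibre_parabolic[OF f h p q] by (simp only: mult.assoc)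
    qed
    also have "\<dots> = (?m * ?c) * (\<integral>q. fibre f h (?u * q) * \<tau> j (quat_conj ?u * (?u * q)) (coeff_vec k j) i \<partial>\<sigma>)"
      by (rule Bochner_Integration.integral_mult_right_zero)
    also have "(\<integral>q. fibre f h (?u * q) * \<tau> j (quat_conj ?u * (?u * q)) (coeff_vec k j) i \<partial>\<sigma>)
        = (\<integral>q. fibre f h q * \<tau> j (quat_conj ?u * q) (coeff_vec k j) i \<partial>\<sigma>)"
    proof (rule integral_left[of "\<lambda>q. fibre f h q * \<tau> j (quat_conj ?u * q) (coeff_vec k j) i"])
      have "(\<lambda>q. \<tau> j (quat_conj ?u * q) (coeff_vec k j) i) \<in> borel_measurable \<sigma>"
        by (rule L2_measurable[OF L2_translate[OF rep_coeff_vec_L2[OF j] u']])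
      then show "(\<lambda>q. fibre f h q * \<tau> j (quat_conj ?u * q) (coeff_vec k j) i) \<in> borel_measurable \<sigma>"
        by (intro borel_measurable_times L2_measurable[OF Lh])
      show "?u \<in> space \<sigma>" using u by (simp only: space_eq)
    qed
    also have "\<dots> = (\<integral>q. (\<Sum>b<Suc j. ?R i b * (fibre f h q * ?t q b)) \<partial>\<sigma>)"
    proof (rule Bochner_Integration.integral_cong[OF refl])
      fix q assume "q \<in> space \<sigma>"
      then have q: "q \<in> Sp1" by (simp add: space_eq)
      have "\<tau> j (quat_conj ?u * q) (coeff_vec k j) = mat_act (Suc j) (Suc j) ?R (?t q)"
        unfolding unitary_rep_D(5)[OF unitary q u' ev] by (rule rep_matrix_act[OF unitary u' unitary_rep_D(1)[OF unitary q ev]])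
      then show "fibre f h q * \<tau> j (quat_conj ?u * q) (coeff_vec k j) i = (\<Sum>b<Suc j. ?R i b * (fibre f h q * ?t q b))"
        using i by (simp only: mat_act_def if_True sum_distrib_left mult.left_commute)
    qed
    also have "\<dots> = (\<Sum>b<Suc j. \<integral>q. ?R i b * (fibre f h q * ?t q b) \<partial>\<sigma>)"
      by (rule Bochner_Integration.integral_sum) (intro integrable_mult_right rep_coeff_vec_integrable Lh j)
    also have "\<dots> = (\<Sum>b<Suc j. ?R i b * (\<integral>q. fibre f h q * ?t q b \<partial>\<sigma>))"
      by (simp only: Bochner_Integration.integral_mult_right_zero)
    finally have "fibre_coeff f j (h ** p) i = ?s * ((?m * ?c) * (\<Sum>b<Suc j. ?R i b * (\<integral>q. fibre f h q * ?t q b \<partial>\<sigma>)))"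
      unfolding fibre_coeff_def using L Lh by (simp only: if_True)
    also have "\<dots> = ?m * (?c * (\<Sum>b<Suc j. ?R i b * (?s * (\<integral>q. fibre f h q * ?t q b \<partial>\<sigma>))))"
      by (simp only: sum_distrib_left mult_ac)
    finally have fin: "fibre_coeff f j (h ** p) i = ?m * (?c * (\<Sum>b<Suc j. ?R i b * (?s * (\<integral>q. fibre f h q * ?t q b \<partial>\<sigma>))))" .
    show ?thesis unfolding rhs fin unfolding mat_act_def fibre_coeff_def using Lh i by (simp only: if_True)
  qed
qed

lemma coeff_lincomb:
  assumes f: "L2 \<sigma> (fibre f h)" and g: "L2 \<sigma> (fibre g h)" and j: "j \<in> admissible k"
  shows "L2 \<sigma> (fibre (\<lambda>h. a * f h + b * g h) h)"
    "fibre_coeff (\<lambda>h. a * f h + b * g h) j h i = a * fibre_coeff f j h i + b * fibre_coeff g j h i"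
proof -
  have fb: "fibre (\<lambda>h. a * f h + b * g h) h = (\<lambda>q. a * fibre f h q + b * fibre g h q)"
    by (simp add: fibre_def fun_eq_iff)
  show L: "L2 \<sigma> (fibre (\<lambda>h. a * f h + b * g h) h)" unfolding fb by (intro L2_add L2_scale f g)
  let ?t = "\<lambda>q. \<tau> j q (coeff_vec k j) i"
  have "(\<integral>q. (a * fibre f h q + b * fibre g h q) * ?t q \<partial>\<sigma>) = (\<integral>q. a * (fibre f h q * ?t q) + b * (fibre g h q * ?t q) \<partial>\<sigma>)"
    by (simp only: distrib_right mult.assoc)
  also have "\<dots> = (\<integral>q. a * (fibre f h q * ?t q) \<partial>\<sigma>) + (\<integral>q. b * (fibre g h q * ?t q) \<partial>\<sigma>)"
    by (rule Bochner_Integration.integral_add) (intro integrable_mult_right rep_coeff_vec_integrable f g j)+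
  also have "\<dots> = a * (\<integral>q. fibre f h q * ?t q \<partial>\<sigma>) + b * (\<integral>q. fibre g h q * ?t q \<partial>\<sigma>)"
    by (simp only: Bochner_Integration.integral_mult_right_zero)
  finally show "fibre_coeff (\<lambda>h. a * f h + b * g h) j h i = a * fibre_coeff f j h i + b * fibre_coeff g j h i"
    unfolding fibre_coeff_def if_P[OF L] if_P[OF f] if_P[OF g] unfolding fb by (simp only: distrib_left mult_ac)
qed

text \<open>
  The corner unit quaternions lie in the compact group, whose measure is right invariant.
\<close>

lemma fibre_norm:
  assumes f: "covariant f"
  shows "(\<integral>\<^sup>+h. (\<integral>\<^sup>+q. ennreal ((cmod (fibre f h q))\<^sup>2) \<partial>\<sigma>) \<partial>\<nu>) = (\<integral>\<^sup>+h. ennreal ((cmod (f h))\<^sup>2) \<partial>\<nu>)"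
proof -
  note m = fibre_pair_measurable_nu[OF covariant_measurable[OF f]]
  interpret P: pair_sigma_finite \<nu> \<sigma> ..
  have mm: "(\<lambda>(h, q). ennreal ((cmod (fibre f h q))\<^sup>2)) \<in> borel_measurable (\<nu> \<Otimes>\<^sub>M \<sigma>)"
    using m by (simp add: split_beta')
  have "(\<integral>\<^sup>+h. (\<integral>\<^sup>+q. ennreal ((cmod (fibre f h q))\<^sup>2) \<partial>\<sigma>) \<partial>\<nu>) = (\<integral>\<^sup>+q. (\<integral>\<^sup>+h. ennreal ((cmod (fibre f h q))\<^sup>2) \<partial>\<nu>) \<partial>\<sigma>)"
    by (rule P.Fubini'[OF mm, symmetric])
  also have "\<dots> = (\<integral>\<^sup>+q. (\<integral>\<^sup>+h. ennreal ((cmod (f h))\<^sup>2) \<partial>\<nu>) \<partial>\<sigma>)"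
  proof (rule nn_integral_cong)
    fix q assume "q \<in> space \<sigma>"
    then have "diag_at e q \<in> space \<nu>" unfolding space_nu space_eq by (intro diag_at_isometry Sp1_norm)
    moreover have "(\<lambda>h. ennreal ((cmod (f h))\<^sup>2)) \<in> borel_measurable \<nu>"
      using measurable_nu[OF covariant_measurable[OF f]] by simp
    ultimately show "(\<integral>\<^sup>+h. ennreal ((cmod (fibre f h q))\<^sup>2) \<partial>\<nu>) = (\<integral>\<^sup>+h. ennreal ((cmod (f h))\<^sup>2) \<partial>\<nu>)"
      unfolding fibre_def by (intro H.nn_integral_right)
  qed
  also have "\<dots> = (\<integral>\<^sup>+h. ennreal ((cmod (f h))\<^sup>2) \<partial>\<nu>)" by (simp add: emeasure_space_1)
  finally show ?thesis .
qed

lemma fibre_L2_AE: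
  assumes f: "covariant f" and L: "L2 \<nu> f" shows "AE h in \<nu>. L2 \<sigma> (fibre f h)"
proof -
  note m = fibre_pair_measurable_nu[OF covariant_measurable[OF f]]
  have "AE h in \<nu>. (\<integral>\<^sup>+q. ennreal ((cmod (fibre f h q))\<^sup>2) \<partial>\<sigma>) \<noteq> \<infinity>"
  proof (rule nn_integral_PInf_AE)
    show "(\<lambda>h. \<integral>\<^sup>+q. ennreal ((cmod (fibre f h q))\<^sup>2) \<partial>\<sigma>) \<in> borel_measurable \<nu>"
      by (rule borel_measurable_nn_integral) (use m in \<open>simp add: split_beta'\<close>)
    show "(\<integral>\<^sup>+h. (\<integral>\<^sup>+q. ennreal ((cmod (fibre f h q))\<^sup>2) \<partial>\<sigma>) \<partial>\<nu>) \<noteq> \<infinity>"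
      unfolding fibre_norm[OF f] L2_nn[OF L] by simp
  qed
  then show ?thesis
    by (rule AE_mp) (auto intro!: AE_I2 simp: L2_iff_nn[OF space_nu_GL covariant_measurable[OF f]] less_top)
qed

definition coeff_norm :: "(quat^'m^'m \<Rightarrow> complex) \<Rightarrow> nat \<Rightarrow> quat^'m^'m \<Rightarrow> real" where
  "coeff_norm f j h = (if j \<in> admissible k then \<Sum>a<Suc j. (cmod (fibre_coeff f j h a))\<^sup>2 else 0)"

lemma coeff_norm_nonneg: "0 \<le> coeff_norm f j h"
  by (simp add: coeff_norm_def sum_nonneg)

lemma coeff_norm_measurable:
  assumes "f \<in> borel_measurable GLb" shows "coeff_norm f j \<in> borel_measurable \<nu>"
proof (cases "j \<in> admissible k")
  case True
  have "(\<lambda>h. fibre_coeff f j h a) \<in> borel_measurable \<nu>" for a by (rule measurable_nu[OF coeff_measurable[OF assms True]])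
  with True have "(\<lambda>h. coeff_norm f j h) \<in> borel_measurable \<nu>" unfolding coeff_norm_def by simp
  then show ?thesis .
next
  case False
  then have "coeff_norm f j = (\<lambda>h. 0)" by (simp add: coeff_norm_def fun_eq_iff)
  then show ?thesis by simp
qed

text \<open>
  Parseval's identity on each fibre, integrated over the compact group.
\<close>

lemma coeff_total:
  assumes f: "covariant f" and L: "AE h in \<nu>. L2 \<sigma> (fibre f h)"
  shows "(\<Sum>j. \<integral>\<^sup>+h. ennreal (coeff_norm f j h) \<partial>\<nu>) = (\<integral>\<^sup>+h. ennreal ((cmod (f h))\<^sup>2) \<partial>\<nu>)"
proof -
  have "(\<Sum>j. \<integral>\<^sup>+h. ennreal (coeff_norm f j h) \<partial>\<nu>) = (\<integral>\<^sup>+h. (\<Sum>j. ennreal (coeff_norm f j h)) \<partial>\<nu>)"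
    by (rule nn_integral_suminf[symmetric]) (use coeff_norm_measurable[OF covariant_measurable[OF f]] in simp)
  also have "\<dots> = (\<integral>\<^sup>+h. (\<integral>\<^sup>+q. ennreal ((cmod (fibre f h q))\<^sup>2) \<partial>\<sigma>) \<partial>\<nu>)"
  proof (rule nn_integral_cong_AE, rule AE_mp[OF L], intro AE_I2 impI)
    fix h assume h: "h \<in> space \<nu>" and Lh: "L2 \<sigma> (fibre f h)"
    have "(\<lambda>j. coeff_norm f j h) sums sqnorm \<sigma> (fibre f h)"
      unfolding coeff_norm_def fibre_coeff_def if_P[OF Lh]
      by (rule parseval_weight[OF Lh fibre_torus[OF f space_nu_GL[OF h]]])
    then show "(\<Sum>j. ennreal (coeff_norm f j h)) = (\<integral>\<^sup>+q. ennreal ((cmod (fibre f h q))\<^sup>2) \<partial>\<sigma>)"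
      unfolding L2_nn[OF Lh] by (intro suminf_ennreal_eq coeff_norm_nonneg)
  qed
  finally show ?thesis unfolding fibre_norm[OF f] .
qed

lemma coeff_norm_sums:
  assumes f: "covariant f" and L: "L2 \<nu> f"
  shows "integrable \<nu> (coeff_norm f j)" "(\<lambda>j. \<integral>h. coeff_norm f j h \<partial>\<nu>) sums sqnorm \<nu> f"
proof -
  note m = coeff_norm_measurable[OF covariant_measurable[OF f]]
  have tot: "(\<Sum>j. \<integral>\<^sup>+h. ennreal (coeff_norm f j h) \<partial>\<nu>) = ennreal (sqnorm \<nu> f)"
    unfolding coeff_total[OF f fibre_L2_AE[OF f L]] by (rule L2_nn[OF L])
  show int: "integrable \<nu> (coeff_norm f j)" for j
  proof (rule integrableI_nonneg[OF m])
    show "AE h in \<nu>. 0 \<le> coeff_norm f j h" by (simp add: coeff_norm_nonneg)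
    have "(\<integral>\<^sup>+h. ennreal (coeff_norm f j h) \<partial>\<nu>) \<le> ennreal (sqnorm \<nu> f)"
      unfolding tot[symmetric] using sum_le_suminf[of "\<lambda>j. \<integral>\<^sup>+h. ennreal (coeff_norm f j h) \<partial>\<nu>" "{j}"] by simp
    then show "(\<integral>\<^sup>+h. ennreal (coeff_norm f j h) \<partial>\<nu>) < \<infinity>" by (rule order_le_less_trans) simp
  qed
  have nn: "(\<integral>\<^sup>+h. ennreal (coeff_norm f j h) \<partial>\<nu>) = ennreal (\<integral>h. coeff_norm f j h \<partial>\<nu>)" for j
    by (rule nn_integral_eq_integral[OF int]) (simp add: coeff_norm_nonneg)
  have pos: "0 \<le> (\<integral>h. coeff_norm f j h \<partial>\<nu>)" for j by (simp add: coeff_norm_nonneg)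
  note t = tot[unfolded nn]
  have sm: "summable (\<lambda>j. \<integral>h. coeff_norm f j h \<partial>\<nu>)"
    by (rule summable_suminf_not_top[OF pos]) (simp add: t)
  have "ennreal (\<Sum>j. \<integral>h. coeff_norm f j h \<partial>\<nu>) = ennreal (sqnorm \<nu> f)"
    using suminf_ennreal2[OF pos sm] t by simp
  then have "(\<Sum>j. \<integral>h. coeff_norm f j h \<partial>\<nu>) = sqnorm \<nu> f"
    using suminf_nonneg[OF sm pos] by (simp add: ennreal_inj)
  with sm show "(\<lambda>j. \<integral>h. coeff_norm f j h \<partial>\<nu>) sums sqnorm \<nu> f" by (simp add: sums_iff)
qed

lemma coeff_L2:
  assumes f: "covariant f" and L: "L2 \<nu> f" and j: "j \<in> admissible k"
  shows "L2 \<nu> (\<lambda>h. fibre_coeff f j h i)"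
proof (cases "i < Suc j")
  case True
  have m: "(\<lambda>h. fibre_coeff f j h i) \<in> borel_measurable \<nu>" by (rule measurable_nu[OF coeff_measurable[OF covariant_measurable[OF f] j]])
  have "integrable \<nu> (\<lambda>h. (cmod (fibre_coeff f j h i))\<^sup>2)"
  proof (rule Bochner_Integration.integrable_bound[OF coeff_norm_sums(1)[OF f L, of j]])
    show "(\<lambda>h. (cmod (fibre_coeff f j h i))\<^sup>2) \<in> borel_measurable \<nu>" using m by simp
    have "(cmod (fibre_coeff f j h i))\<^sup>2 \<le> coeff_norm f j h" for h
      unfolding coeff_norm_def if_P[OF j] using True by (intro member_le_sum) auto
    then show "AE h in \<nu>. norm ((cmod (fibre_coeff f j h i))\<^sup>2) \<le> norm (coeff_norm f j h)" by (simp add: coeff_norm_nonneg)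
  qed
  with m show ?thesis unfolding L2_def by blast
next
  case False
  then have "(\<lambda>h. fibre_coeff f j h i) = (\<lambda>h. 0)" using coeff_cvec[OF j, of f] by (simp add: cvec_def fun_eq_iff)
  then show ?thesis by (simp add: L2_zero)
qed

end

section \<open>Synthesis from fibre coefficients\<close>

text \<open>Inner products are recovered from norms by polarization; \<open>polar\<close> is the combination used.\<close>

definition polar :: "(complex \<Rightarrow> real) \<Rightarrow> complex" where
  "polar N = (1 / 4) * of_real (N 1) + (- (1 / 4)) * of_real (N (- 1)) +
     (\<i> / 4) * of_real (N \<i>) + (- (\<i> / 4)) * of_real (N (- \<i>))"

lemma polarization: "x * cnj y = polar (\<lambda>c. (cmod (x + c * y))\<^sup>2)"
  unfolding polar_def complex_norm_square by (simp add: algebra_simps)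

lemma polar_sum: "(\<Sum>a\<in>A. polar (\<lambda>c. N c a)) = polar (\<lambda>c. \<Sum>a\<in>A. N c a)"
  unfolding polar_def by (simp only: sum.distrib sum_distrib_left of_real_sum)

lemma polar_integral:
  assumes "\<And>c. integrable M (N c)"
  shows "(\<integral>x. polar (\<lambda>c. N c x) \<partial>M) = polar (\<lambda>c. \<integral>x. N c x \<partial>M)"
proof -
  have i: "complex_integrable M (\<lambda>x. a * of_real (N c x))" for a c
    by (intro integrable_mult_right integrable_of_real assms)
  have v: "(\<integral>x. a * complex_of_real (N c x) \<partial>M) = a * of_real (\<integral>x. N c x \<partial>M)" for a c
    by (simp only: Bochner_Integration.integral_mult_right_zero integral_complex_of_real)
  show ?thesis
    unfolding polar_def
    by (simp only: Bochner_Integration.integral_add Bochner_Integration.integrable_add i v)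
qed

lemma polar_has_sum:
  assumes "\<And>c. (N c has_sum S c) A" shows "((\<lambda>j. polar (\<lambda>c. N c j)) has_sum polar S) A"
  unfolding polar_def by (intro has_sum_add has_sum_cmult_right has_sum_of_real assms)

context branching
begin

lemma covariant_one_lincomb: "covariant f \<Longrightarrow> covariant g \<Longrightarrow> covariant (\<lambda>h. f h + c * g h)"
  using covariant_lincomb[of f g 1 c] by simp

lemma L2_one_lincomb: "L2 M f \<Longrightarrow> L2 M g \<Longrightarrow> L2 M (\<lambda>h. f h + c * g h)"
  by (intro L2_add L2_scale)

lemma coeff_one_lincomb:
  assumes "L2 \<sigma> (fibre f h)" "L2 \<sigma> (fibre g h)" "j \<in> admissible k"
  shows "fibre_coeff (\<lambda>h. f h + c * g h) j h i = fibre_coeff f j h i + c * fibre_coeff g j h i"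
    "L2 \<sigma> (fibre (\<lambda>h. f h + c * g h) h)"
  using coeff_lincomb[OF assms, of 1 c] by simp_all

lemma coeff_norm_has_sum:
  assumes "covariant f" "L2 \<nu> f"
  shows "((\<lambda>j. \<integral>h. (\<Sum>a<Suc j. (cmod (fibre_coeff f j h a))\<^sup>2) \<partial>\<nu>) has_sum sqnorm \<nu> f) (admissible k)"
proof -
  have "((\<lambda>j. \<integral>h. coeff_norm f j h \<partial>\<nu>) has_sum sqnorm \<nu> f) UNIV"
    by (rule sums_nonneg_imp_has_sum[OF coeff_norm_sums(2)[OF assms]]) (simp add: coeff_norm_nonneg)
  then show ?thesis
    by (rule iffD1[OF has_sum_cong_neutral, rotated 3]) (simp_all add: coeff_norm_def del: sum.lessThan_Suc)
qed

lemma coeff_inner_has_sum: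
  assumes f: "covariant f" "L2 \<nu> f" and g: "covariant g" "L2 \<nu> g"
  shows "((\<lambda>j. \<integral>h. cinner (Suc j) (fibre_coeff f j h) (fibre_coeff g j h) \<partial>\<nu>) has_sum (\<integral>h. f h * cnj (g h) \<partial>\<nu>)) (admissible k)"
proof -
  let ?F = "\<lambda>c h. f h + c * g h"
  have F: "covariant (?F c)" "L2 \<nu> (?F c)" for c
    by (rule covariant_one_lincomb[OF f(1) g(1)], rule L2_one_lincomb[OF f(2) g(2)])
  have tot: "(\<integral>h. f h * cnj (g h) \<partial>\<nu>) = polar (\<lambda>c. sqnorm \<nu> (?F c))"
    unfolding polarization by (rule polar_integral) (rule L2_integrable[OF F(2)])
  have each: "(\<integral>h. cinner (Suc j) (fibre_coeff f j h) (fibre_coeff g j h) \<partial>\<nu>) =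
      polar (\<lambda>c. \<integral>h. (\<Sum>a<Suc j. (cmod (fibre_coeff (?F c) j h a))\<^sup>2) \<partial>\<nu>)" if j: "j \<in> admissible k" for j
  proof -
    have L: "L2 \<nu> (\<lambda>h. fibre_coeff f j h a + c * fibre_coeff g j h a)" for a c
      by (rule L2_one_lincomb[OF coeff_L2[OF f j] coeff_L2[OF g j]])
    have "(\<integral>h. cinner (Suc j) (fibre_coeff f j h) (fibre_coeff g j h) \<partial>\<nu>) =
        polar (\<lambda>c. \<integral>h. (\<Sum>a<Suc j. (cmod (fibre_coeff f j h a + c * fibre_coeff g j h a))\<^sup>2) \<partial>\<nu>)"
      unfolding cinner_def polarization polar_sum
      by (rule polar_integral) (intro Bochner_Integration.integrable_sum L2_integrable L)
    also have "(\<lambda>c. \<integral>h. (\<Sum>a<Suc j. (cmod (fibre_coeff f j h a + c * fibre_coeff g j h a))\<^sup>2) \<partial>\<nu>)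
        = (\<lambda>c. \<integral>h. (\<Sum>a<Suc j. (cmod (fibre_coeff (?F c) j h a))\<^sup>2) \<partial>\<nu>)"
    proof
      fix c
      show "(\<integral>h. (\<Sum>a<Suc j. (cmod (fibre_coeff f j h a + c * fibre_coeff g j h a))\<^sup>2) \<partial>\<nu>)
        = (\<integral>h. (\<Sum>a<Suc j. (cmod (fibre_coeff (?F c) j h a))\<^sup>2) \<partial>\<nu>)"
      proof (rule Bochner_Integration.integral_cong_AE)
        have "(\<lambda>h. (cmod (fibre_coeff f j h a + c * fibre_coeff g j h a))\<^sup>2) \<in> borel_measurable \<nu>" for a
          by (rule borel_measurable_integrable[OF L2_integrable[OF L]])
        then show "(\<lambda>h. \<Sum>a<Suc j. (cmod (fibre_coeff f j h a + c * fibre_coeff g j h a))\<^sup>2) \<in> borel_measurable \<nu>"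
          by (intro borel_measurable_sum)
        have "(\<lambda>h. (cmod (fibre_coeff (?F c) j h a))\<^sup>2) \<in> borel_measurable \<nu>" for a
          by (rule borel_measurable_integrable[OF L2_integrable[OF coeff_L2[OF F j]]])
        then show "(\<lambda>h. \<Sum>a<Suc j. (cmod (fibre_coeff (?F c) j h a))\<^sup>2) \<in> borel_measurable \<nu>"
          by (intro borel_measurable_sum)
        show "AE h in \<nu>. (\<Sum>a<Suc j. (cmod (fibre_coeff f j h a + c * fibre_coeff g j h a))\<^sup>2) = (\<Sum>a<Suc j. (cmod (fibre_coeff (?F c) j h a))\<^sup>2)"
          using fibre_L2_AE[OF f] fibre_L2_AE[OF g]
        proof eventually_elim
          case (elim h)
          show ?case unfolding coeff_one_lincomb(1)[OF elim j] ..
        qed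
      qed
    qed
    finally show ?thesis .
  qed
  have "((\<lambda>j. polar (\<lambda>c. \<integral>h. (\<Sum>a<Suc j. (cmod (fibre_coeff (?F c) j h a))\<^sup>2) \<partial>\<nu>)) has_sum polar (\<lambda>c. sqnorm \<nu> (?F c))) (admissible k)"
    by (rule polar_has_sum) (rule coeff_norm_has_sum[OF F])
  then show ?thesis unfolding tot by (rule iffD2[OF has_sum_cong, rotated]) (rule each)
qed

lemma pi_H_vectors:
  "F \<in> vectors (pi_H \<nu> e lam \<tau> j) \<longleftrightarrow>
     (\<forall>h\<in>GL. F h \<in> cvec (Suc j)) \<and> (\<forall>i. (\<lambda>h. F h i) \<in> borel_measurable GLb) \<and>
     (\<forall>h\<in>GL. \<forall>p\<in>parabolic e. F (h ** p) = (\<lambda>i. of_real (modulus e p powr (- 1 / 2)) *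
        inv_into (cvec (Suc j)) (omega e lam (\<tau> j) p) (F h) i)) \<and>
     integrable \<nu> (\<lambda>h. cinner (Suc j) (F h) (F h))"
  by (simp only: pi_H_def induced_rep_def hilbert_rep.simps mem_Collect_eq Suc_eq_plus1)

lemma coeff_pi_H:
  assumes f: "covariant f" "L2 \<nu> f" and j: "j \<in> admissible k"
  shows "fibre_coeff f j \<in> vectors (pi_H \<nu> e lam \<tau> j)"
  unfolding pi_H_vectors
proof (intro conjI ballI allI)
  show "fibre_coeff f j h \<in> cvec (Suc j)" for h by (rule coeff_cvec[OF j])
  show "(\<lambda>h. fibre_coeff f j h i) \<in> borel_measurable GLb" for i by (rule coeff_measurable[OF covariant_measurable[OF f(1)] j])
  show "fibre_coeff f j (h ** p) = (\<lambda>i. of_real (modulus e p powr (- 1 / 2)) *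
        inv_into (cvec (Suc j)) (omega e lam (\<tau> j) p) (fibre_coeff f j h) i)" if "h \<in> GL" "p \<in> parabolic e" for h p
    by (rule fibre_coeff_parabolic[OF f(1) that j])
  show "complex_integrable \<nu> (\<lambda>h. cinner (Suc j) (fibre_coeff f j h) (fibre_coeff f j h))"
    unfolding cinner_def by (intro Bochner_Integration.integrable_sum L2_mult_integrable coeff_L2[OF f j])
qed

lemma pi_H_L2:
  assumes F: "F \<in> vectors (pi_H \<nu> e lam \<tau> j)"
  shows "L2 \<nu> (\<lambda>h. F h a)"
proof (cases "a < Suc j")
  case True
  have m: "(\<lambda>h. F h a) \<in> borel_measurable \<nu>" using F unfolding pi_H_vectors by (intro measurable_nu) (elim conjE, erule spec)
  have "complex_integrable \<nu> (\<lambda>h. cinner (Suc j) (F h) (F h))" using F unfolding pi_H_vectors by (elim conjE)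
  then have int: "integrable \<nu> (\<lambda>h. \<Sum>i<Suc j. (cmod (F h i))\<^sup>2)"
    unfolding cinner_self complex_of_real_integrable_eq .
  have "integrable \<nu> (\<lambda>h. (cmod (F h a))\<^sup>2)"
  proof (rule Bochner_Integration.integrable_bound[OF int])
    show "(\<lambda>h. (cmod (F h a))\<^sup>2) \<in> borel_measurable \<nu>" using m by simp
    have "(cmod (F h a))\<^sup>2 \<le> (\<Sum>i<Suc j. (cmod (F h i))\<^sup>2)" for h using True by (intro member_le_sum) auto
    moreover have "0 \<le> (\<Sum>i<Suc j. (cmod (F h i))\<^sup>2)" for h by (rule sum_nonneg) simp
    ultimately show "AE h in \<nu>. norm ((cmod (F h a))\<^sup>2) \<le> norm (\<Sum>i<Suc j. (cmod (F h i))\<^sup>2)" by (simp del: sum.lessThan_Suc)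
  qed
  with m show ?thesis unfolding L2_def by (rule conjI)
next
  case False
  have z: "F h a = 0" if "h \<in> space \<nu>" for h
    using F False space_nu_GL[OF that] unfolding pi_H_vectors by (auto simp: cvec_def)
  have "(\<lambda>h. F h a) \<in> borel_measurable \<nu>" using F unfolding pi_H_vectors by (intro measurable_nu) (elim conjE, erule spec)
  moreover have "integrable \<nu> (\<lambda>h. (cmod (F h a))\<^sup>2)"
    by (subst Bochner_Integration.integrable_cong[where g = "\<lambda>h. 0", OF refl]) (simp_all add: z)
  ultimately show ?thesis unfolding L2_def by (rule conjI)
qed

lemma rep_adjoint:
  assumes u: "u \<in> Sp1" and v: "v \<in> cvec (Suc j)" and x: "x \<in> cvec (Suc j)"
  shows "cinner (Suc j) (\<tau> j (quat_conj u) v) x = cinner (Suc j) v (\<tau> j u x)"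
proof -
  have "\<tau> j u (\<tau> j (quat_conj u) v) = v"
    unfolding unitary_rep_D(5)[OF unitary Sp1_conj[OF u] u v, symmetric] Sp1_conj_cancel(1)[OF u]
    by (rule unitary_rep_D(4)[OF unitary u v])
  then show ?thesis
    using unitary_rep_D(6)[OF unitary u unitary_rep_D(1)[OF unitary Sp1_conj[OF u] v] x] by simp
qed

text \<open>The scalar function whose only nonzero coefficient is the given vector-valued function.\<close>

definition synth :: "(quat^'m^'m \<Rightarrow> nat \<Rightarrow> complex) \<Rightarrow> nat \<Rightarrow> quat^'m^'m \<Rightarrow> complex" where
  "synth F j h = of_real (sqrt (Suc j)) * cinner (Suc j) (F h) (coeff_vec k j)"

lemma synth_parabolic:
  assumes F: "F \<in> vectors (pi_H \<nu> e lam \<tau> j)" and j: "j \<in> admissible k" and h: "h \<in> GL" and p: "p \<in> parabolic e"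
  shows "synth F j (h ** p) = of_real (modulus e p powr (- 1 / 2)) *
    (inverse (of_real (norm (p $ e $ e)) powr (\<i> * of_real lam)) *
     (of_real (sqrt (Suc j)) * cinner (Suc j) (F h) (\<tau> j (corner_unit e p) (coeff_vec k j))))"
proof -
  have v: "F h \<in> cvec (Suc j)" using F h unfolding pi_H_vectors by (elim conjE) (erule bspec)
  have "F (h ** p) = (\<lambda>i. of_real (modulus e p powr (- 1 / 2)) * inv_into (cvec (Suc j)) (omega e lam (\<tau> j) p) (F h) i)"
    using F h p unfolding pi_H_vectors by (elim conjE) (drule bspec, assumption, drule bspec, assumption+)
  then show ?thesis
    unfolding synth_def omega_inverse[OF p v] rep_adjoint[OF corner_unit_Sp1[OF p] v coeff_vec_cvec[OF j], symmetric]
    by (simp only: cinner_def sum_distrib_left mult_ac)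
qed

text \<open>
  The pairing is with a vector of weight \<open>k\<close>, on which the phase of a complex
  corner entry acts by its \<open>k\<close>-th power.
\<close>

lemma synth_covariant:
  assumes F: "F \<in> vectors (pi_H \<nu> e lam \<tau> j)" and j: "j \<in> admissible k"
  shows "covariant (synth F j)"
  unfolding covariant_def
proof (intro conjI ballI allI impI)
  have m: "(\<lambda>h. F h i) \<in> borel_measurable GLb" for i using F unfolding pi_H_vectors by (elim conjE) (erule spec)
  show "synth F j \<in> borel_measurable GLb"
    unfolding synth_def[abs_def] cinner_def
    by (intro borel_measurable_times borel_measurable_sum borel_measurable_const m)
  fix h p :: "quat^'m^'m" and w assume h: "h \<in> GL" and p: "p \<in> parabolic e" and w: "p $ e $ e = quat_of_complex w"
  have n: "norm (p $ e $ e) = cmod w" by (simp only: w norm_quat_of_complex)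
  have w0: "cmod w \<noteq> 0" using parabolic_ee_nonzero[OF p] n by (metis norm_eq_zero)
  define t where "t = Arg w"
  have t: "cis t = w / of_real (cmod w)"
    using cis_Arg[of w] w0 by (simp add: t_def sgn_eq)
  have u: "corner_unit e p = quat_of_complex (cis t)"
    unfolding corner_unit_def w norm_quat_of_complex t
    by (simp add: quat_of_complex_def scaleR_quat_def Re_divide_of_real Im_divide_of_real)
  have "\<tau> j (corner_unit e p) (coeff_vec k j) = (\<lambda>i. cis (of_int k * t) * coeff_vec k j i)"
    unfolding u coeff_vec_def weight_vec_torus[OF weight_position(1)[OF j]] weight_position(2)[OF j] ..
  then have "cinner (Suc j) (F h) (\<tau> j (corner_unit e p) (coeff_vec k j)) = cnj (cis (of_int k * t)) * cinner (Suc j) (F h) (coeff_vec k j)"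
    by (simp only: cinner_def complex_cnj_mult sum_distrib_left mult_ac)
  also have "cnj (cis (of_int k * t)) = inverse ((w / of_real (cmod w)) powi k)"
    unfolding t[symmetric] cis_power_int by (simp add: cis_cnj)
  finally show "synth F j (h ** p) = torus_factor e lam k p w * synth F j h"
    unfolding synth_parabolic[OF F j h p] n by (simp only: synth_def torus_factor_def inverse_mult_distrib mult_ac)
qed

lemma synth_fibre:
  assumes F: "F \<in> vectors (pi_H \<nu> e lam \<tau> j)" and j: "j \<in> admissible k" and h: "h \<in> GL" and q: "q \<in> Sp1"
  shows "fibre (synth F j) h q = of_real (sqrt (Suc j)) * cinner (Suc j) (F h) (\<tau> j q (coeff_vec k j))"
proof -
  have p: "diag_at e q \<in> parabolic e" by (rule diag_at_parabolic[OF Sp1_nonzero[OF q]])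
  have "modulus e (diag_at e q) = 1" by (rule modulus_isometry[OF diag_at_isometry[OF Sp1_norm[OF q]] p])
  moreover have "corner_unit e (diag_at e q) = q" by (simp add: corner_unit_def Sp1_norm[OF q])
  ultimately show ?thesis
    unfolding fibre_def synth_parabolic[OF F j h p] by (simp only: diag_at_ee Sp1_norm[OF q]) simp
qed

lemma coeff_synth:
  assumes F: "F \<in> vectors (pi_H \<nu> e lam \<tau> j)" and j: "j \<in> admissible k" and h: "h \<in> GL"
  shows "L2 \<sigma> (fibre (synth F j) h)"
    "i \<in> admissible k \<Longrightarrow> fibre_coeff (synth F j) i h = (\<lambda>a. if i = j then F h a else 0)"
proof -
  have v: "F h \<in> cvec (Suc j)" using F h unfolding pi_H_vectors by (elim conjE) (erule bspec)
  have "L2 \<sigma> (\<lambda>q. of_real (sqrt (Suc j)) * (\<Sum>b<Suc j. F h b * cnj (\<tau> j q (coeff_vec k j) b)))"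
    by (intro L2_scale L2_sum L2_cnj rep_coeff_vec_L2 j)
  then show L: "L2 \<sigma> (fibre (synth F j) h)"
    by (rule iffD2[OF L2_cong, rotated]) (simp only: synth_fibre[OF F j h] cinner_def)
  assume i: "i \<in> admissible k"
  show "fibre_coeff (synth F j) i h = (\<lambda>a. if i = j then F h a else 0)"
  proof
    fix a
    have "fibre_coeff (synth F j) i h a = of_real (sqrt (Suc i)) * (\<integral>q. (of_real (sqrt (Suc j)) * cinner (Suc j) (F h) (\<tau> j q (coeff_vec k j))) * \<tau> i q (coeff_vec k i) a \<partial>\<sigma>)"
      unfolding fibre_coeff_def if_P[OF L]
      by (rule arg_cong[where f = "(*) _"], rule Bochner_Integration.integral_cong[OF refl]) (simp only: space_eq synth_fibre[OF F j h])
    also have "\<dots> = (if i = j \<and> a < Suc i then F h a else 0)" by (rule coeff_inversion[OF v j i])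
    also have "\<dots> = (if i = j then F h a else 0)" using v by (auto simp: cvec_def)
    finally show "fibre_coeff (synth F j) i h a = (if i = j then F h a else 0)" .
  qed
qed

lemma synth_L2: 
  assumes F: "F \<in> vectors (pi_H \<nu> e lam \<tau> j)" shows "L2 \<nu> (synth F j)"
proof -
  have "L2 \<nu> (\<lambda>h. of_real (sqrt (Suc j)) * (\<Sum>b<Suc j. cnj (coeff_vec k j b) * F h b))"
    by (intro L2_scale L2_sum pi_H_L2[OF F])
  then show ?thesis unfolding synth_def[abs_def] cinner_def by (simp only: mult.commute)
qed

lemma coeff_zero: "fibre_coeff (\<lambda>h. 0) i h = (\<lambda>a. 0)" "L2 \<sigma> (fibre (\<lambda>h. 0) h)"
proof -
  have "fibre (\<lambda>h. 0) h = (\<lambda>q. 0)" by (simp add: fibre_def fun_eq_iff)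
  then show "fibre_coeff (\<lambda>h. 0) i h = (\<lambda>a. 0)" "L2 \<sigma> (fibre (\<lambda>h. 0) h)" by (simp_all add: fibre_coeff_def L2_zero)
qed

lemma torus_factor_nonzero:
  assumes p: "p \<in> parabolic e" and w: "p $ e $ e = quat_of_complex w" shows "torus_factor e lam k p w \<noteq> 0"
proof -
  have "cmod w \<noteq> 0" using parabolic_ee_nonzero[OF p] norm_quat_of_complex[of w] w by (metis norm_eq_zero)
  then show ?thesis using modulus_pos[OF p] by (simp add: torus_factor_def)
qed

text \<open>
  Every square-summable family of vectors arises from a scalar function: the partial sums of the
  synthesized functions are Cauchy because their norms are known, and the limit along an almost
  everywhere convergent subsequence is covariant exactly, not only up to null sets.
\<close>

lemma synthesis:
  assumes FF: "\<And>j. j \<in> admissible k \<Longrightarrow> FF j \<in> vectors (pi_H \<nu> e lam \<tau> j)"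
    and sm: "(\<lambda>j. \<integral>h. (\<Sum>a<Suc j. (cmod (FF j h a))\<^sup>2) \<partial>\<nu>) summable_on admissible k"
  shows "\<exists>f. covariant f \<and> L2 \<nu> f \<and>
    (\<forall>j\<in>admissible k. (\<integral>h. (\<Sum>a<Suc j. (cmod (fibre_coeff f j h a - FF j h a))\<^sup>2) \<partial>\<nu>) = 0)"
proof -
  define G where "G j = (if j \<in> admissible k then synth (FF j) j else (\<lambda>h. 0))" for j
  have Gc: "covariant (G j)" for j
    by (cases "j \<in> admissible k") (simp_all add: G_def covariant_zero synth_covariant[OF FF])
  have GL2: "L2 \<nu> (G j)" for j
    by (cases "j \<in> admissible k") (simp_all add: G_def L2_zero synth_L2[OF FF])
  have Gf: "L2 \<sigma> (fibre (G j) h)" if "h \<in> GL" for h j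
    by (cases "j \<in> admissible k") (simp_all add: G_def coeff_zero coeff_synth(1)[OF FF _ that])
  have Gk: "fibre_coeff (G j) i h a = (if i = j then FF i h a else 0)" if h: "h \<in> GL" and i: "i \<in> admissible k" for h i j a
  proof (cases "j \<in> admissible k")
    case True
    then have "fibre_coeff (G j) i h = (\<lambda>a. if i = j then FF j h a else 0)"
      unfolding G_def if_P[OF True] by (intro coeff_synth(2) FF h i)
    then show ?thesis by simp
  next
    case False
    with i have "i \<noteq> j" by blast
    then show ?thesis unfolding G_def if_not_P[OF False] coeff_zero by simp
  qed
  define S where "S N h = (\<Sum>j<N. G j h)" for N h
  have S0: "S 0 = (\<lambda>h. 0)" by (simp add: S_def fun_eq_iff)
  have SS: "S (Suc N) = (\<lambda>h. S N h + 1 * G N h)" for N by (simp add: S_def fun_eq_iff)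
  have Sc: "covariant (S N)" for N
    by (induction N) (simp_all only: S0 SS covariant_zero covariant_one_lincomb[OF _ Gc])
  have SL: "L2 \<nu> (S N)" for N
    by (induction N) (simp_all only: S0 SS L2_zero L2_one_lincomb[OF _ GL2])
  have Sfk: "L2 \<sigma> (fibre (S N) h) \<and> fibre_coeff (S N) i h a = (if i < N then FF i h a else 0)"
    if h: "h \<in> GL" and i: "i \<in> admissible k" for N h i a
  proof (induction N)
    case 0
    show ?case unfolding S0 by (simp add: coeff_zero)
  next
    case (Suc N)
    then have L: "L2 \<sigma> (fibre (S N) h)" by (rule conjunct1)
    have "fibre_coeff (S (Suc N)) i h a = fibre_coeff (S N) i h a + 1 * fibre_coeff (G N) i h a"
      unfolding SS by (rule coeff_one_lincomb(1)[OF L Gf[OF h] i])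
    also have "\<dots> = (if i < Suc N then FF i h a else 0)" using Suc Gk[OF h i] by (cases "i = N") auto
    finally show ?case using coeff_one_lincomb(2)[OF L Gf[OF h] i] unfolding SS by blast
  qed
  define n where "n j = (if j \<in> admissible k then \<integral>h. (\<Sum>a<Suc j. (cmod (FF j h a))\<^sup>2) \<partial>\<nu> else 0)" for j
  have "n summable_on UNIV"
    using sm by (rule iffD1[OF summable_on_cong_neutral, rotated 3]) (simp_all add: n_def del: sum.lessThan_Suc)
  then obtain t where "(n has_sum t) UNIV" unfolding summable_on_def by (elim exE)
  then have nsum: "summable n" by (rule sums_summable[OF has_sum_imp_sums])
  have diff: "sqnorm \<nu> (\<lambda>h. S m h - S l h) = sum n {min m l..<max m l}" for m l
  proof -
    let ?D = "\<lambda>h. S m h + (- 1) * S l h"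
    have D: "covariant ?D" "L2 \<nu> ?D"
      by (rule covariant_one_lincomb[OF Sc Sc], rule L2_one_lincomb[OF SL SL])
    have "(\<integral>h. coeff_norm ?D j h \<partial>\<nu>) = (if j \<in> {min m l..<max m l} then n j else 0)" for j
    proof (cases "j \<in> admissible k")
      case True
      have c: "fibre_coeff ?D j h a = (if j < m then FF j h a else 0) + (- 1) * (if j < l then FF j h a else 0)" if "h \<in> GL" for h a
        unfolding coeff_one_lincomb(1)[OF conjunct1[OF Sfk[OF that True]] conjunct1[OF Sfk[OF that True]] True]
          conjunct2[OF Sfk[OF that True]] ..
      have "coeff_norm ?D j h = (if j \<in> {min m l..<max m l} then \<Sum>a<Suc j. (cmod (FF j h a))\<^sup>2 else 0)" if "h \<in> GL" for h
        unfolding coeff_norm_def if_P[OF True] c[OF that]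
        by (cases "j < m"; cases "j < l") (simp_all add: min_le_iff_disj less_max_iff_disj del: sum.lessThan_Suc)
      then have "(\<integral>h. coeff_norm ?D j h \<partial>\<nu>) = (\<integral>h. (if j \<in> {min m l..<max m l} then \<Sum>a<Suc j. (cmod (FF j h a))\<^sup>2 else 0) \<partial>\<nu>)"
        by (intro Bochner_Integration.integral_cong refl) (simp only: space_nu_GL)
      then show ?thesis using True by (cases "j \<in> {min m l..<max m l}") (simp_all only: if_True if_False n_def Bochner_Integration.integral_zero)
    qed (simp add: coeff_norm_def n_def)
    then have "(\<lambda>j. if j \<in> {min m l..<max m l} then n j else 0) sums sqnorm \<nu> ?D"
      using coeff_norm_sums(2)[OF D] by (simp only:)
    moreover have "(\<lambda>j. if j \<in> {min m l..<max m l} then n j else 0) sums sum n {min m l..<max m l}"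
      by (rule sums_If_finite_set) simp
    ultimately have "sqnorm \<nu> ?D = sum n {min m l..<max m l}" by (rule sums_unique2)
    then show ?thesis by simp
  qed
  have cauchy: "\<exists>N. \<forall>m\<ge>N. \<forall>l\<ge>N. sqnorm \<nu> (\<lambda>h. S m h - S l h) \<le> \<epsilon>" if e: "\<epsilon> > 0" for \<epsilon>
  proof -
    obtain N where N: "\<And>m l. m \<ge> N \<Longrightarrow> norm (sum n {m..<l}) < \<epsilon>"
      using nsum e unfolding summable_Cauchy by blast
    have "sum n {min m l..<max m l} \<le> \<epsilon>" if "m \<ge> N" "l \<ge> N" for m l
      using N[of "min m l" "max m l"] that by simp
    then show ?thesis unfolding diff by blast
  qed
  have "\<exists>r. strict_mono r \<and> (AE h in \<nu>. convergent (\<lambda>i. S (r i) h))"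
    by (rule H.L2_cauchy_subsequence[OF SL]) (rule cauchy)
  then obtain r where r: "strict_mono r" "AE h in \<nu>. convergent (\<lambda>i. S (r i) h)"
    by (elim exE conjE) (rule that)
  \<comment> \<open>The set of convergence is stable under the parabolic subgroup, so \<open>f\<close> is covariant.\<close>
  define f where "f h = (if Cauchy (\<lambda>i. S (r i) h) then lim (\<lambda>i. S (r i) h) else 0)" for h
  have fc: "covariant f"
    unfolding covariant_def
  proof (intro conjI ballI allI impI)
    have Sm: "S l \<in> borel_measurable GLb" for l by (rule covariant_measurable[OF Sc])
    show "f \<in> borel_measurable GLb"
      unfolding f_def[abs_def]
      by (rule measurable_If[OF borel_measurable_lim_metric[OF Sm] borel_measurable_const sets_Collect_Cauchy[OF Sm]])
    fix h p :: "quat^'m^'m" and w assume h: "h \<in> GL" and p: "p \<in> parabolic e" and w: "p $ e $ e = quat_of_complex w"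
    let ?c = "torus_factor e lam k p w"
    have s: "S l (h ** p) = ?c * S l h" for l by (rule covariantD[OF Sc h p w])
    have c0: "?c \<noteq> 0" by (rule torus_factor_nonzero[OF p w])
    show "f (h ** p) = ?c * f h"
    proof (cases "convergent (\<lambda>i. S (r i) h)")
      case True
      then have "(\<lambda>i. ?c * S (r i) h) \<longlonglongrightarrow> ?c * lim (\<lambda>i. S (r i) h)"
        by (intro tendsto_mult_left) (simp only: convergent_LIMSEQ_iff)
      then have "convergent (\<lambda>i. ?c * S (r i) h)" "lim (\<lambda>i. ?c * S (r i) h) = ?c * lim (\<lambda>i. S (r i) h)"
        by (rule convergentI, rule limI)
      with True show ?thesis unfolding f_def s Cauchy_convergent_iff by (simp only: if_True)
    next
      case False
      then have "\<not> convergent (\<lambda>i. ?c * S (r i) h)" unfolding convergent_mult_const_iff[OF c0] .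
      with False show ?thesis unfolding f_def s Cauchy_convergent_iff by (simp only: if_False mult_zero_right)
    qed
  qed
  have lim: "AE h in \<nu>. (\<lambda>i. S (r i) h) \<longlonglongrightarrow> f h"
    using r(2) by (rule AE_mp) (auto intro!: AE_I2 simp: f_def Cauchy_convergent_iff convergent_LIMSEQ_iff)
  have app: "\<exists>N. \<forall>l\<ge>N. L2 \<nu> (\<lambda>h. f h - S l h) \<and> sqnorm \<nu> (\<lambda>h. f h - S l h) \<le> \<epsilon>" if e: "\<epsilon> > 0" for \<epsilon>
  proof -
    obtain N where N: "\<And>m l. m \<ge> N \<Longrightarrow> l \<ge> N \<Longrightarrow> sqnorm \<nu> (\<lambda>h. S m h - S l h) \<le> \<epsilon>"
      using cauchy[OF e] by blast
    note lm = H.L2_limit[OF SL r(1) measurable_nu[OF covariant_measurable[OF fc]] lim N]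
    show ?thesis by (intro exI[of _ N] allI impI conjI lm) assumption+
  qed
  have "(0::real) < 1" by simp
  from app[OF this] obtain N1 where "\<forall>l\<ge>N1. L2 \<nu> (\<lambda>h. f h - S l h) \<and> sqnorm \<nu> (\<lambda>h. f h - S l h) \<le> 1"
    by (elim exE) (rule that)
  then have "L2 \<nu> (\<lambda>h. (f h - S N1 h) + S N1 h)" by (intro L2_add[OF _ SL]) blast
  then have fL: "L2 \<nu> f" by simp
  have "(\<integral>h. (\<Sum>a<Suc j. (cmod (fibre_coeff f j h a - FF j h a))\<^sup>2) \<partial>\<nu>) = 0" (is "?I = 0") if j: "j \<in> admissible k" for j
  proof (rule antisym)
    show "0 \<le> ?I" by (rule integral_nonneg_AE) (simp add: sum_nonneg del: sum.lessThan_Suc)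
    show "?I \<le> 0"
    proof (rule field_le_epsilon)
      fix \<epsilon> :: real assume e: "\<epsilon> > 0"
      obtain N where N: "\<forall>l\<ge>N. L2 \<nu> (\<lambda>h. f h - S l h) \<and> sqnorm \<nu> (\<lambda>h. f h - S l h) \<le> \<epsilon>"
        using app[OF e] by (elim exE) (rule that)
      \<comment> \<open>The partial sum must contain the term of index \<open>j\<close>.\<close>
      let ?l = "max N (Suc j)"
      let ?D = "\<lambda>h. f h + (- 1) * S ?l h"
      have D: "covariant ?D" "L2 \<nu> ?D"
        by (rule covariant_one_lincomb[OF fc Sc], rule L2_one_lincomb[OF fL SL])
      note cs = coeff_norm_sums(2)[OF D]
      have "?I = (\<integral>h. coeff_norm ?D j h \<partial>\<nu>)"
      proof (rule Bochner_Integration.integral_cong_AE)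
        have "(\<lambda>h. (cmod (fibre_coeff f j h a - FF j h a))\<^sup>2) \<in> borel_measurable \<nu>" for a
          by (rule borel_measurable_integrable[OF L2_integrable[OF L2_diff[OF coeff_L2[OF fc fL j] pi_H_L2[OF FF[OF j]]]]])
        then show "(\<lambda>h. \<Sum>a<Suc j. (cmod (fibre_coeff f j h a - FF j h a))\<^sup>2) \<in> borel_measurable \<nu>"
          by (intro borel_measurable_sum)
        show "(\<lambda>h. coeff_norm ?D j h) \<in> borel_measurable \<nu>" by (rule coeff_norm_measurable[OF covariant_measurable[OF D(1)]])
        show "AE h in \<nu>. (\<Sum>a<Suc j. (cmod (fibre_coeff f j h a - FF j h a))\<^sup>2) = coeff_norm ?D j h"
        proof (rule AE_mp[OF fibre_L2_AE[OF fc fL]], intro AE_I2 impI)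
          fix h assume h: "h \<in> space \<nu>" and L: "L2 \<sigma> (fibre f h)"
          note hG = space_nu_GL[OF h]
          have "fibre_coeff ?D j h a = fibre_coeff f j h a - FF j h a" for a
            unfolding coeff_one_lincomb(1)[OF L conjunct1[OF Sfk[OF hG j]] j] conjunct2[OF Sfk[OF hG j]] by simp
          then show "(\<Sum>a<Suc j. (cmod (fibre_coeff f j h a - FF j h a))\<^sup>2) = coeff_norm ?D j h"
            unfolding coeff_norm_def if_P[OF j] by (simp only:)
        qed
      qed
      also have "\<dots> \<le> (\<Sum>j. \<integral>h. coeff_norm ?D j h \<partial>\<nu>)"
        using sum_le_suminf[OF sums_summable[OF cs], of "{j}"] by (simp add: coeff_norm_nonneg)
      also have "\<dots> = sqnorm \<nu> ?D" by (rule sums_unique[OF cs, symmetric])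
      also have "\<dots> \<le> \<epsilon>" using N by simp
      finally show "?I \<le> 0 + \<epsilon>" by simp
    qed
  qed
  with fc fL show ?thesis by blast
qed

end

section \<open>Extension from the quaternionic group\<close>

lemma complex_to_quat_vec_scale:
  "complex_to_quat_vec (\<chi> s. u $ s * z) = (\<chi> i. complex_to_quat_vec u $ i * quat_of_complex z)"
  for u :: "complex^('m::finite + 'm)"
  by (simp add: vec_eq_iff complex_to_quat_vec_def quat_of_complex_def times_quat_def algebra_simps)

lemma complex_to_quat_vec_eq_0: "complex_to_quat_vec u = 0 \<Longrightarrow> u = 0"
  for u :: "complex^('m::finite + 'm)"
proof -
  assume "complex_to_quat_vec u = 0"
  then have "norm u = 0" using norm_complex_to_quat_vec[of u] by simp
  then show "u = 0" by simp
qed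

lemma continuous_on_complex_to_quat_column:
  fixes e :: "'m::finite"
  shows "continuous_on UNIV (\<lambda>g::complex^('m + 'm)^('m + 'm). complex_to_quat_vec (\<chi> s. g $ s $ Inl e))"
proof -
  have "linear (\<lambda>g::complex^('m + 'm)^('m + 'm). complex_to_quat_vec (\<chi> s. g $ s $ Inl e))"
    by (rule linearI)
      (simp_all add: vec_eq_iff complex_to_quat_vec_def plus_quat_def scaleR_quat_def)
  then show ?thesis by (rule linear_continuous_on[OF linear_conv_bounded_linear[THEN iffD1]])
qed

lemma column_nonzero:
  fixes g :: "'r::{real_inner,ring_1}^'n::finite^'n"
  assumes "g \<in> GL" shows "(\<chi> s. g $ s $ i) \<noteq> 0"
proof
  assume z: "(\<chi> s. g $ s $ i) = 0"
  then have z': "g $ s $ i = 0" for s by (simp add: vec_eq_iff)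
  have "(matrix_inv g ** g) $ i $ i = 0" by (simp add: matrix_matrix_mult_def z')
  then show False unfolding GL_inv_cancel(2)[OF assms] by (simp add: mat_def)
qed

lemma scalar_inverse:
  assumes "c \<noteq> 0" "u \<in> cvec d"
  shows "inv_into (cvec d) (\<lambda>v i. c * v i) u = (\<lambda>i. inverse c * u i)"
proof (rule inv_into_f_eq)
  show "inj_on (\<lambda>v i. c * v i) (cvec d)"
    using assms(1) by (intro inj_onI) (simp add: fun_eq_iff)
  show "(\<lambda>i. inverse c * u i) \<in> cvec d" using assms(2) by (simp add: cvec_def)
  show "(\<lambda>i. c * (inverse c * u i)) = u" using assms(1) by (simp flip: mult.assoc)
qed

lemma chi_nonzero: "x \<in> parabolic i \<Longrightarrow> chi i lam k x \<noteq> 0"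
  using parabolic_ee_nonzero[of x i] by (simp add: chi_def Let_def)

text \<open>
  The modulus factors of the two parabolic elements relating a matrix to its quaternionic
  representative cancel in this way.
\<close>

lemma covariance_cancel:
  fixes a b c d :: real
  assumes "a > 0" "b > 0" "c > 0" "d > 0" "a * b = c * d"
  shows "complex_of_real (b powr x) * of_real (a powr x) = of_real (c powr x) * of_real (d powr x)"
proof -
  have "b powr x * a powr x = c powr x * d powr x"
    using assms by (simp add: mult.commute flip: powr_mult)
  then show ?thesis by (simp only: flip: of_real_mult)
qed

locale branching_unitary = branching \<sigma> \<tau> e lam k \<nu>
  for \<sigma> :: "quat measure" and \<tau> :: "nat \<Rightarrow> quat \<Rightarrow> (nat \<Rightarrow> complex) \<Rightarrow> nat \<Rightarrow> complex"
    and e :: "'m::finite" and lam :: real and k :: int and \<nu> :: "(quat^'m^'m) measure" +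
  fixes \<mu> :: "(complex^('m + 'm)^('m + 'm)) measure"
  assumes haar_unitary: "is_haar_prob isometry_group \<mu>"
begin

abbreviation GLc :: "(complex^('m + 'm)^('m + 'm)) measure" where "GLc \<equiv> restrict_space borel GL"

definition covariant_G :: "(complex^('m + 'm)^('m + 'm) \<Rightarrow> complex) \<Rightarrow> bool" where
  "covariant_G x \<longleftrightarrow> x \<in> borel_measurable GLc \<and> (\<forall>g\<in>GL. \<forall>p\<in>parabolic (Inl e).
     x (g ** p) = of_real (modulus (Inl e) p powr (- 1 / 2)) * inverse (chi (Inl e) lam k p) * x g)"

lemma covariant_GD: "covariant_G x \<Longrightarrow> g \<in> GL \<Longrightarrow> p \<in> parabolic (Inl e) \<Longrightarrow>
    x (g ** p) = of_real (modulus (Inl e) p powr (- 1 / 2)) * inverse (chi (Inl e) lam k p) * x g"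
  unfolding covariant_G_def by (elim conjE) (drule bspec, assumption, drule bspec, assumption+)

lemma covariant_G_lincomb:
  assumes x: "covariant_G x" and y: "covariant_G y" shows "covariant_G (\<lambda>g. x g + c * y g)"
  unfolding covariant_G_def
proof (intro conjI ballI)
  have "x \<in> borel_measurable GLc" "y \<in> borel_measurable GLc" using x y unfolding covariant_G_def by blast+
  then show "(\<lambda>g. x g + c * y g) \<in> borel_measurable GLc"
    by (intro borel_measurable_add borel_measurable_times borel_measurable_const)
  fix g p :: "complex^('m + 'm)^('m + 'm)" assume *: "g \<in> GL" "p \<in> parabolic (Inl e)"
  show "x (g ** p) + c * y (g ** p) = of_real (modulus (Inl e) p powr (- 1 / 2)) * inverse (chi (Inl e) lam k p) * (x g + c * y g)"
    unfolding covariant_GD[OF x *] covariant_GD[OF y *] distrib_left mult.left_commute[of c] ..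
qed

lemma embed_measurable: "quat_matrix_embed \<in> GLb \<rightarrow>\<^sub>M GLc"
  by (rule measurable_restrict_space2)
    (auto simp: space_GLb intro: quat_matrix_embed_GL(1) borel_measurable_continuous_on_restrict continuous_on_quat_matrix_embed)

lemma measurable_mu: "x \<in> borel_measurable GLc \<Longrightarrow> x \<in> borel_measurable \<mu>"
proof (erule measurable_compose[rotated])
  show "(\<lambda>u. u) \<in> \<mu> \<rightarrow>\<^sub>M GLc"
    by (rule measurable_restrict_space2)
      (auto simp: haar_space(1)[OF haar_unitary] intro: isometry_group_GL haar_measurable_from[OF haar_unitary]
        borel_measurable_continuous_on_restrict continuous_on_id)
qed

lemma covariant_restrict:
  assumes x: "covariant_G x" shows "covariant (\<lambda>h. x (quat_matrix_embed h))"
  unfolding covariant_def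
proof (intro conjI ballI allI impI)
  have "x \<in> borel_measurable GLc" using x unfolding covariant_G_def by (rule conjunct1)
  then show "(\<lambda>h. x (quat_matrix_embed h)) \<in> borel_measurable GLb" by (rule measurable_compose[OF embed_measurable])
  fix h p :: "quat^'m^'m" and w assume h: "h \<in> GL" and p: "p \<in> parabolic e" and w: "p $ e $ e = quat_of_complex w"
  show "x (quat_matrix_embed (h ** p)) = torus_factor e lam k p w * x (quat_matrix_embed h)"
    unfolding quat_matrix_embed_hom covariant_GD[OF x quat_matrix_embed_GL(1)[OF h] quat_matrix_embed_parabolic(1)[OF p w]]
      modulus_quat_matrix_embed[OF p w]
    by (simp only: chi_def Let_def quat_matrix_embed_parabolic(2)[OF p w] torus_factor_def)
qed

text \<open>
  On the unitary group the absolute value of a covariant function depends only on the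
  distinguished column.
\<close>

lemma covariant_G_norm:
  assumes x: "covariant_G x"
  shows "(\<integral>\<^sup>+u. ennreal ((cmod (x u))\<^sup>2) \<partial>\<mu>) = (\<integral>\<^sup>+h. ennreal ((cmod (x (quat_matrix_embed h)))\<^sup>2) \<partial>\<nu>)"
proof (rule nn_integral_unitary_eq_symplectic[OF haar_unitary haar, where e = e])
  have "x \<in> borel_measurable \<mu>" using x unfolding covariant_G_def by (intro measurable_mu) (rule conjunct1)
  then show "(\<lambda>u. ennreal ((cmod (x u))\<^sup>2)) \<in> borel_measurable \<mu>" by simp
  fix u u' :: "complex^('m + 'm)^('m + 'm)"
  assume u: "u \<in> isometry_group" and u': "u' \<in> isometry_group" and col: "\<And>s. u $ s $ Inl e = u' $ s $ Inl e"
  let ?p = "matrix_inv u ** u'"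
  have p: "?p \<in> parabolic (Inl e)" "?p $ Inl e $ Inl e = 1"
    by (rule same_column_parabolic[OF isometry_group_GL[OF u] isometry_group_GL[OF u'], where w = 1 and e = "Inl e"], simp add: col)+
  have "modulus (Inl e) ?p = 1"
    by (rule modulus_isometry[OF isometry_group_mult[OF isometry_group_inv[OF u] u'] p(1)])
  moreover have "chi (Inl e) lam k ?p = 1" by (simp add: chi_def Let_def p(2))
  ultimately have "x (u ** ?p) = x u" unfolding covariant_GD[OF x isometry_group_GL[OF u] p(1)] by simp
  then show "ennreal ((cmod (x u))\<^sup>2) = ennreal ((cmod (x u'))\<^sup>2)"
    unfolding GL_cancel_left(1)[OF isometry_group_GL[OF u]] by simp
qed

lemma covariant_G_L2:
  assumes x: "covariant_G x"
  shows "L2 \<mu> x \<longleftrightarrow> L2 \<nu> (\<lambda>h. x (quat_matrix_embed h))"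
    "L2 \<mu> x \<Longrightarrow> sqnorm \<mu> x = sqnorm \<nu> (\<lambda>h. x (quat_matrix_embed h))"
proof -
  have m: "x \<in> borel_measurable \<mu>" using x unfolding covariant_G_def by (intro measurable_mu) (rule conjunct1)
  have m': "(\<lambda>h. x (quat_matrix_embed h)) \<in> borel_measurable \<nu>"
    by (rule measurable_nu[OF covariant_measurable[OF covariant_restrict[OF x]]])
  show eq: "L2 \<mu> x \<longleftrightarrow> L2 \<nu> (\<lambda>h. x (quat_matrix_embed h))"
  proof
    assume "L2 \<mu> x"
    then show "L2 \<nu> (\<lambda>h. x (quat_matrix_embed h))"
      by (intro L2_nnI m') (simp add: covariant_G_norm[OF x, symmetric] L2_nn)
  next
    assume "L2 \<nu> (\<lambda>h. x (quat_matrix_embed h))"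
    then show "L2 \<mu> x" by (intro L2_nnI m) (simp add: covariant_G_norm[OF x] L2_nn)
  qed
  assume L: "L2 \<mu> x"
  have "ennreal (sqnorm \<mu> x) = ennreal (sqnorm \<nu> (\<lambda>h. x (quat_matrix_embed h)))"
    using covariant_G_norm[OF x] unfolding L2_nn[OF L] L2_nn[OF iffD1[OF eq L]] .
  then show "sqnorm \<mu> x = sqnorm \<nu> (\<lambda>h. x (quat_matrix_embed h))" by (simp add: ennreal_inj)
qed

lemma covariant_G_inner:
  assumes x: "covariant_G x" "L2 \<mu> x" and y: "covariant_G y" "L2 \<mu> y"
  shows "(\<integral>u. x u * cnj (y u) \<partial>\<mu>) = (\<integral>h. x (quat_matrix_embed h) * cnj (y (quat_matrix_embed h)) \<partial>\<nu>)"
proof -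
  have c: "covariant_G (\<lambda>g. x g + c * y g)" "L2 \<mu> (\<lambda>g. x g + c * y g)" for c
    by (rule covariant_G_lincomb[OF x(1) y(1)], rule L2_one_lincomb[OF x(2) y(2)])
  have 1: "(\<integral>u. x u * cnj (y u) \<partial>\<mu>) = polar (\<lambda>c. sqnorm \<mu> (\<lambda>g. x g + c * y g))"
    unfolding polarization by (rule polar_integral) (rule L2_integrable[OF c(2)])
  have 2: "(\<integral>h. x (quat_matrix_embed h) * cnj (y (quat_matrix_embed h)) \<partial>\<nu>)
      = polar (\<lambda>c. sqnorm \<nu> (\<lambda>h. x (quat_matrix_embed h) + c * y (quat_matrix_embed h)))"
    unfolding polarization by (rule polar_integral) (rule L2_integrable[OF iffD1[OF covariant_G_L2(1)[OF c(1)] c(2)]])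
  show ?thesis unfolding 1 2 covariant_G_L2(2)[OF c] ..
qed

lemma pi_G_vectors:
  "x \<in> vectors (pi_G \<mu> (Inl e) lam k) \<longleftrightarrow>
     (\<forall>g\<in>GL. x g \<in> cvec 1) \<and> covariant_G (\<lambda>g. x g 0) \<and> L2 \<mu> (\<lambda>g. x g 0)"
proof -
  have int: "integrable \<mu> (\<lambda>u. cinner 1 (x u) (x u)) \<longleftrightarrow> integrable \<mu> (\<lambda>u. (cmod (x u 0))\<^sup>2)"
    unfolding cinner_self complex_of_real_integrable_eq by simp
  have eqv: "x (g ** p) = (\<lambda>i. of_real (modulus (Inl e) p powr (- 1 / 2)) *
        inv_into (cvec 1) (\<lambda>v i. chi (Inl e) lam k p * v i) (x g) i)
      \<longleftrightarrow> x (g ** p) 0 = of_real (modulus (Inl e) p powr (- 1 / 2)) * inverse (chi (Inl e) lam k p) * x g 0"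
    if "\<forall>g\<in>GL. x g \<in> cvec 1" "g \<in> GL" "p \<in> parabolic (Inl e)" for g p
  proof -
    have c: "x g i = 0" "x (g ** p) i = 0" if "i \<noteq> 0" for i
      using \<open>\<forall>g\<in>GL. x g \<in> cvec 1\<close> \<open>g \<in> GL\<close> GL_mult[OF \<open>g \<in> GL\<close> parabolic_GL[OF \<open>p \<in> parabolic (Inl e)\<close>]] that
      by (auto simp: cvec_def)
    have xg: "x g \<in> cvec 1" using that by blast
    show ?thesis
      unfolding scalar_inverse[OF chi_nonzero[OF that(3)] xg] fun_eq_iff
    proof (intro iffI allI)
      fix i assume z: "x (g ** p) 0 = of_real (modulus (Inl e) p powr (- 1 / 2)) * inverse (chi (Inl e) lam k p) * x g 0"
      show "x (g ** p) i = of_real (modulus (Inl e) p powr (- 1 / 2)) * (inverse (chi (Inl e) lam k p) * x g i)"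
        by (cases "i = 0") (simp_all only: z c mult.assoc mult_zero_right not_False_eq_True)
    qed (simp only: mult.assoc)
  qed
  have meas: "(\<forall>i. (\<lambda>g. x g i) \<in> borel_measurable GLc) \<longleftrightarrow> (\<lambda>g. x g 0) \<in> borel_measurable GLc"
    if v: "\<forall>g\<in>GL. x g \<in> cvec 1"
  proof (intro iffI allI)
    fix i assume m: "(\<lambda>g. x g 0) \<in> borel_measurable GLc"
    show "(\<lambda>g. x g i) \<in> borel_measurable GLc"
    proof (cases "i = 0")
      case False
      have "(\<lambda>g. x g i) \<in> borel_measurable GLc \<longleftrightarrow> (\<lambda>g. 0::complex) \<in> borel_measurable GLc"
        using v False by (intro measurable_cong) (auto simp: cvec_def space_restrict_space)
      then show ?thesis by simp
    qed (simp add: m)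
  qed blast
  show ?thesis
  proof (cases "\<forall>g\<in>GL. x g \<in> cvec 1")
    case True
    have eqv': "(\<forall>g\<in>GL. \<forall>p\<in>parabolic (Inl e). x (g ** p) = (\<lambda>i. of_real (modulus (Inl e) p powr (- 1 / 2)) *
        inv_into (cvec 1) (\<lambda>v i. chi (Inl e) lam k p * v i) (x g) i)) \<longleftrightarrow>
      (\<forall>g\<in>GL. \<forall>p\<in>parabolic (Inl e).
         x (g ** p) 0 = of_real (modulus (Inl e) p powr (- 1 / 2)) * inverse (chi (Inl e) lam k p) * x g 0)"
      by (intro ball_cong refl eqv[OF True])
    show ?thesis
      unfolding pi_G_def induced_rep_def hilbert_rep.simps mem_Collect_eq int covariant_G_def L2_def meas[OF True] eqv'
      by (rule iffI; elim conjE; intro conjI; (assumption | (rule measurable_mu, assumption)))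
  next
    case False
    then show ?thesis
      unfolding pi_G_def induced_rep_def hilbert_rep.simps mem_Collect_eq by (simp only: simp_thms)
  qed
qed

text \<open>
  A matrix in \<open>GL(2m, \<complex>)\<close> has the same distinguished column as some quaternionic matrix, so it is
  that matrix times a parabolic element; this extends covariant functions.
\<close>

definition quat_section :: "complex^('m + 'm)^('m + 'm) \<Rightarrow> quat^'m^'m" where
  "quat_section g = column_section e (complex_to_quat_vec (\<chi> s. g $ s $ Inl e))"

lemma quat_section:
  assumes g: "g \<in> GL"
  shows "quat_section g \<in> GL" "quat_section g $ i $ e = complex_to_quat_vec (\<chi> s. g $ s $ Inl e) $ i"
    "matrix_inv (quat_matrix_embed (quat_section g)) ** g \<in> parabolic (Inl e)"
    "(matrix_inv (quat_matrix_embed (quat_section g)) ** g) $ Inl e $ Inl e = 1"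
proof -
  let ?v = "complex_to_quat_vec (\<chi> s. g $ s $ Inl e)"
  have v: "?v \<noteq> 0" using complex_to_quat_vec_eq_0 column_nonzero[OF g] by blast
  show s: "quat_section g \<in> GL" unfolding quat_section_def by (rule column_section(1)[OF v])
  show c: "quat_section g $ i $ e = ?v $ i" for i unfolding quat_section_def by (rule column_section(2)[OF v])
  have "(\<chi> i. quat_section g $ i $ e) = ?v" by (simp add: vec_eq_iff c)
  then have "g $ s $ Inl e = quat_matrix_embed (quat_section g) $ s $ Inl e * 1" for s
    unfolding quat_matrix_embed_column by simp
  then show "matrix_inv (quat_matrix_embed (quat_section g)) ** g \<in> parabolic (Inl e)"
    "(matrix_inv (quat_matrix_embed (quat_section g)) ** g) $ Inl e $ Inl e = 1"
    by (rule same_column_parabolic[OF quat_matrix_embed_GL(1)[OF s] g])+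
qed

definition extension :: "(quat^'m^'m \<Rightarrow> complex) \<Rightarrow> complex^('m + 'm)^('m + 'm) \<Rightarrow> complex" where
  "extension f g = of_real (modulus (Inl e) (matrix_inv (quat_matrix_embed (quat_section g)) ** g) powr (- 1 / 2)) *
     f (quat_section g)"

lemma extension_measurable:
  assumes f: "f \<in> borel_measurable GLb" shows "extension f \<in> borel_measurable GLc"
proof -
  have sp: "space GLc = GL" by (simp add: space_restrict_space)
  have "(\<lambda>g. complex_to_quat_vec (\<chi> s. g $ s $ Inl e)) \<in> borel_measurable GLc"
    by (rule borel_measurable_continuous_on_restrict[OF continuous_on_subset[OF continuous_on_complex_to_quat_column]]) simp
  then have "quat_section \<in> borel_measurable GLc"
    unfolding quat_section_def[abs_def] by (rule measurable_compose[OF _ borel_measurable_column_section])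
  then have s: "quat_section \<in> GLc \<rightarrow>\<^sub>M GLb"
    by (intro measurable_restrict_space2) (auto simp: sp intro: quat_section(1))
  have "matrix_inv \<in> borel_measurable GLc"
    by (rule borel_measurable_continuous_on_restrict[OF continuous_on_matrix_inv])
  then have i: "(\<lambda>g. matrix_inv (quat_matrix_embed (quat_section g))) \<in> borel_measurable GLc"
    by (rule measurable_compose[OF measurable_compose[OF s embed_measurable]])
  have "(\<lambda>g. matrix_inv (quat_matrix_embed (quat_section g)) ** g) \<in> borel_measurable GLc"
    by (rule measurable_matrix_mult[OF i borel_measurable_continuous_on_restrict[OF continuous_on_id]])
  then have "(\<lambda>g. matrix_inv (quat_matrix_embed (quat_section g)) ** g) \<in> GLc \<rightarrow>\<^sub>M GLc"
    by (intro measurable_restrict_space2) (auto simp: sp intro: GL_mult GL_inv quat_matrix_embed_GL(1) quat_section(1))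
  from measurable_compose[OF this borel_measurable_continuous_on_restrict[OF continuous_on_modulus]]
  have "(\<lambda>g. modulus (Inl e) (matrix_inv (quat_matrix_embed (quat_section g)) ** g)) \<in> borel_measurable GLc" .
  then have p: "(\<lambda>g. modulus (Inl e) (matrix_inv (quat_matrix_embed (quat_section g)) ** g) powr (- 1 / 2)) \<in> borel_measurable GLc"
    by (rule powr_real_measurable[OF _ borel_measurable_const])
  have "(\<lambda>g. complex_of_real (modulus (Inl e) (matrix_inv (quat_matrix_embed (quat_section g)) ** g) powr (- 1 / 2))) \<in> borel_measurable GLc"
    by (rule measurable_compose[OF p]) (rule borel_measurable_continuous_onI, intro continuous_intros)
  then show ?thesis unfolding extension_def[abs_def] by (intro borel_measurable_times measurable_compose[OF s f])
qed

text \<open>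
  Right multiplication by a parabolic element with corner entry \<open>w\<close> multiplies the
  distinguished column by \<open>w\<close>, so the quaternionic representative changes by a
  quaternionic parabolic element with the same corner entry, whose modulus compensates.
\<close>

lemma extension_covariant:
  assumes f: "covariant f" shows "covariant_G (extension f)"
  unfolding covariant_G_def
proof (intro conjI ballI)
  show "extension f \<in> borel_measurable GLc" by (rule extension_measurable[OF covariant_measurable[OF f]])
  fix g p :: "complex^('m + 'm)^('m + 'm)" assume g: "g \<in> GL" and p: "p \<in> parabolic (Inl e)"
  let ?w = "p $ Inl e $ Inl e" let ?\<iota> = quat_matrix_embed
  have gp: "g ** p \<in> GL" by (rule GL_mult[OF g parabolic_GL[OF p]])
  let ?s = "quat_section g" and ?s' = "quat_section (g ** p)"
  let ?P = "matrix_inv (?\<iota> ?s) ** g" and ?P' = "matrix_inv (?\<iota> ?s') ** (g ** p)"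
  let ?t = "matrix_inv ?s ** ?s'"
  note s = quat_section(1)[OF g] and s' = quat_section(1)[OF gp]
  have col: "?s' $ i $ e = ?s $ i $ e * quat_of_complex ?w" for i
    unfolding quat_section(2)[OF g] quat_section(2)[OF gp] parabolic_column[OF p]
    using complex_to_quat_vec_scale[of "\<chi> s. g $ s $ Inl e" ?w] by (simp add: vec_eq_iff)
  have t: "?t \<in> parabolic e" "?t $ e $ e = quat_of_complex ?w"
    by (rule same_column_parabolic[OF s s' col])+
  have st: "?s ** ?t = ?s'" by (rule GL_cancel_left(1)[OF s])
  have fs: "f ?s' = torus_factor e lam k ?t ?w * f ?s" using covariantD[OF f s t] unfolding st .
  note P = quat_section(3)[OF g] and P' = quat_section(3)[OF gp]
  note it = quat_matrix_embed_parabolic(1)[OF t]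
  have "?\<iota> ?s ** (?\<iota> ?t ** ?P') = ?\<iota> ?s ** (?P ** p)"
  proof -
    have 1: "?\<iota> ?s ** ?\<iota> ?t = ?\<iota> ?s'" by (simp only: quat_matrix_embed_hom[symmetric] st)
    have "?\<iota> ?s ** (?\<iota> ?t ** ?P') = ?\<iota> ?s' ** ?P'" by (simp only: matrix_mul_assoc[of "?\<iota> ?s" "?\<iota> ?t" ?P'] 1)
    also have "\<dots> = g ** p" by (rule GL_cancel_left(1)[OF quat_matrix_embed_GL(1)[OF s']])
    also have "\<dots> = (?\<iota> ?s ** ?P) ** p" by (simp only: GL_cancel_left(1)[OF quat_matrix_embed_GL(1)[OF s]])
    also have "\<dots> = ?\<iota> ?s ** (?P ** p)" by (rule matrix_mul_assoc[symmetric])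
    finally show ?thesis .
  qed
  then have "matrix_inv (?\<iota> ?s) ** (?\<iota> ?s ** (?\<iota> ?t ** ?P')) = matrix_inv (?\<iota> ?s) ** (?\<iota> ?s ** (?P ** p))" by (rule arg_cong)
  then have "?\<iota> ?t ** ?P' = ?P ** p" unfolding GL_cancel_left(2)[OF quat_matrix_embed_GL(1)[OF s]] .
  then have "modulus (Inl e) (?\<iota> ?t ** ?P') = modulus (Inl e) (?P ** p)" by (rule arg_cong)
  then have mod: "modulus e ?t * modulus (Inl e) ?P' = modulus (Inl e) p * modulus (Inl e) ?P"
    unfolding modulus_mult[OF it P'] modulus_mult[OF P p] modulus_quat_matrix_embed[OF t] by (simp only: mult.commute)
  have cc: "of_real (modulus (Inl e) ?P' powr (- 1 / 2)) * complex_of_real (modulus e ?t powr (- 1 / 2))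
      = of_real (modulus (Inl e) p powr (- 1 / 2)) * of_real (modulus (Inl e) ?P powr (- 1 / 2))"
    by (rule covariance_cancel[OF modulus_pos[OF t(1)] modulus_pos[OF P'] modulus_pos[OF p] modulus_pos[OF P] mod])
  have tf: "torus_factor e lam k ?t ?w = of_real (modulus e ?t powr (- 1 / 2)) * inverse (chi (Inl e) lam k p)"
    by (simp only: torus_factor_def chi_def Let_def)
  have "extension f (g ** p) = (of_real (modulus (Inl e) ?P' powr (- 1 / 2)) * complex_of_real (modulus e ?t powr (- 1 / 2))) *
      (inverse (chi (Inl e) lam k p) * f ?s)"
    unfolding extension_def fs tf by (simp only: mult_ac)
  then show "extension f (g ** p) = of_real (modulus (Inl e) p powr (- 1 / 2)) * inverse (chi (Inl e) lam k p) * extension f g"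
    unfolding cc extension_def by (simp only: mult_ac)
qed

lemma extension_embed:
  assumes f: "covariant f" and h: "h \<in> GL" shows "extension f (quat_matrix_embed h) = f h"
proof -
  let ?\<iota> = quat_matrix_embed
  note g = quat_matrix_embed_GL(1)[OF h]
  let ?s = "quat_section (?\<iota> h)"
  let ?t = "matrix_inv h ** ?s" and ?P = "matrix_inv (?\<iota> ?s) ** ?\<iota> h"
  note s = quat_section(1)[OF g]
  have "(\<chi> s. ?\<iota> h $ s $ Inl e) = quat_to_complex_vec (\<chi> i. h $ i $ e)"
    by (simp add: vec_eq_iff quat_matrix_embed_column)
  then have col: "?s $ i $ e = h $ i $ e * quat_of_complex 1" for i
    unfolding quat_section(2)[OF g] by (simp add: quat_of_complex_def one_quat_def[symmetric])
  have t: "?t \<in> parabolic e" "?t $ e $ e = quat_of_complex 1" by (rule same_column_parabolic[OF h s col])+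
  have ht: "h ** ?t = ?s" by (rule GL_cancel_left(1)[OF h])
  have fs: "f ?s = torus_factor e lam k ?t 1 * f h" using covariantD[OF f h t] unfolding ht .
  have "?\<iota> ?t ** ?P = mat 1"
  proof -
    have "?\<iota> ?t ** ?P = ?\<iota> (matrix_inv h) ** (?\<iota> ?s ** ?P)"
      unfolding quat_matrix_embed_hom by (simp only: matrix_mul_assoc)
    also have "?\<iota> ?s ** ?P = ?\<iota> h" by (rule GL_cancel_left(1)[OF quat_matrix_embed_GL(1)[OF s]])
    also have "?\<iota> (matrix_inv h) ** ?\<iota> h = mat 1"
      unfolding quat_matrix_embed_hom[symmetric] GL_inv_cancel(2)[OF h] by (rule quat_matrix_embed_one)
    finally show ?thesis .
  qed
  then have "modulus (Inl e) (?\<iota> ?t ** ?P) = 1" by (simp only: modulus_one)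
  then have "modulus e ?t * modulus (Inl e) ?P = 1 * 1"
    unfolding modulus_mult[OF quat_matrix_embed_parabolic(1)[OF t] quat_section(3)[OF g]] modulus_quat_matrix_embed[OF t] by simp
  moreover have "(0::real) < 1" by simp
  ultimately have "of_real (modulus (Inl e) ?P powr (- 1 / 2)) * complex_of_real (modulus e ?t powr (- 1 / 2)) = of_real (1 powr (- 1 / 2)) * of_real (1 powr (- 1 / 2))"
    by (intro covariance_cancel[OF modulus_pos[OF t(1)] modulus_pos[OF quat_section(3)[OF g]]])
  then have "of_real (modulus (Inl e) ?P powr (- 1 / 2)) * complex_of_real (modulus e ?t powr (- 1 / 2)) = 1" by simp
  then show ?thesis unfolding extension_def fs torus_factor_def by (simp flip: mult.assoc)
qed

lemma fibre_cong_coeff: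
  assumes "\<And>h. h \<in> GL \<Longrightarrow> f h = f' h" and h: "h \<in> GL"
  shows "fibre_coeff f j h = fibre_coeff f' j h"
proof -
  have fb: "fibre f h q = fibre f' h q" if "q \<in> Sp1" for q unfolding fibre_def by (rule assms(1)[OF diag_Sp1_GL[OF h that]])
  have "L2 \<sigma> (fibre f h) = L2 \<sigma> (fibre f' h)" by (rule L2_cong) (rule fb)
  moreover have "(\<integral>q. fibre f h q * \<tau> j q (coeff_vec k j) i \<partial>\<sigma>) = (\<integral>q. fibre f' h q * \<tau> j q (coeff_vec k j) i \<partial>\<sigma>)" for i
    by (rule Bochner_Integration.integral_cong[OF refl]) (simp add: space_eq fb)
  ultimately show ?thesis unfolding fibre_coeff_def by (simp only:)
qed

abbreviation "sum_rep \<equiv> hilbert_sum (admissible k) (pi_H \<nu> e lam \<tau>)"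

lemma null_eq_sum_rep:
  assumes "\<And>j. j \<in> admissible k \<Longrightarrow> (\<integral>h. (\<Sum>a<Suc j. (cmod (X j h a - Y j h a))\<^sup>2) \<partial>\<nu>) = 0"
  shows "null_eq sum_rep X Y"
proof -
  have "(\<integral>h. cinner (Suc j) (\<lambda>i. X j h i + - 1 * Y j h i) (\<lambda>i. X j h i + - 1 * Y j h i) \<partial>\<nu>) = 0" if "j \<in> admissible k" for j
    unfolding cinner_self integral_complex_of_real using assms[OF that] by simp
  then have "(\<Sum>\<^sub>\<infinity>j\<in>admissible k. \<integral>h. cinner (Suc j) (\<lambda>i. X j h i + - 1 * Y j h i) (\<lambda>i. X j h i + - 1 * Y j h i) \<partial>\<nu>) = 0"
    by (intro infsum_0)
  then show ?thesis
    unfolding null_eq_def Let_def hilbert_sum_def pi_H_def induced_rep_def hilbert_rep.simps Suc_eq_plus1 .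
qed

lemma null_eq_sum_rep_AE:
  assumes "\<And>j. j \<in> admissible k \<Longrightarrow> AE h in \<nu>. \<forall>i. X j h i = Y j h i"
  shows "null_eq sum_rep X Y"
proof (rule null_eq_sum_rep)
  fix j assume "j \<in> admissible k"
  from assms[OF this] have "AE h in \<nu>. (\<Sum>a<Suc j. (cmod (X j h a - Y j h a))\<^sup>2) = 0"
    by (rule AE_mp) (auto intro!: AE_I2)
  then show "(\<integral>h. (\<Sum>a<Suc j. (cmod (X j h a - Y j h a))\<^sup>2) \<partial>\<nu>) = 0" by (rule integral_eq_zero_AE)
qed

definition scalar_restriction where
  "scalar_restriction (x :: complex^('m + 'm)^('m + 'm) \<Rightarrow> nat \<Rightarrow> complex) = (\<lambda>h. x (quat_matrix_embed h) 0)"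

definition analysis_map where
  "analysis_map x j = fibre_coeff (scalar_restriction x) j"

lemma scalar_restriction:
  assumes "x \<in> vectors (pi_G \<mu> (Inl e) lam k)"
  shows "covariant (scalar_restriction x)" "L2 \<nu> (scalar_restriction x)"
  using assms covariant_restrict covariant_G_L2(1) unfolding pi_G_vectors scalar_restriction_def by blast+

lemma analysis_map_inner:
  assumes x: "x \<in> vectors (pi_G \<mu> (Inl e) lam k)" and y: "y \<in> vectors (pi_G \<mu> (Inl e) lam k)"
  shows "((\<lambda>j. ip (pi_H \<nu> e lam \<tau> j) (analysis_map x j) (analysis_map y j)) has_sum ip (pi_G \<mu> (Inl e) lam k) x y) (admissible k)"
proof -
  have "ip (pi_G \<mu> (Inl e) lam k) x y = (\<integral>u. x u 0 * cnj (y u 0) \<partial>\<mu>)"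
    by (simp add: pi_G_def induced_rep_def cinner_def)
  also have "\<dots> = (\<integral>h. scalar_restriction x h * cnj (scalar_restriction y h) \<partial>\<nu>)"
    unfolding scalar_restriction_def using x y unfolding pi_G_vectors by (intro covariant_G_inner) blast+
  finally show ?thesis
    unfolding analysis_map_def pi_H_def induced_rep_def hilbert_rep.simps Suc_eq_plus1[symmetric]
    using coeff_inner_has_sum[OF scalar_restriction[OF x] scalar_restriction[OF y]] by (simp only:)
qed

theorem analysis_map_equivalence:
  "unitarily_equivalent (GL :: (quat^'m^'m) set) (restrict_rep quat_matrix_embed (pi_G \<mu> (Inl e) lam k)) sum_rep"
  unfolding unitarily_equivalent_def
proof (intro exI[of _ analysis_map] conjI ballI allI)
  let ?R = "restrict_rep quat_matrix_embed (pi_G \<mu> (Inl e) lam k)"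
  have vR: "vectors ?R = vectors (pi_G \<mu> (Inl e) lam k)" by (simp add: restrict_rep_def)
  show "analysis_map x \<in> vectors sum_rep" if "x \<in> vectors ?R" for x
  proof -
    from that have x: "x \<in> vectors (pi_G \<mu> (Inl e) lam k)" unfolding vR .
    have "(\<lambda>j. Re (ip (pi_H \<nu> e lam \<tau> j) (analysis_map x j) (analysis_map x j))) summable_on admissible k"
      by (rule summable_on_Re[OF has_sum_imp_summable[OF analysis_map_inner[OF x x]]])
    moreover have "analysis_map x j \<in> vectors (pi_H \<nu> e lam \<tau> j)" if "j \<in> admissible k" for j
      unfolding analysis_map_def by (rule coeff_pi_H[OF scalar_restriction[OF x] that])
    ultimately show ?thesis by (simp add: hilbert_sum_def)
  qed
  show "null_eq sum_rep (analysis_map (hilbert_rep.add ?R x y)) (hilbert_rep.add sum_rep (analysis_map x) (analysis_map y))"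
    if "x \<in> vectors ?R" "y \<in> vectors ?R" for x y
  proof (rule null_eq_sum_rep_AE)
    fix j assume j: "j \<in> admissible k"
    have a: "analysis_map (hilbert_rep.add ?R x y) j = fibre_coeff (\<lambda>h. scalar_restriction x h + 1 * scalar_restriction y h) j"
      by (simp add: analysis_map_def scalar_restriction_def restrict_rep_def pi_G_def induced_rep_def)
    have b: "hilbert_rep.add sum_rep (analysis_map x) (analysis_map y) j h i = fibre_coeff (scalar_restriction x) j h i + 1 * fibre_coeff (scalar_restriction y) j h i" for h i
      by (simp add: analysis_map_def hilbert_sum_def pi_H_def induced_rep_def)
    show "AE h in \<nu>. \<forall>i. analysis_map (hilbert_rep.add ?R x y) j h i = hilbert_rep.add sum_rep (analysis_map x) (analysis_map y) j h i"
      using fibre_L2_AE[OF scalar_restriction[OF that(1)[unfolded vR]]] fibre_L2_AE[OF scalar_restriction[OF that(2)[unfolded vR]]]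
      by eventually_elim (unfold a b, intro allI, rule coeff_one_lincomb(1)[OF _ _ j])
  qed
  show "null_eq sum_rep (analysis_map (scale ?R c x)) (scale sum_rep c (analysis_map x))" if "x \<in> vectors ?R" for c x
  proof (rule null_eq_sum_rep_AE)
    fix j assume j: "j \<in> admissible k"
    have a: "analysis_map (scale ?R c x) j = fibre_coeff (\<lambda>h. c * scalar_restriction x h + 0 * scalar_restriction x h) j"
      by (simp add: analysis_map_def scalar_restriction_def restrict_rep_def pi_G_def induced_rep_def)
    have b: "scale sum_rep c (analysis_map x) j h i = c * fibre_coeff (scalar_restriction x) j h i + 0 * fibre_coeff (scalar_restriction x) j h i" for h i
      by (simp add: analysis_map_def hilbert_sum_def pi_H_def induced_rep_def)
    show "AE h in \<nu>. \<forall>i. analysis_map (scale ?R c x) j h i = scale sum_rep c (analysis_map x) j h i"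
      using fibre_L2_AE[OF scalar_restriction[OF that[unfolded vR]]]
      by eventually_elim (unfold a b, intro allI, rule coeff_lincomb(2)[OF _ _ j])
  qed
  show "ip sum_rep (analysis_map x) (analysis_map y) = ip ?R x y" if "x \<in> vectors ?R" "y \<in> vectors ?R" for x y
    using infsumI[OF analysis_map_inner[OF that(1)[unfolded vR] that(2)[unfolded vR]]]
    by (simp add: hilbert_sum_def restrict_rep_def)
  show "\<exists>x\<in>vectors ?R. null_eq sum_rep (analysis_map x) F" if "F \<in> vectors sum_rep" for F
  proof -
    have F: "F j \<in> vectors (pi_H \<nu> e lam \<tau> j)" if "j \<in> admissible k" for j
      using \<open>F \<in> vectors sum_rep\<close> that by (simp add: hilbert_sum_def)
    have sm: "(\<lambda>j. Re (ip (pi_H \<nu> e lam \<tau> j) (F j) (F j))) summable_on admissible k"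
      using that by (simp add: hilbert_sum_def)
    have "Re (ip (pi_H \<nu> e lam \<tau> j) (F j) (F j)) = (\<integral>h. (\<Sum>a<Suc j. (cmod (F j h a))\<^sup>2) \<partial>\<nu>)" for j
      unfolding pi_H_def induced_rep_def hilbert_rep.simps Suc_eq_plus1[symmetric] cinner_self integral_complex_of_real Re_complex_of_real ..
    with sm have sm': "(\<lambda>j. \<integral>h. (\<Sum>a<Suc j. (cmod (F j h a))\<^sup>2) \<partial>\<nu>) summable_on admissible k" by (simp only:)
    have "\<exists>f. covariant f \<and> L2 \<nu> f \<and>
        (\<forall>j\<in>admissible k. (\<integral>h. (\<Sum>a<Suc j. (cmod (fibre_coeff f j h a - F j h a))\<^sup>2) \<partial>\<nu>) = 0)"
      by (rule synthesis[OF _ sm']) (rule F)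
    then obtain f where f: "covariant f" "L2 \<nu> f"
      "\<forall>j\<in>admissible k. (\<integral>h. (\<Sum>a<Suc j. (cmod (fibre_coeff f j h a - F j h a))\<^sup>2) \<partial>\<nu>) = 0"
      by (elim exE conjE) (rule that)
    define x where "x g i = (if i = (0::nat) then extension f g else 0)" for g i
    have x0: "(\<lambda>g. x g 0) = extension f" by (simp add: x_def fun_eq_iff)
    have ex: "(\<lambda>h. extension f (quat_matrix_embed h)) h = f h" if "h \<in> GL" for h by (rule extension_embed[OF f(1) that])
    have "L2 \<nu> (\<lambda>h. extension f (quat_matrix_embed h))"
    proof -
      have m: "(\<lambda>h. extension f (quat_matrix_embed h)) \<in> borel_measurable \<nu>"
        by (rule measurable_nu[OF covariant_measurable[OF covariant_restrict[OF extension_covariant[OF f(1)]]]])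
      have "integrable \<nu> (\<lambda>h. (cmod (extension f (quat_matrix_embed h)))\<^sup>2) \<longleftrightarrow> integrable \<nu> (\<lambda>h. (cmod (f h))\<^sup>2)"
        by (rule Bochner_Integration.integrable_cong[OF refl]) (simp only: ex space_nu_GL)
      with m show ?thesis unfolding L2_def using L2_integrable[OF f(2)] by blast
    qed
    then have "L2 \<mu> (extension f)" by (rule iffD2[OF covariant_G_L2(1)[OF extension_covariant[OF f(1)]]])
    then have xv: "x \<in> vectors (pi_G \<mu> (Inl e) lam k)"
      unfolding pi_G_vectors x0 using extension_covariant[OF f(1)] by (simp add: x_def cvec_def)
    have "null_eq sum_rep (analysis_map x) F"
    proof (rule null_eq_sum_rep)
      fix j assume j: "j \<in> admissible k"
      have "analysis_map x j h = fibre_coeff f j h" if "h \<in> GL" for h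
        unfolding analysis_map_def
        by (rule fibre_cong_coeff[OF _ that]) (simp only: scalar_restriction_def x_def if_True ex simp_thms)
      then have "(\<integral>h. (\<Sum>a<Suc j. (cmod (analysis_map x j h a - F j h a))\<^sup>2) \<partial>\<nu>) = (\<integral>h. (\<Sum>a<Suc j. (cmod (fibre_coeff f j h a - F j h a))\<^sup>2) \<partial>\<nu>)"
        by (intro Bochner_Integration.integral_cong refl) (simp only: space_nu_GL)
      then show "(\<integral>h. (\<Sum>a<Suc j. (cmod (analysis_map x j h a - F j h a))\<^sup>2) \<partial>\<nu>) = 0" using f(3) j by simp
    qed
    with xv show ?thesis unfolding vR by blast
  qed
  show "null_eq sum_rep (analysis_map (act ?R h x)) (act sum_rep h (analysis_map x))" if h: "h \<in> GL" for h x
  proof -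
    have eq: "scalar_restriction (act ?R h x) = (\<lambda>g. scalar_restriction x (matrix_inv h ** g))"
      by (simp add: scalar_restriction_def restrict_rep_def pi_G_def induced_rep_def quat_matrix_embed_GL(2)[OF h] quat_matrix_embed_hom)
    have fb: "fibre (\<lambda>g. scalar_restriction x (matrix_inv h ** g)) g = fibre (scalar_restriction x) (matrix_inv h ** g)" for g
      by (simp add: fibre_def fun_eq_iff matrix_mul_assoc)
    have "analysis_map (act ?R h x) j g = fibre_coeff (scalar_restriction x) j (matrix_inv h ** g)" for j g
      unfolding analysis_map_def eq fibre_coeff_def fb ..
    then have "analysis_map (act ?R h x) j g = act sum_rep h (analysis_map x) j g" for j g
      by (simp add: analysis_map_def hilbert_sum_def pi_H_def induced_rep_def)
    then show ?thesis by (intro null_eq_sum_rep_AE) simp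
  qed
qed

end

section \<open>The branching law\<close>

theorem theorem5:
  fixes e :: "'m::finite" and lam :: real and k :: int
    and \<tau> :: "nat \<Rightarrow> quat \<Rightarrow> (nat \<Rightarrow> complex) \<Rightarrow> (nat \<Rightarrow> complex)"
    and \<mu> :: "(complex^('m + 'm)^('m + 'm)) measure"
    and \<nu> :: "(quat^'m^'m) measure"
  assumes "\<And>j. irreducible_unitary_rep_on Sp1 (j + 1) (\<tau> j)"
    and "is_haar_prob isometry_group \<mu>"
    and "is_haar_prob isometry_group \<nu>"
  shows "unitarily_equivalent (GL :: (quat^'m^'m) set)
    (restrict_rep quat_matrix_embed (pi_G \<mu> (Inl e) lam k))
    (hilbert_sum {j. \<bar>k\<bar> \<le> int j \<and> even (int j - k)} (pi_H \<nu> e lam \<tau>))"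
proof -
  obtain \<sigma> where \<sigma>: "unit_quaternion_haar \<sigma>"
    using unit_quaternion_haar_exists[OF assms(3)] by (elim exE) (rule that)
  have irr: "irreducible_unitary_rep_on Sp1 (Suc j) (\<tau> j)" for j using assms(1)[of j] by simp
  have A: "all_irreducibles \<sigma> \<tau>" by (rule all_irreducibles.intro[OF \<sigma>]) (unfold_locales, rule irr)
  interpret branching_unitary \<sigma> \<tau> e lam k \<nu> \<mu>
    by (intro branching_unitary.intro branching.intro A branching_axioms.intro branching_unitary_axioms.intro assms(2,3))
  show ?thesis using analysis_map_equivalence unfolding admissible_def .
qed

end
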